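(* Let $p\ge2$ be an integer, $\mathfrak q=e^{i\pi/p}$, $H=\overline{\mathscr U}_{\mathfrak q}s\ell(2)$ the $2p^3$-dimensional quantum group with generators $E,K,F$, and $\mathbb C_{2p}[\lambda]=\mathbb C[\lambda]/(\lambda^{2p}-1)$. Let $A$ be either $\mathrm{Mat}_p(\mathbb C_{2p}[\lambda])$ or $\mathrm{Mat}_p(\mathbb C)$, with the left $H$-action $\triangleright$ and left $H$-coaction $\delta$ described in the context. Then the smash product $A\# H$ is a Hopf algebroid over $A$, with source, target, counit, coproduct and antipode (for $X\in A$, $h\in H$, $\delta(X)=X_{(-1)}\otimes X_{(0)}$) $$s(X)=X\#1,\quad t(X)=X_{(0)}\# S^{-1}(X_{(-1)}),\quad \epsilon(X\# h)=X\,\varepsilon(h),\quad \Delta(X\# h)=(X\# h')\otimes_A(1\# h''),$$ $$\tau(X\# h)=(1\# S(h))\bigl((S(X_{(-1)}'')\triangleright X_{(0)})\# S(X_{(-1)}')\bigr).$$ In particular, $\mathrm{Mat}_p(\overline{\mathscr U}_{\mathfrak q}s\ell(2))$, identified as a vector space with $\mathrm{Mat}_p(\mathbb C)\#\overline{\mathscr U}_{\mathfrak q}s\ell(2)$ and given the smash-product composition, is a Hopf algebroid over $\mathrm{Mat}_p(\mathbb C)$.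
   Context: Quantum group: $\overline{\mathscr U}_{\mathfrak q}s\ell(2)$ is the complex Hopf algebra with generators $E,K,F$ and relations $KEK^{-1}=\mathfrak q^2E$, $KFK^{-1}=\mathfrak q^{-2}F$, $[E,F]=\frac{K-K^{-1}}{\mathfrak q-\mathfrak q^{-1}}$, $E^p=F^p=0$, $K^{2p}=1$, and $\Delta(E)=E\otimes K+1\otimes E$, $\Delta(K)=K\otimes K$, $\Delta(F)=F\otimes1+K^{-1}\otimes F$, $\varepsilon(E)=\varepsilon(F)=0$, $\varepsilon(K)=1$, $S(E)=-EK^{-1}$, $S(K)=K^{-1}$, $S(F)=-KF$. Primes denote Sweedler components of the coproduct. Action and coaction: let $[n]=\frac{\mathfrak q^n-\mathfrak q^{-n}}{\mathfrak q-\mathfrak q^{-1}}$, and let $Z,D\in\mathrm{Mat}_p(\mathbb C)$ have as only nonzero entries $Z_{n+1,n}=1$ and $D_{n,n+1}=(\mathfrak q-\mathfrak q^{-1})\mathfrak q^{1-n}[n]$, $n=1,\dots,p-1$; they generate the algebra $\mathrm{Mat}_p(\mathbb C)$. For $X=(x_{ij})\in\mathrm{Mat}_p(\mathbb C_{2p}[\lambda])$: $(K\triangleright X)_{ij}=\mathfrak q^{2(i-j)}x_{ij}|_{\lambda\to\mathfrak q^{-1}\lambda}$, $\ E\triangleright X=\frac{1}{\mathfrak q-\mathfrak q^{-1}}(XZ-Z(K\triangleright X))$, $\ F\triangleright X=\frac1{\mathfrak q-\mathfrak q^{-1}}(DX-(K^{-1}\triangleright X)D)$. The coaction $\delta$ is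 the algebra homomorphism $\mathrm{Mat}_p(\mathbb C_{2p}[\lambda])\to H\otimes\mathrm{Mat}_p(\mathbb C_{2p}[\lambda])$ with $\delta(\lambda)=1\otimes\lambda$, $\delta(Z)=K^{-1}\otimes Z-(\mathfrak q-\mathfrak q^{-1})EK^{-1}\otimes1$, $\delta(D)=K^{-1}\otimes D+(\mathfrak q-\mathfrak q^{-1})F\otimes1$. On $\mathrm{Mat}_p(\mathbb C)$ the action and coaction are the restrictions. Smash product: $A\# H$ is $A\otimes H$ with product $(X\# h)(Y\# g)=X(h'\triangleright Y)\# h''g$. Hopf algebroid (in the sense of Lu and Brzezi\'nski--Militaru) over an algebra $A$: an algebra $\mathcal X$ with an algebra map $s:A\to\mathcal X$ and an algebra antihomomorphism $t:A\to\mathcal X$ with $s(a)t(b)=t(b)s(a)$; regard $\mathcal X$ as an $A$-bimodule by $a.x.b=s(a)t(b)x$. It is equipped with $A$-bimodule maps $\Delta:\mathcal X\to\mathcal X\otimes_A\mathcal X$ and $\epsilon:\mathcal X\to A$ making $\mathcal X$ an $A$-coring (coassociative and counital), such that: the image of $\Delta$ lies in $\mathcal X\times_A\mathcal X=\{\sum x_i\otimes_A y_i:\sum x_it(a)\otimes_A y_i=\sum x_i\otimes_A y_is(a)\ \forall a\in A\}$ and $\Delta:\mathcal X\to\mathcal X\times_A\mathcal X$ is an algebra map (with componentwise product); $\epsilon(1)=1$ and $\epsilon(xy)=\epsilon(x\,s(\epsilon(y)))=\epsilon(x\,t(\epsilon(y)))$. Further, there is an antipode: an algebra anti-automorphism $\tau$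 of $\mathcal X$ with $\tau\circ t=s$, $m\circ(\tau\otimes\mathrm{id})\circ\Delta=t\circ\epsilon\circ\tau$, and such that there exists a section $\gamma:\mathcal X\otimes_A\mathcal X\to\mathcal X\otimes\mathcal X$ of the natural projection $\mathcal X\otimes\mathcal X\to\mathcal X\otimes_A\mathcal X$ with $m\circ(\mathrm{id}\otimes\tau)\circ\gamma\circ\Delta=s\circ\epsilon$ ($m$ is multiplication in $\mathcal X$). *)

theory Defs
  imports
    Complex_Main
    "HOL-Library.Poly_Mapping"
    "HOL-Computational_Algebra.Polynomial"
    "HOL-Algebra.Module"
    "HOL-Algebra.QuotRing"
begin

section \<open>Complex algebras\<close>

text \<open>
  Vector spaces and algebras over the complex numbers are \<^type>\<open>module_scheme\<close> records of
  HOL-Algebra.  The library's locale \<open>algebra\<close> is restricted to commutative algebras.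
\<close>

definition type_alg :: "(complex \<Rightarrow> 'a \<Rightarrow> 'a) \<Rightarrow> (complex, 'a::ring_1) module" where
  "type_alg sc = \<lparr>carrier = UNIV, mult = (*), one = 1, zero = 0, add = (+), smult = sc\<rparr>"

definition complex_alg :: "(complex, complex) module" where
  "complex_alg = type_alg (*)"

locale complex_algebra = module complex_alg A + ring A for A (structure) +
  assumes smult_mult_left:
    "x \<in> carrier A \<Longrightarrow> y \<in> carrier A \<Longrightarrow> (c \<odot> x) \<otimes> y = c \<odot> (x \<otimes> y)"
  and smult_mult_right:
    "x \<in> carrier A \<Longrightarrow> y \<in> carrier A \<Longrightarrow> x \<otimes> (c \<odot> y) = c \<odot> (x \<otimes> y)"

definition lin_maps ::
  "(complex, 'v, 'm) module_scheme \<Rightarrow> (complex, 'w, 'n) module_scheme \<Rightarrow> ('v \<Rightarrow> 'w) set" where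
  "lin_maps V W = {f \<in> carrier V \<rightarrow> carrier W.
     (\<forall>x\<in>carrier V. \<forall>y\<in>carrier V. f (x \<oplus>\<^bsub>V\<^esub> y) = f x \<oplus>\<^bsub>W\<^esub> f y) \<and>
     (\<forall>c. \<forall>x\<in>carrier V. f (c \<odot>\<^bsub>V\<^esub> x) = c \<odot>\<^bsub>W\<^esub> f x)}"

definition alg_hom ::
  "(complex, 'v, 'm) module_scheme \<Rightarrow> (complex, 'w, 'n) module_scheme \<Rightarrow> ('v \<Rightarrow> 'w) set" where
  "alg_hom A B = ring_hom A B \<inter> lin_maps A B"

definition op_alg :: "('k, 'a, 'm) module_scheme \<Rightarrow> ('k, 'a, 'm) module_scheme" where
  "op_alg A = A\<lparr>mult := \<lambda>x y. y \<otimes>\<^bsub>A\<^esub> x\<rparr>"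

definition end_alg :: "(complex, 'v, 'm) module_scheme \<Rightarrow> (complex, 'v \<Rightarrow> 'v) module" where
  "end_alg V = \<lparr>carrier = lin_maps V V \<inter> extensional (carrier V),
     mult = compose (carrier V), one = (\<lambda>x\<in>carrier V. x), zero = (\<lambda>x\<in>carrier V. \<zero>\<^bsub>V\<^esub>),
     add = (\<lambda>f g. \<lambda>x\<in>carrier V. f x \<oplus>\<^bsub>V\<^esub> g x), smult = (\<lambda>c f. \<lambda>x\<in>carrier V. c \<odot>\<^bsub>V\<^esub> f x)\<rparr>"

text \<open>
  The algebra homomorphism with the prescribed values; \<open>vals\<close> lists pairs (argument, value) for
  a set of algebra generators.  Extensionality makes the description unique.
\<close>

definition the_alg_hom ::
  "(complex, 'v, 'm) module_scheme \<Rightarrow> (complex, 'w, 'n) module_scheme \<Rightarrow> ('v \<times> 'w) set \<Rightarrow> 'v \<Rightarrow> 'w"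
  where
  "the_alg_hom A B vals =
     (THE f. f \<in> alg_hom A B \<and> f \<in> extensional (carrier A) \<and> (\<forall>(x, y)\<in>vals. f x = y))"

definition quot_alg :: "('k, 'a, 'm) module_scheme \<Rightarrow> 'a set \<Rightarrow> ('k, 'a set) module" where
  "quot_alg A I = ring.extend (A Quot I)
     (module.fields (\<lambda>c C. \<Union>x\<in>C. I +>\<^bsub>A\<^esub> (c \<odot>\<^bsub>A\<^esub> x)))"


section \<open>Tensor products\<close>

text \<open>
  A formal linear combination of elements of \<open>'x\<close> is an \<open>f :: 'x \<Rightarrow>\<^sub>0 complex\<close>.  A tensor product
  is the quotient of the formal linear combinations of pairs by a subspace, and its elements are
  cosets, i.e. sets of formal linear combinations.
\<close>

definition fscale :: "complex \<Rightarrow> ('x \<Rightarrow>\<^sub>0 complex) \<Rightarrow> ('x \<Rightarrow>\<^sub>0 complex)" where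
  "fscale c = Poly_Mapping.map ((*) c)"

lemma lookup_fscale [simp]: "Poly_Mapping.lookup (fscale c f) x = c * Poly_Mapping.lookup f x"
  by (simp add: fscale_def Poly_Mapping.map.rep_eq when_def)

interpretation fs: vector_space fscale
  by unfold_locales (auto intro!: poly_mapping_eqI simp: lookup_add algebra_simps)

abbreviation pt :: "'x \<Rightarrow> 'x \<Rightarrow>\<^sub>0 complex" where
  "pt x \<equiv> Poly_Mapping.single x 1"

type_synonym ('v, 'w) tens = "('v \<times> 'w \<Rightarrow>\<^sub>0 complex) set"

definition bilin_rels ::
  "(complex, 'v, 'm) module_scheme \<Rightarrow> (complex, 'w, 'n) module_scheme \<Rightarrow> ('v, 'w) tens" where
  "bilin_rels V W =
     {pt (v \<oplus>\<^bsub>V\<^esub> v', w) - pt (v, w) - pt (v', w) | v v' w.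
        v \<in> carrier V \<and> v' \<in> carrier V \<and> w \<in> carrier W} \<union>
     {pt (v, w \<oplus>\<^bsub>W\<^esub> w') - pt (v, w) - pt (v, w') | v w w'.
        v \<in> carrier V \<and> w \<in> carrier W \<and> w' \<in> carrier W} \<union>
     {pt (c \<odot>\<^bsub>V\<^esub> v, w) - fscale c (pt (v, w)) | c v w. v \<in> carrier V \<and> w \<in> carrier W} \<union>
     {pt (v, c \<odot>\<^bsub>W\<^esub> w) - fscale c (pt (v, w)) | c v w. v \<in> carrier V \<and> w \<in> carrier W}"

definition coset :: "('x \<Rightarrow>\<^sub>0 complex) set \<Rightarrow> ('x \<Rightarrow>\<^sub>0 complex) \<Rightarrow> ('x \<Rightarrow>\<^sub>0 complex) set" where
  "coset N f = {g. g - f \<in> N}"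

definition formal_mult ::
  "('v, 'm) monoid_scheme \<Rightarrow> ('w, 'n) monoid_scheme \<Rightarrow>
   ('v \<times> 'w \<Rightarrow>\<^sub>0 complex) \<Rightarrow> ('v \<times> 'w \<Rightarrow>\<^sub>0 complex) \<Rightarrow> ('v \<times> 'w \<Rightarrow>\<^sub>0 complex)" where
  "formal_mult V W f g =
     (\<Sum>x\<in>Poly_Mapping.keys f. \<Sum>y\<in>Poly_Mapping.keys g.
        Poly_Mapping.single (fst x \<otimes>\<^bsub>V\<^esub> fst y, snd x \<otimes>\<^bsub>W\<^esub> snd y)
          (Poly_Mapping.lookup f x * Poly_Mapping.lookup g y))"

text \<open>
  The quotient by the subspace \<open>N\<close>, with componentwise product.  As with \<^const>\<open>rcoset_mult\<close>, the
  product of two cosets unites the cosets of all products of representatives: it is a single coset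
  exactly when the componentwise product of the two is well defined.
\<close>

definition tensor_quot ::
  "(complex, 'v, 'm) module_scheme \<Rightarrow> (complex, 'w, 'n) module_scheme \<Rightarrow> ('v, 'w) tens \<Rightarrow>
   (complex, ('v, 'w) tens) module" where
  "tensor_quot V W N =
     \<lparr>carrier = coset N ` {f. Poly_Mapping.keys f \<subseteq> carrier V \<times> carrier W},
      mult = (\<lambda>S T. \<Union>f\<in>S. \<Union>g\<in>T. coset N (formal_mult V W f g)),
      one = coset N (pt (\<one>\<^bsub>V\<^esub>, \<one>\<^bsub>W\<^esub>)),
      zero = N,
      add = (\<lambda>S T. \<Union>f\<in>S. \<Union>g\<in>T. coset N (f + g)),
      smult = (\<lambda>c S. \<Union>f\<in>S. coset N (fscale c f))\<rparr>"

definition tensor ::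
  "(complex, 'v, 'm) module_scheme \<Rightarrow> (complex, 'w, 'n) module_scheme \<Rightarrow>
   (complex, ('v, 'w) tens) module" where
  "tensor V W = tensor_quot V W (fs.span (bilin_rels V W))"

text \<open>\<open>V \<otimes>\<^sub>A W\<close> for a right action \<open>r\<close> of \<open>A\<close> on \<open>V\<close> and a left action \<open>l\<close> of \<open>A\<close> on \<open>W\<close>\<close>

definition tensor_over ::
  "('a, 'k) partial_object_scheme \<Rightarrow> ('v \<Rightarrow> 'a \<Rightarrow> 'v) \<Rightarrow> ('a \<Rightarrow> 'w \<Rightarrow> 'w) \<Rightarrow>
   (complex, 'v, 'm) module_scheme \<Rightarrow> (complex, 'w, 'n) module_scheme \<Rightarrow>
   (complex, ('v, 'w) tens) module" where
  "tensor_over A r l V W = tensor_quot V W (fs.span (bilin_rels V W \<union>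
     {pt (r v a, w) - pt (v, l a w) | v a w. v \<in> carrier V \<and> a \<in> carrier A \<and> w \<in> carrier W}))"

text \<open>
  The pure tensor \<open>v \<otimes> w\<close> in the tensor product \<open>T\<close>; the zero of \<open>T\<close> is the subspace divided out.
\<close>

definition pure_tensor ::
  "(complex, ('v, 'w) tens, 'm) module_scheme \<Rightarrow> 'v \<Rightarrow> 'w \<Rightarrow> ('v, 'w) tens" where
  "pure_tensor T v w = coset \<zero>\<^bsub>T\<^esub> (pt (v, w))"

abbreviation pure_tensor_syntax (\<open>(_ \<boxtimes>\<index> _)\<close> [76, 76] 75) where
  "pure_tensor_syntax T v w \<equiv> pure_tensor T v w"

text \<open>
  \<open>tensor_lift V (\<lambda>(x, y). g x y) S\<close> is the Sweedler sum of the \<open>g x\<^sub>i y\<^sub>i\<close> over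
  \<open>S = \<Sum> x\<^sub>i \<otimes> y\<^sub>i\<close>, i.e. the value at \<open>S\<close> of the linear map into \<open>V\<close> induced by \<open>g\<close>.  It is
  unspecified if the sum depends on the representative of \<open>S\<close>.
\<close>

definition tensor_lift ::
  "(complex, 'v, 'm) module_scheme \<Rightarrow> ('x \<Rightarrow> 'v) \<Rightarrow> ('x \<Rightarrow>\<^sub>0 complex) set \<Rightarrow> 'v" where
  "tensor_lift V g S = the_elem
     ((\<lambda>f. \<Oplus>\<^bsub>V\<^esub>x\<in>Poly_Mapping.keys f. Poly_Mapping.lookup f x \<odot>\<^bsub>V\<^esub> g x) ` S)"


section \<open>Hopf algebroids\<close>

text \<open>
  \<open>X \<otimes>\<^sub>A X\<close> and \<open>X \<otimes>\<^sub>A X \<otimes>\<^sub>A X\<close> for the bimodule structure \<open>a.x.b = s(a) t(b) x\<close> on \<open>X\<close>.  The latter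
  is bracketed as \<open>X \<otimes>\<^sub>A (X \<otimes>\<^sub>A X)\<close>, and \<open>(X \<otimes>\<^sub>A X) \<otimes>\<^sub>A X\<close> is identified with it in the
  coassociativity axiom below.
\<close>

definition tensor2 ::
  "(complex, 'a, 'k) module_scheme \<Rightarrow> (complex, 'x, 'm) module_scheme \<Rightarrow> ('a \<Rightarrow> 'x) \<Rightarrow> ('a \<Rightarrow> 'x) \<Rightarrow>
   (complex, ('x, 'x) tens) module" where
  "tensor2 A X s t = tensor_over A (\<lambda>x b. t b \<otimes>\<^bsub>X\<^esub> x) (\<lambda>a x. s a \<otimes>\<^bsub>X\<^esub> x) X X"

definition tensor3 ::
  "(complex, 'a, 'k) module_scheme \<Rightarrow> (complex, 'x, 'm) module_scheme \<Rightarrow> ('a \<Rightarrow> 'x) \<Rightarrow> ('a \<Rightarrow> 'x) \<Rightarrow>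
   (complex, ('x, ('x, 'x) tens) tens) module" where
  "tensor3 A X s t =
     (let XX = tensor2 A X s t in
      tensor_over A (\<lambda>x b. t b \<otimes>\<^bsub>X\<^esub> x)
        (\<lambda>a. tensor_lift XX (\<lambda>(x, y). (s a \<otimes>\<^bsub>X\<^esub> x) \<boxtimes>\<^bsub>XX\<^esub> y)) X XX)"

definition takeuchi ::
  "(complex, 'a, 'k) module_scheme \<Rightarrow> (complex, 'x, 'm) module_scheme \<Rightarrow> ('a \<Rightarrow> 'x) \<Rightarrow> ('a \<Rightarrow> 'x) \<Rightarrow>
   ('x, 'x) tens set" where
  "takeuchi A X s t =
     (let XX = tensor2 A X s t in
      {S \<in> carrier XX. \<forall>a\<in>carrier A.
         tensor_lift XX (\<lambda>(x, y). (x \<otimes>\<^bsub>X\<^esub> t a) \<boxtimes>\<^bsub>XX\<^esub> y) S =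
         tensor_lift XX (\<lambda>(x, y). x \<boxtimes>\<^bsub>XX\<^esub> (y \<otimes>\<^bsub>X\<^esub> s a)) S})"

locale bialgebroid_data = base: complex_algebra A + total: complex_algebra X
  for A :: "(complex, 'a, 'k) module_scheme"
    and X :: "(complex, 'x, 'm) module_scheme" +
  fixes s :: "'a \<Rightarrow> 'x" and t :: "'a \<Rightarrow> 'x"
    and \<epsilon> :: "'x \<Rightarrow> 'a" and \<Delta> :: "'x \<Rightarrow> ('x, 'x) tens"
begin

abbreviation "XX \<equiv> tensor2 A X s t"
abbreviation "XXX \<equiv> tensor3 A X s t"

end

locale bialgebroid = bialgebroid_data A X s t \<epsilon> \<Delta>
  for A :: "(complex, 'a, 'k) module_scheme"
    and X :: "(complex, 'x, 'm) module_scheme"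
    and s :: "'a \<Rightarrow> 'x" and t :: "'a \<Rightarrow> 'x"
    and \<epsilon> :: "'x \<Rightarrow> 'a" and \<Delta> :: "'x \<Rightarrow> ('x, 'x) tens" +
  assumes source: "s \<in> alg_hom A X"
    and target: "t \<in> alg_hom A (op_alg X)"
    and source_target: "\<lbrakk>a \<in> carrier A; b \<in> carrier A\<rbrakk> \<Longrightarrow> s a \<otimes>\<^bsub>X\<^esub> t b = t b \<otimes>\<^bsub>X\<^esub> s a"
    and comult_linear: "\<Delta> \<in> lin_maps X XX"
    and comult_bimodule: "\<lbrakk>a \<in> carrier A; b \<in> carrier A; x \<in> carrier X\<rbrakk> \<Longrightarrow>
      \<Delta> (s a \<otimes>\<^bsub>X\<^esub> t b \<otimes>\<^bsub>X\<^esub> x) =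
      tensor_lift XX (\<lambda>(x', x''). (s a \<otimes>\<^bsub>X\<^esub> x') \<boxtimes>\<^bsub>XX\<^esub> (t b \<otimes>\<^bsub>X\<^esub> x'')) (\<Delta> x)"
    and counit_linear: "\<epsilon> \<in> lin_maps X A"
    and counit_bimodule: "\<lbrakk>a \<in> carrier A; b \<in> carrier A; x \<in> carrier X\<rbrakk> \<Longrightarrow>
      \<epsilon> (s a \<otimes>\<^bsub>X\<^esub> t b \<otimes>\<^bsub>X\<^esub> x) = a \<otimes>\<^bsub>A\<^esub> \<epsilon> x \<otimes>\<^bsub>A\<^esub> b"
    and coassoc: "x \<in> carrier X \<Longrightarrow>
      tensor_lift XXX (\<lambda>(x', x'').
        tensor_lift XXX (\<lambda>(u, v). u \<boxtimes>\<^bsub>XXX\<^esub> (v \<boxtimes>\<^bsub>XX\<^esub> x'')) (\<Delta> x')) (\<Delta> x) =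
      tensor_lift XXX (\<lambda>(x', x''). x' \<boxtimes>\<^bsub>XXX\<^esub> \<Delta> x'') (\<Delta> x)"
    and counit_left: "x \<in> carrier X \<Longrightarrow>
      tensor_lift X (\<lambda>(x', x''). s (\<epsilon> x') \<otimes>\<^bsub>X\<^esub> x'') (\<Delta> x) = x"
    and counit_right: "x \<in> carrier X \<Longrightarrow>
      tensor_lift X (\<lambda>(x', x''). t (\<epsilon> x'') \<otimes>\<^bsub>X\<^esub> x') (\<Delta> x) = x"
    and comult_takeuchi: "x \<in> carrier X \<Longrightarrow> \<Delta> x \<in> takeuchi A X s t"
    and comult_one: "\<Delta> \<one>\<^bsub>X\<^esub> = \<one>\<^bsub>XX\<^esub>"
    and comult_mult: "\<lbrakk>x \<in> carrier X; y \<in> carrier X\<rbrakk> \<Longrightarrow>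
      \<Delta> (x \<otimes>\<^bsub>X\<^esub> y) = \<Delta> x \<otimes>\<^bsub>XX\<^esub> \<Delta> y"
    and counit_one: "\<epsilon> \<one>\<^bsub>X\<^esub> = \<one>\<^bsub>A\<^esub>"
    and counit_mult_source: "\<lbrakk>x \<in> carrier X; y \<in> carrier X\<rbrakk> \<Longrightarrow>
      \<epsilon> (x \<otimes>\<^bsub>X\<^esub> y) = \<epsilon> (x \<otimes>\<^bsub>X\<^esub> s (\<epsilon> y))"
    and counit_mult_target: "\<lbrakk>x \<in> carrier X; y \<in> carrier X\<rbrakk> \<Longrightarrow>
      \<epsilon> (x \<otimes>\<^bsub>X\<^esub> y) = \<epsilon> (x \<otimes>\<^bsub>X\<^esub> t (\<epsilon> y))"

locale hopf_algebroid = bialgebroid A X s t \<epsilon> \<Delta>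
  for A :: "(complex, 'a, 'k) module_scheme"
    and X :: "(complex, 'x, 'm) module_scheme"
    and s :: "'a \<Rightarrow> 'x" and t :: "'a \<Rightarrow> 'x"
    and \<epsilon> :: "'x \<Rightarrow> 'a" and \<Delta> :: "'x \<Rightarrow> ('x, 'x) tens" +
  fixes \<tau> :: "'x \<Rightarrow> 'x"
  assumes antipode_antihom: "\<tau> \<in> alg_hom X (op_alg X)"
    and antipode_bij: "bij_betw \<tau> (carrier X) (carrier X)"
    and antipode_target: "a \<in> carrier A \<Longrightarrow> \<tau> (t a) = s a"
    and antipode_left: "x \<in> carrier X \<Longrightarrow>
      tensor_lift X (\<lambda>(x', x''). \<tau> x' \<otimes>\<^bsub>X\<^esub> x'') (\<Delta> x) = t (\<epsilon> (\<tau> x))"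
    and antipode_right:
      "\<exists>\<gamma> \<in> lin_maps XX (tensor X X).
         (\<forall>S\<in>carrier XX. tensor_lift XX (\<lambda>(x, y). x \<boxtimes>\<^bsub>XX\<^esub> y) (\<gamma> S) = S) \<and>
         (\<forall>x\<in>carrier X. tensor_lift X (\<lambda>(x', x''). x' \<otimes>\<^bsub>X\<^esub> \<tau> x'') (\<gamma> (\<Delta> x)) = s (\<epsilon> x))"


section \<open>Smash products\<close>

record 'h hopf = "(complex, 'h) module" +
  comult :: "'h \<Rightarrow> ('h, 'h) tens"
  counit :: "'h \<Rightarrow> complex"
  antipode :: "'h \<Rightarrow> 'h"

text \<open>
  In the following, \<open>act h X\<close> is \<open>h \<triangleright> X\<close>, and \<open>\<delta> X = X\<^sub>(\<^sub>-\<^sub>1\<^sub>) \<otimes> X\<^sub>(\<^sub>0\<^sub>)\<close> lies in \<open>tensor H A\<close>.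
  The element \<open>X # h\<close> is the pure tensor in \<open>tensor A H\<close>.
\<close>

definition smash ::
  "'h hopf \<Rightarrow> (complex, 'a, 'm) module_scheme \<Rightarrow> ('h \<Rightarrow> 'a \<Rightarrow> 'a) \<Rightarrow> (complex, ('a, 'h) tens) module"
  where
  "smash H A act = (let AH = tensor A H in AH\<lparr>mult := \<lambda>S T.
     tensor_lift AH (\<lambda>(X, h). tensor_lift AH (\<lambda>(Y, g).
       tensor_lift AH (\<lambda>(h', h''). (X \<otimes>\<^bsub>A\<^esub> act h' Y) \<boxtimes>\<^bsub>AH\<^esub> (h'' \<otimes>\<^bsub>H\<^esub> g)) (comult H h)) T) S\<rparr>)"

definition smash_source ::
  "'h hopf \<Rightarrow> (complex, 'a, 'm) module_scheme \<Rightarrow> 'a \<Rightarrow> ('a, 'h) tens" where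
  "smash_source H A X = X \<boxtimes>\<^bsub>tensor A H\<^esub> \<one>\<^bsub>H\<^esub>"

definition smash_target ::
  "'h hopf \<Rightarrow> (complex, 'a, 'm) module_scheme \<Rightarrow> ('a \<Rightarrow> ('h, 'a) tens) \<Rightarrow> 'a \<Rightarrow> ('a, 'h) tens" where
  "smash_target H A \<delta> X =
     tensor_lift (tensor A H)
       (\<lambda>(h, Y). Y \<boxtimes>\<^bsub>tensor A H\<^esub> inv_into (carrier H) (antipode H) h) (\<delta> X)"

definition smash_counit ::
  "'h hopf \<Rightarrow> (complex, 'a, 'm) module_scheme \<Rightarrow> ('a, 'h) tens \<Rightarrow> 'a" where
  "smash_counit H A = tensor_lift A (\<lambda>(X, h). counit H h \<odot>\<^bsub>A\<^esub> X)"

definition smash_comult ::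
  "'h hopf \<Rightarrow> (complex, 'a, 'm) module_scheme \<Rightarrow> ('h \<Rightarrow> 'a \<Rightarrow> 'a) \<Rightarrow> ('a \<Rightarrow> ('h, 'a) tens) \<Rightarrow>
   ('a, 'h) tens \<Rightarrow> (('a, 'h) tens, ('a, 'h) tens) tens" where
  "smash_comult H A act \<delta> =
     (let AH = tensor A H;
          XX = tensor2 A (smash H A act) (smash_source H A) (smash_target H A \<delta>)
      in tensor_lift XX (\<lambda>(X, h). tensor_lift XX
           (\<lambda>(h', h''). (X \<boxtimes>\<^bsub>AH\<^esub> h') \<boxtimes>\<^bsub>XX\<^esub> (\<one>\<^bsub>A\<^esub> \<boxtimes>\<^bsub>AH\<^esub> h'')) (comult H h)))"

definition smash_antipode ::
  "'h hopf \<Rightarrow> (complex, 'a, 'm) module_scheme \<Rightarrow> ('h \<Rightarrow> 'a \<Rightarrow> 'a) \<Rightarrow> ('a \<Rightarrow> ('h, 'a) tens) \<Rightarrow>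
   ('a, 'h) tens \<Rightarrow> ('a, 'h) tens" where
  "smash_antipode H A act \<delta> =
     (let AH = tensor A H; S = antipode H in
      tensor_lift AH (\<lambda>(X, h). (\<one>\<^bsub>A\<^esub> \<boxtimes>\<^bsub>AH\<^esub> S h) \<otimes>\<^bsub>smash H A act\<^esub>
        tensor_lift AH (\<lambda>(k, Y).
          tensor_lift AH (\<lambda>(k', k''). act (S k'') Y \<boxtimes>\<^bsub>AH\<^esub> S k') (comult H k)) (\<delta> X)))"


section \<open>The restricted quantum group\<close>

definition qroot :: "nat \<Rightarrow> complex" where
  "qroot p = exp (\<i> * of_real pi / of_nat p)"

definition qnum :: "nat \<Rightarrow> nat \<Rightarrow> complex" where
  "qnum p n = (let q = qroot p in (q ^ n - inverse q ^ n) / (q - inverse q))"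

text \<open>
  With concatenation of words as addition, \<open>gen list \<Rightarrow>\<^sub>0 complex\<close> is the free algebra on \<open>gen\<close>.
\<close>

instantiation list :: (type) monoid_add
begin
definition zero_list :: "'a list" where "0 = []"
definition plus_list :: "'a list \<Rightarrow> 'a list \<Rightarrow> 'a list" where "xs + ys = xs @ ys"
instance by standard (simp_all add: zero_list_def plus_list_def)
end

datatype gen = GenE | GenK | GenF

definition free_alg :: "(complex, gen list \<Rightarrow>\<^sub>0 complex) module" where
  "free_alg = type_alg fscale"

text \<open>Since \<open>K\<^bsup>2p\<^esup> = 1\<close>, the inverse of \<open>K\<close> is \<open>K\<^bsup>2p - 1\<^esup>\<close>.\<close>

definition uq_rels :: "nat \<Rightarrow> (gen list \<Rightarrow>\<^sub>0 complex) set" where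
  "uq_rels p =
     (let q = qroot p; E = pt [GenE]; K = pt [GenK]; F = pt [GenF]; K' = K ^ (2 * p - 1) in
      {K * E * K' - fscale (q\<^sup>2) E,
       K * F * K' - fscale (inverse (q\<^sup>2)) F,
       E * F - F * E - fscale (1 / (q - inverse q)) (K - K'),
       E ^ p, F ^ p, K ^ (2 * p) - 1})"

definition uq_alg :: "nat \<Rightarrow> (complex, (gen list \<Rightarrow>\<^sub>0 complex) set) module" where
  "uq_alg p = quot_alg free_alg (genideal free_alg (uq_rels p))"

definition uq_gen :: "nat \<Rightarrow> gen \<Rightarrow> (gen list \<Rightarrow>\<^sub>0 complex) set" where
  "uq_gen p g = genideal free_alg (uq_rels p) +>\<^bsub>free_alg\<^esub> pt [g]"

definition uq_comult where
  "uq_comult p =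
     (let U = uq_alg p; UU = tensor U U; E = uq_gen p GenE; K = uq_gen p GenK; F = uq_gen p GenF in
      the_alg_hom U UU
        {(E, (E \<boxtimes>\<^bsub>UU\<^esub> K) \<oplus>\<^bsub>UU\<^esub> (\<one>\<^bsub>U\<^esub> \<boxtimes>\<^bsub>UU\<^esub> E)),
         (K, K \<boxtimes>\<^bsub>UU\<^esub> K),
         (F, (F \<boxtimes>\<^bsub>UU\<^esub> \<one>\<^bsub>U\<^esub>) \<oplus>\<^bsub>UU\<^esub> ((inv\<^bsub>U\<^esub> K) \<boxtimes>\<^bsub>UU\<^esub> F))})"

definition uq_counit where
  "uq_counit p = the_alg_hom (uq_alg p) complex_alg
     {(uq_gen p GenE, 0), (uq_gen p GenK, 1), (uq_gen p GenF, 0)}"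

definition uq_antipode where
  "uq_antipode p =
     (let U = uq_alg p; E = uq_gen p GenE; K = uq_gen p GenK; F = uq_gen p GenF in
      the_alg_hom U (op_alg U)
        {(E, \<ominus>\<^bsub>U\<^esub> (E \<otimes>\<^bsub>U\<^esub> inv\<^bsub>U\<^esub> K)), (K, inv\<^bsub>U\<^esub> K), (F, \<ominus>\<^bsub>U\<^esub> (K \<otimes>\<^bsub>U\<^esub> F))})"

definition uq :: "nat \<Rightarrow> (gen list \<Rightarrow>\<^sub>0 complex) set hopf" where
  "uq p = module.extend (uq_alg p)
     (hopf.fields (uq_comult p) (uq_counit p) (uq_antipode p))"


section \<open>Matrix algebras with action and coaction of the quantum group\<close>

definition mat_alg :: "nat \<Rightarrow> (complex, 'r, 'm) module_scheme \<Rightarrow> (complex, nat \<times> nat \<Rightarrow> 'r) module" where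
  "mat_alg p R = (let P = {1..p} \<times> {1..p} in
     \<lparr>carrier = P \<rightarrow>\<^sub>E carrier R,
      mult = (\<lambda>X Y. \<lambda>(i, j)\<in>P. \<Oplus>\<^bsub>R\<^esub>k\<in>{1..p}. X (i, k) \<otimes>\<^bsub>R\<^esub> Y (k, j)),
      one = (\<lambda>(i, j)\<in>P. if i = j then \<one>\<^bsub>R\<^esub> else \<zero>\<^bsub>R\<^esub>),
      zero = (\<lambda>_\<in>P. \<zero>\<^bsub>R\<^esub>),
      add = (\<lambda>X Y. \<lambda>ij\<in>P. X ij \<oplus>\<^bsub>R\<^esub> Y ij),
      smult = (\<lambda>c X. \<lambda>ij\<in>P. c \<odot>\<^bsub>R\<^esub> X ij)\<rparr>)"

definition scalar_mat :: "nat \<Rightarrow> (complex, 'r, 'm) module_scheme \<Rightarrow> 'r \<Rightarrow> nat \<times> nat \<Rightarrow> 'r" where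
  "scalar_mat p R r = (\<lambda>(i, j)\<in>{1..p} \<times> {1..p}. if i = j then r else \<zero>\<^bsub>R\<^esub>)"

definition Zmat :: "nat \<Rightarrow> (complex, 'r, 'm) module_scheme \<Rightarrow> nat \<times> nat \<Rightarrow> 'r" where
  "Zmat p R = (\<lambda>(i, j)\<in>{1..p} \<times> {1..p}. if i = j + 1 then \<one>\<^bsub>R\<^esub> else \<zero>\<^bsub>R\<^esub>)"

definition Dmat :: "nat \<Rightarrow> (complex, 'r, 'm) module_scheme \<Rightarrow> nat \<times> nat \<Rightarrow> 'r" where
  "Dmat p R = (let q = qroot p in
     (\<lambda>(i, j)\<in>{1..p} \<times> {1..p}.
       if j = i + 1 then ((q - inverse q) * q powi (1 - int i) * qnum p i) \<odot>\<^bsub>R\<^esub> \<one>\<^bsub>R\<^esub> else \<zero>\<^bsub>R\<^esub>))"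

text \<open>
  The coefficient algebra \<open>R\<close> is either \<open>complex_alg\<close> or \<open>cyc_alg p\<close>, and \<open>\<sigma>\<close> is the substitution
  of \<open>q\<^sup>-\<^sup>1\<lambda>\<close> for \<open>\<lambda>\<close> in elements of \<open>R\<close>.  It is the identity on constants, so taking
  \<open>R = complex_alg\<close> and \<open>\<sigma> = id\<close> gives the restriction to matrices with constant entries.
\<close>

definition act_K ::
  "nat \<Rightarrow> (complex, 'r, 'm) module_scheme \<Rightarrow> ('r \<Rightarrow> 'r) \<Rightarrow> (nat \<times> nat \<Rightarrow> 'r) \<Rightarrow> nat \<times> nat \<Rightarrow> 'r" where
  "act_K p R \<sigma> = (\<lambda>X\<in>carrier (mat_alg p R). \<lambda>(i, j)\<in>{1..p} \<times> {1..p}.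
     (qroot p powi (2 * (int i - int j))) \<odot>\<^bsub>R\<^esub> \<sigma> (X (i, j)))"

definition act_E ::
  "nat \<Rightarrow> (complex, 'r, 'm) module_scheme \<Rightarrow> ('r \<Rightarrow> 'r) \<Rightarrow> (nat \<times> nat \<Rightarrow> 'r) \<Rightarrow> nat \<times> nat \<Rightarrow> 'r" where
  "act_E p R \<sigma> = (let q = qroot p; A = mat_alg p R in (\<lambda>X\<in>carrier A.
     (1 / (q - inverse q)) \<odot>\<^bsub>A\<^esub> (X \<otimes>\<^bsub>A\<^esub> Zmat p R \<ominus>\<^bsub>A\<^esub> Zmat p R \<otimes>\<^bsub>A\<^esub> act_K p R \<sigma> X)))"

definition act_F ::
  "nat \<Rightarrow> (complex, 'r, 'm) module_scheme \<Rightarrow> ('r \<Rightarrow> 'r) \<Rightarrow> (nat \<times> nat \<Rightarrow> 'r) \<Rightarrow> nat \<times> nat \<Rightarrow> 'r" where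
  "act_F p R \<sigma> = (let q = qroot p; A = mat_alg p R in (\<lambda>X\<in>carrier A.
     (1 / (q - inverse q)) \<odot>\<^bsub>A\<^esub>
       (Dmat p R \<otimes>\<^bsub>A\<^esub> X \<ominus>\<^bsub>A\<^esub> inv_into (carrier A) (act_K p R \<sigma>) X \<otimes>\<^bsub>A\<^esub> Dmat p R)))"

definition uq_act ::
  "nat \<Rightarrow> (complex, 'r, 'm) module_scheme \<Rightarrow> ('r \<Rightarrow> 'r) \<Rightarrow>
   (gen list \<Rightarrow>\<^sub>0 complex) set \<Rightarrow> (nat \<times> nat \<Rightarrow> 'r) \<Rightarrow> nat \<times> nat \<Rightarrow> 'r" where
  "uq_act p R \<sigma> = the_alg_hom (uq p) (end_alg (mat_alg p R))
     {(uq_gen p GenE, act_E p R \<sigma>), (uq_gen p GenK, act_K p R \<sigma>), (uq_gen p GenF, act_F p R \<sigma>)}"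

text \<open>
  \<open>G\<close> generates the coefficient algebra \<open>R\<close>; together with \<open>Z\<close> and \<open>D\<close>, its scalar matrices
  generate the matrix algebra.
\<close>

definition uq_coact ::
  "nat \<Rightarrow> (complex, 'r, 'm) module_scheme \<Rightarrow> 'r set \<Rightarrow> (nat \<times> nat \<Rightarrow> 'r) \<Rightarrow>
   ((gen list \<Rightarrow>\<^sub>0 complex) set, nat \<times> nat \<Rightarrow> 'r) tens" where
  "uq_coact p R G =
     (let q = qroot p; U = uq p; A = mat_alg p R; UA = tensor U A;
          E = uq_gen p GenE; K = uq_gen p GenK; F = uq_gen p GenF; Z = Zmat p R; D = Dmat p R in
      the_alg_hom A UA
        ((\<lambda>r. (scalar_mat p R r, \<one>\<^bsub>U\<^esub> \<boxtimes>\<^bsub>UA\<^esub> scalar_mat p R r)) ` G \<union>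
         {(Z, ((inv\<^bsub>U\<^esub> K) \<boxtimes>\<^bsub>UA\<^esub> Z) \<ominus>\<^bsub>UA\<^esub>
              (q - inverse q) \<odot>\<^bsub>UA\<^esub> ((E \<otimes>\<^bsub>U\<^esub> inv\<^bsub>U\<^esub> K) \<boxtimes>\<^bsub>UA\<^esub> \<one>\<^bsub>A\<^esub>)),
          (D, ((inv\<^bsub>U\<^esub> K) \<boxtimes>\<^bsub>UA\<^esub> D) \<oplus>\<^bsub>UA\<^esub>
              (q - inverse q) \<odot>\<^bsub>UA\<^esub> (F \<boxtimes>\<^bsub>UA\<^esub> \<one>\<^bsub>A\<^esub>))}))"

definition poly_alg :: "(complex, complex poly) module" where
  "poly_alg = type_alg Polynomial.smult"

definition cyc_ideal :: "nat \<Rightarrow> complex poly set" where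
  "cyc_ideal p = genideal poly_alg {monom 1 (2 * p) - 1}"

definition cyc_alg :: "nat \<Rightarrow> (complex, complex poly set) module" where
  "cyc_alg p = quot_alg poly_alg (cyc_ideal p)"

definition cyc_gen :: "nat \<Rightarrow> complex poly set" where
  "cyc_gen p = cyc_ideal p +>\<^bsub>poly_alg\<^esub> [:0, 1:]"

definition cyc_subst :: "nat \<Rightarrow> complex poly set \<Rightarrow> complex poly set" where
  "cyc_subst p C = (\<lambda>f. pcompose f [:0, inverse (qroot p):]) ` C"


section \<open>Matrices over the quantum group\<close>

definition mat_iso ::
  "nat \<Rightarrow> (nat \<times> nat \<Rightarrow> complex, (gen list \<Rightarrow>\<^sub>0 complex) set) tens \<Rightarrow>
   nat \<times> nat \<Rightarrow> (gen list \<Rightarrow>\<^sub>0 complex) set" where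
  "mat_iso p = tensor_lift (mat_alg p (uq p))
     (\<lambda>(X, h). \<lambda>ij\<in>{1..p} \<times> {1..p}. X ij \<odot>\<^bsub>uq p\<^esub> h)"

text \<open>
  Here \<open>\<Phi>\<close> is an isomorphism of vector spaces from \<open>X\<close> to \<open>M\<close>; any product that \<open>M\<close> already has
  is discarded.
\<close>

definition transport_alg ::
  "('x \<Rightarrow> 'y) \<Rightarrow> (complex, 'x, 'm) module_scheme \<Rightarrow> (complex, 'y, 'n) module_scheme \<Rightarrow>
   (complex, 'y, 'n) module_scheme" where
  "transport_alg \<Phi> X M = (let \<Psi> = inv_into (carrier X) \<Phi> in
     M\<lparr>mult := \<lambda>x y. \<Phi> (\<Psi> x \<otimes>\<^bsub>X\<^esub> \<Psi> y), one := \<Phi> \<one>\<^bsub>X\<^esub>\<rparr>)"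

definition transport_comult ::
  "('x \<Rightarrow> 'y) \<Rightarrow> (complex, 'x, 'm) module_scheme \<Rightarrow> (complex, ('y, 'y) tens, 'n) module_scheme \<Rightarrow>
   ('x \<Rightarrow> ('x, 'x) tens) \<Rightarrow> 'y \<Rightarrow> ('y, 'y) tens" where
  "transport_comult \<Phi> X YY \<Delta> y =
     tensor_lift YY (\<lambda>(x', x''). \<Phi> x' \<boxtimes>\<^bsub>YY\<^esub> \<Phi> x'') (\<Delta> (inv_into (carrier X) \<Phi> y))"

end

(*
  With these actions and coactions A is a braided-commutative Yetter-Drinfeld module algebra over H.
  For any such A over a Hopf algebra with bijective antipode, the Yetter-Drinfeld condition moves t(X)
  past 1 # h and puts the image of the coproduct into the Takeuchi product, braided commutativity
  makes s(X) commute with t(Y), and the antipode is inverted by X # h |-> (1 # S^-1(h)) t(X).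

  Mat_p(R) is generated over R by Z and D subject to D Z = q^-2 Z D + (q - q^-1) and Z^p = D^p = 0,
  the element D^(p-1) Z^(p-1) being a multiple of a matrix unit.  The coaction is therefore
  determined by checking these relations, where p-th powers vanish by the q-binomial theorem at the
  root of unity q^2.  The Yetter-Drinfeld condition for K is checked on generators; for E and F it
  follows, because E and F act by multiplication with Z and D twisted by K.
*)
theory Submission
  imports Defs
begin

text \<open>The maps in the statement are given by \<open>the_elem\<close> and \<open>THE\<close>: a
  Sweedler sum has a specified value only if it is independent of the representative, and coproduct,
  antipode, action and coaction are the homomorphisms with prescribed values on generators.
  Well-definedness is therefore the recurrent obstacle. Over \<open>A\<close> it means balancedness,
  and for componentwise products the Takeuchi condition; for maps out of the quantum group it means
  checking a presentation; for the coaction it means building matrix units in the target out of the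
  images of \<open>Z\<close> and \<open>D\<close>. The algebroid axioms are derived for any algebra
  \<open>M\<close> with maps \<open>s\<close> on \<open>A\<close> and \<open>j\<close> on
  \<open>H\<close> that obey the smash commutation rule and whose products
  \<open>s X \<cdot> j h\<close> identify \<open>M\<close> linearly with the tensor product. The
  smash product and its transport to matrices over the quantum group are both of this kind, so no
  axiom is carried along an isomorphism. \<open>E\<close> and \<open>F\<close> act through two
  commuting copies of the relation between \<open>D\<close> and \<open>Z\<close>, one by left and
  one by right multiplication. The same two-sided form reappears on the tensor product of
  \<open>H\<close> and \<open>A\<close> in the Yetter-Drinfeld condition.\<close>

section \<open>Complex vector spaces and linear maps\<close>

abbreviation cvec :: "(complex, 'v, 'm) module_scheme \<Rightarrow> bool" where
  "cvec V \<equiv> module complex_alg V"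

lemma complex_alg_simps [simp]:
  "carrier complex_alg = UNIV" "a \<oplus>\<^bsub>complex_alg\<^esub> b = a + b" "a \<otimes>\<^bsub>complex_alg\<^esub> b = a * b"
  "\<zero>\<^bsub>complex_alg\<^esub> = 0" "\<one>\<^bsub>complex_alg\<^esub> = 1" "a \<odot>\<^bsub>complex_alg\<^esub> b = a * b"
  by (simp_all add: complex_alg_def type_alg_def)

lemma cring_complex_alg: "cring complex_alg"
proof (rule cringI)
  show "abelian_group complex_alg"
    by (rule abelian_groupI) (auto simp: algebra_simps intro: exI[of _ "- x" for x])
  show "comm_monoid complex_alg"
    by (rule comm_monoidI) (auto simp: algebra_simps)
qed (auto simp: algebra_simps)

lemma cvecI:
  fixes V (structure)
  assumes ag: "abelian_group V"
    and "\<And>c x. x \<in> carrier V \<Longrightarrow> c \<odot> x \<in> carrier V"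
    and "\<And>c d x. x \<in> carrier V \<Longrightarrow> (c + d) \<odot> x = c \<odot> x \<oplus> d \<odot> x"
    and "\<And>c x y. x \<in> carrier V \<Longrightarrow> y \<in> carrier V \<Longrightarrow> c \<odot> (x \<oplus> y) = c \<odot> x \<oplus> c \<odot> y"
    and "\<And>c d x. x \<in> carrier V \<Longrightarrow> (c * d) \<odot> x = c \<odot> (d \<odot> x)"
    and "\<And>x. x \<in> carrier V \<Longrightarrow> 1 \<odot> x = x"
  shows "cvec V"
  by (rule moduleI[OF cring_complex_alg ag]) (use assms in auto)

lemma cvec_complex_alg [simp]: "cvec complex_alg"
  by (rule cvecI) (auto simp: algebra_simps cring.axioms intro: ring.is_abelian_group
      cring_complex_alg[THEN cring.axioms(1)])

lemma cvec_abelian [intro]: "cvec V \<Longrightarrow> abelian_group V"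
  by (simp add: module_def)

context
  fixes V :: "(complex, 'v, 'm) module_scheme" (structure)
  assumes V: "cvec V"
begin

interpretation V: module complex_alg V by (rule V)

lemma cvec_zero_closed: "\<zero> \<in> carrier V"
  and cvec_add_closed: "x \<in> carrier V \<Longrightarrow> y \<in> carrier V \<Longrightarrow> x \<oplus> y \<in> carrier V"
  and cvec_minus_closed: "x \<in> carrier V \<Longrightarrow> y \<in> carrier V \<Longrightarrow> x \<ominus> y \<in> carrier V"
  and cvec_uminus_closed: "x \<in> carrier V \<Longrightarrow> \<ominus> x \<in> carrier V"
  and cvec_smult_closed: "x \<in> carrier V \<Longrightarrow> c \<odot> x \<in> carrier V"
  and cvec_add_zero: "x \<in> carrier V \<Longrightarrow> x \<oplus> \<zero> = x" "x \<in> carrier V \<Longrightarrow> \<zero> \<oplus> x = x"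
  and cvec_smult_one: "x \<in> carrier V \<Longrightarrow> 1 \<odot> x = x"
  by (use V.smult_closed V.smult_one in auto)

lemma cvec_add_smult: "x \<in> carrier V \<Longrightarrow> (c + d) \<odot> x = c \<odot> x \<oplus> d \<odot> x"
  using V.smult_l_distr[of c d x] by simp

lemma cvec_smult_add: "x \<in> carrier V \<Longrightarrow> y \<in> carrier V \<Longrightarrow> c \<odot> (x \<oplus> y) = c \<odot> x \<oplus> c \<odot> y"
  using V.smult_r_distr[of c x y] by simp

lemma cvec_smult_smult: "x \<in> carrier V \<Longrightarrow> c \<odot> (d \<odot> x) = (c * d) \<odot> x"
  using V.smult_assoc1[of c d x] by simp

lemma cvec_zero_smult: "x \<in> carrier V \<Longrightarrow> 0 \<odot> x = \<zero>"
  using V.smult_l_null[of x] by simp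

lemma cvec_smult_zero: "c \<odot> \<zero> = \<zero>"
  using V.smult_r_null[of c] by simp

text \<open>Negatives become multiples by -1, so that linear identities are settled by reordering
  summands and collecting multiples of the same vector.\<close>

lemma cvec_uminus: "x \<in> carrier V \<Longrightarrow> \<ominus> x = (- 1) \<odot> x"
proof -
  assume x: "x \<in> carrier V"
  have "(- 1) \<odot> x \<oplus> x = (- 1 + 1) \<odot> x"
    using x cvec_add_smult[of x "-1" 1] by (simp add: cvec_smult_one)
  then show ?thesis
    using V.minus_equality[of "(-1) \<odot> x" x] x by (simp add: cvec_zero_smult cvec_smult_closed)
qed

lemma cvec_minus: "x \<in> carrier V \<Longrightarrow> y \<in> carrier V \<Longrightarrow> x \<ominus> y = x \<oplus> (- 1) \<odot> y"
  by (simp add: a_minus_def cvec_uminus)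

lemma cvec_ac:
  "x \<in> carrier V \<Longrightarrow> y \<in> carrier V \<Longrightarrow> z \<in> carrier V \<Longrightarrow> (x \<oplus> y) \<oplus> z = x \<oplus> (y \<oplus> z)"
  "x \<in> carrier V \<Longrightarrow> y \<in> carrier V \<Longrightarrow> x \<oplus> y = y \<oplus> x"
  "x \<in> carrier V \<Longrightarrow> y \<in> carrier V \<Longrightarrow> z \<in> carrier V \<Longrightarrow> x \<oplus> (y \<oplus> z) = y \<oplus> (x \<oplus> z)"
  by (simp_all add: V.a_ac)

text \<open>
  Term ordering does not make multiples of the same vector adjacent, so \<open>cvec_collect\<close> also adds
  multiples of \<open>x\<close> across up to two other summands.
\<close>

lemma cvec_collect:
  "\<lbrakk>x \<in> carrier V\<rbrakk> \<Longrightarrow>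
      c \<odot> x \<oplus> d \<odot> x = (c + d) \<odot> x"
  "\<lbrakk>x \<in> carrier V; w \<in> carrier V\<rbrakk> \<Longrightarrow>
      c \<odot> x \<oplus> (d \<odot> x \<oplus> w) = (c + d) \<odot> x \<oplus> w"
  "\<lbrakk>x \<in> carrier V; y \<in> carrier V\<rbrakk> \<Longrightarrow>
      c \<odot> x \<oplus> (y \<oplus> d \<odot> x) = (c + d) \<odot> x \<oplus> y"
  "\<lbrakk>x \<in> carrier V; y \<in> carrier V; w \<in> carrier V\<rbrakk> \<Longrightarrow>
      c \<odot> x \<oplus> (y \<oplus> (d \<odot> x \<oplus> w)) = (c + d) \<odot> x \<oplus> (y \<oplus> w)"
  "\<lbrakk>x \<in> carrier V; y \<in> carrier V; z \<in> carrier V\<rbrakk> \<Longrightarrow>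
      c \<odot> x \<oplus> (y \<oplus> (z \<oplus> d \<odot> x)) = (c + d) \<odot> x \<oplus> (y \<oplus> z)"
  "\<lbrakk>x \<in> carrier V; y \<in> carrier V; z \<in> carrier V; w \<in> carrier V\<rbrakk> \<Longrightarrow>
      c \<odot> x \<oplus> (y \<oplus> (z \<oplus> (d \<odot> x \<oplus> w))) = (c + d) \<odot> x \<oplus> (y \<oplus> (z \<oplus> w))"
  "\<lbrakk>x \<in> carrier V\<rbrakk> \<Longrightarrow>
      x \<oplus> d \<odot> x = (1 + d) \<odot> x"
  "\<lbrakk>x \<in> carrier V; w \<in> carrier V\<rbrakk> \<Longrightarrow>
      x \<oplus> (d \<odot> x \<oplus> w) = (1 + d) \<odot> x \<oplus> w"
  "\<lbrakk>x \<in> carrier V; y \<in> carrier V\<rbrakk> \<Longrightarrow>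
      x \<oplus> (y \<oplus> d \<odot> x) = (1 + d) \<odot> x \<oplus> y"
  "\<lbrakk>x \<in> carrier V; y \<in> carrier V; w \<in> carrier V\<rbrakk> \<Longrightarrow>
      x \<oplus> (y \<oplus> (d \<odot> x \<oplus> w)) = (1 + d) \<odot> x \<oplus> (y \<oplus> w)"
  "\<lbrakk>x \<in> carrier V; y \<in> carrier V; z \<in> carrier V\<rbrakk> \<Longrightarrow>
      x \<oplus> (y \<oplus> (z \<oplus> d \<odot> x)) = (1 + d) \<odot> x \<oplus> (y \<oplus> z)"
  "\<lbrakk>x \<in> carrier V; y \<in> carrier V; z \<in> carrier V; w \<in> carrier V\<rbrakk> \<Longrightarrow>
      x \<oplus> (y \<oplus> (z \<oplus> (d \<odot> x \<oplus> w))) = (1 + d) \<odot> x \<oplus> (y \<oplus> (z \<oplus> w))"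
  "\<lbrakk>x \<in> carrier V\<rbrakk> \<Longrightarrow>
      c \<odot> x \<oplus> x = (c + 1) \<odot> x"
  "\<lbrakk>x \<in> carrier V; w \<in> carrier V\<rbrakk> \<Longrightarrow>
      c \<odot> x \<oplus> (x \<oplus> w) = (c + 1) \<odot> x \<oplus> w"
  "\<lbrakk>x \<in> carrier V; y \<in> carrier V\<rbrakk> \<Longrightarrow>
      c \<odot> x \<oplus> (y \<oplus> x) = (c + 1) \<odot> x \<oplus> y"
  "\<lbrakk>x \<in> carrier V; y \<in> carrier V; w \<in> carrier V\<rbrakk> \<Longrightarrow>
      c \<odot> x \<oplus> (y \<oplus> (x \<oplus> w)) = (c + 1) \<odot> x \<oplus> (y \<oplus> w)"
  "\<lbrakk>x \<in> carrier V; y \<in> carrier V; z \<in> carrier V\<rbrakk> \<Longrightarrow>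
      c \<odot> x \<oplus> (y \<oplus> (z \<oplus> x)) = (c + 1) \<odot> x \<oplus> (y \<oplus> z)"
  "\<lbrakk>x \<in> carrier V; y \<in> carrier V; z \<in> carrier V; w \<in> carrier V\<rbrakk> \<Longrightarrow>
      c \<odot> x \<oplus> (y \<oplus> (z \<oplus> (x \<oplus> w))) = (c + 1) \<odot> x \<oplus> (y \<oplus> (z \<oplus> w))"
  by (simp_all add: cvec_add_smult cvec_smult_one V.a_ac cvec_smult_closed)

end

lemmas cvec_simps [simp] = cvec_zero_closed cvec_add_closed cvec_minus_closed cvec_uminus_closed
  cvec_smult_closed cvec_add_zero cvec_smult_one cvec_smult_add cvec_smult_smult cvec_zero_smult
  cvec_smult_zero

lemma complex_algebra_cvec [simp]: "complex_algebra A \<Longrightarrow> cvec A"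
  by (simp add: complex_algebra_def)

lemma lin_mapsI:
  assumes "\<And>x. x \<in> carrier V \<Longrightarrow> f x \<in> carrier W"
    and "\<And>x y. x \<in> carrier V \<Longrightarrow> y \<in> carrier V \<Longrightarrow> f (x \<oplus>\<^bsub>V\<^esub> y) = f x \<oplus>\<^bsub>W\<^esub> f y"
    and "\<And>c x. x \<in> carrier V \<Longrightarrow> f (c \<odot>\<^bsub>V\<^esub> x) = c \<odot>\<^bsub>W\<^esub> f x"
  shows "f \<in> lin_maps V W"
  using assms by (auto simp: lin_maps_def)

lemma lin_mapsD:
  assumes "f \<in> lin_maps V W"
  shows "x \<in> carrier V \<Longrightarrow> f x \<in> carrier W"
    and "x \<in> carrier V \<Longrightarrow> y \<in> carrier V \<Longrightarrow> f (x \<oplus>\<^bsub>V\<^esub> y) = f x \<oplus>\<^bsub>W\<^esub> f y"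
    and "x \<in> carrier V \<Longrightarrow> f (c \<odot>\<^bsub>V\<^esub> x) = c \<odot>\<^bsub>W\<^esub> f x"
  using assms by (auto simp: lin_maps_def)

lemma lin_maps_zero: "f \<in> lin_maps V W \<Longrightarrow> cvec V \<Longrightarrow> cvec W \<Longrightarrow> f \<zero>\<^bsub>V\<^esub> = \<zero>\<^bsub>W\<^esub>"
  using lin_mapsD(3)[of f V W "\<zero>\<^bsub>V\<^esub>" 0] lin_mapsD(1)[of f V W "\<zero>\<^bsub>V\<^esub>"] by simp

lemma lin_maps_comp: "f \<in> lin_maps U V \<Longrightarrow> g \<in> lin_maps V W \<Longrightarrow> (\<lambda>x. g (f x)) \<in> lin_maps U W"
  by (rule lin_mapsI) (simp_all add: lin_mapsD[of f U V] lin_mapsD[of g V W])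


section \<open>Sums over formal linear combinations\<close>

text \<open>The expression that \<open>tensor_lift\<close> evaluates at each representative, that
  is, the linear extension of \<open>g\<close> to formal combinations.\<close>

definition fsum :: "(complex, 'v, 'm) module_scheme \<Rightarrow> ('x \<Rightarrow> 'v) \<Rightarrow> ('x \<Rightarrow>\<^sub>0 complex) \<Rightarrow> 'v" where
  "fsum V g f = (\<Oplus>\<^bsub>V\<^esub>x\<in>Poly_Mapping.keys f. Poly_Mapping.lookup f x \<odot>\<^bsub>V\<^esub> g x)"

context
  fixes V :: "(complex, 'v, 'm) module_scheme" (structure)
    and g :: "'x \<Rightarrow> 'v" and X :: "'x set"
  assumes V: "cvec V" and g: "\<And>x. x \<in> X \<Longrightarrow> g x \<in> carrier V"
begin

interpretation V: module complex_alg V by (rule V)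

text \<open>Indices with coefficient zero contribute nothing, so combinations with different
  supports can be summed over a common set.\<close>

lemma fsum_superset:
  assumes "Poly_Mapping.keys f \<subseteq> Y" "Y \<subseteq> X" "finite Y"
  shows "fsum V g f = (\<Oplus>x\<in>Y. Poly_Mapping.lookup f x \<odot> g x)"
  unfolding fsum_def
  by (rule V.add.finprod_mono_neutral_cong_left) (use assms g V in \<open>auto simp: in_keys_iff subset_eq\<close>)

lemma fsum_closed:
  assumes "Poly_Mapping.keys f \<subseteq> X"
  shows "fsum V g f \<in> carrier V"
  unfolding fsum_def by (rule V.finsum_closed) (use assms g V in auto)

lemma fsum_add:
  assumes "Poly_Mapping.keys f \<subseteq> X" "Poly_Mapping.keys h \<subseteq> X"
  shows "fsum V g (f + h) = fsum V g f \<oplus> fsum V g h"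
proof -
  define Y where "Y = Poly_Mapping.keys f \<union> Poly_Mapping.keys h"
  have Y: "Y \<subseteq> X" "finite Y" "Poly_Mapping.keys (f + h) \<subseteq> Y"
    using assms Poly_Mapping.keys_add[of f h] by (auto simp: Y_def)
  have gY: "\<And>x. x \<in> Y \<Longrightarrow> g x \<in> carrier V" using g Y by auto
  have "fsum V g (f + h) = (\<Oplus>x\<in>Y. Poly_Mapping.lookup f x \<odot> g x \<oplus> Poly_Mapping.lookup h x \<odot> g x)"
    by (subst fsum_superset[OF Y(3,1,2)], rule V.finsum_cong')
      (use gY V in \<open>auto simp: lookup_add cvec_add_smult\<close>)
  also have "\<dots> = fsum V g f \<oplus> fsum V g h"
    by (subst V.finsum_addf, insert gY V, simp, simp)
      (subst (1 2) fsum_superset[OF _ Y(1,2)], auto simp: Y_def)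
  finally show ?thesis .
qed

lemma fsum_scale:
  assumes "Poly_Mapping.keys f \<subseteq> X"
  shows "fsum V g (fscale c f) = c \<odot> fsum V g f"
proof -
  have Y: "Poly_Mapping.keys (fscale c f) \<subseteq> Poly_Mapping.keys f" by (auto simp: in_keys_iff)
  have gY: "\<And>x. x \<in> Poly_Mapping.keys f \<Longrightarrow> g x \<in> carrier V" using g assms by auto
  have "fsum V g (fscale c f) = (\<Oplus>x\<in>Poly_Mapping.keys f. c \<odot> (Poly_Mapping.lookup f x \<odot> g x))"
    by (subst fsum_superset[OF Y assms], simp, rule V.finsum_cong') (use gY V in auto)
  also have "\<dots> = c \<odot> fsum V g f"
    using V.finsum_smult_ldistr[of "Poly_Mapping.keys f" c "\<lambda>x. Poly_Mapping.lookup f x \<odot> g x"] gY V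
    by (simp add: fsum_def Pi_def)
  finally show ?thesis .
qed

lemma fsum_pt: "x \<in> X \<Longrightarrow> fsum V g (pt x) = g x"
  using g[of x] V by (simp add: fsum_def)

lemma fsum_diff:
  assumes "Poly_Mapping.keys f \<subseteq> X" "Poly_Mapping.keys h \<subseteq> X"
  shows "fsum V g (f - h) = fsum V g f \<ominus> fsum V g h"
proof -
  have "f - h = f + fscale (- 1) h" by (rule poly_mapping_eqI) (simp add: lookup_add lookup_minus)
  moreover have "Poly_Mapping.keys (fscale (- 1) h) \<subseteq> X" using assms by (auto simp: in_keys_iff)
  ultimately have "fsum V g (f - h) = fsum V g f \<oplus> (- 1) \<odot> fsum V g h"
    using fsum_add[OF assms(1), of "fscale (- 1) h"] fsum_scale[OF assms(2), of "- 1"] by metis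
  then show ?thesis using assms V by (simp add: cvec_minus fsum_closed)
qed

end

lemma keys_fscale: "Poly_Mapping.keys (fscale c f) \<subseteq> Poly_Mapping.keys f"
  by (auto simp: in_keys_iff)

lemma keys_span:
  assumes "\<And>r. r \<in> R \<Longrightarrow> Poly_Mapping.keys r \<subseteq> X" "f \<in> fs.span R"
  shows "Poly_Mapping.keys f \<subseteq> X"
  using assms(2)
proof (induction rule: fs.span_induct_alt)
  case (step c r h)
  then show ?case
    using Poly_Mapping.keys_add[of "fscale c r" h] keys_fscale[of c r] assms(1) by blast
qed simp

text \<open>Two representatives of a tensor differ by an element of the span of the relations; this
  lemma is why a Sweedler sum takes the same value at both.\<close>

lemma fsum_span:
  assumes V: "cvec V" and g: "\<And>x. x \<in> X \<Longrightarrow> g x \<in> carrier V"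
    and R: "\<And>r. r \<in> R \<Longrightarrow> Poly_Mapping.keys r \<subseteq> X \<and> fsum V g r = \<zero>\<^bsub>V\<^esub>"
    and f: "f \<in> fs.span R"
  shows "fsum V g f = \<zero>\<^bsub>V\<^esub>"
proof -
  have "Poly_Mapping.keys f \<subseteq> X \<and> fsum V g f = \<zero>\<^bsub>V\<^esub>"
    using f
  proof (induction rule: fs.span_induct_alt)
    case base
    then show ?case using abelian_group.axioms(1)[OF cvec_abelian[OF V]]
      by (simp add: fsum_def abelian_monoid.finsum_empty)
  next
    case (step c r h)
    have k: "Poly_Mapping.keys (fscale c r) \<subseteq> X" "Poly_Mapping.keys r \<subseteq> X"
      using keys_fscale[of c r] R[OF step(1)] by auto
    then have "fsum V g (fscale c r + h) = \<zero>\<^bsub>V\<^esub>"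
      using R[OF step(1)] step fsum_add[where V = V and g = g and X = X and f = "fscale c r" and h = h, OF V g k(1)] fsum_scale[where V = V and g = g and X = X and f = r and c = c, OF V g k(2)] V
      by simp
    then show ?case using Poly_Mapping.keys_add[of "fscale c r" h] k step by blast
  qed
  then show ?thesis by simp
qed

lemma fsum_lin:
  assumes V: "cvec V" and W: "cvec W" and g: "\<And>x. x \<in> Poly_Mapping.keys f \<Longrightarrow> g x \<in> carrier V"
    and F: "F \<in> lin_maps V W"
  shows "F (fsum V g f) = fsum W (\<lambda>x. F (g x)) f"
proof -
  interpret V: module complex_alg V by (rule V)
  interpret W: module complex_alg W by (rule W)
  note Fs = lin_mapsD[OF F]
  have "F (\<Oplus>\<^bsub>V\<^esub>x\<in>K. Poly_Mapping.lookup f x \<odot>\<^bsub>V\<^esub> g x) = (\<Oplus>\<^bsub>W\<^esub>x\<in>K. Poly_Mapping.lookup f x \<odot>\<^bsub>W\<^esub> F (g x))"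
    if "finite K" "K \<subseteq> Poly_Mapping.keys f" for K
    using that
  proof (induction K)
    case empty
    then show ?case using lin_maps_zero[OF F V W] by simp
  next
    case (insert x K)
    have gx: "g x \<in> carrier V" "\<And>z. z \<in> K \<Longrightarrow> g z \<in> carrier V"
      using g insert by auto
    then have s: "(\<Oplus>\<^bsub>V\<^esub>x\<in>K. Poly_Mapping.lookup f x \<odot>\<^bsub>V\<^esub> g x) \<in> carrier V"
      by (intro V.finsum_closed) (use V in auto)
    show ?case
      using insert gx s Fs V W
      by (subst V.finsum_insert W.finsum_insert; simp add: Pi_def)+
  qed
  then show ?thesis unfolding fsum_def by simp
qed

lemma fsum_add_fun:
  assumes V: "cvec V" and g: "\<And>x. x \<in> Poly_Mapping.keys f \<Longrightarrow> g x \<in> carrier V"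
    and h: "\<And>x. x \<in> Poly_Mapping.keys f \<Longrightarrow> h x \<in> carrier V"
  shows "fsum V (\<lambda>x. g x \<oplus>\<^bsub>V\<^esub> h x) f = fsum V g f \<oplus>\<^bsub>V\<^esub> fsum V h f"
proof -
  interpret V: module complex_alg V by (rule V)
  show ?thesis unfolding fsum_def
    by (subst V.finsum_addf[symmetric], insert g h V, simp, simp, rule V.finsum_cong') auto
qed

lemma fsum_cong:
  assumes V: "cvec V" and g: "\<And>x. x \<in> Poly_Mapping.keys f \<Longrightarrow> g x \<in> carrier V"
    and h: "\<And>x. x \<in> Poly_Mapping.keys f \<Longrightarrow> g x = h x"
  shows "fsum V g f = fsum V h f"
proof -
  interpret V: module complex_alg V by (rule V)
  show ?thesis unfolding fsum_def by (rule V.finsum_cong') (use g h V in auto)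
qed

lemma fsum_smult_fun:
  assumes V: "cvec V" and g: "\<And>x. x \<in> Poly_Mapping.keys f \<Longrightarrow> g x \<in> carrier V"
  shows "fsum V (\<lambda>x. c \<odot>\<^bsub>V\<^esub> g x) f = c \<odot>\<^bsub>V\<^esub> fsum V g f"
  by (rule fsum_lin[OF V V g, symmetric, where F = "\<lambda>x. c \<odot>\<^bsub>V\<^esub> x"])
    (auto intro!: lin_mapsI simp: V algebra_simps)

text \<open>A finite Fubini rule; it allows Sweedler sums over unrelated tensors to be taken in
  either order.\<close>

lemma fsum_swap:
  assumes V: "cvec V"
    and g: "\<And>x y. x \<in> Poly_Mapping.keys f \<Longrightarrow> y \<in> Poly_Mapping.keys h \<Longrightarrow> g x y \<in> carrier V"
  shows "fsum V (\<lambda>x. fsum V (\<lambda>y. g x y) h) f = fsum V (\<lambda>y. fsum V (\<lambda>x. g x y) f) h"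
proof -
  interpret V: module complex_alg V by (rule V)
  have "fsum V (\<lambda>x. (\<Oplus>\<^bsub>V\<^esub>y\<in>K. Poly_Mapping.lookup h y \<odot>\<^bsub>V\<^esub> g x y)) f =
    (\<Oplus>\<^bsub>V\<^esub>y\<in>K. Poly_Mapping.lookup h y \<odot>\<^bsub>V\<^esub> fsum V (\<lambda>x. g x y) f)"
    if "finite K" "K \<subseteq> Poly_Mapping.keys h" for K
    using that
  proof (induction K)
    case empty
    have "fsum V (\<lambda>x. \<zero>\<^bsub>V\<^esub>) f = \<zero>\<^bsub>V\<^esub>"
      using fsum_smult_fun[OF V, of f "\<lambda>x. \<zero>\<^bsub>V\<^esub>" 0] fsum_closed[OF V, of "Poly_Mapping.keys f" "\<lambda>x. \<zero>\<^bsub>V\<^esub>" f] V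
      by simp
    then show ?case by simp
  next
    case (insert y K)
    have gx: "g x y \<in> carrier V" "\<And>z. z \<in> K \<Longrightarrow> g x z \<in> carrier V" if "x \<in> Poly_Mapping.keys f" for x
      using g insert that by auto
    then have s: "(\<Oplus>\<^bsub>V\<^esub>z\<in>K. Poly_Mapping.lookup h z \<odot>\<^bsub>V\<^esub> g x z) \<in> carrier V" if "x \<in> Poly_Mapping.keys f" for x
      by (intro V.finsum_closed) (use V that in auto)
    have c: "fsum V (\<lambda>x. g x z) f \<in> carrier V" if "z \<in> insert y K" for z
      using fsum_closed[OF V, of "Poly_Mapping.keys f" "\<lambda>x. g x z" f] gx that by auto
    have "fsum V (\<lambda>x. (\<Oplus>\<^bsub>V\<^esub>z\<in>insert y K. Poly_Mapping.lookup h z \<odot>\<^bsub>V\<^esub> g x z)) f =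
      fsum V (\<lambda>x. Poly_Mapping.lookup h y \<odot>\<^bsub>V\<^esub> g x y \<oplus>\<^bsub>V\<^esub> (\<Oplus>\<^bsub>V\<^esub>z\<in>K. Poly_Mapping.lookup h z \<odot>\<^bsub>V\<^esub> g x z)) f"
      by (rule fsum_cong[OF V]) (insert insert(1,2) gx s V, auto simp: V.finsum_insert Pi_def)
    also have "\<dots> = Poly_Mapping.lookup h y \<odot>\<^bsub>V\<^esub> fsum V (\<lambda>x. g x y) f \<oplus>\<^bsub>V\<^esub>
        (\<Oplus>\<^bsub>V\<^esub>z\<in>K. Poly_Mapping.lookup h z \<odot>\<^bsub>V\<^esub> fsum V (\<lambda>x. g x z) f)"
      using insert gx s V by (simp add: fsum_add_fun fsum_smult_fun)
    also have "\<dots> = (\<Oplus>\<^bsub>V\<^esub>z\<in>insert y K. Poly_Mapping.lookup h z \<odot>\<^bsub>V\<^esub> fsum V (\<lambda>x. g x z) f)"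
      using insert(1,2) c V by (subst V.finsum_insert) (auto simp: Pi_def)
    finally show ?case .
  qed
  then show ?thesis by (subst (2 4) fsum_def) (simp add: fsum_def)
qed

section \<open>Sweedler sums\<close>

text \<open>The default 0 ensures \<open>keys_tens_rep\<close> for every set \<open>S\<close>, so
  that sums over the chosen representative always stay inside the carriers.\<close>

definition tens_rep ::
  "(complex, 'a, 'k) module_scheme \<Rightarrow> (complex, 'b, 'l) module_scheme \<Rightarrow> ('a, 'b) tens \<Rightarrow> 'a \<times> 'b \<Rightarrow>\<^sub>0 complex"
  where
  "tens_rep A B S =
     (if \<exists>f\<in>S. Poly_Mapping.keys f \<subseteq> carrier A \<times> carrier B
      then SOME f. f \<in> S \<and> Poly_Mapping.keys f \<subseteq> carrier A \<times> carrier B else 0)"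

text \<open>
  \<open>TL A B V g S\<close> is a linear extension of \<open>g\<close> evaluated at one chosen representative of \<open>S\<close>.  In
  contrast to \<^const>\<open>tensor_lift\<close>, most rules for it hold whether or not \<open>g\<close> is bilinear.
\<close>

definition TL ::
  "(complex, 'a, 'k) module_scheme \<Rightarrow> (complex, 'b, 'l) module_scheme \<Rightarrow> (complex, 'v, 'm) module_scheme \<Rightarrow>
   ('a \<Rightarrow> 'b \<Rightarrow> 'v) \<Rightarrow> ('a, 'b) tens \<Rightarrow> 'v" where
  "TL A B V g S = fsum V (restrict (\<lambda>(x, y). g x y) (carrier A \<times> carrier B)) (tens_rep A B S)"

lemma keys_tens_rep: "Poly_Mapping.keys (tens_rep A B S) \<subseteq> carrier A \<times> carrier B"
proof (cases "\<exists>f\<in>S. Poly_Mapping.keys f \<subseteq> carrier A \<times> carrier B")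
  case True
  then have "\<exists>f. f \<in> S \<and> Poly_Mapping.keys f \<subseteq> carrier A \<times> carrier B" by blast
  from someI_ex[OF this] True show ?thesis by (simp add: tens_rep_def)
qed (simp add: tens_rep_def)

lemma tens_rep_in: "f \<in> S \<Longrightarrow> Poly_Mapping.keys f \<subseteq> carrier A \<times> carrier B \<Longrightarrow> tens_rep A B S \<in> S"
  using someI_ex[of "\<lambda>f. f \<in> S \<and> Poly_Mapping.keys f \<subseteq> carrier A \<times> carrier B"]
  by (auto simp: tens_rep_def)

text \<open>As a congruence rule this gives the simplifier the carrier membership of the bound
  components while it rewrites under a Sweedler sum. It holds for arbitrary \<open>g\<close> because
  \<open>TL\<close> restricts its summand to the carriers.\<close>

lemma TL_cong [cong]:
  assumes "\<And>x y. x \<in> carrier A \<Longrightarrow> y \<in> carrier B \<Longrightarrow> g x y = g' x y" "S = S'"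
  shows "TL A B V g S = TL A B V g' S'"
proof -
  have "restrict (\<lambda>(x, y). g x y) (carrier A \<times> carrier B) = restrict (\<lambda>(x, y). g' x y) (carrier A \<times> carrier B)"
    using assms by (auto simp: restrict_def)
  then show ?thesis using assms(2) by (simp only: TL_def)
qed

lemma TL_closed [simp]:
  assumes "cvec V" "\<And>x y. x \<in> carrier A \<Longrightarrow> y \<in> carrier B \<Longrightarrow> g x y \<in> carrier V"
  shows "TL A B V g S \<in> carrier V"
  unfolding TL_def
  by (rule fsum_closed[OF assms(1), where X = "carrier A \<times> carrier B"])
    (insert assms keys_tens_rep[of A B S], auto)

lemma TL_lin:
  assumes "cvec V" "cvec W" "F \<in> lin_maps V W"
    "\<And>x y. x \<in> carrier A \<Longrightarrow> y \<in> carrier B \<Longrightarrow> g x y \<in> carrier V"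
  shows "F (TL A B V g S) = TL A B W (\<lambda>x y. F (g x y)) S"
  unfolding TL_def using keys_tens_rep[of A B S]
  by (subst fsum_lin[OF assms(1,2) _ assms(3)])
    (use assms lin_mapsD(1)[OF assms(3)] in \<open>auto intro!: fsum_cong simp: subset_eq\<close>)

lemma TL_add_fun:
  assumes "cvec V" "\<And>x y. x \<in> carrier A \<Longrightarrow> y \<in> carrier B \<Longrightarrow> g x y \<in> carrier V"
    "\<And>x y. x \<in> carrier A \<Longrightarrow> y \<in> carrier B \<Longrightarrow> h x y \<in> carrier V"
  shows "TL A B V (\<lambda>x y. g x y \<oplus>\<^bsub>V\<^esub> h x y) S = TL A B V g S \<oplus>\<^bsub>V\<^esub> TL A B V h S"
  unfolding TL_def using keys_tens_rep[of A B S]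
  by (subst fsum_add_fun[symmetric], insert assms, simp, force, force, intro fsum_cong)
    (force simp: subset_eq)+

lemma TL_smult_fun:
  assumes "cvec V" "\<And>x y. x \<in> carrier A \<Longrightarrow> y \<in> carrier B \<Longrightarrow> g x y \<in> carrier V"
  shows "TL A B V (\<lambda>x y. c \<odot>\<^bsub>V\<^esub> g x y) S = c \<odot>\<^bsub>V\<^esub> TL A B V g S"
  by (rule TL_lin[where F = "\<lambda>x. c \<odot>\<^bsub>V\<^esub> x", OF assms(1,1) _ assms(2), symmetric])
    (auto intro!: lin_mapsI simp: assms algebra_simps)

text \<open>Both sides are finite double sums over the same two chosen representatives, so no
  bilinearity enters.\<close>

lemma TL_swap:
  assumes "cvec V"
    "\<And>x y u v. x \<in> carrier A \<Longrightarrow> y \<in> carrier B \<Longrightarrow> u \<in> carrier C \<Longrightarrow> v \<in> carrier D \<Longrightarrow> g x y u v \<in> carrier V"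
  shows "TL A B V (\<lambda>x y. TL C D V (\<lambda>u v. g x y u v) T) S = TL C D V (\<lambda>u v. TL A B V (\<lambda>x y. g x y u v) S) T"
proof -
  define f h where "f = tens_rep A B S" and "h = tens_rep C D T"
  note k = keys_tens_rep[of A B S, folded f_def] keys_tens_rep[of C D T, folded h_def]
  define G where "G z w = g (fst z) (snd z) (fst w) (snd w)" for z w
  have G: "G z w \<in> carrier V" if "z \<in> Poly_Mapping.keys f" "w \<in> Poly_Mapping.keys h" for z w
    using that k assms(2) by (force simp: G_def)
  have 1: "fsum V (restrict (\<lambda>(u, v). g x y u v) (carrier C \<times> carrier D)) h = fsum V (G (x, y)) h"
    if "(x, y) \<in> Poly_Mapping.keys f" for x y
    by (rule fsum_cong[OF assms(1)]) (use k G[OF that] in \<open>auto simp: G_def subset_eq\<close>)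
  have 2: "fsum V (restrict (\<lambda>(x, y). g x y u v) (carrier A \<times> carrier B)) f = fsum V (\<lambda>z. G z (u, v)) f"
    if "(u, v) \<in> Poly_Mapping.keys h" for u v
    by (rule fsum_cong[OF assms(1)]) (use k G[OF _ that] in \<open>auto simp: G_def subset_eq\<close>)
  have c: "fsum V (G z) h \<in> carrier V" if "z \<in> Poly_Mapping.keys f" for z
    using fsum_closed[OF assms(1), of "Poly_Mapping.keys h" "G z" h] G that by blast
  have d: "fsum V (\<lambda>z. G z w) f \<in> carrier V" if "w \<in> Poly_Mapping.keys h" for w
    using fsum_closed[OF assms(1), of "Poly_Mapping.keys f" "\<lambda>z. G z w" f] G that by blast
  have "TL A B V (\<lambda>x y. TL C D V (\<lambda>u v. g x y u v) T) S = fsum V (\<lambda>z. fsum V (G z) h) f"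
    unfolding TL_def f_def[symmetric] h_def[symmetric]
    by (rule fsum_cong[OF assms(1)]) (use 1 c k(1) in \<open>force simp: subset_eq\<close>)+
  moreover have "TL C D V (\<lambda>u v. TL A B V (\<lambda>x y. g x y u v) S) T = fsum V (\<lambda>w. fsum V (\<lambda>z. G z w) f) h"
    unfolding TL_def f_def[symmetric] h_def[symmetric]
    by (rule fsum_cong[OF assms(1)]) (use 2 d k(2) in \<open>force simp: subset_eq\<close>)+
  ultimately show ?thesis using fsum_swap[OF assms(1) G] by simp
qed

definition bilin ::
  "(complex, 'a, 'k) module_scheme \<Rightarrow> (complex, 'b, 'l) module_scheme \<Rightarrow> (complex, 'v, 'm) module_scheme \<Rightarrow>
   ('a \<Rightarrow> 'b \<Rightarrow> 'v) \<Rightarrow> bool" where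
  "bilin A B V g \<longleftrightarrow>
     (\<forall>x\<in>carrier A. \<forall>y\<in>carrier B. g x y \<in> carrier V) \<and>
     (\<forall>x\<in>carrier A. \<forall>x'\<in>carrier A. \<forall>y\<in>carrier B. g (x \<oplus>\<^bsub>A\<^esub> x') y = g x y \<oplus>\<^bsub>V\<^esub> g x' y) \<and>
     (\<forall>x\<in>carrier A. \<forall>y\<in>carrier B. \<forall>y'\<in>carrier B. g x (y \<oplus>\<^bsub>B\<^esub> y') = g x y \<oplus>\<^bsub>V\<^esub> g x y') \<and>
     (\<forall>c. \<forall>x\<in>carrier A. \<forall>y\<in>carrier B. g (c \<odot>\<^bsub>A\<^esub> x) y = c \<odot>\<^bsub>V\<^esub> g x y) \<and>
     (\<forall>c. \<forall>x\<in>carrier A. \<forall>y\<in>carrier B. g x (c \<odot>\<^bsub>B\<^esub> y) = c \<odot>\<^bsub>V\<^esub> g x y)"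

lemma bilinI:
  assumes "\<And>x y. x \<in> carrier A \<Longrightarrow> y \<in> carrier B \<Longrightarrow> g x y \<in> carrier V"
    "\<And>x x' y. x \<in> carrier A \<Longrightarrow> x' \<in> carrier A \<Longrightarrow> y \<in> carrier B \<Longrightarrow> g (x \<oplus>\<^bsub>A\<^esub> x') y = g x y \<oplus>\<^bsub>V\<^esub> g x' y"
    "\<And>x y y'. x \<in> carrier A \<Longrightarrow> y \<in> carrier B \<Longrightarrow> y' \<in> carrier B \<Longrightarrow> g x (y \<oplus>\<^bsub>B\<^esub> y') = g x y \<oplus>\<^bsub>V\<^esub> g x y'"
    "\<And>c x y. x \<in> carrier A \<Longrightarrow> y \<in> carrier B \<Longrightarrow> g (c \<odot>\<^bsub>A\<^esub> x) y = c \<odot>\<^bsub>V\<^esub> g x y"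
    "\<And>c x y. x \<in> carrier A \<Longrightarrow> y \<in> carrier B \<Longrightarrow> g x (c \<odot>\<^bsub>B\<^esub> y) = c \<odot>\<^bsub>V\<^esub> g x y"
  shows "bilin A B V g"
  using assms by (auto simp: bilin_def)

lemma bilin_closed: "bilin A B V g \<Longrightarrow> x \<in> carrier A \<Longrightarrow> y \<in> carrier B \<Longrightarrow> g x y \<in> carrier V"
  by (simp add: bilin_def)


section \<open>Quotients of formal linear combinations of pairs\<close>

definition kills ::
  "(complex, 'v, 'm) module_scheme \<Rightarrow> ('a \<Rightarrow> 'b \<Rightarrow> 'v) \<Rightarrow> ('a, 'b) tens \<Rightarrow> bool" where
  "kills V g R \<longleftrightarrow> (\<forall>r\<in>R. fsum V (\<lambda>(x, y). g x y) r = \<zero>\<^bsub>V\<^esub>)"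

lemma keys_bilin_rels:
  assumes "cvec A" "cvec B" "r \<in> bilin_rels A B"
  shows "Poly_Mapping.keys r \<subseteq> carrier A \<times> carrier B"
proof -
  have k: "Poly_Mapping.keys (a - b) \<subseteq> X" if "Poly_Mapping.keys a \<subseteq> X" "Poly_Mapping.keys b \<subseteq> X"
    for a b :: "'z \<Rightarrow>\<^sub>0 complex" and X
    using that keys_diff[of a b] by blast
  show ?thesis using assms(3) assms(1,2) unfolding bilin_rels_def
    by - (elim UnE CollectE exE conjE; hypsubst; intro k order_trans[OF keys_fscale]; simp)
qed

lemma kills_bilin_rels:
  assumes V: "cvec V" and A: "cvec A" and B: "cvec B" and g: "bilin A B V g"
  shows "kills V g (bilin_rels A B)"
  unfolding kills_def
proof
  fix r assume r: "r \<in> bilin_rels A B"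
  define X where "X = carrier A \<times> carrier B"
  define G where "G = (\<lambda>(x, y). g x y)"
  have G: "\<And>z. z \<in> X \<Longrightarrow> G z \<in> carrier V" using g by (auto simp: G_def X_def bilin_def)
  have k: "Poly_Mapping.keys (a - b) \<subseteq> X" if "Poly_Mapping.keys a \<subseteq> X" "Poly_Mapping.keys b \<subseteq> X"
    for a b
    using that keys_diff[of a b] by blast
  have d: "fsum V G (a - b) = fsum V G a \<oplus>\<^bsub>V\<^esub> (- 1) \<odot>\<^bsub>V\<^esub> fsum V G b"
    if "Poly_Mapping.keys a \<subseteq> X" "Poly_Mapping.keys b \<subseteq> X" for a b
    using that by (simp add: fsum_diff[where V = V and g = G and X = X, OF V G] fsum_closed[where V = V and g = G and X = X, OF V G] cvec_minus V)
  have p: "Poly_Mapping.keys (pt z) \<subseteq> X" "Poly_Mapping.keys (fscale c (pt z)) \<subseteq> X" "fsum V G (pt z) = G z"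
    "fsum V G (fscale c (pt z)) = c \<odot>\<^bsub>V\<^esub> G z" if "z \<in> X" for z c
    using that fsum_pt[where V = V and g = G and X = X, OF V G] fsum_scale[where V = V and g = G and X = X, OF V G] subset_trans[OF keys_fscale[of c "pt z"]] by auto
  have X: "(v, w) \<in> X" if "v \<in> carrier A" "w \<in> carrier B" for v w
    using that by (simp add: X_def)
  have e: "G (v, w) = g v w" for v w by (simp add: G_def)
  have "fsum V G r = \<zero>\<^bsub>V\<^esub>"
    using r g by (auto simp: bilin_rels_def d k p X e A B V bilin_def cvec_ac cvec_collect)
  then show "fsum V (\<lambda>(x, y). g x y) r = \<zero>\<^bsub>V\<^esub>" by (simp add: G_def)
qed

lemma cvec_minus_eq_zero:
  assumes "cvec V" "x \<in> carrier V" "y \<in> carrier V"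
  shows "x \<ominus>\<^bsub>V\<^esub> y = \<zero>\<^bsub>V\<^esub> \<longleftrightarrow> x = y"
proof
  assume "x \<ominus>\<^bsub>V\<^esub> y = \<zero>\<^bsub>V\<^esub>"
  then have "(x \<ominus>\<^bsub>V\<^esub> y) \<oplus>\<^bsub>V\<^esub> y = y" using assms by simp
  then show "x = y" using assms by (simp add: cvec_minus cvec_ac cvec_collect)
qed (use assms in \<open>simp add: cvec_minus cvec_collect\<close>)

lemma coset_eq_iff:
  assumes "fs.subspace N"
  shows "coset N f = coset N g \<longleftrightarrow> f - g \<in> N"
proof
  assume "coset N f = coset N g"
  then have "f \<in> coset N g" using fs.subspace_0[OF assms] by (auto simp: coset_def)
  then show "f - g \<in> N" by (simp add: coset_def)
next
  assume h: "f - g \<in> N"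
  have "e - f \<in> N \<longleftrightarrow> e - g \<in> N" for e
    using fs.subspace_add[OF assms _ h, of "e - f"] fs.subspace_diff[OF assms _ h, of "e - g"]
    by (auto simp: algebra_simps)
  then show "coset N f = coset N g" by (auto simp: coset_def)
qed

lemma coset_self: "fs.subspace N \<Longrightarrow> f \<in> coset N f"
  by (simp add: coset_def fs.subspace_0)

lemma poly_mapping_sum: "f = (\<Sum>k\<in>Poly_Mapping.keys f. fscale (Poly_Mapping.lookup f k) (pt k))"
proof (rule poly_mapping_eqI)
  fix x
  have "(\<Sum>k\<in>Poly_Mapping.keys f. Poly_Mapping.lookup f k * (1 when k = x)) =
    (\<Sum>k\<in>Poly_Mapping.keys f. if k = x then Poly_Mapping.lookup f x else 0)"
    by (rule sum.cong) (auto simp: when_def)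
  then show "Poly_Mapping.lookup f x = Poly_Mapping.lookup (\<Sum>k\<in>Poly_Mapping.keys f. fscale (Poly_Mapping.lookup f k) (pt k)) x"
    by (simp add: lookup_sum lookup_single sum.delta in_keys_iff)
qed

text \<open>The tensor products over the complex numbers and over \<open>A\<close> are both
  quotients by the span of relations that contain the bilinear ones. The universal property is
  proved once for such a set \<open>R\<close>.\<close>

locale tensor_space =
  fixes A :: "(complex, 'a, 'k) module_scheme" and B :: "(complex, 'b, 'l) module_scheme"
    and R :: "('a, 'b) tens" and T :: "(complex, ('a, 'b) tens) module"
  assumes A: "cvec A" and B: "cvec B" and bilin_R: "bilin_rels A B \<subseteq> R"
    and keys_R: "\<And>r. r \<in> R \<Longrightarrow> Poly_Mapping.keys r \<subseteq> carrier A \<times> carrier B"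
    and T_def: "T = tensor_quot A B (fs.span R)"
begin

definition "N = fs.span R"
definition "X = carrier A \<times> carrier B"

lemma sub: "fs.subspace N" by (simp add: N_def)

lemma keys_N: "n \<in> N \<Longrightarrow> Poly_Mapping.keys n \<subseteq> X"
  using keys_span[OF keys_R] by (simp add: N_def X_def)

lemma carrier_T: "carrier T = coset N ` {f. Poly_Mapping.keys f \<subseteq> X}"
  and zero_T: "\<zero>\<^bsub>T\<^esub> = N"
  and one_T: "\<one>\<^bsub>T\<^esub> = coset N (pt (\<one>\<^bsub>A\<^esub>, \<one>\<^bsub>B\<^esub>))"
  and mult_T: "S \<otimes>\<^bsub>T\<^esub> S' = (\<Union>f\<in>S. \<Union>g\<in>S'. coset N (formal_mult A B f g))"
  by (simp_all add: T_def tensor_quot_def N_def X_def)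

lemma zero_coset: "\<zero>\<^bsub>T\<^esub> = coset N 0" by (simp add: zero_T coset_def)

lemma coset_eqI: "f - g \<in> N \<Longrightarrow> coset N f = coset N g" by (simp add: coset_eq_iff[OF sub])

lemma coset_zero: "n \<in> N \<Longrightarrow> coset N n = \<zero>\<^bsub>T\<^esub>" by (simp add: zero_coset coset_eq_iff[OF sub])

text \<open>The operations of \<open>tensor_quot\<close> are unions over representatives; such a
  union is a single coset as soon as every representative gives the same one.\<close>

lemma UN_coset: "(\<And>f. f \<in> coset N f0 \<Longrightarrow> F f = C) \<Longrightarrow> (\<Union>f\<in>coset N f0. F f) = C"
  using coset_self[OF sub, of f0] by auto

lemma add_coset: "coset N f \<oplus>\<^bsub>T\<^esub> coset N g = coset N (f + g)"
  unfolding T_def tensor_quot_def N_def[symmetric]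
  by simp (intro UN_coset coset_eqI, use sub fs.subspace_add in \<open>force simp: coset_def algebra_simps\<close>)

lemma smult_coset: "c \<odot>\<^bsub>T\<^esub> coset N f = coset N (fscale c f)"
  unfolding T_def tensor_quot_def N_def[symmetric]
  by simp (intro UN_coset coset_eqI,
    use sub fs.subspace_scale[of N _ c] in \<open>auto simp: coset_def fs.scale_right_diff_distrib[symmetric]\<close>)

lemma coset_in: "Poly_Mapping.keys f \<subseteq> X \<Longrightarrow> coset N f \<in> carrier T"
  by (simp add: carrier_T)

lemma carrier_E:
  assumes "S \<in> carrier T"
  obtains f where "S = coset N f" "Poly_Mapping.keys f \<subseteq> X"
  using assms by (auto simp: carrier_T)

lemma cvec_T: "cvec T"
proof (rule cvecI)
  have k: "Poly_Mapping.keys (f + g) \<subseteq> X" if "Poly_Mapping.keys f \<subseteq> X" "Poly_Mapping.keys g \<subseteq> X"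
    for f g :: "'a \<times> 'b \<Rightarrow>\<^sub>0 complex"
    using that Poly_Mapping.keys_add[of f g] by blast
  have k': "Poly_Mapping.keys (fscale c f) \<subseteq> X" if "Poly_Mapping.keys f \<subseteq> X" for c f
    using that keys_fscale[of c f] by blast
  show "abelian_group T"
  proof (rule abelian_groupI)
    fix S assume "S \<in> carrier T"
    then obtain f where f: "S = coset N f" "Poly_Mapping.keys f \<subseteq> X" by (rule carrier_E)
    then show "\<exists>y\<in>carrier T. y \<oplus>\<^bsub>T\<^esub> S = \<zero>\<^bsub>T\<^esub>"
      using coset_in[OF k'[OF f(2), of "- 1"]]
      by (intro bexI[of _ "coset N (fscale (- 1) f)"]) (simp_all add: add_coset zero_coset)
  qed (auto simp: add_coset zero_coset algebra_simps elim!: carrier_E intro!: coset_in dest!: subsetD[OF Poly_Mapping.keys_add])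
qed (auto simp: add_coset smult_coset zero_coset fs.scale_left_distrib fs.scale_right_distrib elim!: carrier_E intro!: coset_in dest!: subsetD[OF keys_fscale])

lemma pure_coset: "pure_tensor T v w = coset N (pt (v, w))"
  by (simp add: pure_tensor_def zero_T)

lemma pure_bilin: "bilin A B T (pure_tensor T)"
proof (rule bilinI)
  note b = fs.span_base[OF subsetD[OF bilin_R], folded N_def]
  show "pure_tensor T x y \<in> carrier T" if "x \<in> carrier A" "y \<in> carrier B" for x y
    using that by (auto simp: pure_coset X_def intro!: coset_in)
  show "pure_tensor T (x \<oplus>\<^bsub>A\<^esub> x') y = pure_tensor T x y \<oplus>\<^bsub>T\<^esub> pure_tensor T x' y"
    if "x \<in> carrier A" "x' \<in> carrier A" "y \<in> carrier B" for x x' y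
    unfolding pure_coset add_coset
    by (rule coset_eqI, unfold diff_diff_eq[symmetric], rule b) (use that in \<open>unfold bilin_rels_def, blast\<close>)
  show "pure_tensor T x (y \<oplus>\<^bsub>B\<^esub> y') = pure_tensor T x y \<oplus>\<^bsub>T\<^esub> pure_tensor T x y'"
    if "x \<in> carrier A" "y \<in> carrier B" "y' \<in> carrier B" for x y y'
    unfolding pure_coset add_coset
    by (rule coset_eqI, unfold diff_diff_eq[symmetric], rule b) (use that in \<open>unfold bilin_rels_def, blast\<close>)
  show "pure_tensor T (c \<odot>\<^bsub>A\<^esub> x) y = c \<odot>\<^bsub>T\<^esub> pure_tensor T x y"
    if "x \<in> carrier A" "y \<in> carrier B" for c x y
    unfolding pure_coset smult_coset
    by (rule coset_eqI, rule b) (use that in \<open>unfold bilin_rels_def, blast\<close>)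
  show "pure_tensor T x (c \<odot>\<^bsub>B\<^esub> y) = c \<odot>\<^bsub>T\<^esub> pure_tensor T x y"
    if "x \<in> carrier A" "y \<in> carrier B" for c x y
    unfolding pure_coset smult_coset
    by (rule coset_eqI, rule b) (use that in \<open>unfold bilin_rels_def, blast\<close>)
qed

lemma keys_coset: "f \<in> coset N f0 \<Longrightarrow> Poly_Mapping.keys f0 \<subseteq> X \<Longrightarrow> Poly_Mapping.keys f \<subseteq> X"
  using keys_N[of "f - f0"] Poly_Mapping.keys_add[of "f - f0" f0] by (auto simp: coset_def)

lemma fsum_coset:
  assumes V: "cvec V" and g: "\<And>z. z \<in> X \<Longrightarrow> g z \<in> carrier V" and k: "\<And>r. r \<in> R \<Longrightarrow> fsum V g r = \<zero>\<^bsub>V\<^esub>"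
    and f: "Poly_Mapping.keys f0 \<subseteq> X" "f \<in> coset N f0"
  shows "fsum V g f = fsum V g f0"
proof -
  interpret V: module complex_alg V by (rule V)
  have "fsum V g (f - f0) = \<zero>\<^bsub>V\<^esub>"
    by (rule fsum_span[where V = V and g = g and X = X and R = R, OF V g]) (use f keys_R k in \<open>auto simp: coset_def N_def X_def\<close>)
  then have "fsum V g f \<ominus>\<^bsub>V\<^esub> fsum V g f0 = \<zero>\<^bsub>V\<^esub>"
    using fsum_diff[where V = V and g = g and X = X, OF V g, of f f0] keys_coset f by simp
  then show ?thesis
    using fsum_closed[where V = V and g = g and X = X, OF V g, of f] fsum_closed[where V = V and g = g and X = X, OF V g, of f0] keys_coset f
    by (simp add: cvec_minus_eq_zero V)
qed

lemma TL_coset: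
  assumes V: "cvec V" and g: "bilin A B V g" "kills V g R" and f: "Poly_Mapping.keys f \<subseteq> X"
  shows "TL A B V g (coset N f) = fsum V (\<lambda>(x, y). g x y) f"
proof -
  have r: "tens_rep A B (coset N f) \<in> coset N f"
    using tens_rep_in[of f "coset N f" A B] coset_self[OF sub] f by (simp add: X_def)
  have gX: "\<And>z. z \<in> X \<Longrightarrow> (case z of (x, y) \<Rightarrow> g x y) \<in> carrier V"
    using g(1) by (auto simp: X_def bilin_def)
  have "TL A B V g (coset N f) = fsum V (\<lambda>(x, y). g x y) (tens_rep A B (coset N f))"
    unfolding TL_def
    by (rule fsum_cong[OF V]) (use keys_coset[OF r f] gX in \<open>auto simp: X_def\<close>)
  also have "\<dots> = fsum V (\<lambda>(x, y). g x y) f"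
    by (rule fsum_coset[OF V gX _ f r]) (use g(2) in \<open>auto simp: kills_def\<close>)
  finally show ?thesis .
qed

lemma TL_lin_maps:
  assumes V: "cvec V" and g: "bilin A B V g" "kills V g R"
  shows "TL A B V g \<in> lin_maps T V"
proof (rule lin_mapsI)
  have gX: "\<And>z. z \<in> X \<Longrightarrow> (case z of (x, y) \<Rightarrow> g x y) \<in> carrier V"
    using g(1) by (auto simp: X_def bilin_def)
  show "TL A B V g S \<in> carrier V" for S using V g by (simp add: bilin_def)
  show "TL A B V g (S \<oplus>\<^bsub>T\<^esub> S') = TL A B V g S \<oplus>\<^bsub>V\<^esub> TL A B V g S'" if "S \<in> carrier T" "S' \<in> carrier T" for S S'
  proof -
    from that obtain f f' where f: "S = coset N f" "Poly_Mapping.keys f \<subseteq> X" "S' = coset N f'" "Poly_Mapping.keys f' \<subseteq> X"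
      by (meson carrier_E)
    then have "Poly_Mapping.keys (f + f') \<subseteq> X" using Poly_Mapping.keys_add[of f f'] by blast
    then show ?thesis using f by (simp add: add_coset TL_coset[OF V g] fsum_add[where V = V and g = "\<lambda>(x, y). g x y" and X = X, OF V gX])
  qed
  show "TL A B V g (c \<odot>\<^bsub>T\<^esub> S) = c \<odot>\<^bsub>V\<^esub> TL A B V g S" if "S \<in> carrier T" for c S
  proof -
    from that obtain f where f: "S = coset N f" "Poly_Mapping.keys f \<subseteq> X" by (meson carrier_E)
    then have "Poly_Mapping.keys (fscale c f) \<subseteq> X" using keys_fscale[of c f] by blast
    then show ?thesis using f by (simp add: smult_coset TL_coset[OF V g] fsum_scale[where V = V and g = "\<lambda>(x, y). g x y" and X = X, OF V gX])
  qed
qed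

lemma TL_pure:
  assumes V: "cvec V" and g: "bilin A B V g" "kills V g R" and x: "x \<in> carrier A" "y \<in> carrier B"
  shows "TL A B V g (pure_tensor T x y) = g x y"
proof -
  have "TL A B V g (pure_tensor T x y) = fsum V (\<lambda>(x, y). g x y) (pt (x, y))"
    unfolding pure_coset by (rule TL_coset[OF V g]) (use x in \<open>simp add: X_def\<close>)
  also have "\<dots> = g x y"
    by (subst fsum_pt[OF V, of "{(x, y)}"]) (use g(1) x in \<open>auto simp: bilin_def\<close>)
  finally show ?thesis .
qed

text \<open>All representatives give the same value, so the image inside \<open>tensor_lift\<close>
  is a singleton, and \<open>TL\<close> reads off its element at one representative. From here on
  definitions are turned into \<open>TL\<close>.\<close>

lemma tensor_lift_eq:
  assumes V: "cvec V" and g: "bilin A B V g" "kills V g R" and S: "S \<in> carrier T"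
  shows "tensor_lift V (\<lambda>(x, y). g x y) S = TL A B V g S"
proof -
  have gX: "\<And>z. z \<in> X \<Longrightarrow> (case z of (x, y) \<Rightarrow> g x y) \<in> carrier V"
    using g(1) by (auto simp: X_def bilin_def)
  obtain f0 where f0: "S = coset N f0" "Poly_Mapping.keys f0 \<subseteq> X" using S by (rule carrier_E)
  have "fsum V (\<lambda>(x, y). g x y) f = TL A B V g S" if "f \<in> S" for f
    using that fsum_coset[OF V gX _ f0(2)] g(2) by (simp add: f0 TL_coset[OF V g] kills_def)
  then have "fsum V (\<lambda>(x, y). g x y) ` S = {TL A B V g S}"
    using coset_self[OF sub, of f0] f0 by auto
  then show ?thesis by (simp add: tensor_lift_def fsum_def[abs_def])
qed

lemma coset_sum:
  assumes "finite I" "\<And>i. i \<in> I \<Longrightarrow> Poly_Mapping.keys (F i) \<subseteq> X"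
  shows "coset N (\<Sum>i\<in>I. F i) = (\<Oplus>\<^bsub>T\<^esub>i\<in>I. coset N (F i))"
proof -
  interpret module complex_alg T by (rule cvec_T)
  show ?thesis using assms
    by (induction I) (auto simp: zero_coset add_coset[symmetric] finsum_insert Pi_def coset_in)
qed

lemma fsum_pt_coset:
  assumes "\<And>z. z \<in> Poly_Mapping.keys f \<Longrightarrow> m z \<in> X"
  shows "fsum T (\<lambda>z. coset N (pt (m z))) f = coset N (\<Sum>z\<in>Poly_Mapping.keys f. fscale (Poly_Mapping.lookup f z) (pt (m z)))"
  unfolding fsum_def smult_coset
  by (rule coset_sum[symmetric]) (use assms in \<open>auto dest: subsetD[OF keys_fscale]\<close>)

lemma pure_kills: "kills T (pure_tensor T) R"
  unfolding kills_def pure_coset case_prod_eta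
proof
  fix r assume r: "r \<in> R"
  have "fsum T (\<lambda>(x, y). coset N (pt (x, y))) r = coset N r"
    using fsum_pt_coset[of r "\<lambda>z. z"] keys_R[OF r] poly_mapping_sum[of r]
    by (auto simp: X_def case_prod_unfold)
  then show "fsum T (\<lambda>(x, y). coset N (pt (x, y))) r = \<zero>\<^bsub>T\<^esub>"
    using coset_zero[OF fs.span_base[OF r, folded N_def]] by simp
qed

text \<open>A representative is itself a combination of pairs, and each pair becomes a pure tensor
  in the quotient. Hence linear maps are determined by their values on pure tensors.\<close>

lemma TL_expand:
  assumes "S \<in> carrier T"
  shows "TL A B T (pure_tensor T) S = S"
proof -
  obtain f where f: "S = coset N f" "Poly_Mapping.keys f \<subseteq> X" using assms by (rule carrier_E)
  have "fsum T (\<lambda>(x, y). pure_tensor T x y) f = coset N f"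
    using fsum_pt_coset[of f "\<lambda>z. z"] f poly_mapping_sum[of f]
    by (auto simp: pure_coset case_prod_unfold)
  then show ?thesis using f by (simp add: TL_coset[OF cvec_T pure_bilin pure_kills])
qed

lemma lin_maps_TL:
  assumes "cvec V" "F \<in> lin_maps T V" "S \<in> carrier T"
  shows "F S = TL A B V (\<lambda>x y. F (pure_tensor T x y)) S"
proof -
  have "F S = F (TL A B T (\<lambda>x y. pure_tensor T x y) S)" using TL_expand assms by simp
  also have "\<dots> = TL A B V (\<lambda>x y. F (pure_tensor T x y)) S"
    by (rule TL_lin[OF cvec_T assms(1,2)]) (use pure_bilin in \<open>simp add: bilin_def\<close>)
  finally show ?thesis .
qed

lemma lin_maps_eqI:
  assumes "cvec V" "F \<in> lin_maps T V" "G \<in> lin_maps T V" "S \<in> carrier T"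
    "\<And>x y. x \<in> carrier A \<Longrightarrow> y \<in> carrier B \<Longrightarrow> F (pure_tensor T x y) = G (pure_tensor T x y)"
  shows "F S = G S"
  using lin_maps_TL[OF assms(1,2,4)] lin_maps_TL[OF assms(1,3,4)] assms(5) by simp

text \<open>
  The componentwise product is well defined as soon as right multiplication of \<open>S\<close> respects the
  relations (the Takeuchi condition), provided that left multiplication always does.
\<close>

lemma mult_TL:
  assumes m: "\<And>x x'. x \<in> carrier A \<Longrightarrow> x' \<in> carrier A \<Longrightarrow> x \<otimes>\<^bsub>A\<^esub> x' \<in> carrier A"
    "\<And>y y'. y \<in> carrier B \<Longrightarrow> y' \<in> carrier B \<Longrightarrow> y \<otimes>\<^bsub>B\<^esub> y' \<in> carrier B"
    and S: "S \<in> carrier T" and S': "S' \<in> carrier T"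
    and l: "\<And>x' y'. x' \<in> carrier A \<Longrightarrow> y' \<in> carrier B \<Longrightarrow>
      bilin A B T (\<lambda>x y. pure_tensor T (x \<otimes>\<^bsub>A\<^esub> x') (y \<otimes>\<^bsub>B\<^esub> y')) \<and>
      kills T (\<lambda>x y. pure_tensor T (x \<otimes>\<^bsub>A\<^esub> x') (y \<otimes>\<^bsub>B\<^esub> y')) R"
    and r: "bilin A B T (\<lambda>x' y'. TL A B T (\<lambda>x y. pure_tensor T (x \<otimes>\<^bsub>A\<^esub> x') (y \<otimes>\<^bsub>B\<^esub> y')) S)"
      "kills T (\<lambda>x' y'. TL A B T (\<lambda>x y. pure_tensor T (x \<otimes>\<^bsub>A\<^esub> x') (y \<otimes>\<^bsub>B\<^esub> y')) S) R"
  shows "S \<otimes>\<^bsub>T\<^esub> S' = TL A B T (\<lambda>x' y'. TL A B T (\<lambda>x y. pure_tensor T (x \<otimes>\<^bsub>A\<^esub> x') (y \<otimes>\<^bsub>B\<^esub> y')) S) S'"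
proof -
  define G where "G z w = pure_tensor T (fst z \<otimes>\<^bsub>A\<^esub> fst w) (snd z \<otimes>\<^bsub>B\<^esub> snd w)" for z w
  have GX: "G z w \<in> carrier T" if "z \<in> X" "w \<in> X" for z w
    using that m by (auto simp: G_def X_def pure_coset intro!: coset_in)
  obtain f0 where f0: "S = coset N f0" "Poly_Mapping.keys f0 \<subseteq> X" using S by (rule carrier_E)
  obtain g0 where g0: "S' = coset N g0" "Poly_Mapping.keys g0 \<subseteq> X" using S' by (rule carrier_E)
  \<comment> \<open>Every pair of representatives has to give the coset on the right; then the union
    that defines the product collapses to it.\<close>
  have main: "coset N (formal_mult A B f g) = TL A B T (\<lambda>x' y'. TL A B T (\<lambda>x y. G (x, y) (x', y')) S) S'"
    if fg: "f \<in> S" "g \<in> S'" for f g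
  proof -
    have kf: "Poly_Mapping.keys f \<subseteq> X" and kg: "Poly_Mapping.keys g \<subseteq> X"
      using keys_coset fg f0 g0 by auto
    define u where "u z w = pt (fst z \<otimes>\<^bsub>A\<^esub> fst w, snd z \<otimes>\<^bsub>B\<^esub> snd w)" for z w
    have uk: "Poly_Mapping.keys (u z w) \<subseteq> X" if "z \<in> X" "w \<in> X" for z w
      using that m by (auto simp: u_def X_def)
    have sk: "Poly_Mapping.keys (\<Sum>w\<in>Poly_Mapping.keys g. fscale (Poly_Mapping.lookup g w) (u z w)) \<subseteq> X" if "z \<in> X" for z
      by (rule order_trans[OF Poly_Mapping.keys_sum], rule UN_least, rule order_trans[OF keys_fscale uk[OF that]])
        (use kg in blast)
    have mX: "(fst z \<otimes>\<^bsub>A\<^esub> fst w, snd z \<otimes>\<^bsub>B\<^esub> snd w) \<in> X"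
      if "z \<in> Poly_Mapping.keys f" "w \<in> Poly_Mapping.keys g" for z w
      using that kf kg m by (auto simp: X_def subset_eq mem_Times_iff)
    have eq: "formal_mult A B f g = (\<Sum>z\<in>Poly_Mapping.keys f. fscale (Poly_Mapping.lookup f z)
        (\<Sum>w\<in>Poly_Mapping.keys g. fscale (Poly_Mapping.lookup g w) (u z w)))"
      unfolding formal_mult_def
      by (intro sum.cong refl poly_mapping_eqI) (simp add: u_def fs.scale_sum_right lookup_sum lookup_single when_def, rule sum.cong, auto)
    have fk: "Poly_Mapping.keys (fscale c (\<Sum>w\<in>Poly_Mapping.keys g. fscale (Poly_Mapping.lookup g w) (u z w))) \<subseteq> X"
      if "z \<in> Poly_Mapping.keys f" for z c
      by (rule order_trans[OF keys_fscale sk]) (use that kf in blast)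
    have "coset N (formal_mult A B f g) = fsum T (\<lambda>z. coset N (\<Sum>w\<in>Poly_Mapping.keys g. fscale (Poly_Mapping.lookup g w) (u z w))) f"
      unfolding fsum_def smult_coset eq by (rule coset_sum[OF finite_keys fk])
    also have "\<dots> = fsum T (\<lambda>z. fsum T (\<lambda>w. G z w) g) f"
    proof (rule fsum_cong[OF cvec_T])
      fix z assume z: "z \<in> Poly_Mapping.keys f"
      show "coset N (\<Sum>w\<in>Poly_Mapping.keys g. fscale (Poly_Mapping.lookup g w) (u z w)) = fsum T (\<lambda>w. G z w) g"
        using fsum_pt_coset[of g "\<lambda>w. (fst z \<otimes>\<^bsub>A\<^esub> fst w, snd z \<otimes>\<^bsub>B\<^esub> snd w)"] mX[OF z]
        by (simp add: G_def pure_coset u_def)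
    qed (use sk kf in \<open>auto intro!: coset_in\<close>)
    \<comment> \<open>After the exchange the inner sum runs over \<open>f\<close>, and
      \<open>l\<close> replaces \<open>f\<close> by the fixed \<open>f0\<close>. Only then is the
      outer summand the map that occurs in \<open>r\<close>, which replaces \<open>g\<close> by
      \<open>g0\<close>.\<close>
    also have "\<dots> = fsum T (\<lambda>w. fsum T (\<lambda>z. G z w) f) g"
      by (rule fsum_swap[OF cvec_T]) (use GX kf kg in blast)
    also have "\<dots> = fsum T (\<lambda>(x', y'). TL A B T (\<lambda>x y. G (x, y) (x', y')) S) g"
    proof (rule fsum_cong[OF cvec_T])
      fix w assume "w \<in> Poly_Mapping.keys g"
      then have w: "w \<in> X" using kg by blast
      show c: "fsum T (\<lambda>z. G z w) f \<in> carrier T"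
        by (rule fsum_closed[OF cvec_T _ kf]) (use GX w in auto)
      have "fsum T (\<lambda>z. G z w) f = fsum T (\<lambda>z. G z w) f0"
        by (rule fsum_coset[OF cvec_T GX[OF _ w] _ f0(2)])
          (use l[of "fst w" "snd w"] w fg f0 in \<open>auto simp: kills_def G_def X_def case_prod_unfold\<close>)
      also have "\<dots> = TL A B T (\<lambda>x y. G (x, y) w) S"
        unfolding f0
        by (subst TL_coset[OF cvec_T _ _ f0(2)])
          (use l[of "fst w" "snd w"] w in \<open>simp_all add: G_def X_def mem_Times_iff case_prod_unfold\<close>)
      finally show "fsum T (\<lambda>z. G z w) f = (case w of (x', y') \<Rightarrow> TL A B T (\<lambda>x y. G (x, y) (x', y')) S)"
        by (simp add: case_prod_unfold)
    qed
    also have "\<dots> = fsum T (\<lambda>(x', y'). TL A B T (\<lambda>x y. G (x, y) (x', y')) S) g0"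
      by (rule fsum_coset[OF cvec_T _ _ g0(2)])
        (use r fg g0 in \<open>auto simp: G_def kills_def X_def bilin_def\<close>)
    also have "\<dots> = TL A B T (\<lambda>x' y'. TL A B T (\<lambda>x y. G (x, y) (x', y')) S) S'"
      unfolding g0(1)
      by (rule TL_coset[OF cvec_T _ _ g0(2), symmetric]) (use r in \<open>simp_all add: G_def\<close>)
    finally show ?thesis .
  qed
  have "S \<otimes>\<^bsub>T\<^esub> S' = TL A B T (\<lambda>x' y'. TL A B T (\<lambda>x y. G (x, y) (x', y')) S) S'"
    unfolding mult_T using main coset_self[OF sub, of f0] coset_self[OF sub, of g0] f0 g0 by auto
  then show ?thesis by (simp add: G_def)
qed

end

section \<open>Complex algebras, homomorphisms and opposite algebras\<close>

context
  fixes A :: "(complex, 'v, 'm) module_scheme" (structure)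
  assumes A: "complex_algebra A"
begin

interpretation A: complex_algebra A by (rule A)

lemma alg_mult_closed: "x \<in> carrier A \<Longrightarrow> y \<in> carrier A \<Longrightarrow> x \<otimes> y \<in> carrier A"
  and alg_one_closed: "\<one> \<in> carrier A"
  and alg_l_one: "x \<in> carrier A \<Longrightarrow> \<one> \<otimes> x = x"
  and alg_r_one: "x \<in> carrier A \<Longrightarrow> x \<otimes> \<one> = x"
  and alg_l_distr: "x \<in> carrier A \<Longrightarrow> y \<in> carrier A \<Longrightarrow> z \<in> carrier A \<Longrightarrow> (x \<oplus> y) \<otimes> z = x \<otimes> z \<oplus> y \<otimes> z"
  and alg_r_distr: "x \<in> carrier A \<Longrightarrow> y \<in> carrier A \<Longrightarrow> z \<in> carrier A \<Longrightarrow> z \<otimes> (x \<oplus> y) = z \<otimes> x \<oplus> z \<otimes> y"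
  and alg_smult_left: "x \<in> carrier A \<Longrightarrow> y \<in> carrier A \<Longrightarrow> (c \<odot> x) \<otimes> y = c \<odot> (x \<otimes> y)"
  and alg_smult_right: "x \<in> carrier A \<Longrightarrow> y \<in> carrier A \<Longrightarrow> x \<otimes> (c \<odot> y) = c \<odot> (x \<otimes> y)"
  and alg_assoc: "x \<in> carrier A \<Longrightarrow> y \<in> carrier A \<Longrightarrow> z \<in> carrier A \<Longrightarrow> (x \<otimes> y) \<otimes> z = x \<otimes> (y \<otimes> z)"
  and alg_l_null: "x \<in> carrier A \<Longrightarrow> \<zero> \<otimes> x = \<zero>"
  and alg_r_null: "x \<in> carrier A \<Longrightarrow> x \<otimes> \<zero> = \<zero>"
  by (simp_all add: A.l_distr A.r_distr A.smult_mult_left A.smult_mult_right A.m_assoc)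

end

lemmas alg_simps [simp] = alg_mult_closed alg_one_closed alg_l_one alg_r_one alg_l_distr alg_r_distr
  alg_smult_left alg_smult_right alg_l_null alg_r_null

lemma complex_algebraI:
  fixes A (structure)
  assumes "cvec A" "\<And>x y. x \<in> carrier A \<Longrightarrow> y \<in> carrier A \<Longrightarrow> x \<otimes> y \<in> carrier A"
    "\<one> \<in> carrier A" "\<And>x. x \<in> carrier A \<Longrightarrow> \<one> \<otimes> x = x" "\<And>x. x \<in> carrier A \<Longrightarrow> x \<otimes> \<one> = x"
    "\<And>x y z. x \<in> carrier A \<Longrightarrow> y \<in> carrier A \<Longrightarrow> z \<in> carrier A \<Longrightarrow> (x \<oplus> y) \<otimes> z = x \<otimes> z \<oplus> y \<otimes> z"
    "\<And>x y z. x \<in> carrier A \<Longrightarrow> y \<in> carrier A \<Longrightarrow> z \<in> carrier A \<Longrightarrow> z \<otimes> (x \<oplus> y) = z \<otimes> x \<oplus> z \<otimes> y"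
    "\<And>c x y. x \<in> carrier A \<Longrightarrow> y \<in> carrier A \<Longrightarrow> (c \<odot> x) \<otimes> y = c \<odot> (x \<otimes> y)"
    "\<And>c x y. x \<in> carrier A \<Longrightarrow> y \<in> carrier A \<Longrightarrow> x \<otimes> (c \<odot> y) = c \<odot> (x \<otimes> y)"
    "\<And>x y z. x \<in> carrier A \<Longrightarrow> y \<in> carrier A \<Longrightarrow> z \<in> carrier A \<Longrightarrow> (x \<otimes> y) \<otimes> z = x \<otimes> (y \<otimes> z)"
  shows "complex_algebra A"
  by (intro complex_algebra.intro complex_algebra_axioms.intro ringI monoidI cvec_abelian)
    (use assms in auto)

lemma complex_algebra_complex_alg [simp]: "complex_algebra complex_alg"
  by (rule complex_algebraI) (auto simp: algebra_simps)

lemma alg_homI: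
  assumes "f \<in> lin_maps A B"
    "\<And>x y. x \<in> carrier A \<Longrightarrow> y \<in> carrier A \<Longrightarrow> f (x \<otimes>\<^bsub>A\<^esub> y) = f x \<otimes>\<^bsub>B\<^esub> f y" "f \<one>\<^bsub>A\<^esub> = \<one>\<^bsub>B\<^esub>"
  shows "f \<in> alg_hom A B"
  using assms by (auto simp: alg_hom_def ring_hom_def lin_maps_def)

lemma alg_homD:
  assumes "f \<in> alg_hom A B"
  shows "f \<in> lin_maps A B"
    and "x \<in> carrier A \<Longrightarrow> f x \<in> carrier B"
    and "x \<in> carrier A \<Longrightarrow> y \<in> carrier A \<Longrightarrow> f (x \<oplus>\<^bsub>A\<^esub> y) = f x \<oplus>\<^bsub>B\<^esub> f y"
    and "x \<in> carrier A \<Longrightarrow> f (c \<odot>\<^bsub>A\<^esub> x) = c \<odot>\<^bsub>B\<^esub> f x"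
    and "x \<in> carrier A \<Longrightarrow> y \<in> carrier A \<Longrightarrow> f (x \<otimes>\<^bsub>A\<^esub> y) = f x \<otimes>\<^bsub>B\<^esub> f y"
    and "f \<one>\<^bsub>A\<^esub> = \<one>\<^bsub>B\<^esub>"
  using assms by (auto simp: alg_hom_def ring_hom_def lin_maps_def)

lemma op_alg_simps [simp]:
  "carrier (op_alg A) = carrier A" "x \<oplus>\<^bsub>op_alg A\<^esub> y = x \<oplus>\<^bsub>A\<^esub> y" "c \<odot>\<^bsub>op_alg A\<^esub> x = c \<odot>\<^bsub>A\<^esub> x"
  "\<zero>\<^bsub>op_alg A\<^esub> = \<zero>\<^bsub>A\<^esub>" "\<one>\<^bsub>op_alg A\<^esub> = \<one>\<^bsub>A\<^esub>" "x \<otimes>\<^bsub>op_alg A\<^esub> y = y \<otimes>\<^bsub>A\<^esub> x"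
  by (simp_all add: op_alg_def)

lemma lin_maps_op_alg [simp]: "lin_maps A (op_alg B) = lin_maps A B"
  by (simp add: lin_maps_def)

text \<open>Serves for records that keep the linear structure and change the product: opposite,
  smash and transported algebras.\<close>

lemma cvec_cong_ops:
  assumes "cvec V" "carrier W = carrier V" "\<zero>\<^bsub>W\<^esub> = \<zero>\<^bsub>V\<^esub>"
    "\<And>x y. x \<in> carrier V \<Longrightarrow> y \<in> carrier V \<Longrightarrow> x \<oplus>\<^bsub>W\<^esub> y = x \<oplus>\<^bsub>V\<^esub> y"
    "\<And>c x. x \<in> carrier V \<Longrightarrow> c \<odot>\<^bsub>W\<^esub> x = c \<odot>\<^bsub>V\<^esub> x"
  shows "cvec W"
proof (rule cvecI)
  show "abelian_group W"
  proof (rule abelian_groupI)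
    fix x assume "x \<in> carrier W"
    then show "\<exists>y\<in>carrier W. y \<oplus>\<^bsub>W\<^esub> x = \<zero>\<^bsub>W\<^esub>"
      using assms by (intro bexI[of _ "(- 1) \<odot>\<^bsub>V\<^esub> x"]) (auto simp: cvec_collect)
  qed (use assms in \<open>auto simp: cvec_ac\<close>)
qed (use assms in \<open>auto simp: cvec_add_smult\<close>)

lemma complex_algebra_op_alg [simp]: "complex_algebra A \<Longrightarrow> complex_algebra (op_alg A)"
  by (rule complex_algebraI) (auto simp: alg_assoc intro: cvec_cong_ops[of A])

lemma lin_maps_mult_left:
  "complex_algebra A \<Longrightarrow> a \<in> carrier A \<Longrightarrow> (\<lambda>x. a \<otimes>\<^bsub>A\<^esub> x) \<in> lin_maps A A"
  and lin_maps_mult_right: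
  "complex_algebra A \<Longrightarrow> a \<in> carrier A \<Longrightarrow> (\<lambda>x. x \<otimes>\<^bsub>A\<^esub> a) \<in> lin_maps A A"
  by (auto intro!: lin_mapsI)

section \<open>Tensor products\<close>

lemma tensor_space_tensor: "cvec A \<Longrightarrow> cvec B \<Longrightarrow> tensor_space A B (bilin_rels A B) (tensor A B)"
  by (rule tensor_space.intro) (simp_all add: tensor_def keys_bilin_rels)

context
  fixes A :: "(complex, 'a, 'k) module_scheme" and B :: "(complex, 'b, 'l) module_scheme"
  assumes A: "cvec A" and B: "cvec B"
begin

interpretation T: tensor_space A B "bilin_rels A B" "tensor A B"
  by (rule tensor_space_tensor[OF A B])

lemma tensor_cvec: "cvec (tensor A B)" by (rule T.cvec_T)

lemma tensor_pure:
  "x \<in> carrier A \<Longrightarrow> y \<in> carrier B \<Longrightarrow> x \<boxtimes>\<^bsub>tensor A B\<^esub> y \<in> carrier (tensor A B)"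
  "x \<in> carrier A \<Longrightarrow> x' \<in> carrier A \<Longrightarrow> y \<in> carrier B \<Longrightarrow>
     (x \<oplus>\<^bsub>A\<^esub> x') \<boxtimes>\<^bsub>tensor A B\<^esub> y = (x \<boxtimes>\<^bsub>tensor A B\<^esub> y) \<oplus>\<^bsub>tensor A B\<^esub> (x' \<boxtimes>\<^bsub>tensor A B\<^esub> y)"
  "x \<in> carrier A \<Longrightarrow> y \<in> carrier B \<Longrightarrow> y' \<in> carrier B \<Longrightarrow>
     x \<boxtimes>\<^bsub>tensor A B\<^esub> (y \<oplus>\<^bsub>B\<^esub> y') = (x \<boxtimes>\<^bsub>tensor A B\<^esub> y) \<oplus>\<^bsub>tensor A B\<^esub> (x \<boxtimes>\<^bsub>tensor A B\<^esub> y')"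
  "x \<in> carrier A \<Longrightarrow> y \<in> carrier B \<Longrightarrow>
     (c \<odot>\<^bsub>A\<^esub> x) \<boxtimes>\<^bsub>tensor A B\<^esub> y = c \<odot>\<^bsub>tensor A B\<^esub> (x \<boxtimes>\<^bsub>tensor A B\<^esub> y)"
  "x \<in> carrier A \<Longrightarrow> y \<in> carrier B \<Longrightarrow>
     x \<boxtimes>\<^bsub>tensor A B\<^esub> (c \<odot>\<^bsub>B\<^esub> y) = c \<odot>\<^bsub>tensor A B\<^esub> (x \<boxtimes>\<^bsub>tensor A B\<^esub> y)"
  using T.pure_bilin by (simp_all add: bilin_def)

lemma tensor_TL_lin_maps:
  "cvec V \<Longrightarrow> bilin A B V g \<Longrightarrow> TL A B V g \<in> lin_maps (tensor A B) V"
  by (rule T.TL_lin_maps) (auto intro: kills_bilin_rels A B)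

lemma tensor_TL_pure:
  "cvec V \<Longrightarrow> bilin A B V g \<Longrightarrow> x \<in> carrier A \<Longrightarrow> y \<in> carrier B \<Longrightarrow>
     TL A B V g (x \<boxtimes>\<^bsub>tensor A B\<^esub> y) = g x y"
  by (rule T.TL_pure) (auto intro: kills_bilin_rels A B)

lemma tensor_TL_add:
  "cvec V \<Longrightarrow> bilin A B V g \<Longrightarrow> S \<in> carrier (tensor A B) \<Longrightarrow> S' \<in> carrier (tensor A B) \<Longrightarrow>
     TL A B V g (S \<oplus>\<^bsub>tensor A B\<^esub> S') = TL A B V g S \<oplus>\<^bsub>V\<^esub> TL A B V g S'"
  and tensor_TL_smult:
  "cvec V \<Longrightarrow> bilin A B V g \<Longrightarrow> S \<in> carrier (tensor A B) \<Longrightarrow>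
     TL A B V g (c \<odot>\<^bsub>tensor A B\<^esub> S) = c \<odot>\<^bsub>V\<^esub> TL A B V g S"
  using lin_mapsD[OF tensor_TL_lin_maps] by blast+

lemma tensor_lift_TL:
  "cvec V \<Longrightarrow> bilin A B V g \<Longrightarrow> S \<in> carrier (tensor A B) \<Longrightarrow>
     tensor_lift V (\<lambda>(x, y). g x y) S = TL A B V g S"
  by (rule T.tensor_lift_eq) (auto intro: kills_bilin_rels A B)

lemma tensor_TL_expand: "S \<in> carrier (tensor A B) \<Longrightarrow> TL A B (tensor A B) (pure_tensor (tensor A B)) S = S"
  by (rule T.TL_expand)

lemma tensor_lin_TL:
  "cvec V \<Longrightarrow> F \<in> lin_maps (tensor A B) V \<Longrightarrow> S \<in> carrier (tensor A B) \<Longrightarrow>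
     F S = TL A B V (\<lambda>x y. F (x \<boxtimes>\<^bsub>tensor A B\<^esub> y)) S"
  by (rule T.lin_maps_TL)

lemma tensor_lin_eqI:
  assumes "cvec V" "F \<in> lin_maps (tensor A B) V" "G \<in> lin_maps (tensor A B) V" "S \<in> carrier (tensor A B)"
    "\<And>x y. x \<in> carrier A \<Longrightarrow> y \<in> carrier B \<Longrightarrow> F (x \<boxtimes>\<^bsub>tensor A B\<^esub> y) = G (x \<boxtimes>\<^bsub>tensor A B\<^esub> y)"
  shows "F S = G S"
  by (rule T.lin_maps_eqI[OF assms])

end

lemmas tensor_simps [simp] = tensor_cvec tensor_pure tensor_TL_pure tensor_TL_add tensor_TL_smult
lemmas TL_fun_simps [simp] = TL_add_fun TL_smult_fun

lemma tensor_one: "\<one>\<^bsub>tensor A B\<^esub> = \<one>\<^bsub>A\<^esub> \<boxtimes>\<^bsub>tensor A B\<^esub> \<one>\<^bsub>B\<^esub>"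
  by (simp add: tensor_def tensor_quot_def pure_tensor_def)

context
  fixes A :: "(complex, 'a, 'k) module_scheme" and B :: "(complex, 'b, 'l) module_scheme"
  assumes A [simp]: "complex_algebra A" and B [simp]: "complex_algebra B"
begin

interpretation T: tensor_space A B "bilin_rels A B" "tensor A B"
  by (rule tensor_space_tensor) auto

text \<open>Left and right multiplications preserve bilinearity, so over the complex numbers the
  hypotheses of \<open>mult_TL\<close> hold for all \<open>S\<close>.\<close>

lemma tensor_mult:
  assumes "S \<in> carrier (tensor A B)" "S' \<in> carrier (tensor A B)"
  shows "S \<otimes>\<^bsub>tensor A B\<^esub> S' = TL A B (tensor A B) (\<lambda>x' y'. TL A B (tensor A B)
    (\<lambda>x y. (x \<otimes>\<^bsub>A\<^esub> x') \<boxtimes>\<^bsub>tensor A B\<^esub> (y \<otimes>\<^bsub>B\<^esub> y')) S) S'"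
  by (rule T.mult_TL) (use assms in \<open>auto intro!: kills_bilin_rels simp: bilin_def\<close>)

lemma tensor_mult_closed:
  "S \<in> carrier (tensor A B) \<Longrightarrow> S' \<in> carrier (tensor A B) \<Longrightarrow> S \<otimes>\<^bsub>tensor A B\<^esub> S' \<in> carrier (tensor A B)"
  by (simp add: tensor_mult)

lemma tensor_mult_lin_left:
  "S' \<in> carrier (tensor A B) \<Longrightarrow> (\<lambda>S. S \<otimes>\<^bsub>tensor A B\<^esub> S') \<in> lin_maps (tensor A B) (tensor A B)"
  by (rule lin_mapsI) (simp_all add: tensor_mult bilin_def)

lemma tensor_mult_lin_right:
  "S \<in> carrier (tensor A B) \<Longrightarrow> (\<lambda>S'. S \<otimes>\<^bsub>tensor A B\<^esub> S') \<in> lin_maps (tensor A B) (tensor A B)"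
  by (rule lin_mapsI) (simp_all add: tensor_mult bilin_def)

lemma tensor_mult_pure:
  "x \<in> carrier A \<Longrightarrow> y \<in> carrier B \<Longrightarrow> x' \<in> carrier A \<Longrightarrow> y' \<in> carrier B \<Longrightarrow>
    (x \<boxtimes>\<^bsub>tensor A B\<^esub> y) \<otimes>\<^bsub>tensor A B\<^esub> (x' \<boxtimes>\<^bsub>tensor A B\<^esub> y') =
    (x \<otimes>\<^bsub>A\<^esub> x') \<boxtimes>\<^bsub>tensor A B\<^esub> (y \<otimes>\<^bsub>B\<^esub> y')"
  by (simp add: tensor_mult bilin_def)

text \<open>As a simplification rule this expands a Sweedler sum over a product, for instance over
  the coproduct of a product, into a double sum over the factors.\<close>

lemma tensor_TL_mult:
  assumes V: "cvec V" and g: "bilin A B V g" and S: "S \<in> carrier (tensor A B)" "S' \<in> carrier (tensor A B)"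
  shows "TL A B V g (S \<otimes>\<^bsub>tensor A B\<^esub> S') =
    TL A B V (\<lambda>x y. TL A B V (\<lambda>x' y'. g (x \<otimes>\<^bsub>A\<^esub> x') (y \<otimes>\<^bsub>B\<^esub> y')) S') S"
proof -
  note l = tensor_TL_lin_maps[OF complex_algebra_cvec[OF A] complex_algebra_cvec[OF B] V g]
  have c: "g x y \<in> carrier V" if "x \<in> carrier A" "y \<in> carrier B" for x y using bilin_closed[OF g that] .
  have "TL A B V g (S \<otimes>\<^bsub>tensor A B\<^esub> S') = TL A B V (\<lambda>x' y'. TL A B V g (TL A B (tensor A B)
      (\<lambda>x y. (x \<otimes>\<^bsub>A\<^esub> x') \<boxtimes>\<^bsub>tensor A B\<^esub> (y \<otimes>\<^bsub>B\<^esub> y')) S)) S'"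
    unfolding tensor_mult[OF S] by (rule TL_lin[OF _ V l]) simp_all
  also have "\<dots> = TL A B V (\<lambda>x' y'. TL A B V (\<lambda>x y. g (x \<otimes>\<^bsub>A\<^esub> x') (y \<otimes>\<^bsub>B\<^esub> y')) S) S'"
    by (rule TL_cong[OF _ refl], subst TL_lin[OF _ V l]) (use V g in simp_all)
  also have "\<dots> = TL A B V (\<lambda>x y. TL A B V (\<lambda>x' y'. g (x \<otimes>\<^bsub>A\<^esub> x') (y \<otimes>\<^bsub>B\<^esub> y')) S') S"
    by (rule TL_swap[OF V]) (simp add: c)
  finally show ?thesis .
qed

lemma tensor_algebra: "complex_algebra (tensor A B)"
proof (rule complex_algebraI)
  let ?T = "tensor A B"
  have one: "\<one>\<^bsub>?T\<^esub> \<in> carrier ?T" by (simp add: tensor_one)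
  then show "\<one>\<^bsub>?T\<^esub> \<in> carrier ?T" .
  have id: "(\<lambda>x. x) \<in> lin_maps ?T ?T" by (auto intro: lin_mapsI)
  show "\<one>\<^bsub>?T\<^esub> \<otimes>\<^bsub>?T\<^esub> S = S" if "S \<in> carrier ?T" for S
    by (rule tensor_lin_eqI[OF _ _ _ tensor_mult_lin_right[OF one] id that])
      (auto simp: tensor_one tensor_mult_pure)
  show "S \<otimes>\<^bsub>?T\<^esub> \<one>\<^bsub>?T\<^esub> = S" if "S \<in> carrier ?T" for S
    by (rule tensor_lin_eqI[OF _ _ _ tensor_mult_lin_left[OF one] id that])
      (auto simp: tensor_one tensor_mult_pure)
  \<comment> \<open>Associativity is linear in each factor. The facts \<open>1\<close>,
    \<open>2\<close> and \<open>3\<close> reduce the first, the second and the third factor in turn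
    to pure tensors.\<close>
  have 1: "(S \<otimes>\<^bsub>?T\<^esub> S') \<otimes>\<^bsub>?T\<^esub> S'' = S \<otimes>\<^bsub>?T\<^esub> (S' \<otimes>\<^bsub>?T\<^esub> S'')"
    if S: "S \<in> carrier ?T" "S' \<in> carrier ?T" "S'' \<in> carrier ?T"
      and pure: "\<And>x y. x \<in> carrier A \<Longrightarrow> y \<in> carrier B \<Longrightarrow>
        ((x \<boxtimes>\<^bsub>?T\<^esub> y) \<otimes>\<^bsub>?T\<^esub> S') \<otimes>\<^bsub>?T\<^esub> S'' = (x \<boxtimes>\<^bsub>?T\<^esub> y) \<otimes>\<^bsub>?T\<^esub> (S' \<otimes>\<^bsub>?T\<^esub> S'')" for S S' S''
    by (rule tensor_lin_eqI[OF _ _ _ lin_maps_comp[OF tensor_mult_lin_left tensor_mult_lin_left]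
          tensor_mult_lin_left S(1), of S' S''])
      (use S pure tensor_mult_closed in auto)
  have 2: "((x \<boxtimes>\<^bsub>?T\<^esub> y) \<otimes>\<^bsub>?T\<^esub> S') \<otimes>\<^bsub>?T\<^esub> S'' = (x \<boxtimes>\<^bsub>?T\<^esub> y) \<otimes>\<^bsub>?T\<^esub> (S' \<otimes>\<^bsub>?T\<^esub> S'')"
    if S: "S' \<in> carrier ?T" "S'' \<in> carrier ?T" and xy: "x \<in> carrier A" "y \<in> carrier B"
      and pure: "\<And>x' y'. x' \<in> carrier A \<Longrightarrow> y' \<in> carrier B \<Longrightarrow>
        ((x \<boxtimes>\<^bsub>?T\<^esub> y) \<otimes>\<^bsub>?T\<^esub> (x' \<boxtimes>\<^bsub>?T\<^esub> y')) \<otimes>\<^bsub>?T\<^esub> S'' = (x \<boxtimes>\<^bsub>?T\<^esub> y) \<otimes>\<^bsub>?T\<^esub> ((x' \<boxtimes>\<^bsub>?T\<^esub> y') \<otimes>\<^bsub>?T\<^esub> S'')"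
    for x y S' S''
    by (rule tensor_lin_eqI[OF _ _ _ lin_maps_comp[OF tensor_mult_lin_right tensor_mult_lin_left]
          lin_maps_comp[OF tensor_mult_lin_left tensor_mult_lin_right] S(1), of "x \<boxtimes>\<^bsub>?T\<^esub> y" S''])
      (use S pure xy in auto)
  have 3: "((x \<boxtimes>\<^bsub>?T\<^esub> y) \<otimes>\<^bsub>?T\<^esub> (x' \<boxtimes>\<^bsub>?T\<^esub> y')) \<otimes>\<^bsub>?T\<^esub> S'' = (x \<boxtimes>\<^bsub>?T\<^esub> y) \<otimes>\<^bsub>?T\<^esub> ((x' \<boxtimes>\<^bsub>?T\<^esub> y') \<otimes>\<^bsub>?T\<^esub> S'')"
    if S: "S'' \<in> carrier ?T" and xy: "x \<in> carrier A" "y \<in> carrier B" "x' \<in> carrier A" "y' \<in> carrier B" for x y x' y' S''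
    by (rule tensor_lin_eqI[OF _ _ _ tensor_mult_lin_right
          lin_maps_comp[OF tensor_mult_lin_right tensor_mult_lin_right] S])
      (use S xy in \<open>auto simp: tensor_mult_pure alg_assoc\<close>)
  show "(S \<otimes>\<^bsub>?T\<^esub> S') \<otimes>\<^bsub>?T\<^esub> S'' = S \<otimes>\<^bsub>?T\<^esub> (S' \<otimes>\<^bsub>?T\<^esub> S'')"
    if "S \<in> carrier ?T" "S' \<in> carrier ?T" "S'' \<in> carrier ?T" for S S' S''
    by (rule 1[OF that 2[OF that(2,3) _ _ 3[OF that(3)]]])
qed (simp_all add: tensor_mult_closed lin_mapsD[OF tensor_mult_lin_left] lin_mapsD[OF tensor_mult_lin_right])

end

lemmas tensor_algebra_simps [simp] = tensor_algebra tensor_mult_pure tensor_TL_mult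

definition trilin ::
  "(complex, 'a, 'k) module_scheme \<Rightarrow> (complex, 'b, 'l) module_scheme \<Rightarrow> (complex, 'c, 'j) module_scheme \<Rightarrow>
   (complex, 'v, 'm) module_scheme \<Rightarrow> ('a \<Rightarrow> 'b \<Rightarrow> 'c \<Rightarrow> 'v) \<Rightarrow> bool" where
  "trilin A B C V g \<longleftrightarrow>
     (\<forall>x\<in>carrier A. bilin B C V (g x)) \<and> (\<forall>z\<in>carrier C. bilin A B V (\<lambda>x y. g x y z))"

text \<open>Applying the resulting linear map to an equation in a triple tensor product, such as
  coassociativity, turns it into an equation of iterated Sweedler sums of \<open>g\<close>.\<close>

lemma trilin_lift:
  assumes "cvec A" "cvec B" "cvec C" "cvec V" "trilin A B C V g"
  obtains F where "F \<in> lin_maps (tensor A (tensor B C)) V"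
    "\<And>x y z. x \<in> carrier A \<Longrightarrow> y \<in> carrier B \<Longrightarrow> z \<in> carrier C \<Longrightarrow>
      F (x \<boxtimes>\<^bsub>tensor A (tensor B C)\<^esub> (y \<boxtimes>\<^bsub>tensor B C\<^esub> z)) = g x y z"
proof
  define G where "G x S = TL B C V (g x) S" for x S
  have G: "bilin A (tensor B C) V G"
    using assms by (simp add: G_def[abs_def] bilin_def trilin_def)
  show "TL A (tensor B C) V G \<in> lin_maps (tensor A (tensor B C)) V"
    by (rule tensor_TL_lin_maps) (use assms G in auto)
  show "TL A (tensor B C) V G (x \<boxtimes>\<^bsub>tensor A (tensor B C)\<^esub> (y \<boxtimes>\<^bsub>tensor B C\<^esub> z)) = g x y z"
    if "x \<in> carrier A" "y \<in> carrier B" "z \<in> carrier C" for x y z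
    using that assms G by (simp, simp add: G_def trilin_def)
qed


section \<open>Hopf algebras\<close>

text \<open>That the antipode is bijective and reverses the coproduct is part of the interface. For
  the quantum group the first follows from an explicit formula for the square of the antipode, the
  second from a check on generators.\<close>

locale hopf_algebra = complex_algebra H for H :: "'h hopf" (structure) +
  assumes comult_hom: "comult H \<in> alg_hom H (tensor H H)"
    and counit_hom: "counit H \<in> alg_hom H complex_alg"
    and comult_coassoc: "h \<in> carrier H \<Longrightarrow>
      TL H H (tensor H (tensor H H)) (\<lambda>x y. TL H H (tensor H (tensor H H))
        (\<lambda>u v. u \<boxtimes>\<^bsub>tensor H (tensor H H)\<^esub> (v \<boxtimes>\<^bsub>tensor H H\<^esub> y)) (comult H x)) (comult H h) =
      TL H H (tensor H (tensor H H)) (\<lambda>x y. TL H H (tensor H (tensor H H))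
        (\<lambda>u v. x \<boxtimes>\<^bsub>tensor H (tensor H H)\<^esub> (u \<boxtimes>\<^bsub>tensor H H\<^esub> v)) (comult H y)) (comult H h)"
    and comult_counit_left: "h \<in> carrier H \<Longrightarrow> TL H H H (\<lambda>x y. counit H x \<odot> y) (comult H h) = h"
    and comult_counit_right: "h \<in> carrier H \<Longrightarrow> TL H H H (\<lambda>x y. counit H y \<odot> x) (comult H h) = h"
    and antipode_hom: "antipode H \<in> alg_hom H (op_alg H)"
    and antipode_bij: "bij_betw (antipode H) (carrier H) (carrier H)"
    and antipode_comult: "h \<in> carrier H \<Longrightarrow> comult H (antipode H h) =
      TL H H (tensor H H) (\<lambda>x y. antipode H y \<boxtimes>\<^bsub>tensor H H\<^esub> antipode H x) (comult H h)"
    and comult_antipode_left: "h \<in> carrier H \<Longrightarrow>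
      TL H H H (\<lambda>x y. antipode H x \<otimes> y) (comult H h) = counit H h \<odot> \<one>"
    and comult_antipode_right: "h \<in> carrier H \<Longrightarrow>
      TL H H H (\<lambda>x y. x \<otimes> antipode H y) (comult H h) = counit H h \<odot> \<one>"
begin

abbreviation "\<epsilon> \<equiv> counit H"
abbreviation "S \<equiv> antipode H"
definition "Si = inv_into (carrier H) S"
abbreviation sw :: "(complex, 'v, 'm) module_scheme \<Rightarrow> ('h \<Rightarrow> 'h \<Rightarrow> 'v) \<Rightarrow> 'h \<Rightarrow> 'v" where
  "sw V g h \<equiv> TL H H V g (comult H h)"

lemma H_alg [simp]: "complex_algebra H" by unfold_locales

lemma H_vec [simp]: "cvec H" by simp

lemmas comult_simps [simp] = alg_homD(2-6)[OF comult_hom]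
lemmas counit_simps [simp] = alg_homD(3-6)[OF counit_hom, simplified]
lemmas antipode_simps [simp] = alg_homD(2-6)[OF antipode_hom, simplified]

lemma Si_closed [simp]: "h \<in> carrier H \<Longrightarrow> Si h \<in> carrier H"
  and S_Si [simp]: "h \<in> carrier H \<Longrightarrow> S (Si h) = h"
  and Si_S [simp]: "h \<in> carrier H \<Longrightarrow> Si (S h) = h"
  using antipode_bij unfolding Si_def
  by (metis bij_betw_imp_surj_on inv_into_into, metis bij_betw_inv_into_right, metis bij_betw_inv_into_left)

lemma Si_eqI: "h \<in> carrier H \<Longrightarrow> S h = k \<Longrightarrow> Si k = h" by auto

lemma Si_simps [simp]:
  "x \<in> carrier H \<Longrightarrow> y \<in> carrier H \<Longrightarrow> Si (x \<oplus> y) = Si x \<oplus> Si y"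
  "x \<in> carrier H \<Longrightarrow> Si (c \<odot> x) = c \<odot> Si x"
  "x \<in> carrier H \<Longrightarrow> y \<in> carrier H \<Longrightarrow> Si (x \<otimes> y) = Si y \<otimes> Si x"
  "Si \<one> = \<one>"
  by (rule Si_eqI; simp)+

text \<open>Coassociativity in the form used for rewriting: three Sweedler components may be
  rebracketed inside any trilinear expression.\<close>

lemma sw_coassoc:
  assumes V: "cvec V" and g: "trilin H H H V g" and h: "h \<in> carrier H"
  shows "sw V (\<lambda>x y. sw V (\<lambda>u v. g u v y) x) h = sw V (\<lambda>x y. sw V (\<lambda>u v. g x u v) y) h"
proof -
  obtain F where F: "F \<in> lin_maps (tensor H (tensor H H)) V"
    "\<And>x y z. x \<in> carrier H \<Longrightarrow> y \<in> carrier H \<Longrightarrow> z \<in> carrier H \<Longrightarrow>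
      F (x \<boxtimes>\<^bsub>tensor H (tensor H H)\<^esub> (y \<boxtimes>\<^bsub>tensor H H\<^esub> z)) = g x y z"
    by (rule trilin_lift[OF H_vec H_vec H_vec V g]) blast
  show ?thesis
    using arg_cong[OF comult_coassoc[OF h], of F] V h by (simp add: TL_lin[OF _ _ F(1)] F(2))
qed

lemma sw_counit_left:
  assumes V: "cvec V" and f: "f \<in> lin_maps H V" and h: "h \<in> carrier H"
  shows "sw V (\<lambda>x y. \<epsilon> x \<odot>\<^bsub>V\<^esub> f y) h = f h"
  using arg_cong[OF comult_counit_left[OF h], of f] V h
  by (simp add: TL_lin[OF _ _ f] lin_mapsD[OF f])

lemma sw_counit_right:
  assumes V: "cvec V" and f: "f \<in> lin_maps H V" and h: "h \<in> carrier H"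
  shows "sw V (\<lambda>x y. \<epsilon> y \<odot>\<^bsub>V\<^esub> f x) h = f h"
  using arg_cong[OF comult_counit_right[OF h], of f] V h
  by (simp add: TL_lin[OF _ _ f] lin_mapsD[OF f])

lemma sw_antipode_left:
  assumes V: "cvec V" and f: "f \<in> lin_maps H V" and h: "h \<in> carrier H"
  shows "sw V (\<lambda>x y. f (S x \<otimes> y)) h = \<epsilon> h \<odot>\<^bsub>V\<^esub> f \<one>"
  using arg_cong[OF comult_antipode_left[OF h], of f] V h
  by (simp add: TL_lin[OF _ _ f] lin_mapsD[OF f])

lemma sw_antipode_right:
  assumes V: "cvec V" and f: "f \<in> lin_maps H V" and h: "h \<in> carrier H"
  shows "sw V (\<lambda>x y. f (x \<otimes> S y)) h = \<epsilon> h \<odot>\<^bsub>V\<^esub> f \<one>"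
  using arg_cong[OF comult_antipode_right[OF h], of f] V h
  by (simp add: TL_lin[OF _ _ f] lin_mapsD[OF f])

lemma sw_S:
  assumes V: "cvec V" and g: "bilin H H V g" and h: "h \<in> carrier H"
  shows "sw V g (S h) = sw V (\<lambda>x y. g (S y) (S x)) h"
proof -
  note l = tensor_TL_lin_maps[OF H_vec H_vec V g]
  show ?thesis using V g h by (simp add: antipode_comult TL_lin[OF _ V l])
qed

lemma sw_Si:
  assumes V: "cvec V" and g: "bilin H H V g" and h: "h \<in> carrier H"
  shows "sw V g (Si h) = sw V (\<lambda>x y. g (Si y) (Si x)) h"
proof -
  have g': "bilin H H V (\<lambda>x y. g (Si y) (Si x))" using g by (simp add: bilin_def)
  show ?thesis using sw_S[OF V g', of "Si h"] h by simp
qed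

text \<open>Applying the counit to the antipode axiom gives \<open>\<epsilon> h\<close> as the sum
  of \<open>\<epsilon> (S x)\<close> times \<open>\<epsilon> y\<close>, and the counit axiom sums
  this to \<open>\<epsilon> (S h)\<close>.\<close>

lemma counit_S [simp]:
  assumes h: "h \<in> carrier H"
  shows "\<epsilon> (S h) = \<epsilon> h"
proof -
  have "\<epsilon> h = sw complex_alg (\<lambda>x y. \<epsilon> (S x \<otimes> y)) h"
    by (subst sw_antipode_left) (use h alg_homD(1)[OF counit_hom] in auto)
  also have "\<dots> = sw complex_alg (\<lambda>x y. \<epsilon> y \<odot>\<^bsub>complex_alg\<^esub> \<epsilon> (S x)) h"
    by (simp add: mult.commute)
  also have "\<dots> = \<epsilon> (S h)"
    by (rule sw_counit_right) (use h in \<open>auto intro!: lin_mapsI\<close>)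
  finally show ?thesis by simp
qed

lemma counit_Si [simp]: "h \<in> carrier H \<Longrightarrow> \<epsilon> (Si h) = \<epsilon> h"
  using counit_S[of "Si h"] by simp

text \<open>This is the antipode axiom at \<open>Si h\<close>. As \<open>S\<close> reverses the
  coproduct, the components of \<open>h\<close> appear in the opposite order.\<close>

lemma sw_Si_left:
  assumes V: "cvec V" and f: "f \<in> lin_maps H V" and h: "h \<in> carrier H"
  shows "sw V (\<lambda>x y. f (Si y \<otimes> x)) h = \<epsilon> h \<odot>\<^bsub>V\<^esub> f \<one>"
proof -
  have g: "bilin H H V (\<lambda>x y. f (Si y \<otimes> x))" by (simp add: bilin_def lin_mapsD[OF f])
  show ?thesis using sw_S[OF V g, of "Si h"] sw_antipode_right[OF V f, of "Si h"] h by simp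
qed

lemma sw_Si_right:
  assumes V: "cvec V" and f: "f \<in> lin_maps H V" and h: "h \<in> carrier H"
  shows "sw V (\<lambda>x y. f (y \<otimes> Si x)) h = \<epsilon> h \<odot>\<^bsub>V\<^esub> f \<one>"
proof -
  have g: "bilin H H V (\<lambda>x y. f (y \<otimes> Si x))" by (simp add: bilin_def lin_mapsD[OF f])
  show ?thesis using sw_S[OF V g, of "Si h"] sw_antipode_left[OF V f, of "Si h"] h by simp
qed

end


section \<open>Braided-commutative Yetter-Drinfeld module algebras\<close>

text \<open>Left actions and left coactions. The Yetter-Drinfeld condition is taken in its form
  without antipode, which passes from two elements of \<open>H\<close> to their product.\<close>

locale yd_algebra = hopf_algebra H for H :: "'h hopf" (structure) +
  fixes A :: "(complex, 'a, 'k) module_scheme"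
    and act :: "'h \<Rightarrow> 'a \<Rightarrow> 'a" and \<delta> :: "'a \<Rightarrow> ('h, 'a) tens"
  assumes A_alg [simp]: "complex_algebra A"
    and act_bilin: "bilin H A A act"
    and act_one [simp]: "X \<in> carrier A \<Longrightarrow> act \<one> X = X"
    and act_mult: "h \<in> carrier H \<Longrightarrow> g \<in> carrier H \<Longrightarrow> X \<in> carrier A \<Longrightarrow> act (h \<otimes> g) X = act h (act g X)"
    and act_unit [simp]: "h \<in> carrier H \<Longrightarrow> act h \<one>\<^bsub>A\<^esub> = counit H h \<odot>\<^bsub>A\<^esub> \<one>\<^bsub>A\<^esub>"
    and act_alg: "h \<in> carrier H \<Longrightarrow> X \<in> carrier A \<Longrightarrow> Y \<in> carrier A \<Longrightarrow>
      act h (X \<otimes>\<^bsub>A\<^esub> Y) = TL H H A (\<lambda>x y. act x X \<otimes>\<^bsub>A\<^esub> act y Y) (comult H h)"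
    and coact_hom: "\<delta> \<in> alg_hom A (tensor H A)"
    and coact_coassoc: "X \<in> carrier A \<Longrightarrow>
      TL H A (tensor H (tensor H A)) (\<lambda>x Y. TL H H (tensor H (tensor H A))
        (\<lambda>u v. u \<boxtimes>\<^bsub>tensor H (tensor H A)\<^esub> (v \<boxtimes>\<^bsub>tensor H A\<^esub> Y)) (comult H x)) (\<delta> X) =
      TL H A (tensor H (tensor H A)) (\<lambda>x Y. TL H A (tensor H (tensor H A))
        (\<lambda>u Z. x \<boxtimes>\<^bsub>tensor H (tensor H A)\<^esub> (u \<boxtimes>\<^bsub>tensor H A\<^esub> Z)) (\<delta> Y)) (\<delta> X)"
    and coact_counit: "X \<in> carrier A \<Longrightarrow> TL H A A (\<lambda>x Y. counit H x \<odot>\<^bsub>A\<^esub> Y) (\<delta> X) = X"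
    and yetter_drinfeld: "h \<in> carrier H \<Longrightarrow> X \<in> carrier A \<Longrightarrow>
      TL H H (tensor H A) (\<lambda>u v. TL H A (tensor H A)
        (\<lambda>x Y. (u \<otimes> x) \<boxtimes>\<^bsub>tensor H A\<^esub> act v Y) (\<delta> X)) (comult H h) =
      TL H H (tensor H A) (\<lambda>u v. TL H A (tensor H A)
        (\<lambda>x Y. (x \<otimes> v) \<boxtimes>\<^bsub>tensor H A\<^esub> Y) (\<delta> (act u X))) (comult H h)"
    and braided_comm: "X \<in> carrier A \<Longrightarrow> Y \<in> carrier A \<Longrightarrow>
      X \<otimes>\<^bsub>A\<^esub> Y = TL H A A (\<lambda>x Z. act x Y \<otimes>\<^bsub>A\<^esub> Z) (\<delta> X)"
begin

abbreviation co :: "(complex, 'v, 'm) module_scheme \<Rightarrow> ('h \<Rightarrow> 'a \<Rightarrow> 'v) \<Rightarrow> 'a \<Rightarrow> 'v" where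
  "co V g X \<equiv> TL H A V g (\<delta> X)"

lemma A_vec [simp]: "cvec A" by simp

lemma act_simps [simp]:
  "h \<in> carrier H \<Longrightarrow> X \<in> carrier A \<Longrightarrow> act h X \<in> carrier A"
  "h \<in> carrier H \<Longrightarrow> k \<in> carrier H \<Longrightarrow> X \<in> carrier A \<Longrightarrow> act (h \<oplus> k) X = act h X \<oplus>\<^bsub>A\<^esub> act k X"
  "h \<in> carrier H \<Longrightarrow> X \<in> carrier A \<Longrightarrow> Y \<in> carrier A \<Longrightarrow> act h (X \<oplus>\<^bsub>A\<^esub> Y) = act h X \<oplus>\<^bsub>A\<^esub> act h Y"
  "h \<in> carrier H \<Longrightarrow> X \<in> carrier A \<Longrightarrow> act (c \<odot> h) X = c \<odot>\<^bsub>A\<^esub> act h X"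
  "h \<in> carrier H \<Longrightarrow> X \<in> carrier A \<Longrightarrow> act h (c \<odot>\<^bsub>A\<^esub> X) = c \<odot>\<^bsub>A\<^esub> act h X"
  using act_bilin by (simp_all add: bilin_def)

lemmas coact_simps [simp] = alg_homD(2-6)[OF coact_hom]

lemma co_coassoc:
  assumes V: "cvec V" and g: "trilin H H A V g" and X: "X \<in> carrier A"
  shows "co V (\<lambda>x Y. sw V (\<lambda>u v. g u v Y) x) X = co V (\<lambda>x Y. co V (\<lambda>u Z. g x u Z) Y) X"
proof -
  obtain F where F: "F \<in> lin_maps (tensor H (tensor H A)) V"
    "\<And>x y z. x \<in> carrier H \<Longrightarrow> y \<in> carrier H \<Longrightarrow> z \<in> carrier A \<Longrightarrow>
      F (x \<boxtimes>\<^bsub>tensor H (tensor H A)\<^esub> (y \<boxtimes>\<^bsub>tensor H A\<^esub> z)) = g x y z"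
    by (rule trilin_lift[OF H_vec H_vec A_vec V g]) blast
  show ?thesis
    using arg_cong[OF coact_coassoc[OF X], of F] V X by (simp add: TL_lin[OF _ _ F(1)] F(2))
qed

lemma co_counit:
  assumes V: "cvec V" and f: "f \<in> lin_maps A V" and X: "X \<in> carrier A"
  shows "co V (\<lambda>x Y. \<epsilon> x \<odot>\<^bsub>V\<^esub> f Y) X = f X"
  using arg_cong[OF coact_counit[OF X], of f] V X by (simp add: TL_lin[OF _ _ f] lin_mapsD[OF f])

lemma co_act:
  assumes V: "cvec V" and g: "bilin H A V g" and h: "h \<in> carrier H" and X: "X \<in> carrier A"
  shows "sw V (\<lambda>u v. co V (\<lambda>x Y. g (u \<otimes> x) (act v Y)) X) h = sw V (\<lambda>u v. co V (\<lambda>x Y. g (x \<otimes> v) Y) (act u X)) h"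
proof -
  define F where "F = TL H A V g"
  have F: "F \<in> lin_maps (tensor H A) V" unfolding F_def by (rule tensor_TL_lin_maps) (use V g in auto)
  have p: "F (x \<boxtimes>\<^bsub>tensor H A\<^esub> Y) = g x Y" if "x \<in> carrier H" "Y \<in> carrier A" for x Y
    using that V g by (simp add: F_def)
  show ?thesis
    using arg_cong[OF yetter_drinfeld[OF h X], of F] V h X by (simp add: TL_lin[OF _ _ F] p)
qed

end

lemma TL_mult_left:
  "complex_algebra M \<Longrightarrow> a \<in> carrier M \<Longrightarrow>
    (\<And>x y. x \<in> carrier A \<Longrightarrow> y \<in> carrier B \<Longrightarrow> g x y \<in> carrier M) \<Longrightarrow>
    a \<otimes>\<^bsub>M\<^esub> TL A B M g S = TL A B M (\<lambda>x y. a \<otimes>\<^bsub>M\<^esub> g x y) S"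
  and TL_mult_right:
  "complex_algebra M \<Longrightarrow> a \<in> carrier M \<Longrightarrow>
    (\<And>x y. x \<in> carrier A \<Longrightarrow> y \<in> carrier B \<Longrightarrow> g x y \<in> carrier M) \<Longrightarrow>
    TL A B M g S \<otimes>\<^bsub>M\<^esub> a = TL A B M (\<lambda>x y. g x y \<otimes>\<^bsub>M\<^esub> a) S"
  by (rule TL_lin[where V = M and W = M, OF _ _ lin_maps_mult_left] TL_lin[where V = M and W = M, OF _ _ lin_maps_mult_right]; simp)+

section \<open>Smash products\<close>

text \<open>
  \<open>M\<close> is a copy of the smash product: \<open>s X\<close> and \<open>j h\<close> stand for \<open>X # 1\<close> and \<open>1 # h\<close>.
\<close>

locale smash_model = yd_algebra H A act \<delta>
  for H :: "'h hopf" (structure) and A :: "(complex, 'a, 'k) module_scheme" and act \<delta> +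
  fixes M :: "(complex, 'x, 'm) module_scheme" and s :: "'a \<Rightarrow> 'x" and j :: "'h \<Rightarrow> 'x" and t :: "'a \<Rightarrow> 'x"
  assumes M_alg [simp]: "complex_algebra M"
    and s_hom: "s \<in> alg_hom A M" and j_hom: "j \<in> alg_hom H M"
    and j_s: "h \<in> carrier H \<Longrightarrow> X \<in> carrier A \<Longrightarrow>
      j h \<otimes>\<^bsub>M\<^esub> s X = TL H H M (\<lambda>u v. s (act u X) \<otimes>\<^bsub>M\<^esub> j v) (comult H h)"
    and basis: "bij_betw (TL A H M (\<lambda>X h. s X \<otimes>\<^bsub>M\<^esub> j h)) (carrier (tensor A H)) (carrier M)"
    and t_eq: "X \<in> carrier A \<Longrightarrow> t X = TL H A M (\<lambda>x Y. s Y \<otimes>\<^bsub>M\<^esub> j (inv_into (carrier H) (antipode H) x)) (\<delta> X)"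
begin

abbreviation mult_M (infixl \<open>\<cdot>\<close> 70) where "x \<cdot> y \<equiv> x \<otimes>\<^bsub>M\<^esub> y"

lemma M_vec [simp]: "cvec M" by simp

lemmas s_simps [simp] = alg_homD(2-6)[OF s_hom]
lemmas j_simps [simp] = alg_homD(2-6)[OF j_hom]
lemmas M_assoc = alg_assoc[OF M_alg]
lemmas push = TL_mult_left[where M = M, OF M_alg] TL_mult_right[where M = M, OF M_alg]

lemma s_TL: "(\<And>x y. x \<in> carrier B \<Longrightarrow> y \<in> carrier C \<Longrightarrow> g x y \<in> carrier A) \<Longrightarrow>
    s (TL B C A g T) = TL B C M (\<lambda>x y. s (g x y)) T"
  by (rule TL_lin[OF _ _ alg_homD(1)[OF s_hom]]) auto

text \<open>Defines linear maps on \<open>M\<close> by prescribing them at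
  \<open>s X \<cdot> j h\<close>, through the inverse of the bijection in
  \<open>basis\<close>.\<close>

definition mlift :: "(complex, 'v, 'w) module_scheme \<Rightarrow> ('a \<Rightarrow> 'h \<Rightarrow> 'v) \<Rightarrow> 'x \<Rightarrow> 'v" where
  "mlift V g m = TL A H V g (inv_into (carrier (tensor A H)) (TL A H M (\<lambda>X h. s X \<cdot> j h)) m)"

lemma basis_lin: "TL A H M (\<lambda>X h. s X \<cdot> j h) \<in> lin_maps (tensor A H) M"
  by (rule tensor_TL_lin_maps) (simp_all add: bilin_def)

lemma basis_inv:
  "m \<in> carrier M \<Longrightarrow> inv_into (carrier (tensor A H)) (TL A H M (\<lambda>X h. s X \<cdot> j h)) m \<in> carrier (tensor A H)"
  "m \<in> carrier M \<Longrightarrow> TL A H M (\<lambda>X h. s X \<cdot> j h) (inv_into (carrier (tensor A H)) (TL A H M (\<lambda>X h. s X \<cdot> j h)) m) = m"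
  "T \<in> carrier (tensor A H) \<Longrightarrow> inv_into (carrier (tensor A H)) (TL A H M (\<lambda>X h. s X \<cdot> j h)) (TL A H M (\<lambda>X h. s X \<cdot> j h) T) = T"
  using basis by (metis bij_betw_imp_surj_on inv_into_into, metis bij_betw_inv_into_right, metis bij_betw_inv_into_left)

lemma mlift_lin:
  assumes V: "cvec V" and g: "bilin A H V g"
  shows "mlift V g \<in> lin_maps M V"
proof -
  let ?F = "TL A H M (\<lambda>X h. s X \<cdot> j h)" let ?G = "inv_into (carrier (tensor A H)) ?F"
  note F = lin_mapsD[OF basis_lin]
  have G: "?G (x \<oplus>\<^bsub>M\<^esub> y) = ?G x \<oplus>\<^bsub>tensor A H\<^esub> ?G y" "?G (c \<odot>\<^bsub>M\<^esub> x) = c \<odot>\<^bsub>tensor A H\<^esub> ?G x"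
    if "x \<in> carrier M" "y \<in> carrier M" for x y c
    using basis_inv(3)[of "?G x \<oplus>\<^bsub>tensor A H\<^esub> ?G y"] basis_inv(3)[of "c \<odot>\<^bsub>tensor A H\<^esub> ?G x"] that
    by (simp_all add: F basis_inv)
  have "?G \<in> lin_maps M (tensor A H)"
    by (rule lin_mapsI) (simp_all add: G basis_inv)
  from lin_maps_comp[OF this tensor_TL_lin_maps[OF A_vec H_vec V g]] show ?thesis
    by (simp add: mlift_def[abs_def])
qed

lemma mlift_gen [simp]:
  assumes "cvec V" "bilin A H V g" "X \<in> carrier A" "h \<in> carrier H"
  shows "mlift V g (s X \<cdot> j h) = g X h"
proof -
  have b: "bilin A H M (\<lambda>X h. s X \<cdot> j h)" by (simp add: bilin_def)
  have "s X \<cdot> j h = TL A H M (\<lambda>X h. s X \<cdot> j h) (X \<boxtimes>\<^bsub>tensor A H\<^esub> h)"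
    using assms b by simp
  then show ?thesis unfolding mlift_def using assms basis_inv(3)[of "X \<boxtimes>\<^bsub>tensor A H\<^esub> h"] by simp
qed

lemma M_eqI:
  assumes V: "cvec V" and f: "f \<in> lin_maps M V" and g: "g \<in> lin_maps M V" and m: "m \<in> carrier M"
    and eq: "\<And>X h. X \<in> carrier A \<Longrightarrow> h \<in> carrier H \<Longrightarrow> f (s X \<cdot> j h) = g (s X \<cdot> j h)"
  shows "f m = g m"
proof -
  let ?F = "TL A H M (\<lambda>X h. s X \<cdot> j h)" let ?G = "inv_into (carrier (tensor A H)) ?F"
  have b: "bilin A H M (\<lambda>X h. s X \<cdot> j h)" by (simp add: bilin_def)
  have "f (?F (?G m)) = g (?F (?G m))"
    by (rule tensor_lin_eqI[OF A_vec H_vec V lin_maps_comp[OF basis_lin f] lin_maps_comp[OF basis_lin g]])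
      (use m b eq in \<open>simp_all add: basis_inv\<close>)
  then show ?thesis using m by (simp add: basis_inv)
qed

lemma t_def: "X \<in> carrier A \<Longrightarrow> t X = co M (\<lambda>x Y. s Y \<cdot> j (Si x)) X"
  by (simp add: t_eq Si_def)

lemma t_simps [simp]:
  "X \<in> carrier A \<Longrightarrow> t X \<in> carrier M"
  "X \<in> carrier A \<Longrightarrow> Y \<in> carrier A \<Longrightarrow> t (X \<oplus>\<^bsub>A\<^esub> Y) = t X \<oplus>\<^bsub>M\<^esub> t Y"
  "X \<in> carrier A \<Longrightarrow> t (c \<odot>\<^bsub>A\<^esub> X) = c \<odot>\<^bsub>M\<^esub> t X"
  by (simp_all add: t_def bilin_def)

lemma t_one [simp]: "t \<one>\<^bsub>A\<^esub> = \<one>\<^bsub>M\<^esub>"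
  by (simp add: t_def tensor_one bilin_def)

text \<open>Braided commutativity read backwards. Applied to the product with \<open>Z\<close> on
  the left, it makes \<open>v \<otimes> Si u\<close> act on \<open>X\<close>, where \<open>u\<close>
  and \<open>v\<close> are the components of a single element, and these cancel.\<close>

lemma braided_comm_Si:
  assumes X: "X \<in> carrier A" and Y: "Y \<in> carrier A"
  shows "co A (\<lambda>x Z. Z \<otimes>\<^bsub>A\<^esub> act (Si x) X) Y = X \<otimes>\<^bsub>A\<^esub> Y"
proof -
  have "co A (\<lambda>x Z. Z \<otimes>\<^bsub>A\<^esub> act (Si x) X) Y = co A (\<lambda>x Z. co A (\<lambda>v W. act v (act (Si x) X) \<otimes>\<^bsub>A\<^esub> W) Z) Y"
    using X by (simp add: braided_comm[symmetric])
  also have "\<dots> = co A (\<lambda>x Z. sw A (\<lambda>u v. act (v \<otimes> Si u) X \<otimes>\<^bsub>A\<^esub> Z) x) Y"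
    by (subst co_coassoc) (use X Y in \<open>simp_all add: trilin_def bilin_def act_mult\<close>)
  also have "\<dots> = co A (\<lambda>x Z. \<epsilon> x \<odot>\<^bsub>A\<^esub> (X \<otimes>\<^bsub>A\<^esub> Z)) Y"
    by (rule TL_cong[OF _ refl], subst sw_Si_right[where f = "\<lambda>h. act h X \<otimes>\<^bsub>A\<^esub> y" for y])
      (use X in \<open>auto intro!: lin_mapsI\<close>)
  also have "\<dots> = X \<otimes>\<^bsub>A\<^esub> Y"
    by (rule co_counit[OF A_vec lin_maps_mult_left[OF A_alg X] Y])
  finally show ?thesis .
qed

text \<open>Moving \<open>s X\<close> to the left of \<open>j (Si x)\<close> makes one component of
  \<open>Si x\<close> act on \<open>X\<close>. Because \<open>Si\<close> reverses the coproduct,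
  this component is the one adjacent to the coacted factor, and \<open>braided_comm_Si\<close>
  applies.\<close>

lemma s_t_comm:
  assumes X: "X \<in> carrier A" and Y: "Y \<in> carrier A"
  shows "t Y \<cdot> s X = s X \<cdot> t Y"
proof -
  have "t Y \<cdot> s X = co M (\<lambda>x Z. s Z \<cdot> (j (Si x) \<cdot> s X)) Y"
    using X Y by (simp add: t_def push M_assoc)
  also have "\<dots> = co M (\<lambda>x Z. sw M (\<lambda>u v. s (Z \<otimes>\<^bsub>A\<^esub> act (Si v) X) \<cdot> j (Si u)) x) Y"
    by (rule TL_cong[OF _ refl], subst j_s, insert X Y, simp, simp, subst sw_Si)
      (simp_all add: push M_assoc bilin_def)
  also have "\<dots> = co M (\<lambda>x Z. co M (\<lambda>v W. s (W \<otimes>\<^bsub>A\<^esub> act (Si v) X) \<cdot> j (Si x)) Z) Y"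
    by (subst co_coassoc) (use X Y in \<open>simp_all add: trilin_def bilin_def\<close>)
  also have "\<dots> = co M (\<lambda>x Z. s (co A (\<lambda>v W. W \<otimes>\<^bsub>A\<^esub> act (Si v) X) Z) \<cdot> j (Si x)) Y"
    by (rule TL_cong[OF _ refl]) (use X in \<open>simp add: s_TL push\<close>)
  also have "\<dots> = s X \<cdot> t Y"
    using X Y by (simp add: braided_comm_Si t_def push M_assoc)
  finally show ?thesis .
qed

text \<open>\<open>Si\<close> reverses the factors from \<open>H\<close>, so everything that comes
  from \<open>Y\<close> stands together and sums to \<open>t Y\<close>; by \<open>s_t_comm\<close>
  it then moves in front of the factor from \<open>X\<close>.\<close>

lemma t_mult [simp]:
  assumes X: "X \<in> carrier A" and Y: "Y \<in> carrier A"
  shows "t (X \<otimes>\<^bsub>A\<^esub> Y) = t Y \<cdot> t X"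
proof -
  have "t (X \<otimes>\<^bsub>A\<^esub> Y) = co M (\<lambda>x Z. co M (\<lambda>y W. s Z \<cdot> (s W \<cdot> (j (Si y) \<cdot> j (Si x)))) Y) X"
    using X Y by (simp add: t_def bilin_def M_assoc)
  also have "\<dots> = co M (\<lambda>x Z. s Z \<cdot> (t Y \<cdot> j (Si x))) X"
    using X Y by (simp add: t_def push M_assoc)
  also have "\<dots> = co M (\<lambda>x Z. t Y \<cdot> (s Z \<cdot> j (Si x))) X"
    by (rule TL_cong[OF _ refl]) (use Y in \<open>simp add: M_assoc[symmetric] s_t_comm\<close>)
  also have "\<dots> = t Y \<cdot> t X"
    using X Y by (simp add: t_def[of X] push)
  finally show ?thesis .
qed

lemma t_hom: "t \<in> alg_hom A (op_alg M)"
  by (rule alg_homI) (auto intro!: lin_mapsI)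

text \<open>The Yetter-Drinfeld condition expressed in \<open>M\<close>: the action of
  \<open>k\<close> on the argument of \<open>t\<close> becomes a twisted conjugation by
  \<open>j\<close>.\<close>

lemma t_act:
  assumes k: "k \<in> carrier H" and X: "X \<in> carrier A"
  shows "t (act k X) = sw M (\<lambda>u v. j v \<cdot> (t X \<cdot> j (Si u))) k"
proof -
  \<comment> \<open>For \<open>z = Si x\<close> the expanded counit yields
    \<open>Si (x \<otimes> v1)\<close>, that is, the factor to the right of \<open>x\<close> which
    the Yetter-Drinfeld condition exchanges.\<close>
  have 1: "\<epsilon> v \<odot>\<^bsub>M\<^esub> (s Y \<cdot> j z) = sw M (\<lambda>v1 v2. s Y \<cdot> j ((v2 \<otimes> Si v1) \<otimes> z)) v"
    if "v \<in> carrier H" "Y \<in> carrier A" "z \<in> carrier H" for v Y z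
    by (subst sw_Si_right[where f = "\<lambda>h. s Y \<cdot> j (h \<otimes> z)"])
      (use that in \<open>auto intro!: lin_mapsI\<close>)
  have 2: "sw M (\<lambda>u v. co M (\<lambda>x Y. s Y \<cdot> j (y \<otimes> Si (x \<otimes> v))) (act u X)) w =
      sw M (\<lambda>u v. co M (\<lambda>x Y. s (act v Y) \<cdot> j (y \<otimes> Si (u \<otimes> x))) X) w"
    if "y \<in> carrier H" "w \<in> carrier H" for y w
    using co_act[where g = "\<lambda>z Y. s Y \<cdot> j (y \<otimes> Si z)" and V = M and h = w and X = X] X that
    by (simp add: bilin_def)
  have "t (act k X) = sw M (\<lambda>u v. \<epsilon> v \<odot>\<^bsub>M\<^esub> t (act u X)) k"
    by (subst sw_counit_right) (use k X in \<open>auto intro!: lin_mapsI\<close>)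
  also have "\<dots> = sw M (\<lambda>u v. co M (\<lambda>x Y. \<epsilon> v \<odot>\<^bsub>M\<^esub> (s Y \<cdot> j (Si x))) (act u X)) k"
    using X by (simp add: t_def)
  also have "\<dots> = sw M (\<lambda>u v. co M (\<lambda>x Y. sw M (\<lambda>v1 v2. s Y \<cdot> j (v2 \<otimes> Si (x \<otimes> v1))) v) (act u X)) k"
    by (intro TL_cong refl, subst 1) (simp_all add: alg_assoc)
  also have "\<dots> = sw M (\<lambda>u v. sw M (\<lambda>v1 v2. co M (\<lambda>x Y. s Y \<cdot> j (v2 \<otimes> Si (x \<otimes> v1))) (act u X)) v) k"
    by (intro TL_cong refl TL_swap) simp_all
  also have "\<dots> = sw M (\<lambda>w v2. sw M (\<lambda>u v1. co M (\<lambda>x Y. s Y \<cdot> j (v2 \<otimes> Si (x \<otimes> v1))) (act u X)) w) k"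
    by (subst sw_coassoc) (use k X in \<open>simp_all add: trilin_def bilin_def\<close>)
  also have "\<dots> = sw M (\<lambda>w v2. sw M (\<lambda>u v1. co M (\<lambda>x Y. s (act v1 Y) \<cdot> j (v2 \<otimes> Si (u \<otimes> x))) X) w) k"
    by (intro TL_cong refl 2)
  also have "\<dots> = sw M (\<lambda>u w. sw M (\<lambda>v1 v2. co M (\<lambda>x Y. s (act v1 Y) \<cdot> j (v2 \<otimes> Si (u \<otimes> x))) X) w) k"
    by (subst sw_coassoc) (use k X in \<open>simp_all add: trilin_def bilin_def\<close>)
  also have "\<dots> = sw M (\<lambda>u w. co M (\<lambda>x Y. sw M (\<lambda>v1 v2. s (act v1 Y) \<cdot> j (v2 \<otimes> Si (u \<otimes> x))) w) X) k"
    by (intro TL_cong refl TL_swap) simp_all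
  also have "\<dots> = sw M (\<lambda>u w. co M (\<lambda>x Y. (j w \<cdot> s Y) \<cdot> (j (Si x) \<cdot> j (Si u))) X) k"
    by (intro TL_cong refl, subst j_s) (simp_all add: push M_assoc)
  also have "\<dots> = sw M (\<lambda>u v. j v \<cdot> (t X \<cdot> j (Si u))) k"
    using X by (simp add: t_def push M_assoc)
  finally show ?thesis .
qed

lemma t_act_S:
  assumes k: "k \<in> carrier H" and X: "X \<in> carrier A"
  shows "t (act (S k) X) = sw M (\<lambda>u v. j (S u) \<cdot> (t X \<cdot> j v)) k"
  by (subst t_act, insert k X, simp, simp, subst sw_S) (simp_all add: bilin_def)

text \<open>By \<open>t_act\<close> each term on the right ends in \<open>Si v1\<close> times
  \<open>u\<close>, and this product cancels. The result is the rule for moving the target to the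
  left of \<open>j h\<close>.\<close>

lemma j_t:
  assumes h: "h \<in> carrier H" and X: "X \<in> carrier A"
  shows "j h \<cdot> t X = sw M (\<lambda>u v. t (act v X) \<cdot> j u) h"
proof -
  have "sw M (\<lambda>u v. t (act v X) \<cdot> j u) h = sw M (\<lambda>u v. sw M (\<lambda>v1 v2. j v2 \<cdot> (t X \<cdot> j (Si v1 \<otimes> u))) v) h"
    by (intro TL_cong refl, subst t_act) (use X in \<open>simp_all add: push M_assoc\<close>)
  also have "\<dots> = sw M (\<lambda>w v2. sw M (\<lambda>u v1. j v2 \<cdot> (t X \<cdot> j (Si v1 \<otimes> u))) w) h"
    by (subst sw_coassoc) (use h X in \<open>simp_all add: trilin_def bilin_def\<close>)
  also have "\<dots> = sw M (\<lambda>w v2. \<epsilon> w \<odot>\<^bsub>M\<^esub> (j v2 \<cdot> t X)) h"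
    by (intro TL_cong refl, subst sw_Si_left[where f = "\<lambda>z. j y \<cdot> (t X \<cdot> j z)" for y])
      (use X in \<open>auto intro!: lin_mapsI\<close>)
  also have "\<dots> = j h \<cdot> t X"
    by (rule sw_counit_left) (use h X in \<open>auto intro!: lin_mapsI\<close>)
  finally show ?thesis by simp
qed

text \<open>Inverts the definition of \<open>t\<close>: inserting it brings \<open>Si v\<close> next
  to \<open>u\<close>, where \<open>u\<close> and \<open>v\<close> are components of the same
  element, and these cancel.\<close>

lemma co_t_j:
  assumes Y: "Y \<in> carrier A"
  shows "co M (\<lambda>x Z. t Z \<cdot> j x) Y = s Y"
proof -
  have "co M (\<lambda>x Z. t Z \<cdot> j x) Y = co M (\<lambda>x Z. co M (\<lambda>w W. s W \<cdot> j (Si w \<otimes> x)) Z) Y"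
    by (intro TL_cong refl) (simp add: t_def push M_assoc)
  also have "\<dots> = co M (\<lambda>x Z. sw M (\<lambda>u v. s Z \<cdot> j (Si v \<otimes> u)) x) Y"
    by (subst co_coassoc) (use Y in \<open>simp_all add: trilin_def bilin_def\<close>)
  also have "\<dots> = co M (\<lambda>x Z. \<epsilon> x \<odot>\<^bsub>M\<^esub> s Z) Y"
    by (intro TL_cong refl, subst sw_Si_left[where f = "\<lambda>z. s y \<cdot> j z" for y])
      (auto intro!: lin_mapsI)
  also have "\<dots> = s Y"
    by (rule co_counit) (use Y alg_homD(1)[OF s_hom] in auto)
  finally show ?thesis .
qed

section \<open>The antipode and its inverse as antihomomorphisms\<close>

text \<open>The antipode of \<open>X # 1\<close>. Since \<open>S\<close> reverses the coproduct, the
  summand \<open>(S(x'') . Y) # S(x')\<close> of the stated formula is the product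
  \<open>(1 # S(x)) (Y # 1)\<close> written out.\<close>

definition "\<tau>s X = co M (\<lambda>x Y. j (S x) \<cdot> s Y) X"

lemma \<tau>s_simps [simp]:
  "X \<in> carrier A \<Longrightarrow> \<tau>s X \<in> carrier M"
  "X \<in> carrier A \<Longrightarrow> Y \<in> carrier A \<Longrightarrow> \<tau>s (X \<oplus>\<^bsub>A\<^esub> Y) = \<tau>s X \<oplus>\<^bsub>M\<^esub> \<tau>s Y"
  "X \<in> carrier A \<Longrightarrow> \<tau>s (c \<odot>\<^bsub>A\<^esub> X) = c \<odot>\<^bsub>M\<^esub> \<tau>s X"
  by (simp_all add: \<tau>s_def bilin_def)

lemma \<tau>s_one [simp]: "\<tau>s \<one>\<^bsub>A\<^esub> = \<one>\<^bsub>M\<^esub>"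
  by (simp add: \<tau>s_def tensor_one bilin_def)

text \<open>The counterpart of the action of the Drinfeld element: it is that action when the
  coaction comes from a universal R-matrix.\<close>

definition "u X = co A (\<lambda>x Y. act (S x) Y) X"

lemma u_closed [simp]: "X \<in> carrier A \<Longrightarrow> u X \<in> carrier A"
  by (simp add: u_def)

lemma t_TL: "(\<And>x y. x \<in> carrier B \<Longrightarrow> y \<in> carrier C \<Longrightarrow> g x y \<in> carrier A) \<Longrightarrow>
    t (TL B C A g T) = TL B C M (\<lambda>x y. t (g x y)) T"
  by (rule TL_lin[where W = M]) (auto intro!: lin_mapsI)

text \<open>Expanding the right side by \<open>t_act_S\<close> and coassociativity produces the sums
  that \<open>co_t_j\<close> recognises as \<open>s Y\<close>. What matters is that
  \<open>\<tau>s X\<close> lies in the image of \<open>t\<close> and so commutes with the image of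
  \<open>s\<close>.\<close>

lemma \<tau>s_eq_t:
  assumes X: "X \<in> carrier A"
  shows "\<tau>s X = t (u X)"
proof -
  have "t (u X) = co M (\<lambda>x Y. sw M (\<lambda>u v. j (S u) \<cdot> (t Y \<cdot> j v)) x) X"
    using X by (simp add: u_def t_TL t_act_S)
  also have "\<dots> = co M (\<lambda>x Y. co M (\<lambda>v Z. j (S x) \<cdot> (t Z \<cdot> j v)) Y) X"
    by (subst co_coassoc) (use X in \<open>simp_all add: trilin_def bilin_def\<close>)
  also have "\<dots> = co M (\<lambda>x Y. j (S x) \<cdot> co M (\<lambda>v Z. t Z \<cdot> j v) Y) X"
    by (intro TL_cong refl) (simp add: push)
  also have "\<dots> = \<tau>s X" by (simp add: co_t_j \<tau>s_def)
  finally show ?thesis by simp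
qed

text \<open>The factors from \<open>X\<close> collect to \<open>\<tau>s X\<close> between
  \<open>j (S y)\<close> and \<open>s W\<close>. By \<open>\<tau>s_eq_t\<close> this element
  commutes with \<open>s W\<close> and can be moved to the right end.\<close>

lemma \<tau>s_mult:
  assumes X: "X \<in> carrier A" and Y: "Y \<in> carrier A"
  shows "\<tau>s (X \<otimes>\<^bsub>A\<^esub> Y) = \<tau>s Y \<cdot> \<tau>s X"
proof -
  have "\<tau>s (X \<otimes>\<^bsub>A\<^esub> Y) = co M (\<lambda>x Z. co M (\<lambda>y W. j (S y) \<cdot> ((j (S x) \<cdot> s Z) \<cdot> s W)) Y) X"
    using X Y by (simp add: \<tau>s_def bilin_def M_assoc)
  also have "\<dots> = co M (\<lambda>y W. co M (\<lambda>x Z. j (S y) \<cdot> ((j (S x) \<cdot> s Z) \<cdot> s W)) X) Y"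
    by (rule TL_swap) simp_all
  also have "\<dots> = co M (\<lambda>y W. j (S y) \<cdot> (\<tau>s X \<cdot> s W)) Y"
    by (intro TL_cong refl) (use X in \<open>simp add: \<tau>s_def push\<close>)
  also have "\<dots> = co M (\<lambda>y W. (j (S y) \<cdot> s W) \<cdot> \<tau>s X) Y"
    by (intro TL_cong refl) (use X in \<open>simp add: \<tau>s_eq_t s_t_comm M_assoc\<close>)
  also have "\<dots> = \<tau>s Y \<cdot> \<tau>s X"
    using X by (simp add: \<tau>s_def[of Y] push)
  finally show ?thesis .
qed

text \<open>The factor \<open>u \<otimes> S v\<close> formed by the two coactions cancels. This
  gives the value of the antipode at \<open>t X\<close>.\<close>

lemma co_j_\<tau>s:
  assumes X: "X \<in> carrier A"
  shows "co M (\<lambda>x Y. j x \<cdot> \<tau>s Y) X = s X"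
proof -
  have "co M (\<lambda>x Y. j x \<cdot> \<tau>s Y) X = co M (\<lambda>x Y. co M (\<lambda>y Z. j (x \<otimes> S y) \<cdot> s Z) Y) X"
    by (intro TL_cong refl) (simp add: \<tau>s_def push M_assoc)
  also have "\<dots> = co M (\<lambda>x Y. sw M (\<lambda>u v. j (u \<otimes> S v) \<cdot> s Y) x) X"
    by (subst co_coassoc) (use X in \<open>simp_all add: trilin_def bilin_def\<close>)
  also have "\<dots> = co M (\<lambda>x Y. \<epsilon> x \<odot>\<^bsub>M\<^esub> s Y) X"
    by (intro TL_cong refl, subst sw_antipode_right[where f = "\<lambda>z. j z \<cdot> s y" for y])
      (auto intro!: lin_mapsI)
  also have "\<dots> = s X"
    by (rule co_counit) (use X alg_homD(1)[OF s_hom] in auto)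
  finally show ?thesis .
qed

text \<open>Commuting \<open>j (S u)\<close> past \<open>s\<close> lets the antipode of one
  component and the next component act together on \<open>Y\<close>, where the antipode axiom
  removes them.\<close>

lemma sw_jS_s:
  assumes h: "h \<in> carrier H" and Y: "Y \<in> carrier A"
  shows "sw M (\<lambda>u v. j (S u) \<cdot> s (act v Y)) h = s Y \<cdot> j (S h)"
proof -
  have "sw M (\<lambda>u v. j (S u) \<cdot> s (act v Y)) h = sw M (\<lambda>u v. sw M (\<lambda>a b. s (act (S b \<otimes> v) Y) \<cdot> j (S a)) u) h"
    by (intro TL_cong refl, subst j_s, insert Y, simp, simp, subst sw_S) (simp_all add: bilin_def act_mult)
  also have "\<dots> = sw M (\<lambda>a w. sw M (\<lambda>b v. s (act (S b \<otimes> v) Y) \<cdot> j (S a)) w) h"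
    by (subst sw_coassoc) (use h Y in \<open>simp_all add: trilin_def bilin_def\<close>)
  also have "\<dots> = sw M (\<lambda>a w. \<epsilon> w \<odot>\<^bsub>M\<^esub> (s Y \<cdot> j (S a))) h"
    by (intro TL_cong refl, subst sw_antipode_left[where f = "\<lambda>z. s (act z Y) \<cdot> j (S x)" for x])
      (use Y in \<open>auto intro!: lin_mapsI\<close>)
  also have "\<dots> = s Y \<cdot> j (S h)"
    by (rule sw_counit_right) (use h Y in \<open>auto intro!: lin_mapsI\<close>)
  finally show ?thesis .
qed

text \<open>The hypothesis \<open>comm\<close> of \<open>antihomI\<close> for the antipode. The
  Yetter-Drinfeld condition takes \<open>h\<close> out of the coacted argument, after which
  \<open>sw_jS_s\<close> applies.\<close>

lemma sw_jS_\<tau>s: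
  assumes h: "h \<in> carrier H" and X: "X \<in> carrier A"
  shows "sw M (\<lambda>u v. j (S v) \<cdot> \<tau>s (act u X)) h = \<tau>s X \<cdot> j (S h)"
proof -
  have "sw M (\<lambda>u v. j (S v) \<cdot> \<tau>s (act u X)) h = sw M (\<lambda>u v. co M (\<lambda>x Y. j (S (x \<otimes> v)) \<cdot> s Y) (act u X)) h"
    by (intro TL_cong refl) (use X in \<open>simp add: \<tau>s_def push M_assoc\<close>)
  also have "\<dots> = sw M (\<lambda>u v. co M (\<lambda>x Y. j (S (u \<otimes> x)) \<cdot> s (act v Y)) X) h"
    by (subst co_act[symmetric, where g = "\<lambda>z Y. j (S z) \<cdot> s Y"]) (use h X in \<open>simp_all add: bilin_def\<close>)
  also have "\<dots> = co M (\<lambda>x Y. sw M (\<lambda>u v. j (S (u \<otimes> x)) \<cdot> s (act v Y)) h) X"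
    by (rule TL_swap) simp_all
  also have "\<dots> = co M (\<lambda>x Y. j (S x) \<cdot> sw M (\<lambda>u v. j (S u) \<cdot> s (act v Y)) h) X"
    by (intro TL_cong refl) (simp add: push M_assoc)
  also have "\<dots> = \<tau>s X \<cdot> j (S h)"
    using h by (simp add: sw_jS_s \<tau>s_def push M_assoc)
  finally show ?thesis .
qed

text \<open>The same hypothesis for the inverse of the antipode; here \<open>t_act\<close> takes the
  place of the Yetter-Drinfeld condition.\<close>

lemma sw_jSi_t:
  assumes h: "h \<in> carrier H" and X: "X \<in> carrier A"
  shows "sw M (\<lambda>u v. j (Si v) \<cdot> t (act u X)) h = t X \<cdot> j (Si h)"
proof -
  have "sw M (\<lambda>u v. j (Si v) \<cdot> t (act u X)) h = sw M (\<lambda>u v. sw M (\<lambda>a b. j (Si v \<otimes> b) \<cdot> (t X \<cdot> j (Si a))) u) h"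
    by (intro TL_cong refl, subst t_act) (use X in \<open>simp_all add: push M_assoc\<close>)
  also have "\<dots> = sw M (\<lambda>a w. sw M (\<lambda>b v. j (Si v \<otimes> b) \<cdot> (t X \<cdot> j (Si a))) w) h"
    by (subst sw_coassoc) (use h X in \<open>simp_all add: trilin_def bilin_def\<close>)
  also have "\<dots> = sw M (\<lambda>a w. \<epsilon> w \<odot>\<^bsub>M\<^esub> (t X \<cdot> j (Si a))) h"
    by (intro TL_cong refl, subst sw_Si_left[where f = "\<lambda>z. j z \<cdot> (t X \<cdot> j (Si x))" for x])
      (use X in \<open>auto intro!: lin_mapsI\<close>)
  also have "\<dots> = t X \<cdot> j (Si h)"
    by (rule sw_counit_right) (use h X in \<open>auto intro!: lin_mapsI\<close>)
  finally show ?thesis .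
qed

text \<open>Reversing products on \<open>M\<close> amounts to reversing them on \<open>A\<close> and
  on \<open>H\<close> and being compatible with the commutation rule \<open>j_s\<close>; the latter
  is \<open>comm\<close>. It is applied to the antipode and to its inverse
  \<open>\<sigma>\<close>.\<close>

lemma antihomI:
  assumes f: "f \<in> lin_maps M M"
    and fs: "\<And>X. X \<in> carrier A \<Longrightarrow> fs X \<in> carrier M"
      "\<And>X Y. X \<in> carrier A \<Longrightarrow> Y \<in> carrier A \<Longrightarrow> fs (X \<otimes>\<^bsub>A\<^esub> Y) = fs Y \<cdot> fs X"
    and fj: "\<And>h. h \<in> carrier H \<Longrightarrow> fj h \<in> carrier M"
      "\<And>h k. h \<in> carrier H \<Longrightarrow> k \<in> carrier H \<Longrightarrow> fj (h \<otimes> k) = fj k \<cdot> fj h"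
    and f_gen: "\<And>X h. X \<in> carrier A \<Longrightarrow> h \<in> carrier H \<Longrightarrow> f (s X \<cdot> j h) = fj h \<cdot> fs X"
    and comm: "\<And>X h. X \<in> carrier A \<Longrightarrow> h \<in> carrier H \<Longrightarrow> sw M (\<lambda>u v. fj v \<cdot> fs (act u X)) h = fs X \<cdot> fj h"
    and m: "m \<in> carrier M" and n: "n \<in> carrier M"
  shows "f (m \<cdot> n) = f n \<cdot> f m"
proof -
  have gen: "f ((s X \<cdot> j h) \<cdot> (s Y \<cdot> j g)) = f (s Y \<cdot> j g) \<cdot> f (s X \<cdot> j h)"
    if X: "X \<in> carrier A" "Y \<in> carrier A" "h \<in> carrier H" "g \<in> carrier H" for X Y h g
  proof -
    have "(s X \<cdot> j h) \<cdot> (s Y \<cdot> j g) = s X \<cdot> ((j h \<cdot> s Y) \<cdot> j g)" using X by (simp add: M_assoc)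
    also have "\<dots> = sw M (\<lambda>u v. s (X \<otimes>\<^bsub>A\<^esub> act u Y) \<cdot> j (v \<otimes> g)) h"
      using X by (simp add: j_s push M_assoc)
    finally have "f ((s X \<cdot> j h) \<cdot> (s Y \<cdot> j g)) = sw M (\<lambda>u v. fj g \<cdot> ((fj v \<cdot> fs (act u Y)) \<cdot> fs X)) h"
      using X by (simp add: TL_lin[OF _ _ f] f_gen fs fj M_assoc del: s_simps(4) j_simps(4))
    also have "\<dots> = fj g \<cdot> (sw M (\<lambda>u v. fj v \<cdot> fs (act u Y)) h \<cdot> fs X)"
      using X by (simp add: push fs fj)
    also have "\<dots> = f (s Y \<cdot> j g) \<cdot> f (s X \<cdot> j h)"
      using X by (simp add: comm f_gen fs fj M_assoc)
    finally show ?thesis .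
  qed
  note fD = lin_mapsD[OF f]
  have "f (m \<cdot> (s Y \<cdot> j g)) = f (s Y \<cdot> j g) \<cdot> f m" if Y: "Y \<in> carrier A" "g \<in> carrier H" for Y g
    by (rule M_eqI[OF M_vec _ _ m, of "\<lambda>m. f (m \<cdot> (s Y \<cdot> j g))" "\<lambda>m. f (s Y \<cdot> j g) \<cdot> f m"])
      (use gen Y in \<open>auto intro!: lin_mapsI simp: fD\<close>)
  then show ?thesis
    by (intro M_eqI[OF M_vec _ _ n, of "\<lambda>n. f (m \<cdot> n)" "\<lambda>n. f n \<cdot> f m"])
      (use m in \<open>auto intro!: lin_mapsI simp: fD\<close>)
qed

definition "\<sigma> = mlift M (\<lambda>X h. j (Si h) \<cdot> t X)"

lemma \<sigma>_lin: "\<sigma> \<in> lin_maps M M"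
  and \<sigma>_gen: "X \<in> carrier A \<Longrightarrow> h \<in> carrier H \<Longrightarrow> \<sigma> (s X \<cdot> j h) = j (Si h) \<cdot> t X"
  unfolding \<sigma>_def by (rule mlift_lin) (simp_all add: bilin_def)

lemma \<sigma>_mult: "m \<in> carrier M \<Longrightarrow> n \<in> carrier M \<Longrightarrow> \<sigma> (m \<cdot> n) = \<sigma> n \<cdot> \<sigma> m"
  by (rule antihomI[OF \<sigma>_lin, of t "\<lambda>h. j (Si h)"]) (simp_all add: \<sigma>_gen sw_jSi_t)

end

section \<open>Tensor products over a noncommutative algebra\<close>

definition balanced ::
  "('a, 'k) partial_object_scheme \<Rightarrow> ('v \<Rightarrow> 'a \<Rightarrow> 'v) \<Rightarrow> ('a \<Rightarrow> 'w \<Rightarrow> 'w) \<Rightarrow>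
   (complex, 'v, 'm) module_scheme \<Rightarrow> (complex, 'w, 'n) module_scheme \<Rightarrow> (complex, 'u, 'l) module_scheme \<Rightarrow>
   ('v \<Rightarrow> 'w \<Rightarrow> 'u) \<Rightarrow> bool" where
  "balanced A r l V W U g \<longleftrightarrow> bilin V W U g \<and>
     (\<forall>v\<in>carrier V. \<forall>a\<in>carrier A. \<forall>w\<in>carrier W. g (r v a) w = g v (l a w))"

definition over_rels ::
  "('a, 'k) partial_object_scheme \<Rightarrow> ('v \<Rightarrow> 'a \<Rightarrow> 'v) \<Rightarrow> ('a \<Rightarrow> 'w \<Rightarrow> 'w) \<Rightarrow>
   (complex, 'v, 'm) module_scheme \<Rightarrow> (complex, 'w, 'n) module_scheme \<Rightarrow> ('v, 'w) tens" where
  "over_rels A r l V W = bilin_rels V W \<union>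
     {pt (r v a, w) - pt (v, l a w) | v a w. v \<in> carrier V \<and> a \<in> carrier A \<and> w \<in> carrier W}"

context
  fixes A :: "('a, 'k) partial_object_scheme" and r :: "'v \<Rightarrow> 'a \<Rightarrow> 'v" and l :: "'a \<Rightarrow> 'w \<Rightarrow> 'w"
    and V :: "(complex, 'v, 'm) module_scheme" and W :: "(complex, 'w, 'n) module_scheme"
  assumes V: "cvec V" and W: "cvec W"
    and r: "\<And>v a. v \<in> carrier V \<Longrightarrow> a \<in> carrier A \<Longrightarrow> r v a \<in> carrier V"
    and l: "\<And>a w. a \<in> carrier A \<Longrightarrow> w \<in> carrier W \<Longrightarrow> l a w \<in> carrier W"
begin

lemma tensor_space_over: "tensor_space V W (over_rels A r l V W) (tensor_over A r l V W)"
proof (rule tensor_space.intro)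
  fix f assume "f \<in> over_rels A r l V W"
  then show "Poly_Mapping.keys f \<subseteq> carrier V \<times> carrier W"
    unfolding over_rels_def
  proof
    assume "f \<in> {pt (r v a, w) - pt (v, l a w) | v a w. v \<in> carrier V \<and> a \<in> carrier A \<and> w \<in> carrier W}"
    then obtain v a w where f: "f = pt (r v a, w) - pt (v, l a w)" "v \<in> carrier V" "a \<in> carrier A" "w \<in> carrier W"
      by blast
    show ?thesis
      unfolding f(1) by (rule order_trans[OF keys_diff]) (use f r l in auto)
  qed (rule keys_bilin_rels[OF V W])
qed (auto simp: V W over_rels_def tensor_over_def)

interpretation T: tensor_space V W "over_rels A r l V W" "tensor_over A r l V W"
  by (rule tensor_space_over)

lemma balanced_kills:
  assumes U: "cvec U" and g: "balanced A r l V W U g"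
  shows "kills U g (over_rels A r l V W)"
  unfolding kills_def
proof
  fix f assume "f \<in> over_rels A r l V W"
  then show "fsum U (\<lambda>(x, y). g x y) f = \<zero>\<^bsub>U\<^esub>"
    unfolding over_rels_def
  proof
    assume "f \<in> bilin_rels V W"
    then show ?thesis using kills_bilin_rels[OF U V W] g by (auto simp: kills_def balanced_def)
  next
    assume "f \<in> {pt (r v a, w) - pt (v, l a w) | v a w. v \<in> carrier V \<and> a \<in> carrier A \<and> w \<in> carrier W}"
    then obtain v a w where f: "f = pt (r v a, w) - pt (v, l a w)" "v \<in> carrier V" "a \<in> carrier A" "w \<in> carrier W"
      by blast
    let ?g = "\<lambda>(x, y). g x y" and ?X = "carrier V \<times> carrier W"
    have gX: "?g z \<in> carrier U" if "z \<in> ?X" for z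
      using that g by (auto simp: balanced_def bilin_def)
    have "fsum U ?g f = ?g (r v a, w) \<ominus>\<^bsub>U\<^esub> ?g (v, l a w)"
      unfolding f(1) using f r l
      by (subst fsum_diff[where X = ?X, OF U gX]; simp?; subst fsum_pt[where X = ?X, OF U gX]; simp?;
          subst fsum_pt[where X = ?X, OF U gX]; simp?)
    also have "\<dots> = \<zero>\<^bsub>U\<^esub>"
      using f g r l gX[of "(v, l a w)"] U by (simp add: balanced_def cvec_minus_eq_zero)
    finally show ?thesis .
  qed
qed

lemma over_cvec: "cvec (tensor_over A r l V W)" by (rule T.cvec_T)

lemma over_bilin: "bilin V W (tensor_over A r l V W) (pure_tensor (tensor_over A r l V W))"
  by (rule T.pure_bilin)

lemma over_balanced:
  assumes "v \<in> carrier V" "a \<in> carrier A" "w \<in> carrier W"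
  shows "r v a \<boxtimes>\<^bsub>tensor_over A r l V W\<^esub> w = v \<boxtimes>\<^bsub>tensor_over A r l V W\<^esub> l a w"
  unfolding T.pure_coset
  by (rule T.coset_eqI, unfold T.N_def, rule fs.span_base) (use assms in \<open>auto simp: over_rels_def\<close>)

lemma over_TL:
  assumes "cvec U" "balanced A r l V W U g"
  shows "TL V W U g \<in> lin_maps (tensor_over A r l V W) U"
    and "x \<in> carrier V \<Longrightarrow> y \<in> carrier W \<Longrightarrow> TL V W U g (x \<boxtimes>\<^bsub>tensor_over A r l V W\<^esub> y) = g x y"
    and "T \<in> carrier (tensor_over A r l V W) \<Longrightarrow> tensor_lift U (\<lambda>(x, y). g x y) T = TL V W U g T"
  using T.TL_lin_maps T.TL_pure T.tensor_lift_eq balanced_kills assms unfolding balanced_def by blast+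

lemma over_lin_eqI:
  assumes "cvec U" "F \<in> lin_maps (tensor_over A r l V W) U" "G \<in> lin_maps (tensor_over A r l V W) U"
    "T \<in> carrier (tensor_over A r l V W)"
    "\<And>x y. x \<in> carrier V \<Longrightarrow> y \<in> carrier W \<Longrightarrow>
      F (x \<boxtimes>\<^bsub>tensor_over A r l V W\<^esub> y) = G (x \<boxtimes>\<^bsub>tensor_over A r l V W\<^esub> y)"
  shows "F T = G T"
  by (rule T.lin_maps_eqI[OF assms])

end


section \<open>The Hopf algebroid of a smash product\<close>

text \<open>The structure maps enter only through linearity and their values at
  \<open>s X \<cdot> j h\<close>, which covers both the maps of the statement and their transports
  to matrices over the quantum group.\<close>

locale smash_algebroid = smash_model H A act \<delta> M s j t
  for H :: "'h hopf" (structure) and A :: "(complex, 'a, 'k) module_scheme" and act \<delta>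
    and M :: "(complex, 'x, 'm) module_scheme" and s j t +
  fixes \<epsilon>' :: "'x \<Rightarrow> 'a" and \<Delta>' :: "'x \<Rightarrow> ('x, 'x) tens" and \<tau>' :: "'x \<Rightarrow> 'x"
  assumes \<epsilon>'_lin: "\<epsilon>' \<in> lin_maps M A"
    and \<epsilon>'_gen: "X \<in> carrier A \<Longrightarrow> h \<in> carrier H \<Longrightarrow> \<epsilon>' (s X \<otimes>\<^bsub>M\<^esub> j h) = counit H h \<odot>\<^bsub>A\<^esub> X"
    and \<Delta>'_lin: "\<Delta>' \<in> lin_maps M (tensor2 A M s t)"
    and \<Delta>'_gen: "X \<in> carrier A \<Longrightarrow> h \<in> carrier H \<Longrightarrow> \<Delta>' (s X \<otimes>\<^bsub>M\<^esub> j h) =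
      TL H H (tensor2 A M s t) (\<lambda>u v. (s X \<otimes>\<^bsub>M\<^esub> j u) \<boxtimes>\<^bsub>tensor2 A M s t\<^esub> j v) (comult H h)"
    and \<tau>'_lin: "\<tau>' \<in> lin_maps M M"
    and \<tau>'_gen: "X \<in> carrier A \<Longrightarrow> h \<in> carrier H \<Longrightarrow> \<tau>' (s X \<otimes>\<^bsub>M\<^esub> j h) =
      j (antipode H h) \<otimes>\<^bsub>M\<^esub> TL H A M (\<lambda>x Y. j (antipode H x) \<otimes>\<^bsub>M\<^esub> s Y) (\<delta> X)"
begin

lemmas \<epsilon>'_simps [simp] = lin_mapsD[OF \<epsilon>'_lin] and \<Delta>'_simps [simp] = lin_mapsD[OF \<Delta>'_lin]
  and \<tau>'_simps [simp] = lin_mapsD[OF \<tau>'_lin]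

lemma \<epsilon>'_s [simp]: "X \<in> carrier A \<Longrightarrow> \<epsilon>' (s X) = X"
  and \<epsilon>'_j [simp]: "h \<in> carrier H \<Longrightarrow> \<epsilon>' (j h) = \<epsilon> h \<odot>\<^bsub>A\<^esub> \<one>\<^bsub>A\<^esub>"
  using \<epsilon>'_gen[of X \<one>] \<epsilon>'_gen[of "\<one>\<^bsub>A\<^esub>" h] by simp_all

lemma \<tau>'_sj: "X \<in> carrier A \<Longrightarrow> h \<in> carrier H \<Longrightarrow> \<tau>' (s X \<cdot> j h) = j (S h) \<cdot> \<tau>s X"
  by (simp add: \<tau>'_gen \<tau>s_def)

lemma \<tau>'_s [simp]: "X \<in> carrier A \<Longrightarrow> \<tau>' (s X) = \<tau>s X"
  and \<tau>'_j [simp]: "h \<in> carrier H \<Longrightarrow> \<tau>' (j h) = j (S h)"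
  using \<tau>'_sj[of X \<one>] \<tau>'_sj[of "\<one>\<^bsub>A\<^esub>" h] by simp_all

lemma \<sigma>_s [simp]: "X \<in> carrier A \<Longrightarrow> \<sigma> (s X) = t X"
  and \<sigma>_j [simp]: "h \<in> carrier H \<Longrightarrow> \<sigma> (j h) = j (Si h)"
  using \<sigma>_gen[of X \<one>] \<sigma>_gen[of "\<one>\<^bsub>A\<^esub>" h] by simp_all

lemma \<tau>'_mult: "m \<in> carrier M \<Longrightarrow> n \<in> carrier M \<Longrightarrow> \<tau>' (m \<cdot> n) = \<tau>' n \<cdot> \<tau>' m"
  by (rule antihomI[OF \<tau>'_lin, of \<tau>s "\<lambda>h. j (S h)"]) (simp_all add: \<tau>'_sj \<tau>s_mult sw_jS_\<tau>s)

lemma \<tau>'_one [simp]: "\<tau>' \<one>\<^bsub>M\<^esub> = \<one>\<^bsub>M\<^esub>"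
  using \<tau>'_j[of \<one>] by (simp del: \<tau>'_j)

lemma \<tau>'_t: "X \<in> carrier A \<Longrightarrow> \<tau>' (t X) = s X"
  by (simp add: t_def TL_lin[OF _ _ \<tau>'_lin] \<tau>'_sj co_j_\<tau>s)

lemma \<sigma>_\<tau>s: "X \<in> carrier A \<Longrightarrow> \<sigma> (\<tau>s X) = s X"
  by (simp add: \<tau>s_def TL_lin[OF _ _ \<sigma>_lin] \<sigma>_mult co_t_j)

lemma \<sigma>_\<tau>': "m \<in> carrier M \<Longrightarrow> \<sigma> (\<tau>' m) = m"
  by (rule M_eqI[OF M_vec lin_maps_comp[OF \<tau>'_lin \<sigma>_lin], of "\<lambda>m. m"])
    (auto intro!: lin_mapsI simp: \<tau>'_sj \<sigma>_mult \<sigma>_\<tau>s)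

lemma \<tau>'_\<sigma>: "m \<in> carrier M \<Longrightarrow> \<tau>' (\<sigma> m) = m"
  by (rule M_eqI[OF M_vec lin_maps_comp[OF \<sigma>_lin \<tau>'_lin], of "\<lambda>m. m"])
    (auto intro!: lin_mapsI simp: \<sigma>_gen \<tau>'_mult \<tau>'_t)

lemma \<epsilon>'_s_mult:
  assumes "X \<in> carrier A" "m \<in> carrier M"
  shows "\<epsilon>' (s X \<cdot> m) = X \<otimes>\<^bsub>A\<^esub> \<epsilon>' m"
proof (rule M_eqI[OF A_vec _ _ assms(2), of "\<lambda>m. \<epsilon>' (s X \<cdot> m)" "\<lambda>m. X \<otimes>\<^bsub>A\<^esub> \<epsilon>' m"])
  fix Y h assume "Y \<in> carrier A" "h \<in> carrier H"
  then show "\<epsilon>' (s X \<cdot> (s Y \<cdot> j h)) = X \<otimes>\<^bsub>A\<^esub> \<epsilon>' (s Y \<cdot> j h)"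
    using \<epsilon>'_gen[of "X \<otimes>\<^bsub>A\<^esub> Y" h] assms by (simp add: M_assoc \<epsilon>'_gen)
qed (use assms in \<open>auto intro!: lin_mapsI\<close>)

text \<open>The map \<open>Y -> \<epsilon>' (m \<cdot> s Y)\<close> is the natural action of
  \<open>M\<close> on \<open>A\<close>, in which \<open>A\<close> acts by multiplication and
  \<open>H\<close> by \<open>act\<close>. This is why the counit of a product depends on its right
  factor only through the counit of that factor.\<close>

lemma \<epsilon>'_mult_gen:
  assumes "X \<in> carrier A" "h \<in> carrier H" "Y \<in> carrier A" "g \<in> carrier H"
  shows "\<epsilon>' ((s X \<cdot> j h) \<cdot> (s Y \<cdot> j g)) = \<epsilon> g \<odot>\<^bsub>A\<^esub> (X \<otimes>\<^bsub>A\<^esub> act h Y)"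
proof -
  have "(s X \<cdot> j h) \<cdot> (s Y \<cdot> j g) = s X \<cdot> ((j h \<cdot> s Y) \<cdot> j g)" using assms by (simp add: M_assoc)
  also have "\<dots> = s X \<cdot> sw M (\<lambda>u v. s (act u Y) \<cdot> j (v \<otimes> g)) h"
    using assms by (simp add: j_s push M_assoc)
  finally have "\<epsilon>' ((s X \<cdot> j h) \<cdot> (s Y \<cdot> j g)) = X \<otimes>\<^bsub>A\<^esub> \<epsilon>' (sw M (\<lambda>u v. s (act u Y) \<cdot> j (v \<otimes> g)) h)"
    using assms by (simp only: \<epsilon>'_s_mult TL_closed M_vec alg_mult_closed[OF M_alg] s_simps(1) j_simps(1) act_simps(1) alg_mult_closed[OF H_alg])
  also have "\<epsilon>' (sw M (\<lambda>u v. s (act u Y) \<cdot> j (v \<otimes> g)) h) = sw A (\<lambda>u v. \<epsilon> v \<odot>\<^bsub>A\<^esub> (\<epsilon> g \<odot>\<^bsub>A\<^esub> act u Y)) h"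
    using assms \<epsilon>'_gen by (simp add: TL_lin[OF _ _ \<epsilon>'_lin] del: j_simps(4))
  also have "\<dots> = \<epsilon> g \<odot>\<^bsub>A\<^esub> act h Y"
    by (rule sw_counit_right) (use assms in \<open>auto intro!: lin_mapsI simp: mult.commute\<close>)
  finally show ?thesis using assms by simp
qed

lemma \<epsilon>'_mult_s:
  assumes m: "m \<in> carrier M" and n: "n \<in> carrier M"
  shows "\<epsilon>' (m \<cdot> n) = \<epsilon>' (m \<cdot> s (\<epsilon>' n))"
proof -
  have gen: "\<epsilon>' ((s X \<cdot> j h) \<cdot> (s Y \<cdot> j g)) = \<epsilon>' ((s X \<cdot> j h) \<cdot> s (\<epsilon>' (s Y \<cdot> j g)))"
    if X: "X \<in> carrier A" "Y \<in> carrier A" "h \<in> carrier H" "g \<in> carrier H" for X Y h g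
    using X \<epsilon>'_mult_gen[of X h "\<epsilon> g \<odot>\<^bsub>A\<^esub> Y" \<one>] by (simp add: \<epsilon>'_mult_gen \<epsilon>'_gen)
  have "\<epsilon>' (m \<cdot> (s Y \<cdot> j g)) = \<epsilon>' (m \<cdot> s (\<epsilon>' (s Y \<cdot> j g)))" if Y: "Y \<in> carrier A" "g \<in> carrier H" for Y g
    by (rule M_eqI[OF A_vec _ _ m, of "\<lambda>m. \<epsilon>' (m \<cdot> (s Y \<cdot> j g))" "\<lambda>m. \<epsilon>' (m \<cdot> s (\<epsilon>' (s Y \<cdot> j g)))"])
      (use gen Y in \<open>auto intro!: lin_mapsI\<close>)
  then show ?thesis
    by (intro M_eqI[OF A_vec _ _ n, of "\<lambda>n. \<epsilon>' (m \<cdot> n)" "\<lambda>n. \<epsilon>' (m \<cdot> s (\<epsilon>' n))"])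
      (use m in \<open>auto intro!: lin_mapsI\<close>)
qed

text \<open>By \<open>\<epsilon>'_mult_s\<close> each \<open>j (Si x)\<close> at the right end
  contributes the scalar \<open>\<epsilon> x\<close>, and the counit axiom of the coaction then
  restores \<open>b\<close>.\<close>

lemma \<epsilon>'_mult_t:
  assumes m: "m \<in> carrier M" and b: "b \<in> carrier A"
  shows "\<epsilon>' (m \<cdot> t b) = \<epsilon>' (m \<cdot> s b)"
proof -
  have "\<epsilon>' (m \<cdot> t b) = co A (\<lambda>x Y. \<epsilon>' (m \<cdot> (s Y \<cdot> j (Si x)))) b"
    using m b by (simp add: t_def push TL_lin[OF _ _ \<epsilon>'_lin])
  also have "\<dots> = co A (\<lambda>x Y. \<epsilon> x \<odot>\<^bsub>A\<^esub> \<epsilon>' (m \<cdot> s Y)) b"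
    by (intro TL_cong refl, subst \<epsilon>'_mult_s) (use m in \<open>simp_all add: \<epsilon>'_gen\<close>)
  also have "\<dots> = \<epsilon>' (m \<cdot> s b)"
    by (rule co_counit) (use m b in \<open>auto intro!: lin_mapsI\<close>)
  finally show ?thesis .
qed

lemma \<epsilon>'_t_mult:
  assumes b: "b \<in> carrier A" and m: "m \<in> carrier M"
  shows "\<epsilon>' (t b \<cdot> m) = \<epsilon>' m \<otimes>\<^bsub>A\<^esub> b"
proof (rule M_eqI[OF A_vec _ _ m, of "\<lambda>m. \<epsilon>' (t b \<cdot> m)" "\<lambda>m. \<epsilon>' m \<otimes>\<^bsub>A\<^esub> b"])
  fix Y h assume Y: "Y \<in> carrier A" "h \<in> carrier H"
  have "t b \<cdot> (s Y \<cdot> j h) = s Y \<cdot> (t b \<cdot> j h)"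
    using Y b by (simp add: M_assoc[symmetric] s_t_comm)
  moreover have "\<epsilon>' (t b \<cdot> j h) = \<epsilon> h \<odot>\<^bsub>A\<^esub> b"
    using \<epsilon>'_mult_s[of "t b" "j h"] \<epsilon>'_mult_t[of "\<one>\<^bsub>M\<^esub>" b] Y b by simp
  ultimately show "\<epsilon>' (t b \<cdot> (s Y \<cdot> j h)) = \<epsilon>' (s Y \<cdot> j h) \<otimes>\<^bsub>A\<^esub> b"
    using Y b by (simp add: \<epsilon>'_s_mult \<epsilon>'_gen)
qed (use b in \<open>auto intro!: lin_mapsI\<close>)

end

section \<open>The balanced square of M and the coproduct\<close>

context smash_model
begin

abbreviation "XX \<equiv> tensor2 A M s t"

definition balM :: "(complex, 'v, 'w) module_scheme \<Rightarrow> ('x \<Rightarrow> 'x \<Rightarrow> 'v) \<Rightarrow> bool" where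
  "balM V g \<longleftrightarrow> bilin M M V g \<and> (\<forall>x\<in>carrier M. \<forall>b\<in>carrier A. \<forall>y\<in>carrier M. g (t b \<cdot> x) y = g x (s b \<cdot> y))"

lemma balM_balanced: "balM V g \<longleftrightarrow> balanced A (\<lambda>x b. t b \<cdot> x) (\<lambda>a x. s a \<cdot> x) M M V g"
  by (simp add: balM_def balanced_def)

lemmas XX_TL = over_TL[of M M A "\<lambda>x b. t b \<cdot> x" "\<lambda>a x. s a \<cdot> x", folded tensor2_def balM_balanced]

lemma XX_vec [simp]: "cvec XX"
  unfolding tensor2_def by (rule over_cvec) simp_all

lemma XX_pure [simp]:
  "x \<in> carrier M \<Longrightarrow> y \<in> carrier M \<Longrightarrow> x \<boxtimes>\<^bsub>XX\<^esub> y \<in> carrier XX"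
  "x \<in> carrier M \<Longrightarrow> x' \<in> carrier M \<Longrightarrow> y \<in> carrier M \<Longrightarrow>
     (x \<oplus>\<^bsub>M\<^esub> x') \<boxtimes>\<^bsub>XX\<^esub> y = (x \<boxtimes>\<^bsub>XX\<^esub> y) \<oplus>\<^bsub>XX\<^esub> (x' \<boxtimes>\<^bsub>XX\<^esub> y)"
  "x \<in> carrier M \<Longrightarrow> y \<in> carrier M \<Longrightarrow> y' \<in> carrier M \<Longrightarrow>
     x \<boxtimes>\<^bsub>XX\<^esub> (y \<oplus>\<^bsub>M\<^esub> y') = (x \<boxtimes>\<^bsub>XX\<^esub> y) \<oplus>\<^bsub>XX\<^esub> (x \<boxtimes>\<^bsub>XX\<^esub> y')"
  "x \<in> carrier M \<Longrightarrow> y \<in> carrier M \<Longrightarrow> (c \<odot>\<^bsub>M\<^esub> x) \<boxtimes>\<^bsub>XX\<^esub> y = c \<odot>\<^bsub>XX\<^esub> (x \<boxtimes>\<^bsub>XX\<^esub> y)"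
  "x \<in> carrier M \<Longrightarrow> y \<in> carrier M \<Longrightarrow> x \<boxtimes>\<^bsub>XX\<^esub> (c \<odot>\<^bsub>M\<^esub> y) = c \<odot>\<^bsub>XX\<^esub> (x \<boxtimes>\<^bsub>XX\<^esub> y)"
  using over_bilin[of M M A "\<lambda>x b. t b \<cdot> x" "\<lambda>a x. s a \<cdot> x", folded tensor2_def]
  by (simp_all add: bilin_def)

lemma XX_bal: "x \<in> carrier M \<Longrightarrow> b \<in> carrier A \<Longrightarrow> y \<in> carrier M \<Longrightarrow> (t b \<cdot> x) \<boxtimes>\<^bsub>XX\<^esub> y = x \<boxtimes>\<^bsub>XX\<^esub> (s b \<cdot> y)"
  using over_balanced[of M M A "\<lambda>x b. t b \<cdot> x" "\<lambda>a x. s a \<cdot> x", folded tensor2_def] by simp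

lemma XX_TL_lin: "cvec V \<Longrightarrow> balM V g \<Longrightarrow> TL M M V g \<in> lin_maps XX V"
  and XX_TL_pure: "cvec V \<Longrightarrow> balM V g \<Longrightarrow> x \<in> carrier M \<Longrightarrow> y \<in> carrier M \<Longrightarrow> TL M M V g (x \<boxtimes>\<^bsub>XX\<^esub> y) = g x y"
  and XX_lift: "cvec V \<Longrightarrow> balM V g \<Longrightarrow> T \<in> carrier XX \<Longrightarrow> tensor_lift V (\<lambda>(x, y). g x y) T = TL M M V g T"
  by (rule XX_TL; simp)+

lemma XX_eqI:
  assumes "cvec V" "F \<in> lin_maps XX V" "G \<in> lin_maps XX V" "T \<in> carrier XX"
    "\<And>x y. x \<in> carrier M \<Longrightarrow> y \<in> carrier M \<Longrightarrow> F (x \<boxtimes>\<^bsub>XX\<^esub> y) = G (x \<boxtimes>\<^bsub>XX\<^esub> y)"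
  shows "F T = G T"
  by (rule over_lin_eqI[of M M A "\<lambda>x b. t b \<cdot> x" "\<lambda>a x. s a \<cdot> x" V F G, folded tensor2_def])
    (use assms in simp_all)

end

context smash_algebroid
begin

lemma \<Delta>_TL:
  assumes V: "cvec V" and g: "balM V g"
  shows "(\<lambda>m. TL M M V g (\<Delta>' m)) \<in> lin_maps M V"
    and "X \<in> carrier A \<Longrightarrow> h \<in> carrier H \<Longrightarrow> TL M M V g (\<Delta>' (s X \<cdot> j h)) = sw V (\<lambda>u v. g (s X \<cdot> j u) (j v)) h"
  using lin_maps_comp[OF \<Delta>'_lin XX_TL_lin[OF V g]]
  by (simp_all add: \<Delta>'_gen TL_lin[OF _ _ XX_TL_lin[OF V g]] V XX_TL_pure g)

text \<open>Identities linear in \<open>\<Delta>' m\<close> need only be checked for \<open>m = s X \<cdot> j h\<close>.\<close>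

lemma \<Delta>_eqI:
  assumes V: "cvec V" and g: "balM V g" and f: "f \<in> lin_maps M V" and m: "m \<in> carrier M"
    and eq: "\<And>X h. X \<in> carrier A \<Longrightarrow> h \<in> carrier H \<Longrightarrow> sw V (\<lambda>u v. g (s X \<cdot> j u) (j v)) h = f (s X \<cdot> j h)"
  shows "TL M M V g (\<Delta>' m) = f m"
  by (rule M_eqI[OF V \<Delta>_TL(1)[OF V g] f m]) (use eq \<Delta>_TL(2)[OF V g] in simp)

lemma \<Delta>_j: "h \<in> carrier H \<Longrightarrow> \<Delta>' (j h) = sw XX (\<lambda>u v. j u \<boxtimes>\<^bsub>XX\<^esub> j v) h"
  using \<Delta>'_gen[of "\<one>\<^bsub>A\<^esub>" h] by simp

lemma \<Delta>_one: "\<Delta>' \<one>\<^bsub>M\<^esub> = \<one>\<^bsub>M\<^esub> \<boxtimes>\<^bsub>XX\<^esub> \<one>\<^bsub>M\<^esub>"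
  using \<Delta>_j[of \<one>] by (simp add: tensor_one bilin_def)

lemma \<Delta>_s:
  assumes a: "a \<in> carrier A" and m: "m \<in> carrier M"
  shows "\<Delta>' (s a \<cdot> m) = TL M M XX (\<lambda>x y. (s a \<cdot> x) \<boxtimes>\<^bsub>XX\<^esub> y) (\<Delta>' m)"
proof (rule \<Delta>_eqI[OF XX_vec _ _ m, of _ "\<lambda>m. \<Delta>' (s a \<cdot> m)", symmetric])
  have "(s a \<cdot> (t b \<cdot> x)) \<boxtimes>\<^bsub>XX\<^esub> y = (s a \<cdot> x) \<boxtimes>\<^bsub>XX\<^esub> (s b \<cdot> y)"
    if "b \<in> carrier A" "x \<in> carrier M" "y \<in> carrier M" for b x y
    using that a by (simp add: M_assoc[symmetric] s_t_comm[symmetric]) (simp add: M_assoc XX_bal)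
  then show "balM XX (\<lambda>x y. (s a \<cdot> x) \<boxtimes>\<^bsub>XX\<^esub> y)" using a by (simp add: balM_def bilin_def)
  fix X h assume "X \<in> carrier A" "h \<in> carrier H"
  then show "sw XX (\<lambda>u v. (s a \<cdot> (s X \<cdot> j u)) \<boxtimes>\<^bsub>XX\<^esub> j v) h = \<Delta>' (s a \<cdot> (s X \<cdot> j h))"
    using \<Delta>'_gen[of "a \<otimes>\<^bsub>A\<^esub> X" h] a by (simp add: M_assoc)
qed (use a in \<open>auto intro!: lin_mapsI\<close>)

lemma pure_TL_left:
  "y \<in> carrier M \<Longrightarrow> (\<And>u v. u \<in> carrier B \<Longrightarrow> v \<in> carrier C \<Longrightarrow> g u v \<in> carrier M) \<Longrightarrow>
    TL B C M g T \<boxtimes>\<^bsub>XX\<^esub> y = TL B C XX (\<lambda>u v. g u v \<boxtimes>\<^bsub>XX\<^esub> y) T"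
  by (rule TL_lin[where F = "\<lambda>m. m \<boxtimes>\<^bsub>XX\<^esub> y"]) (auto intro!: lin_mapsI)

lemma pure_TL_right:
  "x \<in> carrier M \<Longrightarrow> (\<And>u v. u \<in> carrier B \<Longrightarrow> v \<in> carrier C \<Longrightarrow> g u v \<in> carrier M) \<Longrightarrow>
    x \<boxtimes>\<^bsub>XX\<^esub> TL B C M g T = TL B C XX (\<lambda>u v. x \<boxtimes>\<^bsub>XX\<^esub> g u v) T"
  by (rule TL_lin[where F = "\<lambda>m. x \<boxtimes>\<^bsub>XX\<^esub> m"]) (auto intro!: lin_mapsI)

text \<open>\<open>j_t\<close> replaces \<open>j u \<cdot> t a\<close> by the sum of
  \<open>t (act u2 a) \<cdot> j u1\<close>. Balancing carries the target to the second leg as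
  \<open>s (act u2 a)\<close>, where coassociativity and \<open>j_s\<close> assemble
  \<open>j w \<cdot> s a\<close>.\<close>

lemma \<Delta>_takeuchi:
  assumes a: "a \<in> carrier A" and m: "m \<in> carrier M"
  shows "TL M M XX (\<lambda>x y. (x \<cdot> t a) \<boxtimes>\<^bsub>XX\<^esub> y) (\<Delta>' m) = TL M M XX (\<lambda>x y. x \<boxtimes>\<^bsub>XX\<^esub> (y \<cdot> s a)) (\<Delta>' m)"
proof (rule \<Delta>_eqI[OF XX_vec _ \<Delta>_TL(1)[OF XX_vec] m])
  show b1: "balM XX (\<lambda>x y. (x \<cdot> t a) \<boxtimes>\<^bsub>XX\<^esub> y)" and b2: "balM XX (\<lambda>x y. x \<boxtimes>\<^bsub>XX\<^esub> (y \<cdot> s a))"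
    using a by (simp_all add: balM_def bilin_def M_assoc XX_bal)
  fix X h assume X: "X \<in> carrier A" "h \<in> carrier H"
  have "sw XX (\<lambda>u v. (s X \<cdot> j u \<cdot> t a) \<boxtimes>\<^bsub>XX\<^esub> j v) h =
      sw XX (\<lambda>u v. sw XX (\<lambda>u1 u2. (s X \<cdot> j u1) \<boxtimes>\<^bsub>XX\<^esub> (s (act u2 a) \<cdot> j v)) u) h"
  proof (intro TL_cong refl)
    fix u v assume u: "u \<in> carrier H" "v \<in> carrier H"
    have "s X \<cdot> j u \<cdot> t a = sw M (\<lambda>u1 u2. t (act u2 a) \<cdot> (s X \<cdot> j u1)) u"
      using X u a by (simp add: M_assoc j_t push) (simp add: M_assoc[symmetric] s_t_comm)
    then show "(s X \<cdot> j u \<cdot> t a) \<boxtimes>\<^bsub>XX\<^esub> j v = sw XX (\<lambda>u1 u2. (s X \<cdot> j u1) \<boxtimes>\<^bsub>XX\<^esub> (s (act u2 a) \<cdot> j v)) u"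
      using X u a by (simp add: pure_TL_left XX_bal)
  qed
  also have "\<dots> = sw XX (\<lambda>u w. sw XX (\<lambda>u2 v. (s X \<cdot> j u) \<boxtimes>\<^bsub>XX\<^esub> (s (act u2 a) \<cdot> j v)) w) h"
    by (subst sw_coassoc) (use X a in \<open>simp_all add: trilin_def bilin_def\<close>)
  also have "\<dots> = sw XX (\<lambda>u w. (s X \<cdot> j u) \<boxtimes>\<^bsub>XX\<^esub> (j w \<cdot> s a)) h"
    by (intro TL_cong refl) (use X a in \<open>simp add: j_s pure_TL_right\<close>)
  also have "\<dots> = TL M M XX (\<lambda>x y. x \<boxtimes>\<^bsub>XX\<^esub> (y \<cdot> s a)) (\<Delta>' (s X \<cdot> j h))"
    using X by (simp add: \<Delta>_TL(2)[OF XX_vec b2])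
  finally show "sw XX (\<lambda>u v. (s X \<cdot> j u \<cdot> t a) \<boxtimes>\<^bsub>XX\<^esub> j v) h = \<dots>" .
qed

text \<open>Componentwise products over \<open>A\<close> are not defined for arbitrary pairs of
  tensors. For a left factor of the form \<open>\<Delta>' m\<close> the Takeuchi property supplies
  the balancedness that \<open>mult_TL\<close> demands.\<close>

lemma \<Delta>_mult_TL:
  assumes m: "m \<in> carrier M" and T: "T \<in> carrier XX"
  shows "\<Delta>' m \<otimes>\<^bsub>XX\<^esub> T = TL M M XX (\<lambda>x' y'. TL M M XX (\<lambda>x y. (x \<cdot> x') \<boxtimes>\<^bsub>XX\<^esub> (y \<cdot> y')) (\<Delta>' m)) T"
    and "balM XX (\<lambda>x' y'. TL M M XX (\<lambda>x y. (x \<cdot> x') \<boxtimes>\<^bsub>XX\<^esub> (y \<cdot> y')) (\<Delta>' m))"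
proof -
  interpret T: tensor_space M M "over_rels A (\<lambda>x b. t b \<cdot> x) (\<lambda>a x. s a \<cdot> x) M M" XX
    unfolding tensor2_def by (rule tensor_space_over) auto
  have b: "balM XX (\<lambda>x y. (x \<cdot> x') \<boxtimes>\<^bsub>XX\<^esub> (y \<cdot> y'))" if "x' \<in> carrier M" "y' \<in> carrier M" for x' y'
    using that by (simp add: balM_def bilin_def M_assoc XX_bal)
  have c: "TL M M XX (\<lambda>x y. (x \<cdot> (t b \<cdot> x')) \<boxtimes>\<^bsub>XX\<^esub> (y \<cdot> y')) (\<Delta>' m) =
      TL M M XX (\<lambda>x y. (x \<cdot> x') \<boxtimes>\<^bsub>XX\<^esub> (y \<cdot> (s b \<cdot> y'))) (\<Delta>' m)"
    if xy: "x' \<in> carrier M" "y' \<in> carrier M" "b \<in> carrier A" for x' y' b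
  proof -
    note G = XX_TL_lin[OF XX_vec b[OF xy(1,2)]] XX_TL_pure[OF XX_vec b[OF xy(1,2)]]
    \<comment> \<open>The Takeuchi identity for \<open>b\<close>, with right multiplication by
      \<open>x'\<close> and \<open>y'\<close> applied to both sides.\<close>
    have "TL M M XX (\<lambda>x y. (x \<cdot> x') \<boxtimes>\<^bsub>XX\<^esub> (y \<cdot> y')) (TL M M XX (\<lambda>x y. (x \<cdot> t b) \<boxtimes>\<^bsub>XX\<^esub> y) (\<Delta>' m)) =
        TL M M XX (\<lambda>x y. (x \<cdot> x') \<boxtimes>\<^bsub>XX\<^esub> (y \<cdot> y')) (TL M M XX (\<lambda>x y. x \<boxtimes>\<^bsub>XX\<^esub> (y \<cdot> s b)) (\<Delta>' m))"
      using \<Delta>_takeuchi[OF xy(3) m] by simp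
    then show ?thesis using xy by (simp add: TL_lin[OF _ _ G(1)] G(2) M_assoc)
  qed
  show b2: "balM XX (\<lambda>x' y'. TL M M XX (\<lambda>x y. (x \<cdot> x') \<boxtimes>\<^bsub>XX\<^esub> (y \<cdot> y')) (\<Delta>' m))"
    using c by (simp add: balM_def bilin_def)
  have k: "kills XX g (over_rels A (\<lambda>x b. t b \<cdot> x) (\<lambda>a x. s a \<cdot> x) M M)" if "balM XX g" for g
    by (rule balanced_kills) (use that in \<open>auto simp: balM_balanced\<close>)
  show "\<Delta>' m \<otimes>\<^bsub>XX\<^esub> T = TL M M XX (\<lambda>x' y'. TL M M XX (\<lambda>x y. (x \<cdot> x') \<boxtimes>\<^bsub>XX\<^esub> (y \<cdot> y')) (\<Delta>' m)) T"
    by (rule T.mult_TL) (use m T b2 k b in \<open>auto simp: balM_def\<close>)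
qed

lemma \<Delta>_mult_gen:
  assumes X: "X \<in> carrier A" "h \<in> carrier H" "Y \<in> carrier A" "g \<in> carrier H"
  shows "\<Delta>' ((s X \<cdot> j h) \<cdot> (s Y \<cdot> j g)) = \<Delta>' (s X \<cdot> j h) \<otimes>\<^bsub>XX\<^esub> \<Delta>' (s Y \<cdot> j g)"
proof -
  have b: "balM XX (\<lambda>x y. (x \<cdot> x') \<boxtimes>\<^bsub>XX\<^esub> (y \<cdot> y'))" if "x' \<in> carrier M" "y' \<in> carrier M" for x' y'
    using that by (simp add: balM_def bilin_def M_assoc XX_bal)
  \<comment> \<open>The components \<open>u\<close>, \<open>a\<close>, \<open>b\<close> of
    \<open>h\<close> and \<open>g1\<close>, \<open>g2\<close> of \<open>g\<close> are kept apart, so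
    that coassociativity and exchanges of sums can be applied before the product is put together
    again.\<close>
  define G where "G u a b g1 g2 = (s (X \<otimes>\<^bsub>A\<^esub> act u Y) \<cdot> (j a \<cdot> j g1)) \<boxtimes>\<^bsub>XX\<^esub> (j b \<cdot> j g2)" for u a b g1 g2
  have Gc [simp]: "G u a b g1 g2 \<in> carrier XX"
    if "u \<in> carrier H" "a \<in> carrier H" "b \<in> carrier H" "g1 \<in> carrier H" "g2 \<in> carrier H" for u a b g1 g2
    using that X by (simp add: G_def)
  have "(s X \<cdot> j h) \<cdot> (s Y \<cdot> j g) = s X \<cdot> ((j h \<cdot> s Y) \<cdot> j g)" using X by (simp add: M_assoc)
  also have "\<dots> = sw M (\<lambda>u v. s (X \<otimes>\<^bsub>A\<^esub> act u Y) \<cdot> j (v \<otimes> g)) h"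
    using X by (simp add: j_s push M_assoc)
  finally have "\<Delta>' ((s X \<cdot> j h) \<cdot> (s Y \<cdot> j g)) = sw XX (\<lambda>u v. \<Delta>' (s (X \<otimes>\<^bsub>A\<^esub> act u Y) \<cdot> j (v \<otimes> g))) h"
    using X by (simp add: TL_lin[OF _ _ \<Delta>'_lin] del: s_simps(4) j_simps(4))
  also have "\<dots> = sw XX (\<lambda>u v. sw XX (\<lambda>a b. sw XX (\<lambda>g1 g2. G u a b g1 g2) g) v) h"
    using X by (intro TL_cong refl, subst \<Delta>'_gen) (simp_all add: G_def bilin_def del: s_simps(4))
  also have "\<dots> = sw XX (\<lambda>v b. sw XX (\<lambda>u a. sw XX (\<lambda>g1 g2. G u a b g1 g2) g) v) h"
    by (subst sw_coassoc) (use X in \<open>simp_all add: trilin_def bilin_def G_def\<close>)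
  also have "\<dots> = sw XX (\<lambda>v b. sw XX (\<lambda>g1 g2. sw XX (\<lambda>u a. G u a b g1 g2) v) g) h"
    by (intro TL_cong refl TL_swap) simp_all
  also have "\<dots> = sw XX (\<lambda>g1 g2. sw XX (\<lambda>v b. sw XX (\<lambda>u a. G u a b g1 g2) v) h) g"
    by (rule TL_swap) simp_all
  also have "\<dots> = sw XX (\<lambda>g1 g2. sw XX (\<lambda>v b. (s X \<cdot> j v \<cdot> (s Y \<cdot> j g1)) \<boxtimes>\<^bsub>XX\<^esub> (j b \<cdot> j g2)) h) g"
  proof (intro TL_cong refl)
    fix g1 g2 v b assume c: "g1 \<in> carrier H" "g2 \<in> carrier H" "v \<in> carrier H" "b \<in> carrier H"
    have "s X \<cdot> j v \<cdot> (s Y \<cdot> j g1) = s X \<cdot> ((j v \<cdot> s Y) \<cdot> j g1)" using X c by (simp add: M_assoc)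
    also have "\<dots> = sw M (\<lambda>u a. s (X \<otimes>\<^bsub>A\<^esub> act u Y) \<cdot> (j a \<cdot> j g1)) v"
      using X c by (simp add: j_s push M_assoc)
    finally show "sw XX (\<lambda>u a. G u a b g1 g2) v = (s X \<cdot> j v \<cdot> (s Y \<cdot> j g1)) \<boxtimes>\<^bsub>XX\<^esub> (j b \<cdot> j g2)"
      using X c by (simp add: G_def pure_TL_left)
  qed
  also have "\<dots> = sw XX (\<lambda>g1 g2. TL M M XX (\<lambda>x y. (x \<cdot> (s Y \<cdot> j g1)) \<boxtimes>\<^bsub>XX\<^esub> (y \<cdot> j g2)) (\<Delta>' (s X \<cdot> j h))) g"
    by (intro TL_cong refl, subst \<Delta>_TL(2)[OF XX_vec b]) (use X in simp_all)
  also have "\<dots> = \<Delta>' (s X \<cdot> j h) \<otimes>\<^bsub>XX\<^esub> \<Delta>' (s Y \<cdot> j g)"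
    using X by (subst \<Delta>_mult_TL(1), simp, simp, subst \<Delta>_TL(2)[OF XX_vec \<Delta>_mult_TL(2)[OF _ cvec_zero_closed[OF XX_vec]]]) simp_all
  finally show ?thesis .
qed

lemma \<Delta>_mult:
  assumes m: "m \<in> carrier M" and n: "n \<in> carrier M"
  shows "\<Delta>' (m \<cdot> n) = \<Delta>' m \<otimes>\<^bsub>XX\<^esub> \<Delta>' n"
proof -
  have b: "balM XX (\<lambda>x y. (x \<cdot> x') \<boxtimes>\<^bsub>XX\<^esub> (y \<cdot> y'))" if "x' \<in> carrier M" "y' \<in> carrier M" for x' y'
    using that by (simp add: balM_def bilin_def M_assoc XX_bal)
  note bl = lin_mapsD[OF XX_TL_lin[OF XX_vec b]]
  have right: "(\<lambda>n. \<Delta>' m \<otimes>\<^bsub>XX\<^esub> \<Delta>' n) \<in> lin_maps M XX" if m: "m \<in> carrier M" for m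
    using lin_mapsD[OF lin_maps_comp[OF \<Delta>'_lin XX_TL_lin[OF XX_vec \<Delta>_mult_TL(2)[OF m m[THEN \<Delta>'_simps(1)]]]]]
    by (intro lin_mapsI) (simp_all add: \<Delta>_mult_TL(1) m del: \<Delta>'_simps(2,3))
  have left: "(\<lambda>m. \<Delta>' m \<otimes>\<^bsub>XX\<^esub> \<Delta>' n) \<in> lin_maps M XX" if n: "n \<in> carrier M" for n
  proof (rule lin_mapsI)
    show "\<Delta>' x \<otimes>\<^bsub>XX\<^esub> \<Delta>' n \<in> carrier XX" if "x \<in> carrier M" for x
      using that n by (simp add: \<Delta>_mult_TL(1))
    show "\<Delta>' (x \<oplus>\<^bsub>M\<^esub> y) \<otimes>\<^bsub>XX\<^esub> \<Delta>' n = \<Delta>' x \<otimes>\<^bsub>XX\<^esub> \<Delta>' n \<oplus>\<^bsub>XX\<^esub> \<Delta>' y \<otimes>\<^bsub>XX\<^esub> \<Delta>' n"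
      if "x \<in> carrier M" "y \<in> carrier M" for x y
      using that n by (subst (1 2 3) \<Delta>_mult_TL(1)) (simp_all add: bl)
    show "\<Delta>' (c \<odot>\<^bsub>M\<^esub> x) \<otimes>\<^bsub>XX\<^esub> \<Delta>' n = c \<odot>\<^bsub>XX\<^esub> (\<Delta>' x \<otimes>\<^bsub>XX\<^esub> \<Delta>' n)"
      if "x \<in> carrier M" for x c
      using that n by (subst (1 2) \<Delta>_mult_TL(1)) (simp_all add: bl)
  qed
  have "\<Delta>' (m \<cdot> (s Y \<cdot> j g)) = \<Delta>' m \<otimes>\<^bsub>XX\<^esub> \<Delta>' (s Y \<cdot> j g)" if Y: "Y \<in> carrier A" "g \<in> carrier H" for Y g
    by (rule M_eqI[OF XX_vec _ left m, of "\<lambda>m. \<Delta>' (m \<cdot> (s Y \<cdot> j g))"])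
      (use \<Delta>_mult_gen Y in \<open>auto intro!: lin_mapsI\<close>)
  then show ?thesis
    by (intro M_eqI[OF XX_vec _ right[OF m] n, of "\<lambda>n. \<Delta>' (m \<cdot> n)"])
      (use m in \<open>auto intro!: lin_mapsI\<close>)
qed

text \<open>The coproduct takes the target to the second leg. As \<open>Si\<close> reverses
  components, the first leg collects a second application of the coaction and becomes
  \<open>t Y\<close>; balancing turns this into \<open>s Y\<close> on the second leg, where the
  outer coaction completes it to \<open>t b\<close>.\<close>

lemma \<Delta>_t:
  assumes b: "b \<in> carrier A" and m: "m \<in> carrier M"
  shows "\<Delta>' (t b \<cdot> m) = TL M M XX (\<lambda>x y. x \<boxtimes>\<^bsub>XX\<^esub> (t b \<cdot> y)) (\<Delta>' m)"
proof (rule \<Delta>_eqI[OF XX_vec _ _ m, of _ "\<lambda>m. \<Delta>' (t b \<cdot> m)", symmetric])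
  have "x \<boxtimes>\<^bsub>XX\<^esub> (t b \<cdot> (s c \<cdot> y)) = (t c \<cdot> x) \<boxtimes>\<^bsub>XX\<^esub> (t b \<cdot> y)"
    if "c \<in> carrier A" "x \<in> carrier M" "y \<in> carrier M" for c x y
    using that b by (simp add: M_assoc[symmetric] s_t_comm) (simp add: M_assoc XX_bal)
  then show "balM XX (\<lambda>x y. x \<boxtimes>\<^bsub>XX\<^esub> (t b \<cdot> y))" using b by (simp add: balM_def bilin_def)
  fix X h assume X: "X \<in> carrier A" "h \<in> carrier H"
  define G where "G x1 x2 Y h1 h2 = (s X \<cdot> (s Y \<cdot> (j (Si x2) \<cdot> j h1))) \<boxtimes>\<^bsub>XX\<^esub> (j (Si x1) \<cdot> j h2)" for x1 x2 Y h1 h2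
  have Gc [simp]: "G x1 x2 Y h1 h2 \<in> carrier XX"
    if "x1 \<in> carrier H" "x2 \<in> carrier H" "Y \<in> carrier A" "h1 \<in> carrier H" "h2 \<in> carrier H" for x1 x2 Y h1 h2
    using that X by (simp add: G_def)
  have "t b \<cdot> (s X \<cdot> j h) = s X \<cdot> (t b \<cdot> j h)"
    using X b by (simp add: M_assoc[symmetric] s_t_comm)
  also have "\<dots> = co M (\<lambda>x Y. s (X \<otimes>\<^bsub>A\<^esub> Y) \<cdot> j (Si x \<otimes> h)) b"
    using X b by (simp add: t_def push M_assoc)
  finally have "\<Delta>' (t b \<cdot> (s X \<cdot> j h)) = co XX (\<lambda>x Y. \<Delta>' (s (X \<otimes>\<^bsub>A\<^esub> Y) \<cdot> j (Si x \<otimes> h))) b"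
    using X b by (simp add: TL_lin[OF _ _ \<Delta>'_lin] del: s_simps(4) j_simps(4))
  also have "\<dots> = co XX (\<lambda>x Y. sw XX (\<lambda>x1 x2. sw XX (\<lambda>h1 h2. G x1 x2 Y h1 h2) h) x) b"
  proof (intro TL_cong refl)
    fix x Y assume c: "x \<in> carrier H" "Y \<in> carrier A"
    have "\<Delta>' (s (X \<otimes>\<^bsub>A\<^esub> Y) \<cdot> j (Si x \<otimes> h)) =
        sw XX (\<lambda>a b. sw XX (\<lambda>h1 h2. (s (X \<otimes>\<^bsub>A\<^esub> Y) \<cdot> j (a \<otimes> h1)) \<boxtimes>\<^bsub>XX\<^esub> j (b \<otimes> h2)) h) (Si x)"
      using c X by (subst \<Delta>'_gen) (simp_all add: bilin_def del: s_simps(4))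
    also have "\<dots> = sw XX (\<lambda>x1 x2. sw XX (\<lambda>h1 h2. (s (X \<otimes>\<^bsub>A\<^esub> Y) \<cdot> j (Si x2 \<otimes> h1)) \<boxtimes>\<^bsub>XX\<^esub> j (Si x1 \<otimes> h2)) h) x"
      by (rule sw_Si) (use c X in \<open>simp_all add: bilin_def\<close>)
    finally show "\<Delta>' (s (X \<otimes>\<^bsub>A\<^esub> Y) \<cdot> j (Si x \<otimes> h)) = sw XX (\<lambda>x1 x2. sw XX (\<lambda>h1 h2. G x1 x2 Y h1 h2) h) x"
      using c X by (simp add: G_def M_assoc)
  qed
  also have "\<dots> = co XX (\<lambda>x Y. co XX (\<lambda>x2 Z. sw XX (\<lambda>h1 h2. G x x2 Z h1 h2) h) Y) b"
    by (subst co_coassoc) (use X b in \<open>simp_all add: trilin_def bilin_def G_def\<close>)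
  also have "\<dots> = co XX (\<lambda>x Y. sw XX (\<lambda>h1 h2. co XX (\<lambda>x2 Z. G x x2 Z h1 h2) Y) h) b"
    by (intro TL_cong refl TL_swap) simp_all
  also have "\<dots> = co XX (\<lambda>x Y. sw XX (\<lambda>h1 h2. (s X \<cdot> j h1) \<boxtimes>\<^bsub>XX\<^esub> (s Y \<cdot> (j (Si x) \<cdot> j h2))) h) b"
  proof (intro TL_cong refl)
    fix x Y h1 h2 assume c: "x \<in> carrier H" "Y \<in> carrier A" "h1 \<in> carrier H" "h2 \<in> carrier H"
    have "co XX (\<lambda>x2 Z. G x x2 Z h1 h2) Y = (s X \<cdot> (t Y \<cdot> j h1)) \<boxtimes>\<^bsub>XX\<^esub> (j (Si x) \<cdot> j h2)"
      using c X by (simp add: G_def t_def push M_assoc pure_TL_left)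
    also have "s X \<cdot> (t Y \<cdot> j h1) = t Y \<cdot> (s X \<cdot> j h1)"
      using X c by (simp add: M_assoc[symmetric] s_t_comm)
    finally show "co XX (\<lambda>x2 Z. G x x2 Z h1 h2) Y = (s X \<cdot> j h1) \<boxtimes>\<^bsub>XX\<^esub> (s Y \<cdot> (j (Si x) \<cdot> j h2))"
      using c X by (simp add: XX_bal)
  qed
  also have "\<dots> = sw XX (\<lambda>h1 h2. co XX (\<lambda>x Y. (s X \<cdot> j h1) \<boxtimes>\<^bsub>XX\<^esub> (s Y \<cdot> (j (Si x) \<cdot> j h2))) b) h"
    by (rule TL_swap) (use X in simp_all)
  also have "\<dots> = sw XX (\<lambda>u v. (s X \<cdot> j u) \<boxtimes>\<^bsub>XX\<^esub> (t b \<cdot> j v)) h"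
    by (intro TL_cong refl) (use X b in \<open>simp add: t_def push M_assoc pure_TL_right\<close>)
  finally show "sw XX (\<lambda>u v. (s X \<cdot> j u) \<boxtimes>\<^bsub>XX\<^esub> (t b \<cdot> j v)) h = \<Delta>' (t b \<cdot> (s X \<cdot> j h))" by simp
qed (use b in \<open>auto intro!: lin_mapsI\<close>)

abbreviation "lact a \<equiv> tensor_lift XX (\<lambda>(x, y). (s a \<cdot> x) \<boxtimes>\<^bsub>XX\<^esub> y)"
abbreviation "XXX \<equiv> tensor3 A M s t"

lemma lact_bal: "a \<in> carrier A \<Longrightarrow> balM XX (\<lambda>x y. (s a \<cdot> x) \<boxtimes>\<^bsub>XX\<^esub> y)"
proof -
  assume a: "a \<in> carrier A"
  have "(s a \<cdot> (t b \<cdot> x)) \<boxtimes>\<^bsub>XX\<^esub> y = (s a \<cdot> x) \<boxtimes>\<^bsub>XX\<^esub> (s b \<cdot> y)"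
    if "b \<in> carrier A" "x \<in> carrier M" "y \<in> carrier M" for b x y
    using that a by (simp add: M_assoc[symmetric] s_t_comm[symmetric]) (simp add: M_assoc XX_bal)
  then show ?thesis using a by (simp add: balM_def bilin_def)
qed

lemma lact_TL: "a \<in> carrier A \<Longrightarrow> T \<in> carrier XX \<Longrightarrow> lact a T = TL M M XX (\<lambda>x y. (s a \<cdot> x) \<boxtimes>\<^bsub>XX\<^esub> y) T"
  by (rule XX_lift) (simp_all add: lact_bal)

lemma lact_closed: "a \<in> carrier A \<Longrightarrow> T \<in> carrier XX \<Longrightarrow> lact a T \<in> carrier XX"
  by (simp add: lact_TL)

lemma lact_pure: "a \<in> carrier A \<Longrightarrow> x \<in> carrier M \<Longrightarrow> y \<in> carrier M \<Longrightarrow> lact a (x \<boxtimes>\<^bsub>XX\<^esub> y) = (s a \<cdot> x) \<boxtimes>\<^bsub>XX\<^esub> y"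
  by (simp add: lact_TL XX_TL_pure lact_bal)

lemma XXX_def: "XXX = tensor_over A (\<lambda>x b. t b \<cdot> x) lact M XX"
  by (simp add: tensor3_def Let_def)

lemma XXX_vec [simp]: "cvec XXX"
  unfolding XXX_def by (rule over_cvec) (simp_all add: lact_closed)

lemma XXX_pure [simp]:
  "x \<in> carrier M \<Longrightarrow> y \<in> carrier XX \<Longrightarrow> x \<boxtimes>\<^bsub>XXX\<^esub> y \<in> carrier XXX"
  "x \<in> carrier M \<Longrightarrow> x' \<in> carrier M \<Longrightarrow> y \<in> carrier XX \<Longrightarrow>
     (x \<oplus>\<^bsub>M\<^esub> x') \<boxtimes>\<^bsub>XXX\<^esub> y = (x \<boxtimes>\<^bsub>XXX\<^esub> y) \<oplus>\<^bsub>XXX\<^esub> (x' \<boxtimes>\<^bsub>XXX\<^esub> y)"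
  "x \<in> carrier M \<Longrightarrow> y \<in> carrier XX \<Longrightarrow> y' \<in> carrier XX \<Longrightarrow>
     x \<boxtimes>\<^bsub>XXX\<^esub> (y \<oplus>\<^bsub>XX\<^esub> y') = (x \<boxtimes>\<^bsub>XXX\<^esub> y) \<oplus>\<^bsub>XXX\<^esub> (x \<boxtimes>\<^bsub>XXX\<^esub> y')"
  "x \<in> carrier M \<Longrightarrow> y \<in> carrier XX \<Longrightarrow> (c \<odot>\<^bsub>M\<^esub> x) \<boxtimes>\<^bsub>XXX\<^esub> y = c \<odot>\<^bsub>XXX\<^esub> (x \<boxtimes>\<^bsub>XXX\<^esub> y)"
  "x \<in> carrier M \<Longrightarrow> y \<in> carrier XX \<Longrightarrow> x \<boxtimes>\<^bsub>XXX\<^esub> (c \<odot>\<^bsub>XX\<^esub> y) = c \<odot>\<^bsub>XXX\<^esub> (x \<boxtimes>\<^bsub>XXX\<^esub> y)"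
  using over_bilin[of M XX A "\<lambda>x b. t b \<cdot> x" lact, folded XXX_def]
  by (simp_all add: bilin_def lact_closed)

lemma XXX_bal: "x \<in> carrier M \<Longrightarrow> b \<in> carrier A \<Longrightarrow> y \<in> carrier XX \<Longrightarrow> (t b \<cdot> x) \<boxtimes>\<^bsub>XXX\<^esub> y = x \<boxtimes>\<^bsub>XXX\<^esub> lact b y"
  using over_balanced[of M XX A "\<lambda>x b. t b \<cdot> x" lact, folded XXX_def] by (simp add: lact_closed)

lemma XXX_TL_right: "x \<in> carrier M \<Longrightarrow> (\<And>u v. u \<in> carrier B \<Longrightarrow> v \<in> carrier C \<Longrightarrow> g u v \<in> carrier XX) \<Longrightarrow>
    x \<boxtimes>\<^bsub>XXX\<^esub> TL B C XX g T = TL B C XXX (\<lambda>u v. x \<boxtimes>\<^bsub>XXX\<^esub> g u v) T"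
  by (rule TL_lin[where F = "\<lambda>m. x \<boxtimes>\<^bsub>XXX\<^esub> m"]) (auto intro!: lin_mapsI)

lemma XXX_inner_bal: "z \<in> carrier M \<Longrightarrow> balM XXX (\<lambda>u v. u \<boxtimes>\<^bsub>XXX\<^esub> (v \<boxtimes>\<^bsub>XX\<^esub> z))"
  by (simp add: balM_def bilin_def XXX_bal lact_pure)

text \<open>By \<open>\<Delta>_t\<close> a factor \<open>t b\<close> in the argument of the inner
  coproduct ends up on its second leg, where it is balanced against \<open>y\<close>.\<close>

lemma XXX_outer_bal: "balM XXX (\<lambda>x y. TL M M XXX (\<lambda>u v. u \<boxtimes>\<^bsub>XXX\<^esub> (v \<boxtimes>\<^bsub>XX\<^esub> y)) (\<Delta>' x))"
proof -
  note l = lin_mapsD[OF XX_TL_lin[OF XXX_vec XXX_inner_bal]]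
  have "TL M M XXX (\<lambda>u v. u \<boxtimes>\<^bsub>XXX\<^esub> (v \<boxtimes>\<^bsub>XX\<^esub> y)) (\<Delta>' (t b \<cdot> x)) =
      TL M M XXX (\<lambda>u v. u \<boxtimes>\<^bsub>XXX\<^esub> (v \<boxtimes>\<^bsub>XX\<^esub> (s b \<cdot> y))) (\<Delta>' x)"
    if "x \<in> carrier M" "y \<in> carrier M" "b \<in> carrier A" for x y b
    using that by (simp add: \<Delta>_t TL_lin[OF _ _ XX_TL_lin[OF XXX_vec XXX_inner_bal]]
        XX_TL_pure XXX_inner_bal XX_bal)
  then show ?thesis by (simp add: balM_def bilin_def l)
qed

lemma \<Delta>_coassoc:
  assumes x: "x \<in> carrier M"
  shows "tensor_lift XXX (\<lambda>(x', x''). tensor_lift XXX (\<lambda>(u, v). u \<boxtimes>\<^bsub>XXX\<^esub> (v \<boxtimes>\<^bsub>XX\<^esub> x'')) (\<Delta>' x')) (\<Delta>' x) =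
    tensor_lift XXX (\<lambda>(x', x''). x' \<boxtimes>\<^bsub>XXX\<^esub> \<Delta>' x'') (\<Delta>' x)"
proof -
  let ?L = "\<lambda>x' x''. tensor_lift XXX (\<lambda>(u, v). u \<boxtimes>\<^bsub>XXX\<^esub> (v \<boxtimes>\<^bsub>XX\<^esub> x'')) (\<Delta>' x')"
  have LK: "tensor_lift XXX (\<lambda>(u, v). u \<boxtimes>\<^bsub>XXX\<^esub> (v \<boxtimes>\<^bsub>XX\<^esub> z)) T =
      TL M M XXX (\<lambda>u v. u \<boxtimes>\<^bsub>XXX\<^esub> (v \<boxtimes>\<^bsub>XX\<^esub> z)) T" if "T \<in> carrier XX" "z \<in> carrier M" for T z
    using that by (intro XX_lift XXX_inner_bal) simp_all
  have bL: "balM XXX ?L"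
    using XXX_outer_bal LK by (simp add: balM_def bilin_def)
  have bR: "balM XXX (\<lambda>x' x''. x' \<boxtimes>\<^bsub>XXX\<^esub> \<Delta>' x'')"
    by (simp add: balM_def bilin_def XXX_bal lact_TL \<Delta>_s)
  have "TL M M XXX ?L (\<Delta>' x) = TL M M XXX (\<lambda>x' x''. x' \<boxtimes>\<^bsub>XXX\<^esub> \<Delta>' x'') (\<Delta>' x)"
  proof (rule \<Delta>_eqI[OF XXX_vec bL \<Delta>_TL(1)[OF XXX_vec bR] x])
    fix X h assume X: "X \<in> carrier A" "h \<in> carrier H"
    have "sw XXX (\<lambda>a b. ?L (s X \<cdot> j a) (j b)) h =
        sw XXX (\<lambda>a b. sw XXX (\<lambda>u v. (s X \<cdot> j u) \<boxtimes>\<^bsub>XXX\<^esub> (j v \<boxtimes>\<^bsub>XX\<^esub> j b)) a) h"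
      by (intro TL_cong refl) (use X in \<open>simp add: LK \<Delta>_TL(2)[OF XXX_vec XXX_inner_bal]\<close>)
    also have "\<dots> = sw XXX (\<lambda>a b. sw XXX (\<lambda>u v. (s X \<cdot> j a) \<boxtimes>\<^bsub>XXX\<^esub> (j u \<boxtimes>\<^bsub>XX\<^esub> j v)) b) h"
      by (subst sw_coassoc) (use X in \<open>simp_all add: trilin_def bilin_def\<close>)
    also have "\<dots> = sw XXX (\<lambda>a b. (s X \<cdot> j a) \<boxtimes>\<^bsub>XXX\<^esub> \<Delta>' (j b)) h"
      by (intro TL_cong refl) (use X in \<open>simp add: \<Delta>_j XXX_TL_right\<close>)
    also have "\<dots> = TL M M XXX (\<lambda>x' x''. x' \<boxtimes>\<^bsub>XXX\<^esub> \<Delta>' x'') (\<Delta>' (s X \<cdot> j h))"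
      using X by (simp add: \<Delta>_TL(2)[OF XXX_vec bR])
    finally show "sw XXX (\<lambda>a b. ?L (s X \<cdot> j a) (j b)) h = \<dots>" .
  qed
  then show ?thesis
    using x by (simp add: XX_lift[OF XXX_vec bL] XX_lift[OF XXX_vec bR])
qed

lemma \<epsilon>'_left_bal: "balM M (\<lambda>x y. s (\<epsilon>' x) \<cdot> y)"
  and \<epsilon>'_right_bal: "balM M (\<lambda>x y. t (\<epsilon>' y) \<cdot> x)"
  and \<tau>'_left_bal: "balM M (\<lambda>x y. \<tau>' x \<cdot> y)"
  by (simp_all add: balM_def bilin_def \<epsilon>'_t_mult \<epsilon>'_s_mult \<tau>'_mult \<tau>'_t M_assoc)

lemma counit_left_M:
  assumes x: "x \<in> carrier M"
  shows "TL M M M (\<lambda>x y. s (\<epsilon>' x) \<cdot> y) (\<Delta>' x) = x"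
proof (rule \<Delta>_eqI[OF M_vec \<epsilon>'_left_bal _ x])
  fix X h assume X: "X \<in> carrier A" "h \<in> carrier H"
  have "sw M (\<lambda>u v. s (\<epsilon>' (s X \<cdot> j u)) \<cdot> j v) h = sw M (\<lambda>u v. \<epsilon> u \<odot>\<^bsub>M\<^esub> (s X \<cdot> j v)) h"
    by (intro TL_cong refl) (use X in \<open>simp add: \<epsilon>'_gen\<close>)
  also have "\<dots> = s X \<cdot> j h"
    by (rule sw_counit_left) (use X in \<open>auto intro!: lin_mapsI\<close>)
  finally show "sw M (\<lambda>u v. s (\<epsilon>' (s X \<cdot> j u)) \<cdot> j v) h = s X \<cdot> j h" .
qed (auto intro: lin_mapsI)

lemma counit_right_M:
  assumes x: "x \<in> carrier M"
  shows "TL M M M (\<lambda>x y. t (\<epsilon>' y) \<cdot> x) (\<Delta>' x) = x"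
proof (rule \<Delta>_eqI[OF M_vec \<epsilon>'_right_bal _ x])
  fix X h assume X: "X \<in> carrier A" "h \<in> carrier H"
  have "sw M (\<lambda>u v. t (\<epsilon>' (j v)) \<cdot> (s X \<cdot> j u)) h = sw M (\<lambda>u v. \<epsilon> v \<odot>\<^bsub>M\<^esub> (s X \<cdot> j u)) h"
    by (intro TL_cong refl) (use X in simp)
  also have "\<dots> = s X \<cdot> j h"
    by (rule sw_counit_right) (use X in \<open>auto intro!: lin_mapsI\<close>)
  finally show "sw M (\<lambda>u v. t (\<epsilon>' (j v)) \<cdot> (s X \<cdot> j u)) h = s X \<cdot> j h" .
qed (auto intro: lin_mapsI)

lemma t_lin: "t \<in> lin_maps A M"
  by (auto intro!: lin_mapsI)

text \<open>At \<open>s X \<cdot> j h\<close> the sum is a twisted conjugate of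
  \<open>\<tau>s X = t (u X)\<close>, which \<open>t_act_S\<close> evaluates as
  \<open>t (act (S h) (u X))\<close>. The argument is the counit of
  \<open>j (S h) \<cdot> s (u X)\<close>, and under the counit the factor \<open>s (u X)\<close> may
  be replaced by \<open>t (u X)\<close>.\<close>

lemma antipode_left_M:
  assumes x: "x \<in> carrier M"
  shows "TL M M M (\<lambda>x y. \<tau>' x \<cdot> y) (\<Delta>' x) = t (\<epsilon>' (\<tau>' x))"
proof (rule \<Delta>_eqI[OF M_vec \<tau>'_left_bal lin_maps_comp[OF lin_maps_comp[OF \<tau>'_lin \<epsilon>'_lin] t_lin] x])
  fix X h assume X: "X \<in> carrier A" "h \<in> carrier H"
  have "sw M (\<lambda>u v. \<tau>' (s X \<cdot> j u) \<cdot> j v) h = t (act (S h) (u X))"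
    using X by (simp add: \<tau>'_sj \<tau>s_eq_t t_act_S M_assoc)
  also have "act (S h) (u X) = \<epsilon>' (j (S h) \<cdot> s (u X))"
    using \<epsilon>'_mult_gen[of "\<one>\<^bsub>A\<^esub>" "S h" "u X" \<one>] X by simp
  also have "\<dots> = \<epsilon>' (\<tau>' (s X \<cdot> j h))"
    using X by (simp add: \<tau>'_sj \<tau>s_eq_t \<epsilon>'_mult_t)
  finally show "sw M (\<lambda>u v. \<tau>' (s X \<cdot> j u) \<cdot> j v) h = t (\<epsilon>' (\<tau>' (s X \<cdot> j h)))" .
qed

text \<open>The section chooses representatives whose second leg is of the form \<open>j g\<close>:
  the coefficient \<open>s Y\<close> of the second leg is moved to the first leg, where it becomes
  \<open>t Y\<close>.\<close>

definition "\<gamma>1 x = mlift (tensor M M) (\<lambda>Y g. (t Y \<cdot> x) \<boxtimes>\<^bsub>tensor M M\<^esub> j g)"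

lemma \<gamma>1_gen [simp]:
  "x \<in> carrier M \<Longrightarrow> Y \<in> carrier A \<Longrightarrow> g \<in> carrier H \<Longrightarrow> \<gamma>1 x (s Y \<cdot> j g) = (t Y \<cdot> x) \<boxtimes>\<^bsub>tensor M M\<^esub> j g"
  unfolding \<gamma>1_def by (rule mlift_gen) (simp_all add: bilin_def)

lemma \<gamma>1_lin: "x \<in> carrier M \<Longrightarrow> \<gamma>1 x \<in> lin_maps M (tensor M M)"
  unfolding \<gamma>1_def by (rule mlift_lin) (simp_all add: bilin_def)

lemma \<gamma>1_bal: "balM (tensor M M) \<gamma>1"
proof -
  note l = lin_mapsD[OF \<gamma>1_lin]
  have "\<gamma>1 (t b \<cdot> x) y = \<gamma>1 x (s b \<cdot> y)" if "x \<in> carrier M" "b \<in> carrier A" "y \<in> carrier M" for x b y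
  proof (rule M_eqI[OF _ \<gamma>1_lin lin_maps_comp[OF lin_maps_mult_left \<gamma>1_lin]])
    fix Y g assume Y: "Y \<in> carrier A" "g \<in> carrier H"
    show "\<gamma>1 (t b \<cdot> x) (s Y \<cdot> j g) = \<gamma>1 x (s b \<cdot> (s Y \<cdot> j g))"
      using \<gamma>1_gen[of x "b \<otimes>\<^bsub>A\<^esub> Y" g] Y that by (simp add: M_assoc)
  qed (use that in simp_all)
  moreover have "\<gamma>1 (x \<oplus>\<^bsub>M\<^esub> x') y = \<gamma>1 x y \<oplus>\<^bsub>tensor M M\<^esub> \<gamma>1 x' y" "\<gamma>1 (c \<odot>\<^bsub>M\<^esub> x) y = c \<odot>\<^bsub>tensor M M\<^esub> \<gamma>1 x y"
    if "x \<in> carrier M" "x' \<in> carrier M" "y \<in> carrier M" for x x' y c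
    using that by (simp_all add: \<gamma>1_def mlift_def)
  ultimately show ?thesis by (simp add: balM_def bilin_def l)
qed

text \<open>The product \<open>x' \<cdot> \<tau>' x''\<close> need not be balanced, which is why a
  section is involved. The representative that it picks for the coproduct of
  \<open>s X \<cdot> j h\<close> has legs \<open>s X \<cdot> j u\<close> and \<open>j v\<close>, and
  for these the antipode axiom of \<open>H\<close> suffices.\<close>

lemma antipode_right_M:
  "\<exists>\<gamma> \<in> lin_maps XX (tensor M M).
     (\<forall>T\<in>carrier XX. tensor_lift XX (\<lambda>(x, y). x \<boxtimes>\<^bsub>XX\<^esub> y) (\<gamma> T) = T) \<and>
     (\<forall>x\<in>carrier M. tensor_lift M (\<lambda>(x', x''). x' \<cdot> \<tau>' x'') (\<gamma> (\<Delta>' x)) = s (\<epsilon>' x))"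
proof (intro bexI conjI ballI)
  let ?\<gamma> = "TL M M (tensor M M) \<gamma>1"
  have MM: "cvec (tensor M M)" by simp
  note \<gamma> = XX_TL_lin[OF MM \<gamma>1_bal]
  note \<gamma>p = XX_TL_pure[OF MM \<gamma>1_bal]
  note \<gamma>D = lin_mapsD[OF \<gamma>]
  show "?\<gamma> \<in> lin_maps XX (tensor M M)" by (rule \<gamma>)
  have b: "bilin M M XX (pure_tensor XX)" "bilin M M M (\<lambda>x' x''. x' \<cdot> \<tau>' x'')"
    by (simp_all add: bilin_def)
  note l = tensor_TL_lin_maps[OF M_vec M_vec XX_vec b(1)] tensor_TL_lin_maps[OF M_vec M_vec M_vec b(2)]
  fix T assume T: "T \<in> carrier XX"
  have "TL M M XX (pure_tensor XX) (?\<gamma> T) = T"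
  proof (rule XX_eqI[OF XX_vec lin_maps_comp[OF \<gamma> l(1)] _ T, of "\<lambda>T. T"])
    fix x y assume x: "x \<in> carrier M" and y: "y \<in> carrier M"
    have "TL M M XX (pure_tensor XX) (\<gamma>1 x y) = x \<boxtimes>\<^bsub>XX\<^esub> y"
      by (rule M_eqI[OF XX_vec lin_maps_comp[OF \<gamma>1_lin[OF x] l(1)] _ y])
        (use x in \<open>auto intro!: lin_mapsI simp: b XX_bal\<close>)
    then show "TL M M XX (pure_tensor XX) (?\<gamma> (x \<boxtimes>\<^bsub>XX\<^esub> y)) = x \<boxtimes>\<^bsub>XX\<^esub> y"
      using x y by (simp add: \<gamma>p)
  qed (auto intro: lin_mapsI)
  then show "tensor_lift XX (\<lambda>(x, y). x \<boxtimes>\<^bsub>XX\<^esub> y) (?\<gamma> T) = T"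
    using tensor_lift_TL[OF M_vec M_vec XX_vec b(1)] \<gamma>D(1)[OF T] by simp
next
  let ?\<gamma> = "TL M M (tensor M M) \<gamma>1"
  have MM: "cvec (tensor M M)" by simp
  note \<gamma> = XX_TL_lin[OF MM \<gamma>1_bal]
  note \<gamma>D = lin_mapsD[OF \<gamma>]
  have b: "bilin M M M (\<lambda>x' x''. x' \<cdot> \<tau>' x'')" by (simp add: bilin_def)
  note l = tensor_TL_lin_maps[OF M_vec M_vec M_vec b]
  fix x assume x: "x \<in> carrier M"
  have "TL M M M (\<lambda>x' x''. x' \<cdot> \<tau>' x'') (?\<gamma> (\<Delta>' x)) = s (\<epsilon>' x)"
  proof (rule M_eqI[OF M_vec lin_maps_comp[OF \<Delta>_TL(1)[OF MM \<gamma>1_bal] l] lin_maps_comp[OF \<epsilon>'_lin alg_homD(1)[OF s_hom]] x])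
    fix X h assume X: "X \<in> carrier A" "h \<in> carrier H"
    have g: "\<gamma>1 (s X \<cdot> j u) (j v) = (s X \<cdot> j u) \<boxtimes>\<^bsub>tensor M M\<^esub> j v" if "u \<in> carrier H" "v \<in> carrier H" for u v
      using \<gamma>1_gen[of "s X \<cdot> j u" "\<one>\<^bsub>A\<^esub>" v] X that by simp
    have "TL M M M (\<lambda>x' x''. x' \<cdot> \<tau>' x'') (?\<gamma> (\<Delta>' (s X \<cdot> j h))) = sw M (\<lambda>u v. s X \<cdot> j (u \<otimes> S v)) h"
      using X by (simp add: \<Delta>_TL(2)[OF MM \<gamma>1_bal] g TL_lin[OF _ _ l] b M_assoc)
    also have "\<dots> = s (\<epsilon>' (s X \<cdot> j h))"
      by (subst sw_antipode_right[where f = "\<lambda>z. s X \<cdot> j z"])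
        (use X in \<open>auto intro!: lin_mapsI simp: \<epsilon>'_gen\<close>)
    finally show "TL M M M (\<lambda>x' x''. x' \<cdot> \<tau>' x'') (?\<gamma> (\<Delta>' (s X \<cdot> j h))) = s (\<epsilon>' (s X \<cdot> j h))" .
  qed
  then show "tensor_lift M (\<lambda>(x', x''). x' \<cdot> \<tau>' x'') (?\<gamma> (\<Delta>' x)) = s (\<epsilon>' x)"
    using tensor_lift_TL[OF M_vec M_vec M_vec b] \<gamma>D(1)[of "\<Delta>' x"] x by simp
qed

lemma \<Delta>_bimodule:
  assumes "a \<in> carrier A" "b \<in> carrier A" "x \<in> carrier M"
  shows "\<Delta>' (s a \<cdot> t b \<cdot> x) = TL M M XX (\<lambda>x y. (s a \<cdot> x) \<boxtimes>\<^bsub>XX\<^esub> (t b \<cdot> y)) (\<Delta>' x)"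
    and "balM XX (\<lambda>x y. (s a \<cdot> x) \<boxtimes>\<^bsub>XX\<^esub> (t b \<cdot> y))"
proof -
  show "\<Delta>' (s a \<cdot> t b \<cdot> x) = TL M M XX (\<lambda>x y. (s a \<cdot> x) \<boxtimes>\<^bsub>XX\<^esub> (t b \<cdot> y)) (\<Delta>' x)"
    using assms by (simp add: M_assoc \<Delta>_s \<Delta>_t TL_lin[OF _ _ XX_TL_lin[OF XX_vec lact_bal]] XX_TL_pure lact_bal)
  have "(s a \<cdot> (t c \<cdot> x)) \<boxtimes>\<^bsub>XX\<^esub> (t b \<cdot> y) = (s a \<cdot> x) \<boxtimes>\<^bsub>XX\<^esub> (t b \<cdot> (s c \<cdot> y))"
    if c: "c \<in> carrier A" "x \<in> carrier M" "y \<in> carrier M" for c x y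
  proof -
    have "s a \<cdot> (t c \<cdot> x) = t c \<cdot> (s a \<cdot> x)" "t b \<cdot> (s c \<cdot> y) = s c \<cdot> (t b \<cdot> y)"
      using c assms by (simp_all add: M_assoc[symmetric] s_t_comm)
    then show ?thesis using c assms by (simp add: XX_bal)
  qed
  then show "balM XX (\<lambda>x y. (s a \<cdot> x) \<boxtimes>\<^bsub>XX\<^esub> (t b \<cdot> y))"
    using assms by (simp add: balM_def bilin_def)
qed

theorem smash_hopf_algebroid: "hopf_algebroid A M s t \<epsilon>' \<Delta>' \<tau>'"
proof (intro hopf_algebroid.intro bialgebroid.intro bialgebroid_data.intro
    bialgebroid_axioms.intro hopf_algebroid_axioms.intro)
  show "complex_algebra A" "complex_algebra M" by simp_all
  show "s \<in> alg_hom A M" "t \<in> alg_hom A (op_alg M)" by (rule s_hom t_hom)+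
  show "s a \<cdot> t b = t b \<cdot> s a" if "a \<in> carrier A" "b \<in> carrier A" for a b
    using that by (simp add: s_t_comm)
  show "\<Delta>' \<in> lin_maps M XX" "\<epsilon>' \<in> lin_maps M A" by (rule \<Delta>'_lin \<epsilon>'_lin)+
  show "\<Delta>' (s a \<cdot> t b \<cdot> x) = tensor_lift XX (\<lambda>(x', x''). (s a \<cdot> x') \<boxtimes>\<^bsub>XX\<^esub> (t b \<cdot> x'')) (\<Delta>' x)"
    if "a \<in> carrier A" "b \<in> carrier A" "x \<in> carrier M" for a b x
    using that by (simp add: \<Delta>_bimodule(1) XX_lift[OF XX_vec \<Delta>_bimodule(2)])
  show "\<epsilon>' (s a \<cdot> t b \<cdot> x) = a \<otimes>\<^bsub>A\<^esub> \<epsilon>' x \<otimes>\<^bsub>A\<^esub> b" if "a \<in> carrier A" "b \<in> carrier A" "x \<in> carrier M" for a b x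
    using that by (simp add: M_assoc \<epsilon>'_s_mult \<epsilon>'_t_mult alg_assoc[of A])
  show "tensor_lift XXX (\<lambda>(x', x''). tensor_lift XXX (\<lambda>(u, v). u \<boxtimes>\<^bsub>XXX\<^esub> (v \<boxtimes>\<^bsub>XX\<^esub> x'')) (\<Delta>' x')) (\<Delta>' x) =
      tensor_lift XXX (\<lambda>(x', x''). x' \<boxtimes>\<^bsub>XXX\<^esub> \<Delta>' x'') (\<Delta>' x)" if "x \<in> carrier M" for x
    by (rule \<Delta>_coassoc[OF that])
  show "tensor_lift M (\<lambda>(x', x''). s (\<epsilon>' x') \<cdot> x'') (\<Delta>' x) = x" if "x \<in> carrier M" for x
    using that by (simp add: XX_lift[OF M_vec \<epsilon>'_left_bal] counit_left_M)
  show "tensor_lift M (\<lambda>(x', x''). t (\<epsilon>' x'') \<cdot> x') (\<Delta>' x) = x" if "x \<in> carrier M" for x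
    using that by (simp add: XX_lift[OF M_vec \<epsilon>'_right_bal] counit_right_M)
  show "\<Delta>' x \<in> takeuchi A M s t" if x: "x \<in> carrier M" for x
  proof -
    have "tensor_lift XX (\<lambda>(x, y). (x \<cdot> t a) \<boxtimes>\<^bsub>XX\<^esub> y) (\<Delta>' x) =
        tensor_lift XX (\<lambda>(x, y). x \<boxtimes>\<^bsub>XX\<^esub> (y \<cdot> s a)) (\<Delta>' x)" if a: "a \<in> carrier A" for a
    proof -
      have "balM XX (\<lambda>x y. (x \<cdot> t a) \<boxtimes>\<^bsub>XX\<^esub> y)" "balM XX (\<lambda>x y. x \<boxtimes>\<^bsub>XX\<^esub> (y \<cdot> s a))"
        using a by (simp_all add: balM_def bilin_def M_assoc XX_bal)
      then show ?thesis using x a by (simp add: XX_lift \<Delta>_takeuchi)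
    qed
    then show ?thesis using x by (simp add: takeuchi_def Let_def)
  qed
  have "\<one>\<^bsub>XX\<^esub> = \<one>\<^bsub>M\<^esub> \<boxtimes>\<^bsub>XX\<^esub> \<one>\<^bsub>M\<^esub>"
    by (simp add: tensor2_def tensor_over_def tensor_quot_def pure_tensor_def)
  then show "\<Delta>' \<one>\<^bsub>M\<^esub> = \<one>\<^bsub>XX\<^esub>" by (simp add: \<Delta>_one)
  show "\<Delta>' (x \<cdot> y) = \<Delta>' x \<otimes>\<^bsub>XX\<^esub> \<Delta>' y" if "x \<in> carrier M" "y \<in> carrier M" for x y
    by (rule \<Delta>_mult[OF that])
  show "\<epsilon>' \<one>\<^bsub>M\<^esub> = \<one>\<^bsub>A\<^esub>" using \<epsilon>'_s[of "\<one>\<^bsub>A\<^esub>"] by (simp del: \<epsilon>'_s)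
  show "\<epsilon>' (x \<cdot> y) = \<epsilon>' (x \<cdot> s (\<epsilon>' y))" if "x \<in> carrier M" "y \<in> carrier M" for x y
    by (rule \<epsilon>'_mult_s[OF that])
  show "\<epsilon>' (x \<cdot> y) = \<epsilon>' (x \<cdot> t (\<epsilon>' y))" if "x \<in> carrier M" "y \<in> carrier M" for x y
    using that \<epsilon>'_mult_s[of x y] \<epsilon>'_mult_t[of x "\<epsilon>' y"] by simp
  show "\<tau>' \<in> alg_hom M (op_alg M)"
    by (rule alg_homI) (use \<tau>'_lin in \<open>simp_all add: \<tau>'_mult\<close>)
  show "bij_betw \<tau>' (carrier M) (carrier M)"
    by (rule bij_betw_byWitness[of _ \<sigma>]) (auto simp: \<tau>'_\<sigma> \<sigma>_\<tau>' lin_mapsD(1)[OF \<sigma>_lin])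
  show "\<tau>' (t a) = s a" if "a \<in> carrier A" for a by (rule \<tau>'_t[OF that])
  show "tensor_lift M (\<lambda>(x', x''). \<tau>' x' \<cdot> x'') (\<Delta>' x) = t (\<epsilon>' (\<tau>' x))" if "x \<in> carrier M" for x
    using that by (simp add: XX_lift[OF M_vec \<tau>'_left_bal] antipode_left_M)
  show "\<exists>\<gamma> \<in> lin_maps XX (tensor M M).
     (\<forall>S\<in>carrier XX. tensor_lift XX (\<lambda>(x, y). x \<boxtimes>\<^bsub>XX\<^esub> y) (\<gamma> S) = S) \<and>
     (\<forall>x\<in>carrier M. tensor_lift M (\<lambda>(x', x''). x' \<cdot> \<tau>' x'') (\<gamma> (\<Delta>' x)) = s (\<epsilon>' x))"
    by (rule antipode_right_M)
qed

end

section \<open>The smash product as an instance\<close>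

text \<open>For nested sums: once the inner sums are known as \<open>TL\<close> on the carriers, the
  bilinearity of the outer summand can be proved in terms of them.\<close>

lemma tensor_lift_TL_cong:
  assumes A: "cvec A" and B: "cvec B" and V: "cvec V"
    and eq: "\<And>x y. x \<in> carrier A \<Longrightarrow> y \<in> carrier B \<Longrightarrow> g x y = g' x y"
    and g': "bilin A B V g'" and S: "S \<in> carrier (tensor A B)"
  shows "tensor_lift V (\<lambda>(x, y). g x y) S = TL A B V g' S"
proof -
  have "bilin A B V g" using g' eq A B by (simp add: bilin_def)
  from tensor_lift_TL[OF A B V this S] show ?thesis using eq by simp
qed

lemma TL_same_space:
  fixes V W :: "(complex, 'v, 'm) module_scheme"
  assumes "carrier W = carrier V" "\<zero>\<^bsub>W\<^esub> = \<zero>\<^bsub>V\<^esub>"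
    "(\<oplus>\<^bsub>W\<^esub>) = (\<oplus>\<^bsub>V\<^esub>)" "(\<odot>\<^bsub>W\<^esub>) = (\<odot>\<^bsub>V\<^esub>)"
  shows "TL A B W g S = TL A B V g S"
  using assms by (simp add: TL_def fsum_def finsum_def)

context yd_algebra
begin

abbreviation "AH \<equiv> tensor A H"
abbreviation "XS \<equiv> smash H A act"

lemma smash_simps [simp]:
  "carrier XS = carrier AH" "x \<oplus>\<^bsub>XS\<^esub> y = x \<oplus>\<^bsub>AH\<^esub> y" "c \<odot>\<^bsub>XS\<^esub> x = c \<odot>\<^bsub>AH\<^esub> x"
  "\<zero>\<^bsub>XS\<^esub> = \<zero>\<^bsub>AH\<^esub>" "\<one>\<^bsub>XS\<^esub> = \<one>\<^bsub>A\<^esub> \<boxtimes>\<^bsub>AH\<^esub> \<one>" "pure_tensor XS = pure_tensor AH"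
  by (simp_all add: smash_def Let_def tensor_one pure_tensor_def fun_eq_iff)

lemma smash_TL [simp]: "TL B C XS g T = TL B C AH g T"
  by (rule TL_same_space) (simp_all add: smash_def Let_def)

lemma smash_lin_maps [simp]: "lin_maps XS W = lin_maps AH W" "lin_maps W XS = lin_maps W AH"
  by (simp_all add: lin_maps_def)

lemma AH_vec [simp]: "cvec AH" by simp

lemma XS_vec [simp]: "cvec XS"
  by (rule cvec_cong_ops[of AH]) simp_all

lemma smash_mult:
  assumes T: "T \<in> carrier AH" "T' \<in> carrier AH"
  shows "T \<otimes>\<^bsub>XS\<^esub> T' = TL A H AH (\<lambda>X h. TL A H AH (\<lambda>Y g. sw AH
    (\<lambda>u v. (X \<otimes>\<^bsub>A\<^esub> act u Y) \<boxtimes>\<^bsub>AH\<^esub> (v \<otimes> g)) h) T') T"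
proof -
  have 1: "tensor_lift AH (\<lambda>(h', h''). (X \<otimes>\<^bsub>A\<^esub> act h' Y) \<boxtimes>\<^bsub>AH\<^esub> (h'' \<otimes> g)) (comult H h) =
      sw AH (\<lambda>u v. (X \<otimes>\<^bsub>A\<^esub> act u Y) \<boxtimes>\<^bsub>AH\<^esub> (v \<otimes> g)) h"
    if "X \<in> carrier A" "Y \<in> carrier A" "h \<in> carrier H" "g \<in> carrier H" for X Y h g
    by (rule tensor_lift_TL) (use that in \<open>simp_all add: bilin_def\<close>)
  have 2: "tensor_lift AH (\<lambda>(Y, g). tensor_lift AH (\<lambda>(h', h''). (X \<otimes>\<^bsub>A\<^esub> act h' Y) \<boxtimes>\<^bsub>AH\<^esub> (h'' \<otimes> g)) (comult H h)) T' =
      TL A H AH (\<lambda>Y g. sw AH (\<lambda>u v. (X \<otimes>\<^bsub>A\<^esub> act u Y) \<boxtimes>\<^bsub>AH\<^esub> (v \<otimes> g)) h) T'"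
    if X: "X \<in> carrier A" "h \<in> carrier H" for X h
    by (rule tensor_lift_TL_cong) (use T X in \<open>simp_all add: 1 bilin_def\<close>)
  show ?thesis
    unfolding smash_def Let_def
    by simp (rule tensor_lift_TL_cong, use T in \<open>simp_all add: 2 bilin_def\<close>)
qed

lemma smash_mult_closed: "T \<in> carrier AH \<Longrightarrow> T' \<in> carrier AH \<Longrightarrow> T \<otimes>\<^bsub>XS\<^esub> T' \<in> carrier AH"
  by (simp add: smash_mult)

lemma smash_mult_lin_left: "T' \<in> carrier AH \<Longrightarrow> (\<lambda>T. T \<otimes>\<^bsub>XS\<^esub> T') \<in> lin_maps AH AH"
  by (rule lin_mapsI) (simp_all add: smash_mult bilin_def)

lemma smash_mult_lin_right: "T \<in> carrier AH \<Longrightarrow> (\<lambda>T'. T \<otimes>\<^bsub>XS\<^esub> T') \<in> lin_maps AH AH"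
  by (rule lin_mapsI) (simp_all add: smash_mult bilin_def)

lemma smash_mult_pure:
  "X \<in> carrier A \<Longrightarrow> h \<in> carrier H \<Longrightarrow> Y \<in> carrier A \<Longrightarrow> g \<in> carrier H \<Longrightarrow>
    (X \<boxtimes>\<^bsub>AH\<^esub> h) \<otimes>\<^bsub>XS\<^esub> (Y \<boxtimes>\<^bsub>AH\<^esub> g) = sw AH (\<lambda>u v. (X \<otimes>\<^bsub>A\<^esub> act u Y) \<boxtimes>\<^bsub>AH\<^esub> (v \<otimes> g)) h"
  by (simp add: smash_mult bilin_def)

lemma smash_mult_TL_left:
  "T' \<in> carrier AH \<Longrightarrow> (\<And>u v. u \<in> carrier B \<Longrightarrow> v \<in> carrier C \<Longrightarrow> f u v \<in> carrier AH) \<Longrightarrow>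
    TL B C AH f T \<otimes>\<^bsub>XS\<^esub> T' = TL B C AH (\<lambda>u v. f u v \<otimes>\<^bsub>XS\<^esub> T') T"
  by (rule TL_lin[OF _ _ smash_mult_lin_left]) simp_all

lemma smash_mult_TL_right:
  "T' \<in> carrier AH \<Longrightarrow> (\<And>u v. u \<in> carrier B \<Longrightarrow> v \<in> carrier C \<Longrightarrow> f u v \<in> carrier AH) \<Longrightarrow>
    T' \<otimes>\<^bsub>XS\<^esub> TL B C AH f T = TL B C AH (\<lambda>u v. T' \<otimes>\<^bsub>XS\<^esub> f u v) T"
  by (rule TL_lin[OF _ _ smash_mult_lin_right]) simp_all

text \<open>Coassociativity brings together the two components of \<open>h\<close> that act on
  \<open>Y\<close> and on \<open>Z\<close>; the module algebra axiom then combines them into one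
  action on a product.\<close>

lemma smash_assoc_pure:
  assumes "X \<in> carrier A" "h \<in> carrier H" "Y \<in> carrier A" "g \<in> carrier H" "Z \<in> carrier A" "k \<in> carrier H"
  shows "((X \<boxtimes>\<^bsub>AH\<^esub> h) \<otimes>\<^bsub>XS\<^esub> (Y \<boxtimes>\<^bsub>AH\<^esub> g)) \<otimes>\<^bsub>XS\<^esub> (Z \<boxtimes>\<^bsub>AH\<^esub> k) =
    (X \<boxtimes>\<^bsub>AH\<^esub> h) \<otimes>\<^bsub>XS\<^esub> ((Y \<boxtimes>\<^bsub>AH\<^esub> g) \<otimes>\<^bsub>XS\<^esub> (Z \<boxtimes>\<^bsub>AH\<^esub> k))"
proof -
  define G where "G u a b g1 g2 = (X \<otimes>\<^bsub>A\<^esub> (act u Y \<otimes>\<^bsub>A\<^esub> act a (act g1 Z))) \<boxtimes>\<^bsub>AH\<^esub> (b \<otimes> (g2 \<otimes> k))" for u a b g1 g2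
  have Gc [simp]: "G u a b g1 g2 \<in> carrier AH"
    if "u \<in> carrier H" "a \<in> carrier H" "b \<in> carrier H" "g1 \<in> carrier H" "g2 \<in> carrier H" for u a b g1 g2
    using that assms by (simp add: G_def)
  have "((X \<boxtimes>\<^bsub>AH\<^esub> h) \<otimes>\<^bsub>XS\<^esub> (Y \<boxtimes>\<^bsub>AH\<^esub> g)) \<otimes>\<^bsub>XS\<^esub> (Z \<boxtimes>\<^bsub>AH\<^esub> k) =
      sw AH (\<lambda>u v. sw AH (\<lambda>a b. sw AH (\<lambda>g1 g2. G u a b g1 g2) g) v) h"
    using assms
    by (simp add: smash_mult_pure smash_mult_TL_left bilin_def G_def act_mult alg_assoc[of A] alg_assoc[of H])
  also have "\<dots> = sw AH (\<lambda>v b. sw AH (\<lambda>u a. sw AH (\<lambda>g1 g2. G u a b g1 g2) g) v) h"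
    by (subst sw_coassoc) (use assms in \<open>simp_all add: trilin_def bilin_def G_def\<close>)
  also have "\<dots> = sw AH (\<lambda>v b. sw AH (\<lambda>g1 g2. sw AH (\<lambda>u a. G u a b g1 g2) v) g) h"
    by (intro TL_cong refl TL_swap) simp_all
  also have "\<dots> = sw AH (\<lambda>g1 g2. sw AH (\<lambda>v b. sw AH (\<lambda>u a. G u a b g1 g2) v) h) g"
    by (rule TL_swap) simp_all
  also have "\<dots> = sw AH (\<lambda>g1 g2. sw AH (\<lambda>v b. (X \<otimes>\<^bsub>A\<^esub> act v (Y \<otimes>\<^bsub>A\<^esub> act g1 Z)) \<boxtimes>\<^bsub>AH\<^esub> (b \<otimes> (g2 \<otimes> k))) h) g"
  proof (intro TL_cong refl)
    fix g1 g2 v b assume c: "g1 \<in> carrier H" "g2 \<in> carrier H" "v \<in> carrier H" "b \<in> carrier H"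
    show "sw AH (\<lambda>u a. G u a b g1 g2) v = (X \<otimes>\<^bsub>A\<^esub> act v (Y \<otimes>\<^bsub>A\<^esub> act g1 Z)) \<boxtimes>\<^bsub>AH\<^esub> (b \<otimes> (g2 \<otimes> k))"
      using c assms by (subst act_alg, simp, simp, simp)
        (subst TL_lin[where F = "\<lambda>W. (X \<otimes>\<^bsub>A\<^esub> W) \<boxtimes>\<^bsub>AH\<^esub> (b \<otimes> (g2 \<otimes> k))" and V = A and W = AH];
          auto intro!: lin_mapsI simp: G_def)
  qed
  also have "\<dots> = (X \<boxtimes>\<^bsub>AH\<^esub> h) \<otimes>\<^bsub>XS\<^esub> ((Y \<boxtimes>\<^bsub>AH\<^esub> g) \<otimes>\<^bsub>XS\<^esub> (Z \<boxtimes>\<^bsub>AH\<^esub> k))"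
    using assms by (simp add: smash_mult_pure smash_mult_TL_right)
  finally show ?thesis .
qed

lemma smash_algebra [simp]: "complex_algebra XS"
proof (rule complex_algebraI, simp_all add: smash_mult_closed lin_mapsD[OF smash_mult_lin_left] lin_mapsD[OF smash_mult_lin_right])
  have id: "(\<lambda>x. x) \<in> lin_maps AH AH" by (auto intro: lin_mapsI)
  have one: "\<one>\<^bsub>A\<^esub> \<boxtimes>\<^bsub>AH\<^esub> \<one> \<in> carrier AH" by simp
  show "(\<one>\<^bsub>A\<^esub> \<boxtimes>\<^bsub>AH\<^esub> \<one>) \<otimes>\<^bsub>XS\<^esub> T = T" if "T \<in> carrier AH" for T
    by (rule tensor_lin_eqI[OF _ _ _ smash_mult_lin_right[OF one] id that])
      (auto simp: smash_mult_pure tensor_one bilin_def cvec_add_smult[OF AH_vec] mult.commute mult.left_commute)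
  show "T \<otimes>\<^bsub>XS\<^esub> (\<one>\<^bsub>A\<^esub> \<boxtimes>\<^bsub>AH\<^esub> \<one>) = T" if "T \<in> carrier AH" for T
  proof (rule tensor_lin_eqI[OF _ _ _ smash_mult_lin_left[OF one] id that])
    fix X h assume X: "X \<in> carrier A" "h \<in> carrier H"
    have "(X \<boxtimes>\<^bsub>AH\<^esub> h) \<otimes>\<^bsub>XS\<^esub> (\<one>\<^bsub>A\<^esub> \<boxtimes>\<^bsub>AH\<^esub> \<one>) = sw AH (\<lambda>u v. \<epsilon> u \<odot>\<^bsub>AH\<^esub> (X \<boxtimes>\<^bsub>AH\<^esub> v)) h"
      using X by (simp add: smash_mult_pure)
    also have "\<dots> = X \<boxtimes>\<^bsub>AH\<^esub> h"
      by (rule sw_counit_left) (use X in \<open>auto intro!: lin_mapsI\<close>)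
    finally show "(X \<boxtimes>\<^bsub>AH\<^esub> h) \<otimes>\<^bsub>XS\<^esub> (\<one>\<^bsub>A\<^esub> \<boxtimes>\<^bsub>AH\<^esub> \<one>) = X \<boxtimes>\<^bsub>AH\<^esub> h" .
  qed simp_all
  note c = smash_mult_closed
  \<comment> \<open>As for tensor products, associativity is extended from pure tensors to the
    third, then the second, then the first factor.\<close>
  have 3: "((X \<boxtimes>\<^bsub>AH\<^esub> h) \<otimes>\<^bsub>XS\<^esub> (Y \<boxtimes>\<^bsub>AH\<^esub> g)) \<otimes>\<^bsub>XS\<^esub> T = (X \<boxtimes>\<^bsub>AH\<^esub> h) \<otimes>\<^bsub>XS\<^esub> ((Y \<boxtimes>\<^bsub>AH\<^esub> g) \<otimes>\<^bsub>XS\<^esub> T)"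
    if X: "X \<in> carrier A" "h \<in> carrier H" "Y \<in> carrier A" "g \<in> carrier H" and T: "T \<in> carrier AH" for X h Y g T
    by (rule tensor_lin_eqI[OF _ _ _ smash_mult_lin_right lin_maps_comp[OF smash_mult_lin_right smash_mult_lin_right] T])
      (use X T c smash_assoc_pure in auto)
  have 2: "((X \<boxtimes>\<^bsub>AH\<^esub> h) \<otimes>\<^bsub>XS\<^esub> T') \<otimes>\<^bsub>XS\<^esub> T = (X \<boxtimes>\<^bsub>AH\<^esub> h) \<otimes>\<^bsub>XS\<^esub> (T' \<otimes>\<^bsub>XS\<^esub> T)"
    if X: "X \<in> carrier A" "h \<in> carrier H" and T: "T \<in> carrier AH" "T' \<in> carrier AH" for X h T T'
    by (rule tensor_lin_eqI[OF _ _ _ lin_maps_comp[OF smash_mult_lin_right smash_mult_lin_left]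
          lin_maps_comp[OF smash_mult_lin_left smash_mult_lin_right] T(2), of "X \<boxtimes>\<^bsub>AH\<^esub> h" T])
      (use X T c 3 in auto)
  show "(T'' \<otimes>\<^bsub>XS\<^esub> T') \<otimes>\<^bsub>XS\<^esub> T = T'' \<otimes>\<^bsub>XS\<^esub> (T' \<otimes>\<^bsub>XS\<^esub> T)"
    if T: "T'' \<in> carrier AH" "T' \<in> carrier AH" "T \<in> carrier AH" for T T' T''
    by (rule tensor_lin_eqI[OF _ _ _ lin_maps_comp[OF smash_mult_lin_left smash_mult_lin_left]
          smash_mult_lin_left T(1), of T' T])
      (use T c 2 in auto)
qed

abbreviation "s0 \<equiv> smash_source H A"
abbreviation "j0 h \<equiv> \<one>\<^bsub>A\<^esub> \<boxtimes>\<^bsub>AH\<^esub> h"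
abbreviation "t0 \<equiv> smash_target H A \<delta>"

lemma s0_j0: "X \<in> carrier A \<Longrightarrow> h \<in> carrier H \<Longrightarrow> s0 X \<otimes>\<^bsub>XS\<^esub> j0 h = X \<boxtimes>\<^bsub>AH\<^esub> h"
  by (simp add: smash_source_def smash_mult_pure tensor_one bilin_def cvec_add_smult[OF AH_vec] mult.commute mult.left_commute)

lemma t0_eq: "X \<in> carrier A \<Longrightarrow> t0 X = co AH (\<lambda>x Y. Y \<boxtimes>\<^bsub>AH\<^esub> Si x) X"
  unfolding smash_target_def Si_def[symmetric] by (rule tensor_lift_TL) (simp_all add: bilin_def)

lemma smash_model_smash: "smash_model H A act \<delta> XS s0 j0 t0"
proof (intro smash_model.intro smash_model_axioms.intro)
  show "yd_algebra H A act \<delta>" by unfold_locales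
  show "complex_algebra XS" by simp
  show "s0 \<in> alg_hom A XS"
    by (intro alg_homI lin_mapsI) (simp_all add: smash_source_def smash_mult_pure tensor_one bilin_def cvec_add_smult[OF AH_vec] mult.commute mult.left_commute)
  show "j0 \<in> alg_hom H XS"
  proof (intro alg_homI lin_mapsI)
    fix h k assume h: "h \<in> carrier H" and k: "k \<in> carrier H"
    have "j0 h \<otimes>\<^bsub>XS\<^esub> j0 k = sw AH (\<lambda>u v. \<epsilon> u \<odot>\<^bsub>AH\<^esub> (\<one>\<^bsub>A\<^esub> \<boxtimes>\<^bsub>AH\<^esub> (v \<otimes> k))) h"
      using h k by (simp add: smash_mult_pure)
    also have "\<dots> = j0 (h \<otimes> k)"
      by (rule sw_counit_left) (use h k in \<open>auto intro!: lin_mapsI\<close>)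
    finally show "j0 (h \<otimes> k) = j0 h \<otimes>\<^bsub>XS\<^esub> j0 k" by simp
  qed simp_all
  show "j0 h \<otimes>\<^bsub>XS\<^esub> s0 X = TL H H XS (\<lambda>u v. s0 (act u X) \<otimes>\<^bsub>XS\<^esub> j0 v) (comult H h)"
    if "h \<in> carrier H" "X \<in> carrier A" for h X
    using that by (simp add: s0_j0) (simp add: smash_source_def smash_mult_pure)
  \<comment> \<open>In this model the map in \<open>basis\<close> is the identity of the tensor
    product.\<close>
  have "TL A H XS (\<lambda>X h. s0 X \<otimes>\<^bsub>XS\<^esub> j0 h) T = T" if "T \<in> carrier AH" for T
    using that tensor_TL_expand[of A H T] by (simp add: s0_j0)
  then show "bij_betw (TL A H XS (\<lambda>X h. s0 X \<otimes>\<^bsub>XS\<^esub> j0 h)) (carrier (tensor A H)) (carrier XS)"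
    by (auto intro!: bij_betw_byWitness[of _ "\<lambda>x. x"])
  show "t0 X = TL H A XS (\<lambda>x Y. s0 Y \<otimes>\<^bsub>XS\<^esub> j0 (inv_into (carrier H) S x)) (\<delta> X)" if "X \<in> carrier A" for X
    using that by (simp add: t0_eq Si_def[symmetric] s0_j0)
qed

lemma smash_algebroid_smash:
  "smash_algebroid H A act \<delta> XS s0 j0 t0 (smash_counit H A) (smash_comult H A act \<delta>) (smash_antipode H A act \<delta>)"
proof -
  interpret X: smash_model H A act \<delta> XS s0 j0 t0 by (rule smash_model_smash)
  have sj: "X \<boxtimes>\<^bsub>AH\<^esub> h = s0 X \<otimes>\<^bsub>XS\<^esub> j0 h" if "X \<in> carrier A" "h \<in> carrier H" for X h
    using that by (simp add: s0_j0)
  have bA: "bilin A H A (\<lambda>X h. \<epsilon> h \<odot>\<^bsub>A\<^esub> X)"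
    by (simp add: bilin_def algebra_simps cvec_add_smult[OF A_vec])
  have eA: "smash_counit H A T = TL A H A (\<lambda>X h. \<epsilon> h \<odot>\<^bsub>A\<^esub> X) T" if "T \<in> carrier AH" for T
    unfolding smash_counit_def by (rule tensor_lift_TL) (use that bA in simp_all)
  have bX: "bilin A H X.XX (\<lambda>X h. sw X.XX (\<lambda>u v. (X \<boxtimes>\<^bsub>AH\<^esub> u) \<boxtimes>\<^bsub>X.XX\<^esub> j0 v) h)"
    by (simp add: bilin_def X.XX_pure[simplified])
  have eX: "smash_comult H A act \<delta> T = TL A H X.XX (\<lambda>X h. sw X.XX (\<lambda>u v. (X \<boxtimes>\<^bsub>AH\<^esub> u) \<boxtimes>\<^bsub>X.XX\<^esub> j0 v) h) T"
    if T: "T \<in> carrier AH" for T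
  proof -
    have 1: "tensor_lift X.XX (\<lambda>(h', h''). (X \<boxtimes>\<^bsub>AH\<^esub> h') \<boxtimes>\<^bsub>X.XX\<^esub> j0 h'') (comult H h) =
        sw X.XX (\<lambda>u v. (X \<boxtimes>\<^bsub>AH\<^esub> u) \<boxtimes>\<^bsub>X.XX\<^esub> j0 v) h" if "X \<in> carrier A" "h \<in> carrier H" for X h
      by (rule tensor_lift_TL) (use that in \<open>simp_all add: bilin_def X.XX_pure[simplified]\<close>)
    show ?thesis
      unfolding smash_comult_def Let_def
      by (rule tensor_lift_TL_cong[OF _ _ _ _ bX]) (use T 1 in simp_all)
  qed
  have \<tau>s: "X.\<tau>s X \<in> carrier AH" if "X \<in> carrier A" for X using X.\<tau>s_simps(1)[OF that] by simp
  have bT: "bilin A H AH (\<lambda>X h. j0 (S h) \<otimes>\<^bsub>XS\<^esub> X.\<tau>s X)"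
    using X.\<tau>s_simps X.push by (simp add: bilin_def lin_mapsD[OF smash_mult_lin_left] lin_mapsD[OF smash_mult_lin_right])
  have eT: "smash_antipode H A act \<delta> T = TL A H AH (\<lambda>X h. j0 (S h) \<otimes>\<^bsub>XS\<^esub> X.\<tau>s X) T"
    if T: "T \<in> carrier AH" for T
  proof -
    have 1: "tensor_lift AH (\<lambda>(k', k''). act (S k'') Y \<boxtimes>\<^bsub>AH\<^esub> S k') (comult H k) =
        sw AH (\<lambda>u v. act (S v) Y \<boxtimes>\<^bsub>AH\<^esub> S u) k" if "Y \<in> carrier A" "k \<in> carrier H" for Y k
      by (rule tensor_lift_TL) (use that in \<open>simp_all add: bilin_def\<close>)
    have 2: "tensor_lift AH (\<lambda>(k, Y). tensor_lift AH (\<lambda>(k', k''). act (S k'') Y \<boxtimes>\<^bsub>AH\<^esub> S k') (comult H k)) (\<delta> X) =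
        co AH (\<lambda>k Y. sw AH (\<lambda>u v. act (S v) Y \<boxtimes>\<^bsub>AH\<^esub> S u) k) X" if "X \<in> carrier A" for X
      by (rule tensor_lift_TL_cong) (use that 1 in \<open>simp_all add: bilin_def\<close>)
    \<comment> \<open>Expanding the smash product of \<open>j0 (S k)\<close> and \<open>s0 Y\<close>
      with the reversed coproduct of \<open>S k\<close> gives the summand in
      \<open>smash_antipode\<close>.\<close>
    have 3: "co AH (\<lambda>k Y. sw AH (\<lambda>u v. act (S v) Y \<boxtimes>\<^bsub>AH\<^esub> S u) k) X = X.\<tau>s X" if "X \<in> carrier A" for X
    proof -
      have "j0 (S k) \<otimes>\<^bsub>XS\<^esub> s0 Y = sw AH (\<lambda>u v. act (S v) Y \<boxtimes>\<^bsub>AH\<^esub> S u) k" if "k \<in> carrier H" "Y \<in> carrier A" for k Y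
        using that by (simp add: X.j_s s0_j0, subst sw_S) (simp_all add: bilin_def)
      then show ?thesis by (simp add: X.\<tau>s_def)
    qed
    show ?thesis
      unfolding smash_antipode_def Let_def
      by (rule tensor_lift_TL_cong[OF _ _ _ _ bT]) (use T 2 3 in simp_all)
  qed
  show ?thesis
  proof (intro smash_algebroid.intro smash_algebroid_axioms.intro smash_model_smash)
    show "smash_counit H A \<in> lin_maps XS A"
      using lin_mapsD[OF tensor_TL_lin_maps[OF A_vec H_vec A_vec bA]]
      by (simp, intro lin_mapsI) (simp_all add: eA)
    show "smash_comult H A act \<delta> \<in> lin_maps XS X.XX"
      using lin_mapsD[OF tensor_TL_lin_maps[OF A_vec H_vec X.XX_vec bX]]
      by (simp, intro lin_mapsI) (simp_all add: eX)
    show "smash_antipode H A act \<delta> \<in> lin_maps XS XS"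
      using lin_mapsD[OF tensor_TL_lin_maps[OF A_vec H_vec AH_vec bT]]
      by (simp, intro lin_mapsI) (simp_all add: eT)
    fix X h assume X: "X \<in> carrier A" "h \<in> carrier H"
    show "smash_counit H A (s0 X \<otimes>\<^bsub>XS\<^esub> j0 h) = \<epsilon> h \<odot>\<^bsub>A\<^esub> X"
      using X bA by (simp add: s0_j0 eA)
    show "smash_comult H A act \<delta> (s0 X \<otimes>\<^bsub>XS\<^esub> j0 h) = sw X.XX (\<lambda>u v. (s0 X \<otimes>\<^bsub>XS\<^esub> j0 u) \<boxtimes>\<^bsub>X.XX\<^esub> j0 v) h"
      using X bX by (simp add: s0_j0 eX)
    show "smash_antipode H A act \<delta> (s0 X \<otimes>\<^bsub>XS\<^esub> j0 h) =
        j0 (S h) \<otimes>\<^bsub>XS\<^esub> TL H A XS (\<lambda>x Y. j0 (S x) \<otimes>\<^bsub>XS\<^esub> s0 Y) (\<delta> X)"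
      using X bT by (simp add: s0_j0 eT X.\<tau>s_def)
  qed
qed

theorem hopf_algebroid_smash:
  "hopf_algebroid A XS s0 t0 (smash_counit H A) (smash_comult H A act \<delta>) (smash_antipode H A act \<delta>)"
  by (rule smash_algebroid.smash_hopf_algebroid[OF smash_algebroid_smash])

end

section \<open>Transport along a linear isomorphism\<close>

lemma transport_alg_simps [simp]:
  "carrier (transport_alg \<Phi> X V) = carrier V" "x \<oplus>\<^bsub>transport_alg \<Phi> X V\<^esub> y = x \<oplus>\<^bsub>V\<^esub> y"
  "c \<odot>\<^bsub>transport_alg \<Phi> X V\<^esub> x = c \<odot>\<^bsub>V\<^esub> x" "\<zero>\<^bsub>transport_alg \<Phi> X V\<^esub> = \<zero>\<^bsub>V\<^esub>"
  "\<one>\<^bsub>transport_alg \<Phi> X V\<^esub> = \<Phi> \<one>\<^bsub>X\<^esub>"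
  by (simp_all add: transport_alg_def Let_def)

lemma transport_alg_mult:
  "x \<otimes>\<^bsub>transport_alg \<Phi> X V\<^esub> y = \<Phi> (inv_into (carrier X) \<Phi> x \<otimes>\<^bsub>X\<^esub> inv_into (carrier X) \<Phi> y)"
  by (simp add: transport_alg_def Let_def)

lemma transport_TL [simp]: "TL B C (transport_alg \<Phi> X V) g T = TL B C V g T"
  by (rule TL_same_space) (simp_all add: transport_alg_def Let_def)

lemma transport_lin_maps [simp]:
  "lin_maps (transport_alg \<Phi> X V) W = lin_maps V W" "lin_maps W (transport_alg \<Phi> X V) = lin_maps W V"
  by (simp_all add: lin_maps_def)

context yd_algebra
begin

text \<open>The maps \<open>s\<close>, \<open>j\<close> and \<open>t\<close> composed with
  \<open>\<Phi>\<close> form another model of the smash product, for which the axioms are already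
  proved. Only the structure maps have to be evaluated on generators.\<close>

theorem hopf_algebroid_transport:
  fixes V :: "(complex, 'v, 'n) module_scheme" and \<Phi>
  assumes V [simp]: "cvec V" and \<Phi>: "\<Phi> \<in> lin_maps XS V" and bij: "bij_betw \<Phi> (carrier XS) (carrier V)"
  defines "\<Psi> \<equiv> inv_into (carrier XS) \<Phi>" and "M \<equiv> transport_alg \<Phi> XS V"
  defines "s \<equiv> \<Phi> \<circ> s0" and "t \<equiv> \<Phi> \<circ> t0"
  shows "hopf_algebroid A M s t (smash_counit H A \<circ> \<Psi>)
    (transport_comult \<Phi> XS (tensor2 A M s t) (smash_comult H A act \<delta>)) (\<Phi> \<circ> smash_antipode H A act \<delta> \<circ> \<Psi>)"
proof -
  interpret X: smash_algebroid H A act \<delta> XS s0 j0 t0 "smash_counit H A" "smash_comult H A act \<delta>" "smash_antipode H A act \<delta>"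
    by (rule smash_algebroid_smash)
  note X.j_simps [simp del]
  define j where "j h = \<Phi> (j0 h)" for h
  have \<Phi>': "\<Phi> \<in> lin_maps AH V" using \<Phi> by simp
  note \<Phi>D [simp] = lin_mapsD[OF \<Phi>']
  have \<Psi>c [simp]: "\<Psi> y \<in> carrier AH" if "y \<in> carrier V" for y
    using bij that unfolding \<Psi>_def by (metis bij_betw_imp_surj_on inv_into_into smash_simps(1))
  have \<Phi>\<Psi> [simp]: "\<Phi> (\<Psi> y) = y" if "y \<in> carrier V" for y
    using bij that unfolding \<Psi>_def by (metis bij_betw_inv_into_right)
  have \<Psi>\<Phi> [simp]: "\<Psi> (\<Phi> x) = x" if "x \<in> carrier AH" for x
    using bij that unfolding \<Psi>_def by (metis bij_betw_inv_into_left smash_simps(1))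
  have \<Psi>_lin: "\<Psi> \<in> lin_maps V AH"
  proof (rule lin_mapsI)
    show "\<Psi> (x \<oplus>\<^bsub>V\<^esub> y) = \<Psi> x \<oplus>\<^bsub>AH\<^esub> \<Psi> y" if "x \<in> carrier V" "y \<in> carrier V" for x y
      using \<Psi>\<Phi>[of "\<Psi> x \<oplus>\<^bsub>AH\<^esub> \<Psi> y"] that by (simp del: \<Psi>\<Phi>)
    show "\<Psi> (c \<odot>\<^bsub>V\<^esub> x) = c \<odot>\<^bsub>AH\<^esub> \<Psi> x" if "x \<in> carrier V" for c x
      using \<Psi>\<Phi>[of "c \<odot>\<^bsub>AH\<^esub> \<Psi> x"] that by (simp del: \<Psi>\<Phi>)
  qed simp
  note [simp] = lin_mapsD(2,3)[OF \<Psi>_lin]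
  have M_simps [simp]: "carrier M = carrier V" "x \<oplus>\<^bsub>M\<^esub> y = x \<oplus>\<^bsub>V\<^esub> y" "c \<odot>\<^bsub>M\<^esub> x = c \<odot>\<^bsub>V\<^esub> x"
    "\<zero>\<^bsub>M\<^esub> = \<zero>\<^bsub>V\<^esub>" "\<one>\<^bsub>M\<^esub> = \<Phi> \<one>\<^bsub>XS\<^esub>" for x y c
    by (simp_all add: M_def)
  have M_mult: "x \<otimes>\<^bsub>M\<^esub> y = \<Phi> (\<Psi> x \<otimes>\<^bsub>XS\<^esub> \<Psi> y)" for x y
    by (simp add: M_def transport_alg_mult \<Psi>_def)
  have M_TL [simp]: "TL B C M g T = TL B C V g T"
    for B :: "(complex, 'z, 'w) module_scheme" and C :: "(complex, 'y, 'u) module_scheme" and g T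
    unfolding M_def by (rule transport_TL)
  have M_lin [simp]: "lin_maps M W = lin_maps V W" for W :: "(complex, 'z, 'w) module_scheme"
    by (simp add: M_def)
  have M_lin' [simp]: "lin_maps W M = lin_maps W V" for W :: "(complex, 'z, 'w) module_scheme"
    by (simp add: M_def)
  note c [simp] = smash_mult_closed
  have M_vec [simp]: "cvec M"
    by (rule cvec_cong_ops[of V]) simp_all
  have M_alg: "complex_algebra M"
    by (rule complex_algebraI)
      (simp_all add: M_mult alg_assoc[OF smash_algebra, simplified] lin_mapsD[OF smash_mult_lin_left] lin_mapsD[OF smash_mult_lin_right]
        alg_l_one[OF smash_algebra, simplified] alg_r_one[OF smash_algebra, simplified])
  have hom: "\<Phi> (x \<otimes>\<^bsub>XS\<^esub> y) = \<Phi> x \<otimes>\<^bsub>M\<^esub> \<Phi> y" if "x \<in> carrier AH" "y \<in> carrier AH" for x y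
    using that by (simp add: M_mult)
  have sc [simp]: "s0 X \<in> carrier AH" "t0 X \<in> carrier AH" if "X \<in> carrier A" for X
    using X.s_simps(1)[OF that] X.t_simps(1)[OF that] by simp_all
  have gen: "s X \<otimes>\<^bsub>M\<^esub> j h = \<Phi> (X \<boxtimes>\<^bsub>AH\<^esub> h)" if "X \<in> carrier A" "h \<in> carrier H" for X h
    using that hom[of "s0 X" "j0 h"] by (simp add: s_def j_def s0_j0)
  have model: "smash_model H A act \<delta> M s j t"
  proof (intro smash_model.intro smash_model_axioms.intro M_alg)
    show "yd_algebra H A act \<delta>" by unfold_locales
    show "s \<in> alg_hom A M"
      using X.s_simps by (intro alg_homI lin_mapsI) (simp_all add: s_def hom)
    show "j \<in> alg_hom H M"
      using X.j_simps by (intro alg_homI lin_mapsI) (simp_all add: j_def hom)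
    show "j h \<otimes>\<^bsub>M\<^esub> s X = TL H H M (\<lambda>u v. s (act u X) \<otimes>\<^bsub>M\<^esub> j v) (comult H h)"
      if "h \<in> carrier H" "X \<in> carrier A" for h X
    proof -
      have "j h \<otimes>\<^bsub>M\<^esub> s X = \<Phi> (sw AH (\<lambda>u v. act u X \<boxtimes>\<^bsub>AH\<^esub> v) h)"
        using that X.j_s[OF that] hom[of "j0 h" "s0 X"] by (simp add: j_def s_def s0_j0)
      also have "\<dots> = sw V (\<lambda>u v. s (act u X) \<otimes>\<^bsub>M\<^esub> j v) h"
        using that by (simp add: TL_lin[OF _ _ \<Phi>'] gen)
      finally show ?thesis by simp
    qed
    have "TL A H M (\<lambda>X h. s X \<otimes>\<^bsub>M\<^esub> j h) T = \<Phi> T" if "T \<in> carrier AH" for T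
      using tensor_lin_TL[OF A_vec H_vec V \<Phi>' that] by (simp add: gen)
    then show "bij_betw (TL A H M (\<lambda>X h. s X \<otimes>\<^bsub>M\<^esub> j h)) (carrier (tensor A H)) (carrier M)"
      using bij by (subst bij_betw_cong) auto
    show "t X = TL H A M (\<lambda>x Y. s Y \<otimes>\<^bsub>M\<^esub> j (inv_into (carrier H) S x)) (\<delta> X)" if "X \<in> carrier A" for X
      using that by (simp add: t_def t0_eq TL_lin[OF _ _ \<Phi>'] Si_def[symmetric] gen)
  qed
  interpret N: smash_model H A act \<delta> M s j t by (rule model)
  \<comment> \<open>\<open>\<Phi>\<close> intertwines \<open>s0\<close>, \<open>t0\<close> with
    \<open>s\<close>, \<open>t\<close>, hence \<open>\<Phi>\<close> on both legs descends to the
    balanced squares and \<open>transport_comult\<close> is well defined.\<close>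
  have bal: "X.balM N.XX (\<lambda>x' x''. \<Phi> x' \<boxtimes>\<^bsub>N.XX\<^esub> \<Phi> x'')"
  proof -
    have "\<Phi> (t0 b \<otimes>\<^bsub>XS\<^esub> x) \<boxtimes>\<^bsub>N.XX\<^esub> \<Phi> y = \<Phi> x \<boxtimes>\<^bsub>N.XX\<^esub> \<Phi> (s0 b \<otimes>\<^bsub>XS\<^esub> y)"
      if "x \<in> carrier AH" "b \<in> carrier A" "y \<in> carrier AH" for x b y
      using that N.XX_bal[of "\<Phi> x" b "\<Phi> y"] by (simp add: hom s_def t_def)
    then show ?thesis
      using N.XX_pure by (simp add: X.balM_def bilin_def)
  qed
  define \<Delta>' where "\<Delta>' = transport_comult \<Phi> XS N.XX (smash_comult H A act \<delta>)"
  have \<Delta>'_eq: "\<Delta>' y = TL XS XS N.XX (\<lambda>x' x''. \<Phi> x' \<boxtimes>\<^bsub>N.XX\<^esub> \<Phi> x'') (smash_comult H A act \<delta> (\<Psi> y))"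
    if "y \<in> carrier V" for y
    unfolding \<Delta>'_def transport_comult_def \<Psi>_def[symmetric]
    by (rule X.XX_lift[OF N.XX_vec bal]) (use that X.\<Delta>'_simps(1) in simp)
  have "smash_algebroid H A act \<delta> M s j t (smash_counit H A \<circ> \<Psi>) \<Delta>' (\<Phi> \<circ> smash_antipode H A act \<delta> \<circ> \<Psi>)"
  proof (intro smash_algebroid.intro smash_algebroid_axioms.intro model)
    show "smash_counit H A \<circ> \<Psi> \<in> lin_maps M A"
      using lin_maps_comp[OF \<Psi>_lin X.\<epsilon>'_lin[simplified]] by (simp add: comp_def)
    have "(\<lambda>y. TL XS XS N.XX (\<lambda>x' x''. \<Phi> x' \<boxtimes>\<^bsub>N.XX\<^esub> \<Phi> x'') (smash_comult H A act \<delta> (\<Psi> y))) \<in> lin_maps V N.XX"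
      using lin_maps_comp[OF \<Psi>_lin X.\<Delta>_TL(1)[OF N.XX_vec bal, simplified]] .
    from lin_mapsD[OF this] show "\<Delta>' \<in> lin_maps M N.XX"
      by (simp, intro lin_mapsI) (simp_all add: \<Delta>'_eq)
    show "\<Phi> \<circ> smash_antipode H A act \<delta> \<circ> \<Psi> \<in> lin_maps M M"
      using lin_maps_comp[OF lin_maps_comp[OF \<Psi>_lin X.\<tau>'_lin[simplified]] \<Phi>'] by (simp add: comp_def)
    fix X h assume X: "X \<in> carrier A" "h \<in> carrier H"
    show "(smash_counit H A \<circ> \<Psi>) (s X \<otimes>\<^bsub>M\<^esub> j h) = \<epsilon> h \<odot>\<^bsub>A\<^esub> X"
      using X X.\<epsilon>'_gen[OF X] by (simp add: gen s0_j0)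
    show "\<Delta>' (s X \<otimes>\<^bsub>M\<^esub> j h) = sw N.XX (\<lambda>u v. (s X \<otimes>\<^bsub>M\<^esub> j u) \<boxtimes>\<^bsub>N.XX\<^esub> j v) h"
      using X X.\<Delta>_TL(2)[OF N.XX_vec bal X] by (simp add: gen[unfolded j_def] \<Delta>'_eq s0_j0 j_def)
    have "\<Phi> (j0 (S h) \<otimes>\<^bsub>XS\<^esub> X.\<tau>s X) = \<Phi> (j0 (S h)) \<otimes>\<^bsub>M\<^esub> \<Phi> (X.\<tau>s X)"
      using X X.\<tau>s_simps(1)[of X] by (intro hom) simp_all
    also have "\<Phi> (X.\<tau>s X) = co V (\<lambda>x Y. j (S x) \<otimes>\<^bsub>M\<^esub> s Y) X"
      using X by (simp add: X.\<tau>s_def TL_lin[OF _ _ \<Phi>'] hom j_def s_def)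
    finally show "(\<Phi> \<circ> smash_antipode H A act \<delta> \<circ> \<Psi>) (s X \<otimes>\<^bsub>M\<^esub> j h) =
        j (S h) \<otimes>\<^bsub>M\<^esub> TL H A M (\<lambda>x Y. j (S x) \<otimes>\<^bsub>M\<^esub> s Y) (\<delta> X)"
      using X X.\<tau>'_sj[OF X] by (simp add: gen[unfolded j_def] s0_j0 j_def)
  qed
  from smash_algebroid.smash_hopf_algebroid[OF this] show ?thesis by (simp add: \<Delta>'_def)
qed

end

section \<open>The q-binomial theorem\<close>

text \<open>Gaussian binomial coefficients. The Pascal recursion defines them without division,
  hence also at roots of unity.\<close>

fun qbin :: "complex \<Rightarrow> nat \<Rightarrow> nat \<Rightarrow> complex" where
  "qbin z n 0 = 1"
| "qbin z 0 (Suc k) = 0"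
| "qbin z (Suc n) (Suc k) = qbin z n k + z ^ Suc k * qbin z n (Suc k)"

lemma qbin_eq_0: "n < k \<Longrightarrow> qbin z n k = 0"
  by (induction z n k rule: qbin.induct) auto

lemma qbin_same [simp]: "qbin z n n = 1"
  by (induction n) (auto simp: qbin_eq_0)

text \<open>The q-Pochhammer symbol \<open>(z; z)_n\<close>.\<close>

definition qfact :: "complex \<Rightarrow> nat \<Rightarrow> complex" where
  "qfact z n = (\<Prod>i\<in>{1..n}. 1 - z ^ i)"

lemma qfact_Suc: "qfact z (Suc n) = qfact z n * (1 - z ^ Suc n)"
  by (simp add: qfact_def)

text \<open>The quotient formula with denominators cleared, as \<open>qfact\<close> may vanish at a
  root of unity.\<close>

lemma qbin_qfact: "k \<le> n \<Longrightarrow> qbin z n k * qfact z k * qfact z (n - k) = qfact z n"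
proof (induction n arbitrary: k)
  case 0
  then show ?case by (simp add: qfact_def)
next
  case (Suc n)
  show ?case
  proof (cases k)
    case 0
    then show ?thesis by (simp add: qfact_def)
  next
    case (Suc m)
    with Suc.prems have m: "m \<le> n" by simp
    show ?thesis
    proof (cases "m = n")
      case True
      then show ?thesis using Suc by (simp add: qbin_eq_0 qfact_def)
    next
      case False
      with m have mn: "Suc m \<le> n" "n - m = Suc (n - Suc m)" by auto
      have z: "z ^ m * z ^ (n - m) = z ^ n"
        using m by (simp flip: power_add)
      have "qbin z (Suc n) k * qfact z k * qfact z (Suc n - k) =
          (qbin z n m * qfact z m * qfact z (n - m)) * (1 - z ^ Suc m) +
          z ^ Suc m * (qbin z n (Suc m) * qfact z (Suc m) * qfact z (n - Suc m)) * (1 - z ^ (n - m))"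
        using Suc mn qfact_Suc[of z "n - Suc m"] by (simp add: qfact_Suc algebra_simps)
      also have "\<dots> = qfact z n * ((1 - z ^ Suc m) + z ^ Suc m * (1 - z ^ (n - m)))"
        using Suc.IH[OF m] Suc.IH[OF mn(1)] by (simp add: algebra_simps)
      also have "\<dots> = qfact z (Suc n)"
        using z by (simp add: qfact_Suc algebra_simps)
      finally show ?thesis .
    qed
  qed
qed

text \<open>At a primitive \<open>p\<close>-th root of unity \<open>qfact\<close> vanishes at
  \<open>p\<close> but not below, so \<open>qbin_qfact\<close> forces the middle coefficients to be
  zero.\<close>

lemma qbin_root:
  assumes "z ^ p = 1" "\<And>i. 0 < i \<Longrightarrow> i < p \<Longrightarrow> z ^ i \<noteq> 1" "0 < k" "k < p"
  shows "qbin z p k = 0"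
proof -
  have "qfact z p = 0" using assms by (auto simp: qfact_def)
  moreover have "qfact z m \<noteq> 0" if "m < p" for m
    using assms(2) that by (auto simp: qfact_def)
  ultimately show ?thesis using qbin_qfact[of k p z] assms by auto
qed

context complex_algebra
begin

lemma is_calg: "complex_algebra A" by unfold_locales

lemmas calg [simp] = alg_simps[OF is_calg] cvec_simps[OF complex_algebra_cvec[OF is_calg]]
lemmas calg_assoc = alg_assoc[OF is_calg]

lemma qpower_comm:
  assumes x: "x \<in> carrier A" and y: "y \<in> carrier A" and yx: "y \<otimes> x = z \<odot> (x \<otimes> y)"
  shows "y \<otimes> x [^] (k::nat) = z ^ k \<odot> (x [^] k \<otimes> y)"
proof (induction k)
  case (Suc k)
  have "y \<otimes> x [^] Suc k = (y \<otimes> x [^] k) \<otimes> x" using x y by (simp add: calg_assoc)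
  also have "\<dots> = z ^ k \<odot> (x [^] k \<otimes> (y \<otimes> x))" using x y by (simp add: Suc calg_assoc)
  also have "\<dots> = z ^ Suc k \<odot> (x [^] Suc k \<otimes> y)" using x y by (simp add: yx calg_assoc mult.commute)
  finally show ?case .
qed (use x y in simp)

text \<open>Multiplication by \<open>x\<close> raises the index, while \<open>y\<close> passes
  \<open>x [^] k\<close> at the price of \<open>z ^ k\<close>; these are the two terms of the Pascal
  recursion.\<close>

lemma qbinomial:
  assumes x: "x \<in> carrier A" and y: "y \<in> carrier A" and yx: "y \<otimes> x = z \<odot> (x \<otimes> y)"
  shows "(x \<oplus> y) [^] (n::nat) = (\<Oplus>k\<in>{..n}. qbin z n k \<odot> (x [^] k \<otimes> y [^] (n - k)))"
proof (induction n)
  case 0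
  then show ?case using x y by simp
next
  case (Suc n)
  let ?a = "\<lambda>n k. x [^] (k::nat) \<otimes> y [^] (n - k :: nat)"
  have m: "?a n k \<in> carrier A" for n k using x y by simp
  have c: "x \<otimes> (x [^] k \<otimes> w) = x [^] k \<otimes> (x \<otimes> w)" if "w \<in> carrier A" for k :: nat and w
    using nat_pow_Suc2[OF x, of k] x that by (simp add: calg_assoc[symmetric])
  have 1: "x \<otimes> (\<Oplus>k\<in>{..n}. qbin z n k \<odot> ?a n k) = (\<Oplus>k\<in>{..n}. qbin z n k \<odot> ?a (Suc n) (Suc k))"
    using x y by (subst finsum_rdistr) (auto intro!: finsum_cong' simp: c calg_assoc)
  have 2: "y \<otimes> (\<Oplus>k\<in>{..n}. qbin z n k \<odot> ?a n k) = (\<Oplus>k\<in>{..n}. (z ^ k * qbin z n k) \<odot> ?a (Suc n) k)"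
  proof (subst finsum_rdistr)
    show "(\<Oplus>k\<in>{..n}. y \<otimes> (qbin z n k \<odot> ?a n k)) = (\<Oplus>k\<in>{..n}. (z ^ k * qbin z n k) \<odot> ?a (Suc n) k)"
    proof (rule finsum_cong')
      fix k assume k: "k \<in> {..n}"
      have "y \<otimes> ?a n k = (y \<otimes> x [^] k) \<otimes> y [^] (n - k)" using x y by (simp add: calg_assoc)
      also have "\<dots> = z ^ k \<odot> (x [^] k \<otimes> (y \<otimes> y [^] (n - k)))"
        using x y by (simp add: qpower_comm[OF x y yx] calg_assoc)
      also have "y \<otimes> y [^] (n - k) = y [^] (Suc n - k)"
        using y k by (simp add: Suc_diff_le nat_pow_Suc2[symmetric] del: nat_pow_Suc)
      finally show "y \<otimes> (qbin z n k \<odot> ?a n k) = (z ^ k * qbin z n k) \<odot> ?a (Suc n) k"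
        using x y by (simp add: mult.commute)
    qed (use m in auto)
  qed (use x y in auto)
  \<comment> \<open>The sum is first extended by the index \<open>Suc n\<close>, whose coefficient
    \<open>qbin z n (Suc n)\<close> is zero; then its first term is split off and the rest
    reindexed.\<close>
  have 3: "(\<Oplus>k\<in>{..n}. (z ^ k * qbin z n k) \<odot> ?a (Suc n) k) =
      (\<Oplus>k\<in>{..n}. (z ^ Suc k * qbin z n (Suc k)) \<odot> ?a (Suc n) (Suc k)) \<oplus> ?a (Suc n) 0"
  proof -
    have "(\<Oplus>k\<in>{..Suc n}. (z ^ k * qbin z n k) \<odot> ?a (Suc n) k) = (\<Oplus>k\<in>{..n}. (z ^ k * qbin z n k) \<odot> ?a (Suc n) k)"
      by (rule add.finprod_mono_neutral_cong_right) (use m x y in \<open>auto simp: qbin_eq_0 not_le\<close>)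
    moreover have "(\<Oplus>k\<in>{..Suc n}. (z ^ k * qbin z n k) \<odot> ?a (Suc n) k) =
      (\<Oplus>k\<in>{..n}. (z ^ Suc k * qbin z n (Suc k)) \<odot> ?a (Suc n) (Suc k)) \<oplus> ?a (Suc n) 0"
      using x y by (subst finsum_Suc2) auto
    ultimately show ?thesis by simp
  qed
  define S0 S1 S2 where "S0 = (\<Oplus>k\<in>{..n}. qbin z n k \<odot> ?a n k)"
    and "S1 = (\<Oplus>k\<in>{..n}. qbin z n k \<odot> ?a (Suc n) (Suc k))"
    and "S2 = (\<Oplus>k\<in>{..n}. (z ^ Suc k * qbin z n (Suc k)) \<odot> ?a (Suc n) (Suc k))"
  have S [simp]: "S0 \<in> carrier A" "S1 \<in> carrier A" "S2 \<in> carrier A"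
    unfolding S0_def S1_def S2_def by (intro finsum_closed; use m x y in auto)+
  have e: "?a (Suc n) 0 \<in> carrier A" by (rule m)
  have "(x \<oplus> y) [^] Suc n = (x \<oplus> y) \<otimes> S0"
    unfolding S0_def Suc[symmetric] by (rule nat_pow_Suc2) (use x y in simp)
  also have "\<dots> = x \<otimes> S0 \<oplus> y \<otimes> S0" using x y by (intro alg_l_distr[OF is_calg]) simp_all
  also have "x \<otimes> S0 = S1" unfolding S0_def S1_def by (rule 1)
  also have "y \<otimes> S0 = S2 \<oplus> ?a (Suc n) 0" unfolding S0_def S2_def by (rule trans[OF 2 3])
  also have "S1 \<oplus> (S2 \<oplus> ?a (Suc n) 0) = (S1 \<oplus> S2) \<oplus> ?a (Suc n) 0"
    by (rule a_assoc[symmetric, OF S(2,3) e])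
  also have "S1 \<oplus> S2 = (\<Oplus>k\<in>{..n}. qbin z (Suc n) (Suc k) \<odot> ?a (Suc n) (Suc k))"
    unfolding S1_def S2_def
    by (subst finsum_addf[symmetric])
      (use x y in \<open>auto intro!: finsum_cong' simp: cvec_add_smult[OF complex_algebra_cvec[OF is_calg]]\<close>)
  also have "\<dots> \<oplus> ?a (Suc n) 0 = (\<Oplus>k\<in>{..Suc n}. qbin z (Suc n) k \<odot> ?a (Suc n) k)"
    by (subst finsum_Suc2) (use x y in auto)
  finally show ?case .
qed

lemma qbinomial_nilpotent:
  assumes x: "x \<in> carrier A" and y: "y \<in> carrier A" and yx: "y \<otimes> x = z \<odot> (x \<otimes> y)"
    and z: "z ^ p = 1" "\<And>i. 0 < i \<Longrightarrow> i < p \<Longrightarrow> z ^ i \<noteq> 1"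
    and nil: "x [^] p = \<zero>" "y [^] p = \<zero>"
  shows "(x \<oplus> y) [^] (p::nat) = \<zero>"
proof -
  have "(x \<oplus> y) [^] p = (\<Oplus>k\<in>{..p}. \<zero>)"
    unfolding qbinomial[OF x y yx]
  proof (rule finsum_cong')
    fix k assume "k \<in> {..p}"
    then have "k = 0 \<or> k = p \<or> 0 < k \<and> k < p" by auto
    then consider "k = 0" | "k = p" | "0 < k" "k < p" by blast
    then show "qbin z p k \<odot> (x [^] k \<otimes> y [^] (p - k)) = \<zero>"
    proof cases
      case 3
      then show ?thesis using qbin_root[OF z 3] x y by simp
    qed (use x y nil in simp_all)
  qed simp_all
  then show ?thesis by simp
qed

lemma smult_pow: "x \<in> carrier A \<Longrightarrow> (c \<odot> x) [^] (n::nat) = c ^ n \<odot> x [^] n"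
  by (induction n) (simp_all add: mult.commute)

end


section \<open>Free algebras and presentations\<close>

lemma formal_induct:
  assumes "P 0" "\<And>k c. P (Poly_Mapping.single k c)" "\<And>f g. P f \<Longrightarrow> P g \<Longrightarrow> P (f + g)"
  shows "P (f :: 'x \<Rightarrow>\<^sub>0 complex)"
proof -
  have s: "fscale c (pt k) = Poly_Mapping.single k c" for c and k :: 'x
    by (rule poly_mapping_eqI) (simp add: lookup_single when_def)
  have "P (\<Sum>k\<in>K. fscale (Poly_Mapping.lookup f k) (pt k))" if "finite K" for K
    using that by (induction K) (auto simp: s assms)
  then show ?thesis using poly_mapping_sum[of f] by (metis finite_keys)
qed

lemma fscale_single: "fscale c (Poly_Mapping.single k d) = Poly_Mapping.single k (c * d)"
  by (rule poly_mapping_eqI) (simp add: lookup_single when_def)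

lemma fscale_mult: "fscale c f = Poly_Mapping.single 0 c * (f :: 'x::monoid_add \<Rightarrow>\<^sub>0 complex)"
  by (induction f rule: formal_induct) (simp_all add: fscale_single mult_single distrib_left fs.scale_right_distrib)

lemma fscale_mult': "fscale c f = (f :: 'x::monoid_add \<Rightarrow>\<^sub>0 complex) * Poly_Mapping.single 0 c"
  by (induction f rule: formal_induct) (simp_all add: fscale_single mult_single distrib_right fs.scale_right_distrib mult.commute)

lemma type_alg_simps [simp]:
  "carrier (type_alg sc) = UNIV" "x \<otimes>\<^bsub>type_alg sc\<^esub> y = x * y" "\<one>\<^bsub>type_alg sc\<^esub> = 1"
  "\<zero>\<^bsub>type_alg sc\<^esub> = 0" "x \<oplus>\<^bsub>type_alg sc\<^esub> y = x + y" "c \<odot>\<^bsub>type_alg sc\<^esub> x = sc c x"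
  by (simp_all add: type_alg_def)

lemma complex_algebra_type_alg:
  assumes "vector_space sc" "\<And>c x y. sc c x * y = sc c (x * y)" "\<And>c x y. x * sc c y = sc c (x * y)"
  shows "complex_algebra (type_alg sc)"
proof -
  interpret vector_space sc by (rule assms)
  have ag: "abelian_group (type_alg sc)"
    by (rule abelian_groupI) (auto simp: algebra_simps intro: exI[of _ "- x" for x])
  show ?thesis
    by (intro complex_algebraI cvecI ag) (auto simp: assms algebra_simps scale_left_distrib scale_right_distrib)
qed

lemma free_alg_algebra [simp]: "complex_algebra free_alg"
  unfolding free_alg_def
proof (rule complex_algebra_type_alg)
  show "fscale c x * y = fscale c (x * y)" for c and x y :: "gen list \<Rightarrow>\<^sub>0 complex"
    by (simp add: fscale_mult mult.assoc)
  show "x * fscale c y = fscale c (x * y)" for c and x y :: "gen list \<Rightarrow>\<^sub>0 complex"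
    by (simp add: fscale_mult' mult.assoc)
qed unfold_locales

lemma free_alg_simps [simp]:
  "carrier free_alg = UNIV" "x \<otimes>\<^bsub>free_alg\<^esub> y = x * y" "\<one>\<^bsub>free_alg\<^esub> = 1"
  "\<zero>\<^bsub>free_alg\<^esub> = 0" "x \<oplus>\<^bsub>free_alg\<^esub> y = x + y" "c \<odot>\<^bsub>free_alg\<^esub> x = fscale c x"
  by (simp_all add: free_alg_def)

lemma ring_one_pt: "(1 :: gen list \<Rightarrow>\<^sub>0 complex) = pt []"
  by (simp add: single_one[symmetric] zero_list_def)

definition word_val :: "(complex, 'b, 'm) module_scheme \<Rightarrow> (gen \<Rightarrow> 'b) \<Rightarrow> gen list \<Rightarrow> 'b" where
  "word_val B v w = foldr (\<lambda>g a. v g \<otimes>\<^bsub>B\<^esub> a) w \<one>\<^bsub>B\<^esub>"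

lemma free_alg_hom:
  assumes B [simp]: "complex_algebra B" and v [simp]: "\<And>g. v g \<in> carrier B"
  obtains f where "f \<in> alg_hom free_alg B" "\<And>g. f (pt [g]) = v g"
proof
  let ?f = "fsum B (word_val B v)"
  have wv: "word_val B v [] = \<one>\<^bsub>B\<^esub>" "word_val B v (g # w) = v g \<otimes>\<^bsub>B\<^esub> word_val B v w" for g w
    by (simp_all add: word_val_def)
  have w [simp]: "word_val B v w \<in> carrier B" for w by (induction w) (simp_all add: wv)
  have app: "word_val B v (w @ w') = word_val B v w \<otimes>\<^bsub>B\<^esub> word_val B v w'" for w w'
    by (induction w) (simp_all add: wv alg_assoc)
  have BV: "cvec B" by simp
  have cl [simp]: "?f x \<in> carrier B" for x
    by (rule fsum_closed[where X = UNIV]) simp_all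
  have add: "?f (x + y) = ?f x \<oplus>\<^bsub>B\<^esub> ?f y" for x y
    by (rule fsum_add[where X = UNIV]) simp_all
  have scale: "?f (fscale c x) = c \<odot>\<^bsub>B\<^esub> ?f x" for c x
    by (rule fsum_scale[where X = UNIV]) simp_all
  have pt: "?f (pt w) = word_val B v w" for w
    by (rule fsum_pt[where X = UNIV]) simp_all
  have single: "?f (Poly_Mapping.single w c) = c \<odot>\<^bsub>B\<^esub> word_val B v w" for w c
    using scale[of c "pt w"] by (simp add: fscale_single pt)
  have zero: "?f 0 = \<zero>\<^bsub>B\<^esub>" using scale[of 0 "pt []"] by simp
  have 1: "?f (Poly_Mapping.single w c * y) = ?f (Poly_Mapping.single w c) \<otimes>\<^bsub>B\<^esub> ?f y" for w c y
    by (induction y rule: formal_induct)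
      (simp_all add: zero add single distrib_left mult_single plus_list_def app mult.commute)
  have 2: "?f (x * y) = ?f x \<otimes>\<^bsub>B\<^esub> ?f y" for x y
    by (induction x rule: formal_induct) (simp_all add: zero add 1 distrib_right)
  show "?f \<in> alg_hom free_alg B"
    by (intro alg_homI lin_mapsI) (simp_all add: add scale 2 ring_one_pt pt word_val_def)
  show "?f (pt [g]) = v g" for g
    by (simp add: pt word_val_def)
qed

section \<open>Generation, homomorphisms given on generators, quotient algebras\<close>

text \<open>Generation is encoded as an induction principle, the form in which it is applied
  throughout.\<close>

definition alg_generated :: "(complex, 'a, 'm) module_scheme \<Rightarrow> 'a set \<Rightarrow> bool" where
  "alg_generated A G \<longleftrightarrow> G \<subseteq> carrier A \<and>
     (\<forall>P. P \<one>\<^bsub>A\<^esub> \<longrightarrow> (\<forall>g\<in>G. P g) \<longrightarrow>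
        (\<forall>x\<in>carrier A. \<forall>y\<in>carrier A. P x \<longrightarrow> P y \<longrightarrow> P (x \<oplus>\<^bsub>A\<^esub> y) \<and> P (x \<otimes>\<^bsub>A\<^esub> y)) \<longrightarrow>
        (\<forall>c. \<forall>x\<in>carrier A. P x \<longrightarrow> P (c \<odot>\<^bsub>A\<^esub> x)) \<longrightarrow> (\<forall>x\<in>carrier A. P x))"

lemma alg_generated_induct:
  assumes "alg_generated A G" "x \<in> carrier A" "P \<one>\<^bsub>A\<^esub>" "\<And>g. g \<in> G \<Longrightarrow> P g"
    "\<And>x y. x \<in> carrier A \<Longrightarrow> y \<in> carrier A \<Longrightarrow> P x \<Longrightarrow> P y \<Longrightarrow> P (x \<oplus>\<^bsub>A\<^esub> y)"
    "\<And>x y. x \<in> carrier A \<Longrightarrow> y \<in> carrier A \<Longrightarrow> P x \<Longrightarrow> P y \<Longrightarrow> P (x \<otimes>\<^bsub>A\<^esub> y)"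
    "\<And>c x. x \<in> carrier A \<Longrightarrow> P x \<Longrightarrow> P (c \<odot>\<^bsub>A\<^esub> x)"
  shows "P x"
  using assms(1)[unfolded alg_generated_def, THEN conjunct2, THEN spec[of _ P]] assms(2-) by blast

lemma alg_hom_eqI:
  assumes "alg_generated A G" "f \<in> alg_hom A B" "f' \<in> alg_hom A B"
    "\<And>g. g \<in> G \<Longrightarrow> f g = f' g" "x \<in> carrier A"
  shows "f x = f' x"
  by (rule alg_generated_induct[OF assms(1,5)]) (simp_all add: alg_homD[OF assms(2)] alg_homD[OF assms(3)] assms(4))

text \<open>Generation and extensionality give uniqueness in the definite description. It remains to
  exhibit some homomorphism with the given values, and its restriction to the carrier is the
  extensional one.\<close>

lemma the_alg_hom:
  assumes A: "complex_algebra A" and gen: "alg_generated A (fst ` vals)"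
    and f: "f \<in> alg_hom A B" "\<And>x y. (x, y) \<in> vals \<Longrightarrow> f x = y"
  shows "the_alg_hom A B vals \<in> alg_hom A B" and "(x, y) \<in> vals \<Longrightarrow> the_alg_hom A B vals x = y"
proof -
  let ?P = "\<lambda>f. f \<in> alg_hom A B \<and> f \<in> extensional (carrier A) \<and> (\<forall>(x, y)\<in>vals. f x = y)"
  have G: "fst ` vals \<subseteq> carrier A" using gen by (simp add: alg_generated_def)
  have P: "?P (restrict f (carrier A))"
    using alg_homD[OF f(1)] f(2) A G
    by (auto intro!: alg_homI lin_mapsI)
  have u: "g = h" if "?P g" "?P h" for g h
  proof (rule extensionalityI[of _ "carrier A"])
    show "g x = h x" if "x \<in> carrier A" for x
      by (rule alg_hom_eqI[OF gen _ _ _ that]) (use \<open>?P g\<close> \<open>?P h\<close> in fastforce)+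
  qed (use that in auto)
  have "?P (the_alg_hom A B vals)"
    unfolding the_alg_hom_def by (rule theI[of ?P, OF P]) (rule u[OF _ P])
  then show "the_alg_hom A B vals \<in> alg_hom A B" "(x, y) \<in> vals \<Longrightarrow> the_alg_hom A B vals x = y"
    by auto
qed

text \<open>Serves for quotient algebras and, with the identity map, for the extended record
  \<open>uq p\<close>.\<close>

lemma complex_algebra_image:
  assumes A [simp]: "complex_algebra A" and c: "carrier Q = \<pi> ` carrier A"
    and p: "\<And>x y. x \<in> carrier A \<Longrightarrow> y \<in> carrier A \<Longrightarrow> \<pi> x \<oplus>\<^bsub>Q\<^esub> \<pi> y = \<pi> (x \<oplus>\<^bsub>A\<^esub> y)"
      "\<And>x y. x \<in> carrier A \<Longrightarrow> y \<in> carrier A \<Longrightarrow> \<pi> x \<otimes>\<^bsub>Q\<^esub> \<pi> y = \<pi> (x \<otimes>\<^bsub>A\<^esub> y)"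
      "\<And>c x. x \<in> carrier A \<Longrightarrow> c \<odot>\<^bsub>Q\<^esub> \<pi> x = \<pi> (c \<odot>\<^bsub>A\<^esub> x)"
      "\<zero>\<^bsub>Q\<^esub> = \<pi> \<zero>\<^bsub>A\<^esub>" "\<one>\<^bsub>Q\<^esub> = \<pi> \<one>\<^bsub>A\<^esub>"
  shows "complex_algebra Q"
proof -
  have A' [simp]: "cvec A" by simp
  have ag: "abelian_group Q"
  proof (rule abelian_groupI)
    fix x assume "x \<in> carrier Q"
    then obtain a where a: "x = \<pi> a" "a \<in> carrier A" using c by auto
    then show "\<exists>y\<in>carrier Q. y \<oplus>\<^bsub>Q\<^esub> x = \<zero>\<^bsub>Q\<^esub>"
      by (intro bexI[of _ "\<pi> ((- 1) \<odot>\<^bsub>A\<^esub> a)"]) (auto simp: p c cvec_collect[OF A'])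
  qed (auto simp: c p cvec_ac[OF A'])
  show ?thesis
    by (intro complex_algebraI cvecI ag) (auto simp: c p cvec_add_smult[OF A'] alg_assoc[OF A])
qed

context
  fixes A :: "(complex, 'a, 'm) module_scheme" and I
  assumes A [simp]: "complex_algebra A" and I: "ideal I A"
begin

interpretation A: complex_algebra A by (rule A)
interpretation I: ideal I A by (rule I)

abbreviation (input) "\<pi> x \<equiv> I +>\<^bsub>A\<^esub> x"

lemma quot_alg_fields:
  "carrier (quot_alg A I) = \<pi> ` carrier A"
  "x \<oplus>\<^bsub>quot_alg A I\<^esub> y = x <+>\<^bsub>A\<^esub> y" "x \<otimes>\<^bsub>quot_alg A I\<^esub> y = rcoset_mult A I x y"
  "\<zero>\<^bsub>quot_alg A I\<^esub> = I" "\<one>\<^bsub>quot_alg A I\<^esub> = \<pi> \<one>\<^bsub>A\<^esub>"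
  "c \<odot>\<^bsub>quot_alg A I\<^esub> x = (\<Union>y\<in>x. \<pi> (c \<odot>\<^bsub>A\<^esub> y))"
  by (auto simp: quot_alg_def ring.defs module.defs FactRing_def A_RCOSETS_def')

lemma pi_eqI: "x \<in> carrier A \<Longrightarrow> y \<in> \<pi> x \<Longrightarrow> \<pi> y = \<pi> x"
  using I.a_repr_independence'[of y x] by simp

lemma quot_alg_pi:
  "x \<in> carrier A \<Longrightarrow> y \<in> carrier A \<Longrightarrow> \<pi> x \<oplus>\<^bsub>quot_alg A I\<^esub> \<pi> y = \<pi> (x \<oplus>\<^bsub>A\<^esub> y)"
  "x \<in> carrier A \<Longrightarrow> y \<in> carrier A \<Longrightarrow> \<pi> x \<otimes>\<^bsub>quot_alg A I\<^esub> \<pi> y = \<pi> (x \<otimes>\<^bsub>A\<^esub> y)"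
  "x \<in> carrier A \<Longrightarrow> c \<odot>\<^bsub>quot_alg A I\<^esub> \<pi> x = \<pi> (c \<odot>\<^bsub>A\<^esub> x)"
  "\<zero>\<^bsub>quot_alg A I\<^esub> = \<pi> \<zero>\<^bsub>A\<^esub>"
proof -
  show "\<pi> x \<oplus>\<^bsub>quot_alg A I\<^esub> \<pi> y = \<pi> (x \<oplus>\<^bsub>A\<^esub> y)" if "x \<in> carrier A" "y \<in> carrier A"
    using that by (simp add: quot_alg_fields I.a_rcos_sum)
  show "\<pi> x \<otimes>\<^bsub>quot_alg A I\<^esub> \<pi> y = \<pi> (x \<otimes>\<^bsub>A\<^esub> y)" if "x \<in> carrier A" "y \<in> carrier A"
    using that by (simp add: quot_alg_fields I.rcoset_mult_add)
  show "\<zero>\<^bsub>quot_alg A I\<^esub> = \<pi> \<zero>\<^bsub>A\<^esub>"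
    using I.a_subset by (simp add: quot_alg_fields A.a_coset_add_zero)
  show "c \<odot>\<^bsub>quot_alg A I\<^esub> \<pi> x = \<pi> (c \<odot>\<^bsub>A\<^esub> x)" if x: "x \<in> carrier A"
  proof -
    have "\<pi> (c \<odot>\<^bsub>A\<^esub> y) = \<pi> (c \<odot>\<^bsub>A\<^esub> x)" if y: "y \<in> \<pi> x" for y
    proof (rule pi_eqI)
      obtain i where i: "i \<in> I" "y = i \<oplus>\<^bsub>A\<^esub> x" using y by (auto simp: a_r_coset_def')
      have "c \<odot>\<^bsub>A\<^esub> i = (c \<odot>\<^bsub>A\<^esub> \<one>\<^bsub>A\<^esub>) \<otimes>\<^bsub>A\<^esub> i"
        using i I.a_subset by (auto simp: subset_eq)
      also have "\<dots> \<in> I" by (rule I.I_l_closed[OF i(1)]) simp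
      finally have "c \<odot>\<^bsub>A\<^esub> i \<in> I" .
      then show "c \<odot>\<^bsub>A\<^esub> y \<in> \<pi> (c \<odot>\<^bsub>A\<^esub> x)"
        using i x I.a_subset by (auto simp: a_r_coset_def' subset_eq)
    qed (use x in simp)
    then show ?thesis unfolding quot_alg_fields
      by (intro SUP_eq_const) (use I.a_rcos_self[OF x] in blast)+
  qed
qed

lemma quot_alg_algebra: "complex_algebra (quot_alg A I)"
  by (rule complex_algebra_image[OF A, of _ \<pi>]) (simp_all add: quot_alg_pi quot_alg_fields(1,5))

lemma quot_alg_proj: "\<pi> \<in> alg_hom A (quot_alg A I)"
  by (intro alg_homI lin_mapsI) (simp_all add: quot_alg_pi quot_alg_fields(1,5))

lemma quot_alg_lift:
  assumes B: "complex_algebra B" and f: "f \<in> alg_hom A B" and fI: "\<And>x. x \<in> I \<Longrightarrow> f x = \<zero>\<^bsub>B\<^esub>"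
  obtains g where "g \<in> alg_hom (quot_alg A I) B" "\<And>x. x \<in> carrier A \<Longrightarrow> g (\<pi> x) = f x"
proof
  let ?g = "\<lambda>C. the_elem (f ` C)"
  note fD = alg_homD[OF f]
  show g: "?g (\<pi> x) = f x" if x: "x \<in> carrier A" for x
  proof -
    have "f y = f x" if "y \<in> \<pi> x" for y
      using that x I.a_subset B by (auto simp: a_r_coset_def' subset_eq fD fI)
    then have "f ` \<pi> x = {f x}" using I.a_rcos_self[OF x] by blast
    then show ?thesis by simp
  qed
  show "?g \<in> alg_hom (quot_alg A I) B"
    by (intro alg_homI lin_mapsI)
      (use B in \<open>auto simp: quot_alg_fields(1,5) quot_alg_pi(1-3) g fD\<close>)
qed

lemma quot_alg_generated:
  assumes "alg_generated A G"
  shows "alg_generated (quot_alg A I) (\<pi> ` G)"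
  unfolding alg_generated_def
proof (intro conjI allI impI ballI)
  show "\<pi> ` G \<subseteq> carrier (quot_alg A I)"
    using assms by (auto simp: alg_generated_def quot_alg_fields(1))
  fix P C assume P: "P \<one>\<^bsub>quot_alg A I\<^esub>" "\<forall>g\<in>\<pi> ` G. P g"
    "\<forall>x\<in>carrier (quot_alg A I). \<forall>y\<in>carrier (quot_alg A I). P x \<longrightarrow> P y \<longrightarrow>
      P (x \<oplus>\<^bsub>quot_alg A I\<^esub> y) \<and> P (x \<otimes>\<^bsub>quot_alg A I\<^esub> y)"
    "\<forall>c. \<forall>x\<in>carrier (quot_alg A I). P x \<longrightarrow> P (c \<odot>\<^bsub>quot_alg A I\<^esub> x)"
    and C: "C \<in> carrier (quot_alg A I)"
  obtain x where x: "C = \<pi> x" "x \<in> carrier A" using C by (auto simp: quot_alg_fields(1))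
  have "P (\<pi> x)"
    by (rule alg_generated_induct[OF assms x(2), of "\<lambda>x. P (\<pi> x)"])
      (use P in \<open>auto simp: quot_alg_fields(1,5) quot_alg_pi(1-3)[symmetric] simp del: A.calg\<close>)
  then show "P C" by (simp add: x)
qed

end

text \<open>The kernel of \<open>f\<close> is an ideal containing \<open>R\<close>, hence it
  contains the ideal generated by \<open>R\<close>.\<close>

lemma genideal_hom_zero:
  assumes A: "complex_algebra A" and B: "complex_algebra B" and f: "f \<in> alg_hom A B"
    and R: "R \<subseteq> carrier A" and fR: "\<And>r. r \<in> R \<Longrightarrow> f r = \<zero>\<^bsub>B\<^esub>" and x: "x \<in> genideal A R"
  shows "f x = \<zero>\<^bsub>B\<^esub>"
proof -
  interpret A: complex_algebra A by (rule A)
  interpret B: complex_algebra B by (rule B)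
  interpret ring_hom_ring A B f
    by (rule ring_hom_ringI2) (use f in \<open>auto simp: alg_hom_def A.ring_axioms B.ring_axioms\<close>)
  have "genideal A R \<subseteq> a_kernel A B f"
  proof (rule A.genideal_minimal[OF kernel_is_ideal], rule subsetI)
    fix r assume "r \<in> R"
    then show "r \<in> a_kernel A B f" using R fR unfolding a_kernel_def' by blast
  qed
  with x have "x \<in> a_kernel A B f" by (rule rev_subsetD)
  then show ?thesis unfolding a_kernel_def' by blast
qed

lemma free_alg_generated: "alg_generated free_alg (range (\<lambda>g. pt [g]))"
  unfolding alg_generated_def
proof (intro conjI allI impI ballI)
  fix P :: "(gen list \<Rightarrow>\<^sub>0 complex) \<Rightarrow> bool" and x
  assume P: "P \<one>\<^bsub>free_alg\<^esub>" "\<forall>g\<in>range (\<lambda>g. pt [g]). P g"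
    "\<forall>x\<in>carrier free_alg. \<forall>y\<in>carrier free_alg. P x \<longrightarrow> P y \<longrightarrow> P (x \<oplus>\<^bsub>free_alg\<^esub> y) \<and> P (x \<otimes>\<^bsub>free_alg\<^esub> y)"
    "\<forall>c. \<forall>x\<in>carrier free_alg. P x \<longrightarrow> P (c \<odot>\<^bsub>free_alg\<^esub> x)"
  have w: "P (pt w)" for w
  proof (induction w)
    case (Cons g w)
    have "P (pt [g] * pt w)" using P Cons by simp
    then show ?case by (simp add: mult_single plus_list_def)
  qed (use P(1) in \<open>simp add: ring_one_pt\<close>)
  show "P x"
  proof (induction x rule: formal_induct)
    case 1
    then show ?case using P(4) w[of "[]"] by (metis free_alg_simps(1,6) UNIV_I fs.scale_zero_left)
  next
    case (2 k c)
    then show ?case using P(4) w[of k] fscale_single[of c k 1] by (metis free_alg_simps(1,6) UNIV_I mult.right_neutral)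
  qed (use P(3) in simp)
qed simp

text \<open>Continues \<open>cvec_collect\<close> for multiples separated by three or four summands,
  which occur in the products of coproducts and coactions of generators.\<close>

lemma cvec_collect_far:
  fixes V (structure)
  assumes V: "cvec V"
  shows "\<lbrakk>x \<in> carrier V; y \<in> carrier V; z \<in> carrier V; u \<in> carrier V\<rbrakk> \<Longrightarrow>
      c \<odot> x \<oplus> (y \<oplus> (z \<oplus> (u \<oplus> d \<odot> x))) = (c + d) \<odot> x \<oplus> (y \<oplus> (z \<oplus> u))"
  "\<lbrakk>x \<in> carrier V; y \<in> carrier V; z \<in> carrier V; u \<in> carrier V; w \<in> carrier V\<rbrakk> \<Longrightarrow>
      c \<odot> x \<oplus> (y \<oplus> (z \<oplus> (u \<oplus> (d \<odot> x \<oplus> w)))) = (c + d) \<odot> x \<oplus> (y \<oplus> (z \<oplus> (u \<oplus> w)))"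
  "\<lbrakk>x \<in> carrier V; y \<in> carrier V; z \<in> carrier V; u \<in> carrier V; v \<in> carrier V\<rbrakk> \<Longrightarrow>
      c \<odot> x \<oplus> (y \<oplus> (z \<oplus> (u \<oplus> (v \<oplus> d \<odot> x)))) = (c + d) \<odot> x \<oplus> (y \<oplus> (z \<oplus> (u \<oplus> v)))"
  "\<lbrakk>x \<in> carrier V; y \<in> carrier V; z \<in> carrier V; u \<in> carrier V; v \<in> carrier V; w \<in> carrier V\<rbrakk> \<Longrightarrow>
      c \<odot> x \<oplus> (y \<oplus> (z \<oplus> (u \<oplus> (v \<oplus> (d \<odot> x \<oplus> w))))) = (c + d) \<odot> x \<oplus> (y \<oplus> (z \<oplus> (u \<oplus> (v \<oplus> w))))"
  "\<lbrakk>x \<in> carrier V; y \<in> carrier V; z \<in> carrier V; u \<in> carrier V\<rbrakk> \<Longrightarrow>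
      x \<oplus> (y \<oplus> (z \<oplus> (u \<oplus> d \<odot> x))) = (1 + d) \<odot> x \<oplus> (y \<oplus> (z \<oplus> u))"
  "\<lbrakk>x \<in> carrier V; y \<in> carrier V; z \<in> carrier V; u \<in> carrier V; w \<in> carrier V\<rbrakk> \<Longrightarrow>
      x \<oplus> (y \<oplus> (z \<oplus> (u \<oplus> (d \<odot> x \<oplus> w)))) = (1 + d) \<odot> x \<oplus> (y \<oplus> (z \<oplus> (u \<oplus> w)))"
  "\<lbrakk>x \<in> carrier V; y \<in> carrier V; z \<in> carrier V; u \<in> carrier V; v \<in> carrier V\<rbrakk> \<Longrightarrow>
      x \<oplus> (y \<oplus> (z \<oplus> (u \<oplus> (v \<oplus> d \<odot> x)))) = (1 + d) \<odot> x \<oplus> (y \<oplus> (z \<oplus> (u \<oplus> v)))"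
  "\<lbrakk>x \<in> carrier V; y \<in> carrier V; z \<in> carrier V; u \<in> carrier V; v \<in> carrier V; w \<in> carrier V\<rbrakk> \<Longrightarrow>
      x \<oplus> (y \<oplus> (z \<oplus> (u \<oplus> (v \<oplus> (d \<odot> x \<oplus> w))))) = (1 + d) \<odot> x \<oplus> (y \<oplus> (z \<oplus> (u \<oplus> (v \<oplus> w))))"
  "\<lbrakk>x \<in> carrier V; y \<in> carrier V; z \<in> carrier V; u \<in> carrier V\<rbrakk> \<Longrightarrow>
      c \<odot> x \<oplus> (y \<oplus> (z \<oplus> (u \<oplus> x))) = (c + 1) \<odot> x \<oplus> (y \<oplus> (z \<oplus> u))"
  "\<lbrakk>x \<in> carrier V; y \<in> carrier V; z \<in> carrier V; u \<in> carrier V; w \<in> carrier V\<rbrakk> \<Longrightarrow>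
      c \<odot> x \<oplus> (y \<oplus> (z \<oplus> (u \<oplus> (x \<oplus> w)))) = (c + 1) \<odot> x \<oplus> (y \<oplus> (z \<oplus> (u \<oplus> w)))"
  "\<lbrakk>x \<in> carrier V; y \<in> carrier V; z \<in> carrier V; u \<in> carrier V; v \<in> carrier V\<rbrakk> \<Longrightarrow>
      c \<odot> x \<oplus> (y \<oplus> (z \<oplus> (u \<oplus> (v \<oplus> x)))) = (c + 1) \<odot> x \<oplus> (y \<oplus> (z \<oplus> (u \<oplus> v)))"
  "\<lbrakk>x \<in> carrier V; y \<in> carrier V; z \<in> carrier V; u \<in> carrier V; v \<in> carrier V; w \<in> carrier V\<rbrakk> \<Longrightarrow>
      c \<odot> x \<oplus> (y \<oplus> (z \<oplus> (u \<oplus> (v \<oplus> (x \<oplus> w))))) = (c + 1) \<odot> x \<oplus> (y \<oplus> (z \<oplus> (u \<oplus> (v \<oplus> w))))"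
  using V by (simp_all add: cvec_ac cvec_add_smult)

lemma TL_prod:
  assumes M: "complex_algebra M"
    and f: "\<And>x y. x \<in> carrier A \<Longrightarrow> y \<in> carrier B \<Longrightarrow> f x y \<in> carrier M"
    and g: "\<And>x y. x \<in> carrier C \<Longrightarrow> y \<in> carrier D \<Longrightarrow> g x y \<in> carrier M"
  shows "TL A B M f S \<otimes>\<^bsub>M\<^esub> TL C D M g T = TL A B M (\<lambda>x y. TL C D M (\<lambda>u v. f x y \<otimes>\<^bsub>M\<^esub> g u v) T) S"
  using assms by (simp add: TL_mult_left[OF M] TL_mult_right[OF M]) (rule TL_swap; simp)

lemma pow_free_alg: "x [^]\<^bsub>free_alg\<^esub> (n::nat) = x ^ n"
  by (induction n) (simp_all add: power_commutes)

lemma pow_complex_alg: "x [^]\<^bsub>complex_alg\<^esub> (n::nat) = x ^ n"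
  by (induction n) (simp_all add: mult.commute)

lemma pow_op_alg:
  assumes "complex_algebra A" "x \<in> carrier A"
  shows "x [^]\<^bsub>op_alg A\<^esub> (n::nat) = x [^]\<^bsub>A\<^esub> n"
proof -
  interpret complex_algebra A by (rule assms)
  show ?thesis
  proof (induction n)
    case (Suc n)
    have "x [^]\<^bsub>op_alg A\<^esub> Suc n = x \<otimes>\<^bsub>A\<^esub> x [^]\<^bsub>op_alg A\<^esub> n" by (simp add: nat_pow_def)
    then show ?case using nat_pow_Suc2[OF assms(2)] by (simp only: Suc)
  qed (simp add: nat_pow_def)
qed

lemma alg_hom_pow:
  assumes "f \<in> alg_hom A B" "complex_algebra A" "x \<in> carrier A"
  shows "f (x [^]\<^bsub>A\<^esub> (n::nat)) = f x [^]\<^bsub>B\<^esub> n"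
proof -
  interpret complex_algebra A by (rule assms)
  show ?thesis using assms(3) by (induction n) (simp_all add: alg_homD[OF assms(1)])
qed

lemma pure_pow:
  assumes A: "complex_algebra A" and B: "complex_algebra B" and x: "x \<in> carrier A" and y: "y \<in> carrier B"
  shows "(x \<boxtimes>\<^bsub>tensor A B\<^esub> y) [^]\<^bsub>tensor A B\<^esub> (n::nat) = (x [^]\<^bsub>A\<^esub> n) \<boxtimes>\<^bsub>tensor A B\<^esub> (y [^]\<^bsub>B\<^esub> n)"
proof -
  interpret A: complex_algebra A by (rule A)
  interpret B: complex_algebra B by (rule B)
  show ?thesis using x y A B
    by (induction n) (simp_all add: tensor_one)
qed

text \<open>Reordering the factors costs only powers of \<open>z\<close>. The scalar is left
  implicit because the purpose is to deduce that \<open>x \<otimes> y\<close> is nilpotent when one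
  factor is.\<close>

lemma qcomm_pow:
  assumes A: "complex_algebra A" and x: "x \<in> carrier A" and y: "y \<in> carrier A"
    and yx: "y \<otimes>\<^bsub>A\<^esub> x = z \<odot>\<^bsub>A\<^esub> (x \<otimes>\<^bsub>A\<^esub> y)"
  shows "\<exists>c. (x \<otimes>\<^bsub>A\<^esub> y) [^]\<^bsub>A\<^esub> (n::nat) = c \<odot>\<^bsub>A\<^esub> (x [^]\<^bsub>A\<^esub> n \<otimes>\<^bsub>A\<^esub> y [^]\<^bsub>A\<^esub> n)"
proof -
  interpret complex_algebra A by (rule A)
  show ?thesis
  proof (induction n)
    case 0
    show ?case by (rule exI[of _ 1]) simp
  next
    case (Suc n)
    then obtain c where c: "(x \<otimes>\<^bsub>A\<^esub> y) [^]\<^bsub>A\<^esub> n = c \<odot>\<^bsub>A\<^esub> (x [^]\<^bsub>A\<^esub> n \<otimes>\<^bsub>A\<^esub> y [^]\<^bsub>A\<^esub> n)" by blast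
    have "(x \<otimes>\<^bsub>A\<^esub> y) [^]\<^bsub>A\<^esub> Suc n = (x \<otimes>\<^bsub>A\<^esub> y) \<otimes>\<^bsub>A\<^esub> (x \<otimes>\<^bsub>A\<^esub> y) [^]\<^bsub>A\<^esub> n"
      by (rule nat_pow_Suc2) (use x y in simp)
    also have "\<dots> = c \<odot>\<^bsub>A\<^esub> (x \<otimes>\<^bsub>A\<^esub> (y \<otimes>\<^bsub>A\<^esub> x [^]\<^bsub>A\<^esub> n) \<otimes>\<^bsub>A\<^esub> y [^]\<^bsub>A\<^esub> n)"
      using x y by (simp add: c calg_assoc)
    also have "\<dots> = (c * z ^ n) \<odot>\<^bsub>A\<^esub> ((x \<otimes>\<^bsub>A\<^esub> x [^]\<^bsub>A\<^esub> n) \<otimes>\<^bsub>A\<^esub> (y \<otimes>\<^bsub>A\<^esub> y [^]\<^bsub>A\<^esub> n))"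
      unfolding qpower_comm[OF x y yx] using x y by (simp add: calg_assoc)
    also have "\<dots> = (c * z ^ n) \<odot>\<^bsub>A\<^esub> (x [^]\<^bsub>A\<^esub> Suc n \<otimes>\<^bsub>A\<^esub> y [^]\<^bsub>A\<^esub> Suc n)"
      unfolding nat_pow_Suc2[OF x] nat_pow_Suc2[OF y] ..
    finally show ?case by blast
  qed
qed


section \<open>The restricted quantum group\<close>

locale restricted_quantum_group =
  fixes p :: nat
  assumes p2: "2 \<le> p"
begin

definition "q = qroot p"
definition "w = q - inverse q"

lemma q_pow: "q ^ n = exp (\<i> * of_real (pi * real n / real p))"
  by (simp add: q_def qroot_def exp_of_nat_mult[symmetric] mult_ac)

lemma q_nz [simp]: "q \<noteq> 0"
  by (simp add: q_def qroot_def)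

text \<open>Equality would make the angle \<open>2 pi i / p\<close> a multiple of
  \<open>2 pi\<close>, so that \<open>p\<close> divides \<open>i\<close>. Thus
  \<open>q\<^sup>2\<close> is a primitive \<open>p\<close>-th root of unity, as the q-binomial
  theorem requires.\<close>

lemma q_pow_ne_1: "(q\<^sup>2) ^ i \<noteq> 1" if "0 < i" "i < p"
proof
  assume "(q\<^sup>2) ^ i = 1"
  then have "q ^ (2 * i) = 1" by (simp add: power_mult)
  then have "exp (\<i> * of_real (pi * real (2 * i) / real p)) = 1" by (simp only: q_pow)
  then have "cis (pi * real (2 * i) / real p) = 1" by (simp add: cis_conv_exp)
  then have "cos (pi * real (2 * i) / real p) = 1" by (metis cis.sel(1) one_complex.sel(1))
  then obtain n :: int where n: "pi * real (2 * i) / real p = 2 * pi * n"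
    by (auto simp: cos_one_2pi_int mult_ac)
  then have "pi * (real i) = pi * (real p * n)" using p2 by (simp add: field_simps)
  then have "real i = real p * n" by simp
  then have e: "int i = int p * n" by (metis of_int_eq_iff of_int_mult of_int_of_nat_eq)
  then have "int p dvd int i" by simp
  then show False using that by (auto dest: dvd_imp_le)
qed

lemma q_2p: "q ^ (2 * p) = 1"
proof -
  have "pi * real (2 * p) / real p = 2 * pi" using p2 by simp
  then show ?thesis unfolding q_pow by (simp add: exp_two_pi_i mult.commute)
qed

lemma q_sq_p: "(q\<^sup>2) ^ p = 1"
  using q_2p by (simp add: power_mult)

lemma q_sq_ne: "q\<^sup>2 \<noteq> 1"
  using q_pow_ne_1[of 1] p2 by simp

lemma w_nz [simp]: "w \<noteq> 0"
  using q_sq_ne by (simp add: w_def field_simps power2_eq_square)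

abbreviation "U \<equiv> uq_alg p"
abbreviation "H \<equiv> uq p"
abbreviation "E \<equiv> uq_gen p GenE"
abbreviation "K \<equiv> uq_gen p GenK"
abbreviation "F \<equiv> uq_gen p GenF"
definition "L = inv\<^bsub>H\<^esub> K"

lemma H_simps:
  "carrier H = carrier U" "x \<oplus>\<^bsub>H\<^esub> y = x \<oplus>\<^bsub>U\<^esub> y" "x \<otimes>\<^bsub>H\<^esub> y = x \<otimes>\<^bsub>U\<^esub> y" "c \<odot>\<^bsub>H\<^esub> x = c \<odot>\<^bsub>U\<^esub> x"
  "\<zero>\<^bsub>H\<^esub> = \<zero>\<^bsub>U\<^esub>" "\<one>\<^bsub>H\<^esub> = \<one>\<^bsub>U\<^esub>" "comult H = uq_comult p" "counit H = uq_counit p" "antipode H = uq_antipode p"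
  by (simp_all add: uq_def module.defs hopf.defs)

abbreviation "J \<equiv> genideal free_alg (uq_rels p)"

lemma J_ideal: "ideal J free_alg"
proof -
  interpret complex_algebra free_alg by simp
  show ?thesis by (rule genideal_ideal) simp
qed

lemma U_alg [simp]: "complex_algebra U"
  unfolding uq_alg_def by (rule quot_alg_algebra[OF _ J_ideal]) simp

lemma uq_proj: "(\<lambda>x. J +>\<^bsub>free_alg\<^esub> x) \<in> alg_hom free_alg U"
  unfolding uq_alg_def by (rule quot_alg_proj[OF _ J_ideal]) simp

lemma uq_proj_zero:
  assumes "r \<in> uq_rels p"
  shows "J +>\<^bsub>free_alg\<^esub> r = \<zero>\<^bsub>U\<^esub>"
proof -
  interpret complex_algebra free_alg by simp
  interpret J: ideal J free_alg by (rule J_ideal)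
  have "r \<in> J" using assms genideal_self[of "uq_rels p"] by auto
  then show ?thesis
    using J.a_rcos_const by (simp add: uq_alg_def quot_alg_fields(4)[OF _ J_ideal])
qed

lemma uq_generated: "alg_generated U {E, K, F}"
proof -
  have "range f = {f GenE, f GenK, f GenF}" for f :: "gen \<Rightarrow> gen list \<Rightarrow>\<^sub>0 complex"
  proof (intro equalityI subsetI)
    fix x assume "x \<in> range f"
    then obtain g where "x = f g" by blast
    then show "x \<in> {f GenE, f GenK, f GenF}" by (cases g) simp_all
  qed blast
  then show ?thesis
    using quot_alg_generated[OF _ J_ideal free_alg_generated]
    by (simp add: uq_alg_def uq_gen_def)
qed

lemma gens_closed [simp]: "E \<in> carrier U" "K \<in> carrier U" "F \<in> carrier U"
  using uq_generated by (auto simp: alg_generated_def)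

text \<open>The defining relations in commutation form, with an explicit inverse \<open>l\<close> in
  place of the power \<open>2 * p - 1\<close> of \<open>k\<close>.\<close>

definition uq_images :: "(complex, 'b, 'm) module_scheme \<Rightarrow> 'b \<Rightarrow> 'b \<Rightarrow> 'b \<Rightarrow> 'b \<Rightarrow> bool" where
  "uq_images B e k l f \<longleftrightarrow> complex_algebra B \<and> e \<in> carrier B \<and> k \<in> carrier B \<and> l \<in> carrier B \<and> f \<in> carrier B \<and>
     k \<otimes>\<^bsub>B\<^esub> l = \<one>\<^bsub>B\<^esub> \<and> l \<otimes>\<^bsub>B\<^esub> k = \<one>\<^bsub>B\<^esub> \<and>
     k \<otimes>\<^bsub>B\<^esub> e = q\<^sup>2 \<odot>\<^bsub>B\<^esub> (e \<otimes>\<^bsub>B\<^esub> k) \<and> k \<otimes>\<^bsub>B\<^esub> f = inverse (q\<^sup>2) \<odot>\<^bsub>B\<^esub> (f \<otimes>\<^bsub>B\<^esub> k) \<and>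
     e \<otimes>\<^bsub>B\<^esub> f = f \<otimes>\<^bsub>B\<^esub> e \<oplus>\<^bsub>B\<^esub> ((1 / w) \<odot>\<^bsub>B\<^esub> k \<oplus>\<^bsub>B\<^esub> (- (1 / w)) \<odot>\<^bsub>B\<^esub> l) \<and>
     e [^]\<^bsub>B\<^esub> p = \<zero>\<^bsub>B\<^esub> \<and> f [^]\<^bsub>B\<^esub> p = \<zero>\<^bsub>B\<^esub> \<and> k [^]\<^bsub>B\<^esub> (2 * p) = \<one>\<^bsub>B\<^esub>"

lemma free_minus: "x - y = x \<oplus>\<^bsub>free_alg\<^esub> (- 1) \<odot>\<^bsub>free_alg\<^esub> y"
  by (simp add: fs.scale_minus_left)

lemma inv_is_pow:
  assumes "complex_algebra B" "k \<in> carrier B" "l \<in> carrier B" "l \<otimes>\<^bsub>B\<^esub> k = \<one>\<^bsub>B\<^esub>" "k [^]\<^bsub>B\<^esub> (2 * p) = \<one>\<^bsub>B\<^esub>"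
  shows "k [^]\<^bsub>B\<^esub> (2 * p - 1) = l"
proof -
  interpret complex_algebra B by (rule assms)
  have s: "Suc (2 * p - 1) = 2 * p" using p2 by simp
  have "l = l \<otimes>\<^bsub>B\<^esub> k [^]\<^bsub>B\<^esub> Suc (2 * p - 1)" unfolding s using assms by simp
  also have "\<dots> = (l \<otimes>\<^bsub>B\<^esub> k) \<otimes>\<^bsub>B\<^esub> k [^]\<^bsub>B\<^esub> (2 * p - 1)"
    unfolding nat_pow_Suc2[OF assms(2)] by (rule calg_assoc[symmetric]) (use assms in simp_all)
  also have "\<dots> = k [^]\<^bsub>B\<^esub> (2 * p - 1)" using assms by simp
  finally show ?thesis by simp
qed

text \<open>The universal property of the presentation. Since \<open>l\<close> is the power
  \<open>2 * p - 1\<close> of \<open>k\<close>, the homomorphism from the free algebra kills the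
  relations and hence the ideal they generate.\<close>

lemma uq_hom:
  assumes im: "uq_images B e k l f"
  obtains \<phi> where "\<phi> \<in> alg_hom U B" "\<phi> E = e" "\<phi> K = k" "\<phi> F = f"
proof -
  have B [simp]: "complex_algebra B" and cl [simp]: "e \<in> carrier B" "k \<in> carrier B" "l \<in> carrier B" "f \<in> carrier B"
    using im by (simp_all add: uq_images_def)
  have BV [simp]: "cvec B" by simp
  define v where "v g = (case g of GenE \<Rightarrow> e | GenK \<Rightarrow> k | GenF \<Rightarrow> f)" for g
  have "v g \<in> carrier B" for g by (cases g) (simp_all add: v_def)
  then obtain \<psi> where \<psi>: "\<psi> \<in> alg_hom free_alg B" "\<And>g. \<psi> (pt [g]) = v g"
    using free_alg_hom[OF B, of v] by blast
  note h = alg_homD[OF \<psi>(1), simplified]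
  have pw: "\<psi> (x ^ n) = \<psi> x [^]\<^bsub>B\<^esub> n" for x n
    using alg_hom_pow[OF \<psi>(1) free_alg_algebra, of x n] by (simp add: pow_free_alg)
  have mi: "\<psi> (x - y) = \<psi> x \<oplus>\<^bsub>B\<^esub> (- 1) \<odot>\<^bsub>B\<^esub> \<psi> y" for x y
    unfolding free_minus by (simp only: h free_alg_simps)
  have ass: "x \<otimes>\<^bsub>B\<^esub> k \<otimes>\<^bsub>B\<^esub> l = x" if "x \<in> carrier B" for x
    using im that by (simp add: uq_images_def alg_assoc)
  have l: "k [^]\<^bsub>B\<^esub> (2 * p - 1) = l"
    by (rule inv_is_pow) (use im in \<open>simp_all add: uq_images_def\<close>)
  have "\<psi> r = \<zero>\<^bsub>B\<^esub>" if "r \<in> uq_rels p" for r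
    using that im unfolding uq_rels_def Let_def q_def[symmetric] w_def[symmetric]
    by (auto simp: mi pw h(1-5) \<psi>(2) v_def l l[unfolded One_nat_def] ass uq_images_def cvec_ac[OF BV] cvec_collect[OF BV] h(6))
  then have "\<psi> x = \<zero>\<^bsub>B\<^esub>" if "x \<in> J" for x
    using genideal_hom_zero[OF free_alg_algebra B \<psi>(1) _ _ that] by simp
  then obtain \<phi> where "\<phi> \<in> alg_hom U B" "\<And>x. \<phi> (J +>\<^bsub>free_alg\<^esub> x) = \<psi> x"
    using quot_alg_lift[OF free_alg_algebra J_ideal B \<psi>(1)] unfolding uq_alg_def by auto
  then show thesis using that[of \<phi>] by (simp add: uq_gen_def \<psi>(2) v_def)
qed

lemma U_vec [simp]: "cvec U" by simp

lemma uq_relations: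
  shows "K [^]\<^bsub>U\<^esub> (2 * p) = \<one>\<^bsub>U\<^esub>" "E [^]\<^bsub>U\<^esub> p = \<zero>\<^bsub>U\<^esub>" "F [^]\<^bsub>U\<^esub> p = \<zero>\<^bsub>U\<^esub>"
    and "K \<otimes>\<^bsub>U\<^esub> E \<otimes>\<^bsub>U\<^esub> K [^]\<^bsub>U\<^esub> (2 * p - 1) = q\<^sup>2 \<odot>\<^bsub>U\<^esub> E"
    and "K \<otimes>\<^bsub>U\<^esub> F \<otimes>\<^bsub>U\<^esub> K [^]\<^bsub>U\<^esub> (2 * p - 1) = inverse (q\<^sup>2) \<odot>\<^bsub>U\<^esub> F"
    and "E \<otimes>\<^bsub>U\<^esub> F = F \<otimes>\<^bsub>U\<^esub> E \<oplus>\<^bsub>U\<^esub> ((1 / w) \<odot>\<^bsub>U\<^esub> K \<oplus>\<^bsub>U\<^esub> (- (1 / w)) \<odot>\<^bsub>U\<^esub> K [^]\<^bsub>U\<^esub> (2 * p - 1))"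
proof -
  interpret complex_algebra U by simp
  define \<psi> where "\<psi> x = J +>\<^bsub>free_alg\<^esub> x" for x
  have \<psi>: "\<psi> \<in> alg_hom free_alg U" using uq_proj by (simp add: \<psi>_def[abs_def])
  note h = alg_homD[OF \<psi>, simplified]
  have g: "\<psi> (pt [x]) = uq_gen p x" for x by (simp add: \<psi>_def uq_gen_def)
  have pw: "\<psi> (x ^ n) = \<psi> x [^]\<^bsub>U\<^esub> n" for x n
    using alg_hom_pow[OF \<psi> free_alg_algebra, of x n] by (simp add: pow_free_alg)
  have mi: "\<psi> (x - y) = \<psi> x \<ominus>\<^bsub>U\<^esub> \<psi> y" for x y
  proof -
    have "\<psi> (x - y) = \<psi> x \<oplus>\<^bsub>U\<^esub> (- 1) \<odot>\<^bsub>U\<^esub> \<psi> y"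
      unfolding free_minus by (simp only: h free_alg_simps)
    then show ?thesis using h(2) by (simp add: cvec_minus[OF U_vec])
  qed
  have z: "\<psi> r = \<zero>\<^bsub>U\<^esub>" if "r \<in> uq_rels p" for r using uq_proj_zero[OF that] by (simp add: \<psi>_def)
  have eq: "a = b" if "a \<ominus>\<^bsub>U\<^esub> b = \<zero>\<^bsub>U\<^esub>" "a \<in> carrier U" "b \<in> carrier U" for a b
    using that by (simp add: cvec_minus_eq_zero[OF U_vec])
  let ?K = "pt [GenK]" and ?E = "pt [GenE]" and ?F = "pt [GenF]"
  have "?K ^ (2 * p) - 1 \<in> uq_rels p" "?E ^ p \<in> uq_rels p" "?F ^ p \<in> uq_rels p"
    "?K * ?E * ?K ^ (2 * p - 1) - fscale (q\<^sup>2) ?E \<in> uq_rels p"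
    "?K * ?F * ?K ^ (2 * p - 1) - fscale (inverse (q\<^sup>2)) ?F \<in> uq_rels p"
    "?E * ?F - ?F * ?E - fscale (1 / w) (?K - ?K ^ (2 * p - 1)) \<in> uq_rels p"
    unfolding uq_rels_def Let_def q_def w_def by blast+
  note zz = this[THEN z]
  note s = mi pw g h(2-6)
  show "K [^]\<^bsub>U\<^esub> (2 * p) = \<one>\<^bsub>U\<^esub>"
    by (rule eq) (use zz(1) in \<open>simp_all add: s del: One_nat_def\<close>)
  show "E [^]\<^bsub>U\<^esub> p = \<zero>\<^bsub>U\<^esub>" "F [^]\<^bsub>U\<^esub> p = \<zero>\<^bsub>U\<^esub>"
    using zz(2,3) by (simp_all add: s)
  show "K \<otimes>\<^bsub>U\<^esub> E \<otimes>\<^bsub>U\<^esub> K [^]\<^bsub>U\<^esub> (2 * p - 1) = q\<^sup>2 \<odot>\<^bsub>U\<^esub> E"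
    by (rule eq) (use zz(4) in \<open>simp_all add: s del: One_nat_def\<close>)
  show "K \<otimes>\<^bsub>U\<^esub> F \<otimes>\<^bsub>U\<^esub> K [^]\<^bsub>U\<^esub> (2 * p - 1) = inverse (q\<^sup>2) \<odot>\<^bsub>U\<^esub> F"
    by (rule eq) (use zz(5) in \<open>simp_all add: s del: One_nat_def\<close>)
  let ?d = "(1 / w) \<odot>\<^bsub>U\<^esub> K \<oplus>\<^bsub>U\<^esub> (- (1 / w)) \<odot>\<^bsub>U\<^esub> K [^]\<^bsub>U\<^esub> (2 * p - 1)"
  have "(E \<otimes>\<^bsub>U\<^esub> F \<ominus>\<^bsub>U\<^esub> F \<otimes>\<^bsub>U\<^esub> E) \<ominus>\<^bsub>U\<^esub> ?d = \<zero>\<^bsub>U\<^esub>"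
    using zz(6) by (simp add: s del: One_nat_def) (simp add: cvec_minus[OF U_vec] del: One_nat_def)
  then have "E \<otimes>\<^bsub>U\<^esub> F \<ominus>\<^bsub>U\<^esub> F \<otimes>\<^bsub>U\<^esub> E = ?d"
    by (rule eq) simp_all
  then have "F \<otimes>\<^bsub>U\<^esub> E \<oplus>\<^bsub>U\<^esub> (E \<otimes>\<^bsub>U\<^esub> F \<ominus>\<^bsub>U\<^esub> F \<otimes>\<^bsub>U\<^esub> E) = F \<otimes>\<^bsub>U\<^esub> E \<oplus>\<^bsub>U\<^esub> ?d" by simp
  then show "E \<otimes>\<^bsub>U\<^esub> F = F \<otimes>\<^bsub>U\<^esub> E \<oplus>\<^bsub>U\<^esub> ?d"
    by (simp add: cvec_minus[OF U_vec] cvec_ac[OF U_vec] cvec_collect[OF U_vec])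
qed

abbreviation H_mult (infixl "\<cdot>" 70) where "x \<cdot> y \<equiv> x \<otimes>\<^bsub>H\<^esub> y"

lemma H_alg [simp]: "complex_algebra H"
  by (rule complex_algebra_image[OF U_alg, of _ "\<lambda>x. x"]) (simp_all add: H_simps)

lemma H_vec [simp]: "cvec H" by simp

lemma H_generated: "alg_generated H {E, K, F}"
  using uq_generated by (simp add: alg_generated_def H_simps)

lemma alg_hom_H: "alg_hom H B = alg_hom U B"
  by (auto simp: alg_hom_def ring_hom_def lin_maps_def H_simps)

lemma alg_hom_op_H: "alg_hom B (op_alg H) = alg_hom B (op_alg U)"
  by (auto simp: alg_hom_def ring_hom_def lin_maps_def H_simps)

text \<open>The record \<open>uq p\<close> extends \<open>uq_alg p\<close>, and the tensor product
  depends only on the common fields.\<close>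

lemma tensor_H: "tensor H H = tensor U U"
proof -
  have "formal_mult H H = formal_mult U U" by (intro ext) (simp add: formal_mult_def H_simps)
  then show ?thesis by (simp add: tensor_def tensor_quot_def bilin_rels_def H_simps)
qed

lemma inv_H: "inv\<^bsub>U\<^esub> K = L"
  by (simp add: L_def m_inv_def H_simps)

lemma EKF [simp]: "E \<in> carrier H" "K \<in> carrier H" "F \<in> carrier H"
  by (simp_all add: H_simps)

lemma pow_H: "x [^]\<^bsub>U\<^esub> (n::nat) = x [^]\<^bsub>H\<^esub> n"
  by (simp add: nat_pow_def H_simps)

lemma L_eq: "L = K [^]\<^bsub>H\<^esub> (2 * p - 1)"
  and K_L [simp]: "K \<cdot> L = \<one>\<^bsub>H\<^esub>" and L_K [simp]: "L \<cdot> K = \<one>\<^bsub>H\<^esub>" and L_closed [simp]: "L \<in> carrier H"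
proof -
  interpret H: complex_algebra H by simp
  let ?l = "K [^]\<^bsub>H\<^esub> (2 * p - 1)"
  have s: "Suc (2 * p - 1) = 2 * p" using p2 by simp
  have one: "K [^]\<^bsub>H\<^esub> (2 * p) = \<one>\<^bsub>H\<^esub>" using uq_relations(1) by (simp add: pow_H H_simps)
  have 1: "?l \<cdot> K = \<one>\<^bsub>H\<^esub>"
    using H.nat_pow_Suc[of K "2 * p - 1"] unfolding s one by simp
  have 2: "K \<cdot> ?l = \<one>\<^bsub>H\<^esub>"
    using H.nat_pow_Suc2[of K "2 * p - 1"] unfolding s one by simp
  have l: "?l \<in> carrier H" by simp
  show "L = ?l" unfolding L_def by (rule H.inv_unique'[symmetric]) (simp_all only: EKF l 1 2)
  then show "K \<cdot> L = \<one>\<^bsub>H\<^esub>" "L \<cdot> K = \<one>\<^bsub>H\<^esub>" "L \<in> carrier H"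
    by (simp_all only: 1 2 l)
qed

lemma pow_rels: "K [^]\<^bsub>H\<^esub> (2 * p) = \<one>\<^bsub>H\<^esub>" "E [^]\<^bsub>H\<^esub> p = \<zero>\<^bsub>H\<^esub>" "F [^]\<^bsub>H\<^esub> p = \<zero>\<^bsub>H\<^esub>" "L [^]\<^bsub>H\<^esub> (2 * p) = \<one>\<^bsub>H\<^esub>"
proof -
  interpret H: complex_algebra H by simp
  show K: "K [^]\<^bsub>H\<^esub> (2 * p) = \<one>\<^bsub>H\<^esub>" and "E [^]\<^bsub>H\<^esub> p = \<zero>\<^bsub>H\<^esub>" "F [^]\<^bsub>H\<^esub> p = \<zero>\<^bsub>H\<^esub>"
    using uq_relations(1-3) by (simp_all add: pow_H H_simps)
  have "L [^]\<^bsub>H\<^esub> (2 * p) = (K [^]\<^bsub>H\<^esub> (2 * p)) [^]\<^bsub>H\<^esub> (2 * p - 1)"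
    unfolding L_eq by (simp add: H.nat_pow_pow mult.commute del: One_nat_def)
  then show "L [^]\<^bsub>H\<^esub> (2 * p) = \<one>\<^bsub>H\<^esub>" by (simp add: K)
qed

lemma H_assoc: "x \<in> carrier H \<Longrightarrow> y \<in> carrier H \<Longrightarrow> z \<in> carrier H \<Longrightarrow>
    (x \<cdot> y) \<cdot> z = x \<cdot> (y \<cdot> z)"
  by (rule alg_assoc[OF H_alg])

lemma comm_rel:
  assumes "x \<in> carrier H" "K \<cdot> x \<cdot> L = c \<odot>\<^bsub>H\<^esub> x" "c \<noteq> 0"
  shows "K \<cdot> x = c \<odot>\<^bsub>H\<^esub> (x \<cdot> K)" "L \<cdot> x = inverse c \<odot>\<^bsub>H\<^esub> (x \<cdot> L)"
proof -
  have "K \<cdot> x = (K \<cdot> x \<cdot> L) \<cdot> K" using assms(1) by (simp add: H_assoc)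
  then show 1: "K \<cdot> x = c \<odot>\<^bsub>H\<^esub> (x \<cdot> K)" using assms by simp
  have "x \<cdot> L = L \<cdot> (K \<cdot> x \<cdot> L)" using assms(1) by (simp add: H_assoc[symmetric])
  then have "x \<cdot> L = c \<odot>\<^bsub>H\<^esub> (L \<cdot> x)" using assms by simp
  then show "L \<cdot> x = inverse c \<odot>\<^bsub>H\<^esub> (x \<cdot> L)" using assms by simp
qed

text \<open>As rewrite rules these move products towards the order \<open>F\<close>,
  \<open>E\<close>, powers of \<open>K\<close>.\<close>

lemma rels:
  "K \<cdot> E = q\<^sup>2 \<odot>\<^bsub>H\<^esub> (E \<cdot> K)" "L \<cdot> E = inverse (q\<^sup>2) \<odot>\<^bsub>H\<^esub> (E \<cdot> L)"
  "K \<cdot> F = inverse (q\<^sup>2) \<odot>\<^bsub>H\<^esub> (F \<cdot> K)" "L \<cdot> F = q\<^sup>2 \<odot>\<^bsub>H\<^esub> (F \<cdot> L)"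
  "E \<cdot> F = F \<cdot> E \<oplus>\<^bsub>H\<^esub> ((1 / w) \<odot>\<^bsub>H\<^esub> K \<oplus>\<^bsub>H\<^esub> (- (1 / w)) \<odot>\<^bsub>H\<^esub> L)"
  using comm_rel[of E "q\<^sup>2"] comm_rel[of F "inverse (q\<^sup>2)"] uq_relations(4-6)
  by (simp_all add: L_eq pow_H H_simps)

lemma comm_assoc:
  assumes "a \<cdot> b = c \<odot>\<^bsub>H\<^esub> (b \<cdot> a)" "a \<in> carrier H" "b \<in> carrier H" "x \<in> carrier H"
  shows "a \<cdot> (b \<cdot> x) = c \<odot>\<^bsub>H\<^esub> (b \<cdot> (a \<cdot> x))"
  using assms by (simp add: H_assoc[symmetric])

lemma rels_assoc:
  assumes x: "x \<in> carrier H"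
  shows "K \<cdot> (L \<cdot> x) = x" "L \<cdot> (K \<cdot> x) = x"
  "K \<cdot> (E \<cdot> x) = q\<^sup>2 \<odot>\<^bsub>H\<^esub> (E \<cdot> (K \<cdot> x))"
  "L \<cdot> (E \<cdot> x) = inverse (q\<^sup>2) \<odot>\<^bsub>H\<^esub> (E \<cdot> (L \<cdot> x))"
  "K \<cdot> (F \<cdot> x) = inverse (q\<^sup>2) \<odot>\<^bsub>H\<^esub> (F \<cdot> (K \<cdot> x))"
  "L \<cdot> (F \<cdot> x) = q\<^sup>2 \<odot>\<^bsub>H\<^esub> (F \<cdot> (L \<cdot> x))"
  using x comm_assoc[OF rels(1)] comm_assoc[OF rels(2)] comm_assoc[OF rels(3)] comm_assoc[OF rels(4)]
  by (simp_all add: H_assoc[symmetric])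

lemmas H_lin = cvec_ac[OF H_vec] cvec_collect[OF H_vec] cvec_collect_far[OF H_vec]

abbreviation "HH \<equiv> tensor H H"
lemmas HH_lin = cvec_ac[OF tensor_cvec[OF H_vec H_vec]] cvec_collect[OF tensor_cvec[OF H_vec H_vec]]
  cvec_collect_far[OF tensor_cvec[OF H_vec H_vec]]

section \<open>Coproduct, counit and antipode on generators\<close>

lemma uq_images_comult:
  "uq_images HH ((E \<boxtimes>\<^bsub>HH\<^esub> K) \<oplus>\<^bsub>HH\<^esub> (\<one>\<^bsub>H\<^esub> \<boxtimes>\<^bsub>HH\<^esub> E)) (K \<boxtimes>\<^bsub>HH\<^esub> K) (L \<boxtimes>\<^bsub>HH\<^esub> L)
    ((F \<boxtimes>\<^bsub>HH\<^esub> \<one>\<^bsub>H\<^esub>) \<oplus>\<^bsub>HH\<^esub> (L \<boxtimes>\<^bsub>HH\<^esub> F))"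
proof -
  interpret HH: complex_algebra HH by simp
  interpret H: complex_algebra H by simp
  have z: "(a \<boxtimes>\<^bsub>HH\<^esub> b) [^]\<^bsub>HH\<^esub> p = \<zero>\<^bsub>HH\<^esub>" if "a \<in> carrier H" "b \<in> carrier H"
    "a [^]\<^bsub>H\<^esub> p = \<zero>\<^bsub>H\<^esub> \<or> b [^]\<^bsub>H\<^esub> p = \<zero>\<^bsub>H\<^esub>" for a b
  proof -
    have "a' \<boxtimes>\<^bsub>HH\<^esub> b' = \<zero>\<^bsub>HH\<^esub>" if "a' \<in> carrier H" "b' \<in> carrier H" "a' = \<zero>\<^bsub>H\<^esub> \<or> b' = \<zero>\<^bsub>H\<^esub>" for a' b'
      using that tensor_pure(4)[OF H_vec H_vec, of "\<one>\<^bsub>H\<^esub>" b' 0] tensor_pure(5)[OF H_vec H_vec, of a' "\<one>\<^bsub>H\<^esub>" 0] by auto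
    then show ?thesis using that by (simp add: pure_pow)
  qed
  have eq: "(q\<^sup>2) ^ p = 1" "\<And>i. 0 < i \<Longrightarrow> i < p \<Longrightarrow> (q\<^sup>2) ^ i \<noteq> 1" using q_sq_p q_pow_ne_1 by auto
  \<comment> \<open>The summands are interchanged: with the tensor of \<open>E\<close> and
    \<open>K\<close> in second place, the relation for \<open>K \<cdot> E\<close> gives the
    q-commutation with factor \<open>q\<^sup>2\<close>.\<close>
  have "((\<one>\<^bsub>H\<^esub> \<boxtimes>\<^bsub>HH\<^esub> E) \<oplus>\<^bsub>HH\<^esub> (E \<boxtimes>\<^bsub>HH\<^esub> K)) [^]\<^bsub>HH\<^esub> p = \<zero>\<^bsub>HH\<^esub>"
    by (rule HH.qbinomial_nilpotent[OF _ _ _ eq]) (simp_all add: rels pow_rels z)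
  moreover have "((F \<boxtimes>\<^bsub>HH\<^esub> \<one>\<^bsub>H\<^esub>) \<oplus>\<^bsub>HH\<^esub> (L \<boxtimes>\<^bsub>HH\<^esub> F)) [^]\<^bsub>HH\<^esub> p = \<zero>\<^bsub>HH\<^esub>"
    by (rule HH.qbinomial_nilpotent[OF _ _ _ eq]) (simp_all add: rels pow_rels z)
  ultimately show ?thesis
    unfolding uq_images_def
    by (intro conjI) (simp_all add: rels pow_rels pure_pow tensor_one HH_lin H_lin)
qed

lemma uq_images_counit: "uq_images complex_alg 0 1 1 0"
  using p2 by (simp add: uq_images_def pow_complex_alg)

lemma uq_images_antipode:
  "uq_images (op_alg H) ((- 1) \<odot>\<^bsub>H\<^esub> (E \<cdot> L)) L K ((- 1) \<odot>\<^bsub>H\<^esub> (K \<cdot> F))"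
proof -
  interpret H: complex_algebra H by simp
  have "((- 1) \<odot>\<^bsub>H\<^esub> (E \<cdot> L)) [^]\<^bsub>H\<^esub> p = \<zero>\<^bsub>H\<^esub>"
  proof -
    obtain c where "(E \<cdot> L) [^]\<^bsub>H\<^esub> p = c \<odot>\<^bsub>H\<^esub> (E [^]\<^bsub>H\<^esub> p \<cdot> L [^]\<^bsub>H\<^esub> p)"
      using qcomm_pow[OF H_alg _ _ rels(2)] by auto
    then show ?thesis by (simp add: H.smult_pow pow_rels)
  qed
  moreover have "((- 1) \<odot>\<^bsub>H\<^esub> (K \<cdot> F)) [^]\<^bsub>H\<^esub> p = \<zero>\<^bsub>H\<^esub>"
  proof -
    have FK: "F \<cdot> K = q\<^sup>2 \<odot>\<^bsub>H\<^esub> (K \<cdot> F)" by (simp add: rels)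
    then obtain c where "(K \<cdot> F) [^]\<^bsub>H\<^esub> p = c \<odot>\<^bsub>H\<^esub> (K [^]\<^bsub>H\<^esub> p \<cdot> F [^]\<^bsub>H\<^esub> p)"
      using qcomm_pow[OF H_alg EKF(2,3) FK, of p] by blast
    then show ?thesis by (simp add: H.smult_pow pow_rels)
  qed
  ultimately show ?thesis
    unfolding uq_images_def
    by (intro conjI) (simp_all add: pow_op_alg rels rels_assoc pow_rels H_assoc H_lin)
qed

lemma uq_the_hom:
  assumes "uq_images B e k l f"
  shows "the_alg_hom U B {(E, e), (K, k), (F, f)} \<in> alg_hom H B"
    and "the_alg_hom U B {(E, e), (K, k), (F, f)} E = e" "the_alg_hom U B {(E, e), (K, k), (F, f)} K = k"
    "the_alg_hom U B {(E, e), (K, k), (F, f)} F = f"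
proof -
  obtain \<phi> where \<phi>: "\<phi> \<in> alg_hom U B" "\<phi> E = e" "\<phi> K = k" "\<phi> F = f" by (rule uq_hom[OF assms])
  have "alg_generated U (fst ` {(E, e), (K, k), (F, f)})" using uq_generated by simp
  note t = the_alg_hom[OF U_alg this \<phi>(1)]
  show "the_alg_hom U B {(E, e), (K, k), (F, f)} \<in> alg_hom H B"
    unfolding alg_hom_H by (rule t) (use \<phi> in auto)
  show "the_alg_hom U B {(E, e), (K, k), (F, f)} E = e" "the_alg_hom U B {(E, e), (K, k), (F, f)} K = k"
    "the_alg_hom U B {(E, e), (K, k), (F, f)} F = f"
    by (rule t; use \<phi> in auto)+
qed

lemma \<Delta>_hom: "comult H \<in> alg_hom H HH"
  and \<Delta>_gens [simp]: "comult H E = (E \<boxtimes>\<^bsub>HH\<^esub> K) \<oplus>\<^bsub>HH\<^esub> (\<one>\<^bsub>H\<^esub> \<boxtimes>\<^bsub>HH\<^esub> E)" "comult H K = K \<boxtimes>\<^bsub>HH\<^esub> K"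
    "comult H F = (F \<boxtimes>\<^bsub>HH\<^esub> \<one>\<^bsub>H\<^esub>) \<oplus>\<^bsub>HH\<^esub> (L \<boxtimes>\<^bsub>HH\<^esub> F)"
proof -
  have e: "comult H = the_alg_hom U HH {(E, (E \<boxtimes>\<^bsub>HH\<^esub> K) \<oplus>\<^bsub>HH\<^esub> (\<one>\<^bsub>H\<^esub> \<boxtimes>\<^bsub>HH\<^esub> E)), (K, K \<boxtimes>\<^bsub>HH\<^esub> K),
      (F, (F \<boxtimes>\<^bsub>HH\<^esub> \<one>\<^bsub>H\<^esub>) \<oplus>\<^bsub>HH\<^esub> (L \<boxtimes>\<^bsub>HH\<^esub> F))}"
    by (simp add: H_simps uq_comult_def Let_def tensor_H inv_H)
  show "comult H \<in> alg_hom H HH" "comult H E = (E \<boxtimes>\<^bsub>HH\<^esub> K) \<oplus>\<^bsub>HH\<^esub> (\<one>\<^bsub>H\<^esub> \<boxtimes>\<^bsub>HH\<^esub> E)" "comult H K = K \<boxtimes>\<^bsub>HH\<^esub> K"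
    "comult H F = (F \<boxtimes>\<^bsub>HH\<^esub> \<one>\<^bsub>H\<^esub>) \<oplus>\<^bsub>HH\<^esub> (L \<boxtimes>\<^bsub>HH\<^esub> F)"
    unfolding e by (rule uq_the_hom[OF uq_images_comult])+
qed

lemma \<epsilon>_hom: "counit H \<in> alg_hom H complex_alg"
  and \<epsilon>_gens [simp]: "counit H E = 0" "counit H K = 1" "counit H F = 0"
proof -
  have e: "counit H = the_alg_hom U complex_alg {(E, 0), (K, 1), (F, 0)}"
    by (simp add: H_simps uq_counit_def Let_def)
  show "counit H \<in> alg_hom H complex_alg" "counit H E = 0" "counit H K = 1" "counit H F = 0"
    unfolding e by (rule uq_the_hom[OF uq_images_counit])+
qed

lemma S_hom: "antipode H \<in> alg_hom H (op_alg H)"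
  and S_gens [simp]: "antipode H E = (- 1) \<odot>\<^bsub>H\<^esub> (E \<cdot> L)" "antipode H K = L"
    "antipode H F = (- 1) \<odot>\<^bsub>H\<^esub> (K \<cdot> F)"
proof -
  have im: "uq_images (op_alg U) ((- 1) \<odot>\<^bsub>H\<^esub> (E \<cdot> L)) L K ((- 1) \<odot>\<^bsub>H\<^esub> (K \<cdot> F))"
    using uq_images_antipode by (simp add: uq_images_def H_simps nat_pow_def)
  have L: "L \<in> carrier U" using L_closed by (simp add: H_simps)
  have e: "antipode H = the_alg_hom U (op_alg U) {(E, (- 1) \<odot>\<^bsub>H\<^esub> (E \<cdot> L)), (K, L), (F, (- 1) \<odot>\<^bsub>H\<^esub> (K \<cdot> F))}"
    using L by (simp add: H_simps uq_antipode_def Let_def inv_H cvec_uminus[OF U_vec])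
  show "antipode H \<in> alg_hom H (op_alg H)" "antipode H E = (- 1) \<odot>\<^bsub>H\<^esub> (E \<cdot> L)" "antipode H K = L"
    "antipode H F = (- 1) \<odot>\<^bsub>H\<^esub> (K \<cdot> F)"
    unfolding e alg_hom_op_H by (rule uq_the_hom[OF im])+
qed

lemmas \<Delta>_simps [simp] = alg_homD(2-6)[OF \<Delta>_hom]
lemmas \<epsilon>_simps [simp] = alg_homD(3-6)[OF \<epsilon>_hom, simplified]
lemmas S_simps [simp] = alg_homD(2-6)[OF S_hom, simplified]

lemma S_L [simp]: "antipode H L = K" and \<Delta>_L [simp]: "comult H L = L \<boxtimes>\<^bsub>HH\<^esub> L" and \<epsilon>_L [simp]: "counit H L = 1"
proof -
  interpret H: complex_algebra H by simp
  interpret HH: complex_algebra HH by simp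
  have "antipode H L \<cdot> L = \<one>\<^bsub>H\<^esub>" using S_simps(4)[of K L] by (simp del: S_simps(4))
  then have "(antipode H L \<cdot> L) \<cdot> K = K" by simp
  then show "antipode H L = K" by (simp add: H_assoc)
  have "comult H K \<otimes>\<^bsub>HH\<^esub> comult H L = \<one>\<^bsub>HH\<^esub>" using \<Delta>_simps(4)[of K L] by (simp del: \<Delta>_simps(4))
  then have "(L \<boxtimes>\<^bsub>HH\<^esub> L) \<otimes>\<^bsub>HH\<^esub> ((K \<boxtimes>\<^bsub>HH\<^esub> K) \<otimes>\<^bsub>HH\<^esub> comult H L) = L \<boxtimes>\<^bsub>HH\<^esub> L" by simp
  moreover have "(L \<boxtimes>\<^bsub>HH\<^esub> L) \<otimes>\<^bsub>HH\<^esub> (K \<boxtimes>\<^bsub>HH\<^esub> K) = \<one>\<^bsub>HH\<^esub>" by (simp add: tensor_one)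
  ultimately show "comult H L = L \<boxtimes>\<^bsub>HH\<^esub> L"
    by (simp add: alg_assoc[symmetric])
  show "counit H L = 1" using \<epsilon>_simps(3)[of K L] by (simp del: \<epsilon>_simps(3))
qed

lemma H_induct [consumes 1, case_names one E K F add mult smult]:
  assumes "h \<in> carrier H" "P \<one>\<^bsub>H\<^esub>" "P E" "P K" "P F"
    "\<And>x y. x \<in> carrier H \<Longrightarrow> y \<in> carrier H \<Longrightarrow> P x \<Longrightarrow> P y \<Longrightarrow> P (x \<oplus>\<^bsub>H\<^esub> y)"
    "\<And>x y. x \<in> carrier H \<Longrightarrow> y \<in> carrier H \<Longrightarrow> P x \<Longrightarrow> P y \<Longrightarrow> P (x \<cdot> y)"
    "\<And>c x. x \<in> carrier H \<Longrightarrow> P x \<Longrightarrow> P (c \<odot>\<^bsub>H\<^esub> x)"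
  shows "P h"
  by (rule alg_generated_induct[OF H_generated assms(1)]) (use assms in auto)

text \<open>The square of the antipode is multiplicative, so conjugation by \<open>K\<close> need
  only be recognised on generators. It yields the inverse
  \<open>h -> L \<cdot> antipode H h \<cdot> K\<close> of the antipode.\<close>

lemma S_S: "h \<in> carrier H \<Longrightarrow> antipode H (antipode H h) = K \<cdot> h \<cdot> L"
proof (induction h rule: H_induct)
  case (mult x y)
  then show ?case by (simp add: H_assoc rels_assoc)
qed (simp_all add: H_assoc rels rels_assoc)

section \<open>Hopf algebra axioms of the quantum group\<close>

text \<open>Both iterated coproducts are linear and multiplicative maps into the triple tensor
  product, so they are compared on generators.\<close>

lemma coassoc:
  assumes "h \<in> carrier H"
  shows "TL H H (tensor H HH) (\<lambda>x y. TL H H (tensor H HH)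
        (\<lambda>u v. u \<boxtimes>\<^bsub>tensor H HH\<^esub> (v \<boxtimes>\<^bsub>HH\<^esub> y)) (comult H x)) (comult H h) =
      TL H H (tensor H HH) (\<lambda>x y. TL H H (tensor H HH)
        (\<lambda>u v. x \<boxtimes>\<^bsub>tensor H HH\<^esub> (u \<boxtimes>\<^bsub>HH\<^esub> v)) (comult H y)) (comult H h)"
    (is "?A h = ?B h")
proof -
  let ?T = "tensor H HH"
  have lin: "?A \<in> lin_maps H ?T" "?B \<in> lin_maps H ?T"
    by (rule lin_mapsI; simp add: bilin_def)+
  note linD = lin_mapsD[OF lin(1)] lin_mapsD[OF lin(2)]
  have A: "?A (h \<cdot> k) = ?A h \<otimes>\<^bsub>?T\<^esub> ?A k" if "h \<in> carrier H" "k \<in> carrier H" for h k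
  proof -
    have "?A (h \<cdot> k) = TL H H ?T (\<lambda>x y. TL H H ?T (\<lambda>x' y'. TL H H ?T (\<lambda>u v. TL H H ?T (\<lambda>u' v'.
        (u \<boxtimes>\<^bsub>?T\<^esub> (v \<boxtimes>\<^bsub>HH\<^esub> y)) \<otimes>\<^bsub>?T\<^esub> (u' \<boxtimes>\<^bsub>?T\<^esub> (v' \<boxtimes>\<^bsub>HH\<^esub> y')))
        (comult H x')) (comult H x)) (comult H k)) (comult H h)"
      using that by (simp add: bilin_def)
    also have "\<dots> = TL H H ?T (\<lambda>x y. TL H H ?T (\<lambda>x' y'.
        TL H H ?T (\<lambda>u v. u \<boxtimes>\<^bsub>?T\<^esub> (v \<boxtimes>\<^bsub>HH\<^esub> y)) (comult H x) \<otimes>\<^bsub>?T\<^esub>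
        TL H H ?T (\<lambda>u' v'. u' \<boxtimes>\<^bsub>?T\<^esub> (v' \<boxtimes>\<^bsub>HH\<^esub> y')) (comult H x')) (comult H k)) (comult H h)"
      by (intro TL_cong refl, subst TL_prod) simp_all
    also have "\<dots> = ?A h \<otimes>\<^bsub>?T\<^esub> ?A k"
      by (subst TL_prod) simp_all
    finally show ?thesis .
  qed
  have B: "?B (h \<cdot> k) = ?B h \<otimes>\<^bsub>?T\<^esub> ?B k" if "h \<in> carrier H" "k \<in> carrier H" for h k
  proof -
    have "?B (h \<cdot> k) = TL H H ?T (\<lambda>x y. TL H H ?T (\<lambda>x' y'. TL H H ?T (\<lambda>u v. TL H H ?T (\<lambda>u' v'.
        (x \<boxtimes>\<^bsub>?T\<^esub> (u \<boxtimes>\<^bsub>HH\<^esub> v)) \<otimes>\<^bsub>?T\<^esub> (x' \<boxtimes>\<^bsub>?T\<^esub> (u' \<boxtimes>\<^bsub>HH\<^esub> v')))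
        (comult H y')) (comult H y)) (comult H k)) (comult H h)"
      using that by (simp add: bilin_def)
    also have "\<dots> = TL H H ?T (\<lambda>x y. TL H H ?T (\<lambda>x' y'.
        TL H H ?T (\<lambda>u v. x \<boxtimes>\<^bsub>?T\<^esub> (u \<boxtimes>\<^bsub>HH\<^esub> v)) (comult H y) \<otimes>\<^bsub>?T\<^esub>
        TL H H ?T (\<lambda>u' v'. x' \<boxtimes>\<^bsub>?T\<^esub> (u' \<boxtimes>\<^bsub>HH\<^esub> v')) (comult H y')) (comult H k)) (comult H h)"
      by (intro TL_cong refl, subst TL_prod) simp_all
    also have "\<dots> = ?B h \<otimes>\<^bsub>?T\<^esub> ?B k"
      by (subst TL_prod) simp_all
    finally show ?thesis .
  qed
  show ?thesis using assms
  proof (induction h rule: H_induct)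
    case (add x y)
    then show ?case by (simp only: linD)
  next
    case (mult x y)
    then show ?case by (simp only: A B)
  next
    case (smult c x)
    then show ?case by (simp only: linD)
  qed (simp_all add: tensor_one bilin_def cvec_ac[where V = "tensor H HH"])
qed

lemma counit_axiom:
  assumes "h \<in> carrier H"
  shows "TL H H H (\<lambda>x y. counit H x \<odot>\<^bsub>H\<^esub> y) (comult H h) = h" (is "?A h = h")
    and "TL H H H (\<lambda>x y. counit H y \<odot>\<^bsub>H\<^esub> x) (comult H h) = h" (is "?B h = h")
proof -
  have b: "bilin H H H (\<lambda>x y. counit H x \<odot>\<^bsub>H\<^esub> y)" "bilin H H H (\<lambda>x y. counit H y \<odot>\<^bsub>H\<^esub> x)"
    by (simp_all add: bilin_def cvec_add_smult[OF H_vec] mult.commute)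
  have A: "?A (h \<cdot> k) = ?A h \<cdot> ?A k" "?B (h \<cdot> k) = ?B h \<cdot> ?B k"
    if "h \<in> carrier H" "k \<in> carrier H" for h k
    using that b by (simp_all add: TL_prod[OF H_alg] mult.commute)
  show "?A h = h" using assms
    by (induction h rule: H_induct) (simp_all only: A, simp_all add: b tensor_one)
  show "?B h = h" using assms
    by (induction h rule: H_induct) (simp_all only: A, simp_all add: b tensor_one)
qed

text \<open>Neither convolution is visibly multiplicative. For a product \<open>h \<cdot> k\<close>
  the first identity collapses the sum over \<open>h\<close> between the components of
  \<open>k\<close>, the second the sum over \<open>k\<close> between the components of
  \<open>h\<close>; so the property, not the map, passes to products.\<close>

lemma antipode_axiom:
  assumes "h \<in> carrier H"
  shows "TL H H H (\<lambda>x y. antipode H x \<cdot> y) (comult H h) = counit H h \<odot>\<^bsub>H\<^esub> \<one>\<^bsub>H\<^esub>" (is "?A h = ?e h")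
    and "TL H H H (\<lambda>x y. x \<cdot> antipode H y) (comult H h) = counit H h \<odot>\<^bsub>H\<^esub> \<one>\<^bsub>H\<^esub>" (is "?B h = ?e h")
proof -
  have b: "bilin H H H (\<lambda>x y. antipode H x \<cdot> y)" "bilin H H H (\<lambda>x y. x \<cdot> antipode H y)"
    by (simp_all add: bilin_def)
  have A: "?A (h \<cdot> k) = ?e (h \<cdot> k)"
    if "h \<in> carrier H" "k \<in> carrier H" "?A h = ?e h" "?A k = ?e k" for h k
  proof -
    have "?A (h \<cdot> k) = TL H H H (\<lambda>x y. TL H H H (\<lambda>x' y'.
        antipode H x' \<cdot> ((antipode H x \<cdot> y) \<cdot> y')) (comult H k)) (comult H h)"
      using that(1,2) b by (simp add: H_assoc)
    also have "\<dots> = TL H H H (\<lambda>x' y'. TL H H H (\<lambda>x y.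
        antipode H x' \<cdot> ((antipode H x \<cdot> y) \<cdot> y')) (comult H h)) (comult H k)"
      by (rule TL_swap) simp_all
    also have "\<dots> = TL H H H (\<lambda>x' y'. antipode H x' \<cdot> (?A h \<cdot> y')) (comult H k)"
      by (intro TL_cong refl) (simp add: TL_mult_left[OF H_alg] TL_mult_right[OF H_alg])
    also have "\<dots> = counit H h \<odot>\<^bsub>H\<^esub> ?A k" using that(1) by (simp add: that(3))
    also have "\<dots> = ?e (h \<cdot> k)" using that(1,2) by (simp add: that(4))
    finally show ?thesis .
  qed
  have B: "?B (h \<cdot> k) = ?e (h \<cdot> k)"
    if "h \<in> carrier H" "k \<in> carrier H" "?B h = ?e h" "?B k = ?e k" for h k
  proof -
    have "?B (h \<cdot> k) = TL H H H (\<lambda>x y. TL H H H (\<lambda>x' y'.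
        x \<cdot> ((x' \<cdot> antipode H y') \<cdot> antipode H y)) (comult H k)) (comult H h)"
      using that(1,2) b by (simp add: H_assoc)
    also have "\<dots> = TL H H H (\<lambda>x y. x \<cdot> (?B k \<cdot> antipode H y)) (comult H h)"
      by (intro TL_cong refl) (simp add: TL_mult_left[OF H_alg] TL_mult_right[OF H_alg])
    also have "\<dots> = counit H k \<odot>\<^bsub>H\<^esub> ?B h" using that(2) by (simp add: that(4))
    also have "\<dots> = ?e (h \<cdot> k)" using that(1,2) by (simp add: that(3) mult.commute)
    finally show ?thesis .
  qed
  have add: "?e (x \<oplus>\<^bsub>H\<^esub> y) = ?e x \<oplus>\<^bsub>H\<^esub> ?e y" if "x \<in> carrier H" "y \<in> carrier H" for x y
    using that by (simp add: cvec_add_smult[OF H_vec])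
  show "?A h = ?e h" using assms
  proof (induction h rule: H_induct)
    case (mult x y)
    then show ?case by (rule A)
  next
    case (add x y)
    then show ?case by (simp add: b cvec_add_smult[OF H_vec])
  qed (simp_all add: b tensor_one H_assoc rels rels_assoc H_lin)
  show "?B h = ?e h" using assms
  proof (induction h rule: H_induct)
    case (mult x y)
    then show ?case by (rule B)
  next
    case (add x y)
    then show ?case by (simp add: b cvec_add_smult[OF H_vec])
  qed (simp_all add: b tensor_one H_assoc rels rels_assoc H_lin)
qed

lemma S_comult:
  assumes "h \<in> carrier H"
  shows "comult H (antipode H h) = TL H H HH (\<lambda>x y. antipode H y \<boxtimes>\<^bsub>HH\<^esub> antipode H x) (comult H h)" (is "_ = ?A h")
  using assms
proof (induction h rule: H_induct)
  case (mult x y)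
  have b: "bilin H H HH (\<lambda>x y. antipode H y \<boxtimes>\<^bsub>HH\<^esub> antipode H x)" by (simp add: bilin_def)
  have "?A (x \<cdot> y) = TL H H HH (\<lambda>u v. TL H H HH (\<lambda>u' v'.
      (antipode H v' \<boxtimes>\<^bsub>HH\<^esub> antipode H u') \<otimes>\<^bsub>HH\<^esub> (antipode H v \<boxtimes>\<^bsub>HH\<^esub> antipode H u)) (comult H y)) (comult H x)"
    using mult b by simp
  also have "\<dots> = TL H H HH (\<lambda>u' v'. TL H H HH (\<lambda>u v.
      (antipode H v' \<boxtimes>\<^bsub>HH\<^esub> antipode H u') \<otimes>\<^bsub>HH\<^esub> (antipode H v \<boxtimes>\<^bsub>HH\<^esub> antipode H u)) (comult H x)) (comult H y)"
    by (rule TL_swap) simp_all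
  also have "\<dots> = ?A y \<otimes>\<^bsub>HH\<^esub> ?A x" by (subst TL_prod) simp_all
  finally show ?case using mult by simp
qed (simp_all add: bilin_def tensor_one rels HH_lin)

lemma uq_hopf_algebra: "hopf_algebra H"
proof (intro hopf_algebra.intro hopf_algebra_axioms.intro)
  show "bij_betw (antipode H) (carrier H) (carrier H)"
  proof (rule bij_betw_byWitness[of _ "\<lambda>h. L \<cdot> antipode H h \<cdot> K"])
    show "\<forall>h\<in>carrier H. L \<cdot> antipode H (antipode H h) \<cdot> K = h"
      by (simp add: S_S H_assoc rels_assoc)
    show "\<forall>h\<in>carrier H. antipode H (L \<cdot> antipode H h \<cdot> K) = h"
      by (simp add: S_S H_assoc rels_assoc)
  qed auto
qed (simp_all add: \<Delta>_hom \<epsilon>_hom S_hom coassoc counit_axiom antipode_axiom S_comult)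

end

section \<open>Finite sums with few nonzero terms\<close>

context abelian_monoid
begin

lemma finsum_single:
  assumes "i \<in> I" "finite I" "\<And>k. k \<in> I \<Longrightarrow> g k \<in> carrier G"
  shows "(\<Oplus>k\<in>I. if k = i then g k else \<zero>) = g i"
proof -
  have "(\<Oplus>k\<in>I. if i = k then g k else \<zero>) = g i"
    by (rule finsum_singleton) (use assms in auto)
  then show ?thesis by (simp add: eq_commute[of i])
qed

lemma finsum_only:
  assumes "finite I" "\<And>k. k \<in> I \<Longrightarrow> k \<noteq> i \<Longrightarrow> f k = \<zero>" "\<And>k. k \<in> I \<Longrightarrow> f k \<in> carrier G"
  shows "(\<Oplus>k\<in>I. f k) = (if i \<in> I then f i else \<zero>)"
proof (cases "i \<in> I")
  case True
  have "(\<Oplus>k\<in>I. f k) = (\<Oplus>k\<in>I. if k = i then f i else \<zero>)"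
    by (rule finsum_cong') (use assms True in auto)
  also have "\<dots> = f i" by (rule finsum_single) (use assms True in auto)
  finally show ?thesis using True by simp
next
  case False
  have "(\<Oplus>k\<in>I. f k) = (\<Oplus>k\<in>I. \<zero>)"
    by (rule finsum_cong') (use assms False in auto)
  then show ?thesis using False by auto
qed

text \<open>An index shift on \<open>{1..p}\<close> with the outermost term replaced by zero, which
  is how multiplication by a shift matrix changes a sum over rows.\<close>

lemma finsum_shift:
  assumes g: "\<And>i. g i \<in> carrier G"
  shows "(\<Oplus>i\<in>{1..p::nat}. if i = 1 then \<zero> else g (i - 1)) = (\<Oplus>i\<in>{1..p}. if i = p then \<zero> else g i)"
proof (induction p)
  case (Suc p)
  have gc: "(\<lambda>i. if i = 1 then \<zero> else g (i - 1)) \<in> {1..p} \<rightarrow> carrier G" "g \<in> {1..p} \<rightarrow> carrier G"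
    "(\<lambda>i. if i = n then \<zero> else g i) \<in> {1..p} \<rightarrow> carrier G" for n
    using g by auto
  have ex: "(\<Oplus>i\<in>{1..p}. g i) = (if p = 0 then \<zero> else g p) \<oplus> (\<Oplus>i\<in>{1..p}. if i = p then \<zero> else g i)"
  proof (cases p)
    case (Suc m)
    have "(\<lambda>i. if i = p then \<zero> else g i) \<in> {1..m} \<rightarrow> carrier G" "g \<in> {1..m} \<rightarrow> carrier G" using g by auto
    moreover have "(\<Oplus>i\<in>{1..m}. if i = p then \<zero> else g i) = (\<Oplus>i\<in>{1..m}. g i)"
      by (rule finsum_cong') (use Suc g in auto)
    ultimately show ?thesis unfolding Suc using g Suc
      by (simp add: atLeastAtMostSuc_conv finsum_insert del: finsum_addf)
  qed simp
  have "(\<Oplus>i\<in>{1..Suc p}. if i = Suc p then \<zero> else g i) = (\<Oplus>i\<in>{1..p}. if i = Suc p then \<zero> else g i)"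
    using gc g by (simp add: atLeastAtMostSuc_conv finsum_insert)
  also have "\<dots> = (\<Oplus>i\<in>{1..p}. g i)"
    by (rule finsum_cong') (use g in auto)
  also have "\<dots> = (\<Oplus>i\<in>{1..Suc p}. if i = 1 then \<zero> else g (i - 1))"
    using gc g Suc.IH ex by (cases "p = 0") (simp_all add: atLeastAtMostSuc_conv)
  finally show ?case by simp
qed simp

lemma finsum_swap:
  assumes "finite I" "finite J" "\<And>i j. i \<in> I \<Longrightarrow> j \<in> J \<Longrightarrow> g i j \<in> carrier G"
  shows "(\<Oplus>i\<in>I. \<Oplus>j\<in>J. g i j) = (\<Oplus>j\<in>J. \<Oplus>i\<in>I. g i j)"
  using assms(1,3)
proof (induction I)
  case empty
  then show ?case by simp
next
  case (insert i I)
  have c: "(\<lambda>j. \<Oplus>i\<in>I. g i j) \<in> J \<rightarrow> carrier G" "(\<lambda>i. \<Oplus>j\<in>J. g i j) \<in> I \<rightarrow> carrier G"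
    using insert by auto
  have "(\<Oplus>i\<in>insert i I. \<Oplus>j\<in>J. g i j) = (\<Oplus>j\<in>J. g i j) \<oplus> (\<Oplus>j\<in>J. \<Oplus>i\<in>I. g i j)"
    using insert c by (subst finsum_insert) auto
  also have "\<dots> = (\<Oplus>j\<in>J. g i j \<oplus> (\<Oplus>i\<in>I. g i j))"
    using insert c by (subst finsum_addf) auto
  also have "\<dots> = (\<Oplus>j\<in>J. \<Oplus>i\<in>insert i I. g i j)"
    using insert c by (intro finsum_cong') auto
  finally show ?case .
qed

end


section \<open>Matrix algebras\<close>

locale matrix_space = restricted_quantum_group p + R: complex_algebra R
  for p :: nat and R :: "(complex, 'r, 'm) module_scheme" (structure)
begin

lemma R_alg [simp]: "complex_algebra R" by unfold_locales

lemma R_vec [simp]: "cvec R" by simp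

abbreviation "A \<equiv> mat_alg p R"
abbreviation mat_mult (infixl "\<star>" 70) where "X \<star> Y \<equiv> X \<otimes>\<^bsub>A\<^esub> Y"
abbreviation "P \<equiv> {1..p} \<times> {1..p}"
abbreviation "Z \<equiv> Zmat p R"
abbreviation "D \<equiv> Dmat p R"
abbreviation "\<rho> \<equiv> scalar_mat p R"

lemma mat_carrier: "X \<in> carrier A \<longleftrightarrow> X \<in> P \<rightarrow>\<^sub>E carrier R"
  by (simp add: mat_alg_def Let_def)

lemma mat_entry [simp]: "X \<in> carrier A \<Longrightarrow> 1 \<le> i \<Longrightarrow> i \<le> p \<Longrightarrow> 1 \<le> j \<Longrightarrow> j \<le> p \<Longrightarrow> X (i, j) \<in> carrier R"
  by (auto simp: mat_carrier)

lemma mat_eqI: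
  assumes "X \<in> carrier A" "Y \<in> carrier A"
    "\<And>i j. 1 \<le> i \<Longrightarrow> i \<le> p \<Longrightarrow> 1 \<le> j \<Longrightarrow> j \<le> p \<Longrightarrow> X (i, j) = Y (i, j)"
  shows "X = Y"
  by (rule extensionalityI[of _ P]) (use assms in \<open>auto simp: mat_carrier PiE_def\<close>)

lemma mat_ops:
  "X \<star> Y = (\<lambda>(i, j)\<in>P. \<Oplus>k\<in>{1..p}. X (i, k) \<otimes> Y (k, j))"
  "\<one>\<^bsub>A\<^esub> = (\<lambda>(i, j)\<in>P. if i = j then \<one> else \<zero>)"
  "\<zero>\<^bsub>A\<^esub> = (\<lambda>_\<in>P. \<zero>)"
  "X \<oplus>\<^bsub>A\<^esub> Y = (\<lambda>ij\<in>P. X ij \<oplus> Y ij)"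
  "c \<odot>\<^bsub>A\<^esub> X = (\<lambda>ij\<in>P. c \<odot> X ij)"
  by (simp_all add: mat_alg_def Let_def)

lemma mat_entries [simp]:
  assumes "1 \<le> i" "i \<le> p" "1 \<le> j" "j \<le> p"
  shows "(X \<star> Y) (i, j) = (\<Oplus>k\<in>{1..p}. X (i, k) \<otimes> Y (k, j))"
    "\<one>\<^bsub>A\<^esub> (i, j) = (if i = j then \<one> else \<zero>)" "\<zero>\<^bsub>A\<^esub> (i, j) = \<zero>"
    "(X \<oplus>\<^bsub>A\<^esub> Y) (i, j) = X (i, j) \<oplus> Y (i, j)" "(c \<odot>\<^bsub>A\<^esub> X) (i, j) = c \<odot> X (i, j)"
  using assms by (simp_all add: mat_ops)

lemma mat_closed:
  "X \<in> carrier A \<Longrightarrow> Y \<in> carrier A \<Longrightarrow> X \<star> Y \<in> carrier A" "\<one>\<^bsub>A\<^esub> \<in> carrier A" "\<zero>\<^bsub>A\<^esub> \<in> carrier A"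
  "X \<in> carrier A \<Longrightarrow> Y \<in> carrier A \<Longrightarrow> X \<oplus>\<^bsub>A\<^esub> Y \<in> carrier A" "X \<in> carrier A \<Longrightarrow> c \<odot>\<^bsub>A\<^esub> X \<in> carrier A"
  by (auto simp: mat_ops mat_carrier PiE_iff intro!: R.finsum_closed)

lemma mat_vec [simp]: "cvec A"
proof (rule cvecI)
  show "abelian_group A"
  proof (rule abelian_groupI)
    fix X assume "X \<in> carrier A"
    then show "\<exists>Y\<in>carrier A. Y \<oplus>\<^bsub>A\<^esub> X = \<zero>\<^bsub>A\<^esub>"
      by (intro bexI[of _ "(- 1) \<odot>\<^bsub>A\<^esub> X"] mat_eqI) (simp_all add: mat_closed cvec_collect[OF R_vec])
  qed (auto intro!: mat_eqI simp: mat_closed cvec_ac[OF R_vec])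
qed (auto intro!: mat_eqI simp: mat_closed cvec_add_smult[OF R_vec])

lemma mat_alg [simp]: "complex_algebra A"
proof (rule complex_algebraI, simp_all add: mat_closed)
  fix X assume X: "X \<in> carrier A"
  show "\<one>\<^bsub>A\<^esub> \<star> X = X"
  proof (rule mat_eqI)
    fix i j assume ij: "1 \<le> i" "i \<le> p" "1 \<le> j" "j \<le> p"
    have "(\<Oplus>k\<in>{1..p}. \<one>\<^bsub>A\<^esub> (i, k) \<otimes> X (k, j)) = (\<Oplus>k\<in>{1..p}. if k = i then X (k, j) else \<zero>)"
      by (rule R.finsum_cong') (use ij X in auto)
    also have "\<dots> = X (i, j)" by (rule R.finsum_single) (use ij X in auto)
    finally show "(\<one>\<^bsub>A\<^esub> \<star> X) (i, j) = X (i, j)" using ij by simp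
  qed (use X mat_closed in auto)
  show "X \<star> \<one>\<^bsub>A\<^esub> = X"
  proof (rule mat_eqI)
    fix i j assume ij: "1 \<le> i" "i \<le> p" "1 \<le> j" "j \<le> p"
    have "(\<Oplus>k\<in>{1..p}. X (i, k) \<otimes> \<one>\<^bsub>A\<^esub> (k, j)) = (\<Oplus>k\<in>{1..p}. if k = j then X (i, k) else \<zero>)"
      by (rule R.finsum_cong') (use ij X in auto)
    also have "\<dots> = X (i, j)" by (rule R.finsum_single) (use ij X in auto)
    finally show "(X \<star> \<one>\<^bsub>A\<^esub>) (i, j) = X (i, j)" using ij by simp
  qed (use X mat_closed in auto)
  fix Y assume Y: "Y \<in> carrier A"
  show "(c \<odot>\<^bsub>A\<^esub> X) \<star> Y = c \<odot>\<^bsub>A\<^esub> (X \<star> Y)" "X \<star> (c \<odot>\<^bsub>A\<^esub> Y) = c \<odot>\<^bsub>A\<^esub> (X \<star> Y)" for c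
  proof -
    have "c \<odot> (\<Oplus>k\<in>{1..p}. X (i, k) \<otimes> Y (k, j)) = (\<Oplus>k\<in>{1..p}. c \<odot> (X (i, k) \<otimes> Y (k, j)))"
      if "1 \<le> i" "i \<le> p" "1 \<le> j" "j \<le> p" for i j
      using that X Y R.finsum_smult_ldistr[of "{1..p}" c "\<lambda>k. X (i, k) \<otimes> Y (k, j)"] by (auto simp: Pi_def)
    then show "(c \<odot>\<^bsub>A\<^esub> X) \<star> Y = c \<odot>\<^bsub>A\<^esub> (X \<star> Y)" "X \<star> (c \<odot>\<^bsub>A\<^esub> Y) = c \<odot>\<^bsub>A\<^esub> (X \<star> Y)"
      using X Y by (auto intro!: mat_eqI R.finsum_cong' simp: mat_closed)
  qed
  fix W assume W: "W \<in> carrier A"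
  show "(X \<oplus>\<^bsub>A\<^esub> Y) \<star> W = X \<star> W \<oplus>\<^bsub>A\<^esub> Y \<star> W" "W \<star> (X \<oplus>\<^bsub>A\<^esub> Y) = W \<star> X \<oplus>\<^bsub>A\<^esub> W \<star> Y"
    using X Y W
    by (auto intro!: mat_eqI R.finsum_cong' simp: mat_closed R.l_distr R.r_distr R.finsum_addf[symmetric] simp del: R.finsum_addf)
  show "(X \<star> Y) \<star> W = X \<star> (Y \<star> W)"
  proof (rule mat_eqI)
    fix i j assume ij: "1 \<le> i" "i \<le> p" "1 \<le> j" "j \<le> p"
    have "((X \<star> Y) \<star> W) (i, j) = (\<Oplus>k\<in>{1..p}. \<Oplus>l\<in>{1..p}. X (i, l) \<otimes> (Y (l, k) \<otimes> W (k, j)))"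
      using ij X Y W by (simp, intro R.finsum_cong') (auto simp: R.finsum_ldistr R.m_assoc intro!: R.finsum_cong')
    also have "\<dots> = (\<Oplus>l\<in>{1..p}. \<Oplus>k\<in>{1..p}. X (i, l) \<otimes> (Y (l, k) \<otimes> W (k, j)))"
      by (rule R.finsum_swap) (use ij X Y W in auto)
    also have "\<dots> = (X \<star> (Y \<star> W)) (i, j)"
      using ij X Y W by (simp, intro R.finsum_cong') (auto simp: R.finsum_rdistr)
    finally show "((X \<star> Y) \<star> W) (i, j) = (X \<star> (Y \<star> W)) (i, j)" .
  qed (use X Y W mat_closed in auto)
qed

text \<open>The entries of \<open>D\<close> in closed form: \<open>w\<close> times
  \<open>q powi (1 - i)\<close> times the q-number of \<open>i\<close>. They solve the recursion
  \<open>\<beta>_Suc\<close> with initial value 0 and return to 0 at \<open>p\<close>.\<close>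

definition \<beta> :: "nat \<Rightarrow> complex" where "\<beta> i = q * (1 - inverse (q\<^sup>2) ^ i)"

lemma \<beta>_0 [simp]: "\<beta> 0 = 0" and \<beta>_p [simp]: "\<beta> p = 0"
  by (simp_all add: \<beta>_def power_inverse q_sq_p)

lemma \<beta>_Suc: "\<beta> (Suc i) = inverse (q\<^sup>2) * \<beta> i + w"
  by (simp add: \<beta>_def w_def field_simps power2_eq_square)

lemma \<beta>_nz: "0 < i \<Longrightarrow> i < p \<Longrightarrow> \<beta> i \<noteq> 0"
  using q_pow_ne_1[of i] by (simp add: \<beta>_def power_inverse)

lemma ZD_entries [simp]:
  assumes "1 \<le> i" "i \<le> p" "1 \<le> j" "j \<le> p"
  shows "Z (i, j) = (if i = j + 1 then \<one> else \<zero>)"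
    "D (i, j) = (if j = i + 1 then \<beta> i \<odot> \<one> else \<zero>)"
    "\<rho> r (i, j) = (if i = j then r else \<zero>)"
proof -
  show "Z (i, j) = (if i = j + 1 then \<one> else \<zero>)" "\<rho> r (i, j) = (if i = j then r else \<zero>)"
    using assms by (simp_all add: Zmat_def scalar_mat_def)
  have "w \<noteq> 0" using q_pow_ne_1[of 1] p2 by (auto simp: w_def field_simps power2_eq_square)
  then have "w * q powi (1 - int i) * qnum p i = q powi (1 - int i) * (q ^ i - inverse q ^ i)"
    by (simp add: qnum_def Let_def q_def[symmetric] w_def[symmetric])
  also have "\<dots> = \<beta> i"
    by (simp add: \<beta>_def power_int_diff field_simps power_mult_distrib power2_eq_square)
  finally have "w * q powi (1 - int i) * qnum p i = \<beta> i" .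
  then show "D (i, j) = (if j = i + 1 then \<beta> i \<odot> \<one> else \<zero>)"
    using assms by (simp add: Dmat_def Let_def q_def[symmetric] w_def[symmetric])
qed

lemma ZD_closed [simp]: "Z \<in> carrier A" "D \<in> carrier A" "r \<in> carrier R \<Longrightarrow> \<rho> r \<in> carrier A"
  by (auto simp: mat_carrier Zmat_def Dmat_def scalar_mat_def Let_def)

text \<open>At most one summand of each matrix product is nonzero. The tests for 1 and
  \<open>p\<close> cover the border, where its index would leave the range.\<close>

lemma shift_entries:
  assumes X: "X \<in> carrier A" and ij: "1 \<le> i" "i \<le> p" "1 \<le> j" "j \<le> p"
  shows "(Z \<star> X) (i, j) = (if i = 1 then \<zero> else X (i - 1, j))"
    and "(X \<star> Z) (i, j) = (if j = p then \<zero> else X (i, j + 1))"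
    and "(D \<star> X) (i, j) = (if i = p then \<zero> else \<beta> i \<odot> X (i + 1, j))"
    and "(X \<star> D) (i, j) = (if j = 1 then \<zero> else \<beta> (j - 1) \<odot> X (i, j - 1))"
    and "r \<in> carrier R \<Longrightarrow> (\<rho> r \<star> X) (i, j) = r \<otimes> X (i, j)"
    and "r \<in> carrier R \<Longrightarrow> (X \<star> \<rho> r) (i, j) = X (i, j) \<otimes> r"
proof -
  show "(Z \<star> X) (i, j) = (if i = 1 then \<zero> else X (i - 1, j))"
    by (subst mat_entries(1)[OF ij], subst R.finsum_only[of _ "i - 1"]) (use X ij in auto)
  show "(X \<star> Z) (i, j) = (if j = p then \<zero> else X (i, j + 1))"
    by (subst mat_entries(1)[OF ij], subst R.finsum_only[of _ "j + 1"]) (use X ij in auto)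
  show "(D \<star> X) (i, j) = (if i = p then \<zero> else \<beta> i \<odot> X (i + 1, j))"
    by (subst mat_entries(1)[OF ij], subst R.finsum_only[of _ "i + 1"]) (use X ij in auto)
  show "(X \<star> D) (i, j) = (if j = 1 then \<zero> else \<beta> (j - 1) \<odot> X (i, j - 1))"
    by (subst mat_entries(1)[OF ij], subst R.finsum_only[of _ "j - 1"]) (use X ij in auto)
  show "(\<rho> r \<star> X) (i, j) = r \<otimes> X (i, j)" if "r \<in> carrier R"
    by (subst mat_entries(1)[OF ij], subst R.finsum_only[of _ i]) (use X ij that in auto)
  show "(X \<star> \<rho> r) (i, j) = X (i, j) \<otimes> r" if "r \<in> carrier R"
    by (subst mat_entries(1)[OF ij], subst R.finsum_only[of _ j]) (use X ij that in auto)
qed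

lemma \<rho>_hom: "\<rho> \<in> alg_hom R A"
proof (intro alg_homI lin_mapsI)
  show "\<rho> (x \<otimes> y) = \<rho> x \<star> \<rho> y" if "x \<in> carrier R" "y \<in> carrier R" for x y
    by (rule mat_eqI) (use that in \<open>simp_all add: shift_entries(5) del: mat_entries(1)\<close>)
qed (auto intro!: mat_eqI)

text \<open>Both products are diagonal, with entries \<open>\<beta> i\<close> and
  \<open>\<beta> (i - 1)\<close>, so this is \<open>\<beta>_Suc\<close>. The values
  \<open>\<beta> 0 = 0\<close> and \<open>\<beta> p = 0\<close> make it hold in the first and last
  row.\<close>

lemma D_Z: "D \<star> Z = inverse (q\<^sup>2) \<odot>\<^bsub>A\<^esub> (Z \<star> D) \<oplus>\<^bsub>A\<^esub> w \<odot>\<^bsub>A\<^esub> \<one>\<^bsub>A\<^esub>"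
proof (rule mat_eqI)
  fix i j assume ij: "1 \<le> i" "i \<le> p" "1 \<le> j" "j \<le> p"
  have "\<beta> i = inverse (q\<^sup>2) * \<beta> (i - 1) + w" using \<beta>_Suc[of "i - 1"] ij by simp
  moreover have "(D \<star> Z) (i, j) = (if i = j then \<beta> i \<odot> \<one> else \<zero>)"
    using ij by (cases "i = j"; cases "j = p") (simp_all add: shift_entries(3) del: mat_entries(1))
  moreover have "(Z \<star> D) (i, j) = (if i = j then \<beta> (i - 1) \<odot> \<one> else \<zero>)"
    using ij by (auto simp add: shift_entries(1) simp del: mat_entries(1))
  ultimately show "(D \<star> Z) (i, j) = (inverse (q\<^sup>2) \<odot>\<^bsub>A\<^esub> (Z \<star> D) \<oplus>\<^bsub>A\<^esub> w \<odot>\<^bsub>A\<^esub> \<one>\<^bsub>A\<^esub>) (i, j)"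
    using ij by (cases "i = j") (simp_all add: cvec_collect[OF R_vec] del: mat_entries(1))
qed (simp_all add: mat_closed)

lemma Z_pow: "1 \<le> i \<Longrightarrow> i \<le> p \<Longrightarrow> 1 \<le> j \<Longrightarrow> j \<le> p \<Longrightarrow>
    (Z [^]\<^bsub>A\<^esub> k) (i, j) = (if i = j + k then \<one> else \<zero>)"
proof (induction k arbitrary: i j)
  case (Suc k)
  interpret A: complex_algebra A by simp
  show ?case
    using Suc by (simp add: shift_entries A.nat_pow_closed del: mat_entries(1))
qed simp

definition Dc :: "nat \<Rightarrow> nat \<Rightarrow> complex" where "Dc i k = (\<Prod>n\<in>{i..<i + k}. \<beta> n)"

lemma D_pow: "1 \<le> i \<Longrightarrow> i \<le> p \<Longrightarrow> 1 \<le> j \<Longrightarrow> j \<le> p \<Longrightarrow>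
    (D [^]\<^bsub>A\<^esub> k) (i, j) = (if j = i + k then Dc i k \<odot> \<one> else \<zero>)"
proof (induction k arbitrary: i j)
  case 0
  then show ?case by (simp add: Dc_def)
next
  case (Suc k)
  interpret A: complex_algebra A by simp
  show ?case
    using Suc by (auto simp: shift_entries Dc_def mult.commute simp del: mat_entries(1))
qed

lemma Z_nil: "Z [^]\<^bsub>A\<^esub> p = \<zero>\<^bsub>A\<^esub>" and D_nil: "D [^]\<^bsub>A\<^esub> p = \<zero>\<^bsub>A\<^esub>"
proof -
  interpret A: complex_algebra A by simp
  show "Z [^]\<^bsub>A\<^esub> p = \<zero>\<^bsub>A\<^esub>" "D [^]\<^bsub>A\<^esub> p = \<zero>\<^bsub>A\<^esub>"
    by (rule mat_eqI; simp add: Z_pow D_pow)+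
qed

end

section \<open>Generation of the matrix algebra by scalars, Z and D\<close>

locale matrix_algebra = matrix_space p R
  for p :: nat and R :: "(complex, 'r, 'm) module_scheme" +
  fixes G :: "'r set"
  assumes R_comm: "x \<in> carrier R \<Longrightarrow> y \<in> carrier R \<Longrightarrow> x \<otimes>\<^bsub>R\<^esub> y = y \<otimes>\<^bsub>R\<^esub> x"
    and R_generated: "alg_generated R G"
begin

lemma \<rho>_comm: "r \<in> carrier R \<Longrightarrow> X \<in> carrier A \<Longrightarrow> X \<star> \<rho> r = \<rho> r \<star> X"
  by (rule mat_eqI) (simp_all add: shift_entries R_comm del: mat_entries(1))

text \<open>The power \<open>p - 1\<close> of \<open>D\<close> has a single nonzero entry, in the
  corner \<open>(1, p)\<close>; multiplying it by powers of \<open>Z\<close> on both sides gives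
  every matrix unit.\<close>

lemma mat_generated: "alg_generated A (\<rho> ` G \<union> {Z, D})"
proof -
  interpret A: complex_algebra A by simp
  have sub: "\<rho> ` G \<union> {Z, D} \<subseteq> carrier A" using R_generated[unfolded alg_generated_def, THEN conjunct1] by auto
  have main: "Q X" if one: "Q \<one>\<^bsub>A\<^esub>" and gen: "\<forall>g\<in>\<rho> ` G \<union> {Z, D}. Q g"
    and cl: "\<forall>x\<in>carrier A. \<forall>y\<in>carrier A. Q x \<longrightarrow> Q y \<longrightarrow> Q (x \<oplus>\<^bsub>A\<^esub> y) \<and> Q (x \<star> y)"
    and sm: "\<forall>c. \<forall>x\<in>carrier A. Q x \<longrightarrow> Q (c \<odot>\<^bsub>A\<^esub> x)" and X: "X \<in> carrier A" for Q X
  proof -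
  note \<rho>D = alg_homD[OF \<rho>_hom]
  have Qr: "Q (\<rho> r)" if "r \<in> carrier R" for r
    by (rule alg_generated_induct[OF R_generated that, of "\<lambda>r. Q (\<rho> r)"]) (use one gen cl sm in \<open>simp_all add: \<rho>D\<close>)
  have pow: "Q (x [^]\<^bsub>A\<^esub> (k::nat))" if "x \<in> carrier A" "Q x" for x k
    using that cl one by (induction k) auto
  define u where "u a b = (\<lambda>(i, j)\<in>P. if i = a \<and> j = b then \<one>\<^bsub>R\<^esub> else \<zero>\<^bsub>R\<^esub>)" for a b :: nat
  have u_entry [simp]: "u a b (i, j) = (if i = a \<and> j = b then \<one>\<^bsub>R\<^esub> else \<zero>\<^bsub>R\<^esub>)"
    if "1 \<le> i" "i \<le> p" "1 \<le> j" "j \<le> p" for a b i j using that by (simp add: u_def)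
  have u_c [simp]: "u a b \<in> carrier A" for a b by (auto simp: u_def mat_carrier)
  have nz: "Dc 1 (p - 1) \<noteq> 0" using \<beta>_nz by (auto simp: Dc_def)
  have u1: "u 1 p = inverse (Dc 1 (p - 1)) \<odot>\<^bsub>A\<^esub> D [^]\<^bsub>A\<^esub> (p - 1)"
    by (rule mat_eqI) (use nz p2 in \<open>auto simp: D_pow\<close>)
  have "Q (u 1 p)" unfolding u1 using sm pow gen by simp
  \<comment> \<open>Left factors \<open>Z\<close> raise the row index from 1 to \<open>a\<close>,
    right factors lower the column index from \<open>p\<close> to \<open>b\<close>.\<close>
  have Zu: "Z [^]\<^bsub>A\<^esub> (a - 1) \<star> (u 1 p \<star> Z [^]\<^bsub>A\<^esub> (p - b)) = u a b" if "1 \<le> a" "a \<le> p" "1 \<le> b" "b \<le> p" for a b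
  proof -
    have right: "u 1 p \<star> Z [^]\<^bsub>A\<^esub> k = u 1 (p - k)" if "k < p" for k
      using that
    proof (induction k)
      case (Suc k)
      have "u 1 p \<star> Z [^]\<^bsub>A\<^esub> Suc k = u 1 (p - k) \<star> Z"
        using Suc by (simp add: A.m_assoc[symmetric])
      also have "\<dots> = u 1 (p - Suc k)"
        by (rule mat_eqI) (use Suc in \<open>auto simp: shift_entries simp del: mat_entries(1)\<close>)
      finally show ?case .
    qed simp
    have left: "Z [^]\<^bsub>A\<^esub> k \<star> u 1 b = u (Suc k) b" if "k < p" for k
      using that
    proof (induction k)
      case (Suc k)
      have "Z [^]\<^bsub>A\<^esub> Suc k \<star> u 1 b = Z \<star> u (Suc k) b"
        unfolding A.nat_pow_Suc2[OF ZD_closed(1)] using Suc by (simp add: A.m_assoc)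
      also have "\<dots> = u (Suc (Suc k)) b"
        by (rule mat_eqI) (use Suc in \<open>auto simp: shift_entries simp del: mat_entries(1)\<close>)
      finally show ?case .
    qed simp
    show ?thesis using that right[of "p - b"] left[of "a - 1"] by simp
  qed
  have Qu: "Q (u a b)" if "1 \<le> a" "a \<le> p" "1 \<le> b" "b \<le> p" for a b
    unfolding Zu[OF that, symmetric] using cl pow gen \<open>Q (u 1 p)\<close> by simp
  have fs: "Q (\<Oplus>\<^bsub>A\<^esub>k\<in>K. f k)" if "finite K" "\<And>k. k \<in> K \<Longrightarrow> f k \<in> carrier A \<and> Q (f k)" for K :: "(nat \<times> nat) set" and f
    using that
  proof (induction K)
    case empty
    have "Q (0 \<odot>\<^bsub>A\<^esub> \<one>\<^bsub>A\<^esub>)" using sm one by blast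
    then show ?case by simp
  next
    case (insert k K)
    then show ?case using cl by (subst A.finsum_insert) auto
  qed
  have ent: "(\<Oplus>\<^bsub>A\<^esub>k\<in>K. f k) (i, j) = (\<Oplus>\<^bsub>R\<^esub>k\<in>K. f k (i, j))"
    if "finite K" "\<And>k. k \<in> K \<Longrightarrow> f k \<in> carrier A" "1 \<le> i" "i \<le> p" "1 \<le> j" "j \<le> p" for K :: "(nat \<times> nat) set" and f i j
    using that(1,2)
  proof (induction K)
    case (insert k K)
    have "f k (i, j) \<in> carrier R" "(\<lambda>k. f k (i, j)) \<in> K \<rightarrow> carrier R" using insert that(3-6) by auto
    then show ?case using insert that(3-6) by (subst A.finsum_insert R.finsum_insert; auto)+
  qed (use that(3-6) in simp)
  have "X = (\<Oplus>\<^bsub>A\<^esub>k\<in>P. \<rho> (X k) \<star> u (fst k) (snd k))"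
  proof (rule mat_eqI[OF X])
    have Xc: "\<rho> (X k) \<in> carrier A" if "k \<in> P" for k using that X by auto
    then show "(\<Oplus>\<^bsub>A\<^esub>k\<in>P. \<rho> (X k) \<star> u (fst k) (snd k)) \<in> carrier A"
      by (intro A.finsum_closed) auto
    fix i j assume ij: "1 \<le> i" "i \<le> p" "1 \<le> j" "j \<le> p"
    have "(\<Oplus>\<^bsub>A\<^esub>k\<in>P. \<rho> (X k) \<star> u (fst k) (snd k)) (i, j) = (\<Oplus>\<^bsub>R\<^esub>k\<in>P. (\<rho> (X k) \<star> u (fst k) (snd k)) (i, j))"
      by (rule ent) (use Xc ij in auto)
    also have "\<dots> = (\<Oplus>\<^bsub>R\<^esub>k\<in>P. if k = (i, j) then X k else \<zero>\<^bsub>R\<^esub>)"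
      by (rule R.finsum_cong') (use X ij in \<open>auto simp: shift_entries simp del: mat_entries(1) split: if_splits\<close>)
    also have "\<dots> = X (i, j)"
      by (rule R.finsum_single) (use X ij in auto)
    finally show "X (i, j) = (\<Oplus>\<^bsub>A\<^esub>k\<in>P. \<rho> (X k) \<star> u (fst k) (snd k)) (i, j)" by simp
  qed
  moreover have "Q (\<Oplus>\<^bsub>A\<^esub>k\<in>P. \<rho> (X k) \<star> u (fst k) (snd k))"
    by (rule fs) (use X Qr Qu cl in auto)
  ultimately show "Q X" by simp
  qed
  show ?thesis
    unfolding alg_generated_def
    by (intro conjI allI impI sub) (rule ballI, erule (4) main)
qed

end

section \<open>Homomorphisms out of the matrix algebra\<close>

locale matrix_hom = matrix_algebra p R G + B: complex_algebra B
  for p :: nat and R :: "(complex, 'r, 'm) module_scheme" and G :: "'r set"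
    and B :: "(complex, 'b, 'n) module_scheme" (structure) +
  fixes f :: "'r \<Rightarrow> 'b" and z d :: 'b
  assumes f: "f \<in> alg_hom R B" and z [simp]: "z \<in> carrier B" and d [simp]: "d \<in> carrier B"
    and f_z: "r \<in> carrier R \<Longrightarrow> z \<otimes> f r = f r \<otimes> z"
    and f_d: "r \<in> carrier R \<Longrightarrow> d \<otimes> f r = f r \<otimes> d"
    and dz: "d \<otimes> z = inverse (q\<^sup>2) \<odot> (z \<otimes> d) \<oplus> w \<odot> \<one>"
    and z_nil: "z [^] p = \<zero>" and d_nil: "d [^] p = \<zero>"
begin

lemma B_alg [simp]: "complex_algebra B" by unfold_locales

lemma B_vec [simp]: "cvec B" by simp

lemmas B_lin = cvec_ac[OF B_vec] cvec_collect[OF B_vec]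

lemma f_closed [simp]: "r \<in> carrier R \<Longrightarrow> f r \<in> carrier B"
  by (rule alg_homD[OF f])

lemma f_zero [simp]: "f \<zero>\<^bsub>R\<^esub> = \<zero>"
  by (rule lin_maps_zero[OF alg_homD(1)[OF f]]) simp_all

lemma \<beta>_Suc': "\<beta> (Suc i) = \<beta> i + inverse (q\<^sup>2) ^ i * w"
  by (simp add: \<beta>_def w_def field_simps power2_eq_square)

text \<open>Commuting \<open>d\<close> through powers of \<open>z\<close> behaves like a
  q-derivative, with \<open>\<beta> k\<close> in the role of the integer \<open>k\<close>.\<close>

lemma d_z_pow:
  "d \<otimes> z [^] Suc k = inverse (q\<^sup>2) ^ Suc k \<odot> (z [^] Suc k \<otimes> d) \<oplus> \<beta> (Suc k) \<odot> z [^] k"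
proof (induction k)
  case 0
  show ?case by (simp add: dz \<beta>_Suc')
next
  case (Suc k)
  have "d \<otimes> z [^] Suc (Suc k) = (d \<otimes> z [^] Suc k) \<otimes> z"
    by (simp add: B.calg_assoc)
  also have "\<dots> = inverse (q\<^sup>2) ^ Suc k \<odot> (z [^] Suc k \<otimes> (d \<otimes> z)) \<oplus> \<beta> (Suc k) \<odot> z [^] Suc k"
    unfolding Suc by (simp add: B.calg_assoc)
  also have "\<dots> = inverse (q\<^sup>2) ^ Suc (Suc k) \<odot> (z [^] Suc (Suc k) \<otimes> d) \<oplus> \<beta> (Suc (Suc k)) \<odot> z [^] Suc k"
    unfolding dz \<beta>_Suc'[of "Suc k"] by (simp add: B.calg_assoc B_lin algebra_simps)
  finally show ?case .
qed

lemma d_pow_z: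
  "d [^] Suc k \<otimes> z = inverse (q\<^sup>2) ^ Suc k \<odot> (z \<otimes> d [^] Suc k) \<oplus> \<beta> (Suc k) \<odot> d [^] k"
proof (induction k)
  case 0
  show ?case by (simp add: dz \<beta>_Suc')
next
  case (Suc k)
  have dc: "d \<otimes> (d [^] k \<otimes> x) = d [^] k \<otimes> (d \<otimes> x)" if "x \<in> carrier B" for x
    using that B.qpower_comm[OF d d, of 1 k] by (simp add: B.calg_assoc[symmetric])
  have dd: "d \<otimes> d [^] k = d [^] Suc k" for k by (rule B.nat_pow_Suc2[symmetric]) simp
  have "d [^] Suc (Suc k) \<otimes> z = d \<otimes> (d [^] Suc k \<otimes> z)"
    unfolding dd[symmetric] by (simp add: B.calg_assoc del: B.nat_pow_Suc)
  also have "\<dots> = inverse (q\<^sup>2) ^ Suc k \<odot> ((d \<otimes> z) \<otimes> d [^] Suc k) \<oplus> \<beta> (Suc k) \<odot> d [^] Suc k"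
    unfolding Suc by (simp add: B.calg_assoc dd del: B.nat_pow_Suc)
  also have "\<dots> = inverse (q\<^sup>2) ^ Suc (Suc k) \<odot> (z \<otimes> d [^] Suc (Suc k)) \<oplus> \<beta> (Suc (Suc k)) \<odot> d [^] Suc k"
    unfolding dz \<beta>_Suc'[of "Suc k"] by (simp add: B.calg_assoc B_lin dc algebra_simps)
  finally show ?case .
qed

text \<open>\<open>e\<close>, \<open>g j\<close> and \<open>u i j\<close> are what the matrix units
  at \<open>(1, 1)\<close>, \<open>(1, j)\<close> and \<open>(i, j)\<close> become when
  \<open>Z\<close> and \<open>D\<close> are replaced by \<open>z\<close> and \<open>d\<close>. The
  constant \<open>cc j\<close> is the entry at \<open>(1, j)\<close> of the power
  \<open>j - 1\<close> of \<open>D\<close>.\<close>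

definition "cc j = (\<Prod>n\<in>{1..<j}. \<beta> n)"
definition "e = inverse (cc p) \<odot> (d [^] (p - 1) \<otimes> z [^] (p - 1))"
definition "g (j::nat) = inverse (cc j) \<odot> (e \<otimes> d [^] (j - 1))"
definition "u (i::nat) j = z [^] (i - 1) \<otimes> g j"

lemma egu_closed [simp]: "e \<in> carrier B" "g j \<in> carrier B" "u i j \<in> carrier B"
  by (simp_all add: e_def g_def u_def)

lemma cc_nz: "j \<le> p \<Longrightarrow> cc j \<noteq> 0"
  using \<beta>_nz by (auto simp: cc_def)

lemma cc_Suc: "1 \<le> j \<Longrightarrow> cc (Suc j) = cc j * \<beta> j"
  by (simp add: cc_def)

lemma d_e: "d \<otimes> e = \<zero>" and e_z: "e \<otimes> z = \<zero>"
proof -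
  have s: "Suc (p - 1) = p" using p2 by simp
  have 1: "d \<otimes> d [^] (p - 1) = \<zero>" using B.nat_pow_Suc2[OF d, of "p - 1"] unfolding s d_nil by simp
  have 2: "z [^] (p - 1) \<otimes> z = \<zero>" using B.nat_pow_Suc[of z "p - 1"] unfolding s z_nil by simp
  show "d \<otimes> e = \<zero>" using 1 by (simp add: e_def B.calg_assoc[symmetric] del: One_nat_def)
  show "e \<otimes> z = \<zero>" using 2 by (simp add: e_def B.calg_assoc del: One_nat_def)
qed

lemma d_z_pow_e:
  assumes "x \<in> carrier B" "d \<otimes> x = \<zero>"
  shows "d \<otimes> (z [^] Suc k \<otimes> x) = \<beta> (Suc k) \<odot> (z [^] k \<otimes> x)"
proof -
  have "d \<otimes> (z [^] Suc k \<otimes> x) = (d \<otimes> z [^] Suc k) \<otimes> x"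
    by (rule B.calg_assoc[symmetric]) (use assms in simp_all)
  also have "\<dots> = \<beta> (Suc k) \<odot> (z [^] k \<otimes> x)"
    unfolding d_z_pow using assms by (simp add: B.calg_assoc)
  finally show ?thesis .
qed

text \<open>As \<open>d\<close> kills \<open>e\<close>, each \<open>d\<close> removes one
  \<open>z\<close> in front of \<open>e\<close> and contributes a factor \<open>\<beta>\<close>;
  removing all \<open>p - 1\<close> of them gives \<open>cc p\<close>, the normalisation of
  \<open>e\<close>.\<close>

lemma e_idem: "e \<otimes> e = e"
proof -
  have k: "d [^] k \<otimes> (z [^] k \<otimes> e) = cc (Suc k) \<odot> e" for k
  proof (induction k)
    case 0
    show ?case by (simp add: cc_def)
  next
    case (Suc k)
    have "d [^] Suc k \<otimes> (z [^] Suc k \<otimes> e) = d [^] k \<otimes> (d \<otimes> (z [^] Suc k \<otimes> e))"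
      unfolding B.nat_pow_Suc[of d] by (rule B.calg_assoc) simp_all
    also have "\<dots> = cc (Suc (Suc k)) \<odot> e"
      unfolding d_z_pow_e[OF egu_closed(1) d_e] by (simp add: Suc cc_Suc mult.commute)
    finally show ?case .
  qed
  have "e \<otimes> e = inverse (cc p) \<odot> (d [^] (p - 1) \<otimes> (z [^] (p - 1) \<otimes> e))"
    by (subst (1) e_def) (simp add: B.calg_assoc del: One_nat_def)
  then show ?thesis using p2 cc_nz[of p] by (simp add: k)
qed

text \<open>This and the next three lemmas say that \<open>u i j\<close> multiplies with
  \<open>z\<close> and \<open>d\<close> as a matrix unit does with \<open>Z\<close> and
  \<open>D\<close>. The vanishing at the border comes from the nilpotency of \<open>z\<close> and
  \<open>d\<close>.\<close>

lemma z_u: "1 \<le> i \<Longrightarrow> i \<le> p \<Longrightarrow> z \<otimes> u i j = (if i = p then \<zero> else u (Suc i) j)"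
proof -
  assume i: "1 \<le> i" "i \<le> p"
  have "z \<otimes> u i j = z [^] Suc (i - 1) \<otimes> g j"
    unfolding B.nat_pow_Suc2[OF z] by (simp add: u_def B.calg_assoc)
  then show ?thesis using i by (auto simp: u_def z_nil simp del: B.nat_pow_Suc)
qed

lemma d_u: "1 \<le> i \<Longrightarrow> d \<otimes> u i j = (if i = 1 then \<zero> else \<beta> (i - 1) \<odot> u (i - 1) j)"
proof -
  assume i: "1 \<le> i"
  have g0: "d \<otimes> g j = \<zero>" using d_e by (simp add: g_def B.calg_assoc[symmetric])
  show ?thesis
  proof (cases "i = 1")
    case False
    then obtain k where "i = Suc (Suc k)" using i by (metis One_nat_def Suc_le_D not_less_eq_eq le_antisym)
    then show ?thesis using d_z_pow_e[OF egu_closed(2) g0, of k] by (simp add: u_def)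
  qed (simp add: u_def g0)
qed

lemma u_z: "1 \<le> j \<Longrightarrow> j \<le> p \<Longrightarrow> u i j \<otimes> z = (if j = 1 then \<zero> else u i (j - 1))"
proof -
  assume j: "1 \<le> j" "j \<le> p"
  show ?thesis
  proof (cases "j = 1")
    case False
    then obtain k where k: "j = Suc (Suc k)" using j by (metis One_nat_def Suc_le_D not_less_eq_eq le_antisym)
    have "e \<otimes> d [^] Suc k \<otimes> z = e \<otimes> (d [^] Suc k \<otimes> z)" by (rule B.calg_assoc) simp_all
    also have "\<dots> = inverse (q\<^sup>2) ^ Suc k \<odot> ((e \<otimes> z) \<otimes> d [^] Suc k) \<oplus> \<beta> (Suc k) \<odot> (e \<otimes> d [^] k)"
      unfolding d_pow_z by (simp add: B.calg_assoc del: B.nat_pow_Suc)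
    finally have "e \<otimes> d [^] Suc k \<otimes> z = \<beta> (Suc k) \<odot> (e \<otimes> d [^] k)" by (simp add: e_z del: B.nat_pow_Suc)
    then have "g j \<otimes> z = g (j - 1)"
      using j \<beta>_nz[of "Suc k"] unfolding k by (simp add: g_def cc_Suc mult.assoc del: B.nat_pow_Suc)
    then show ?thesis using False by (simp add: u_def B.calg_assoc)
  qed (simp add: u_def g_def B.calg_assoc e_z)
qed

lemma u_d: "1 \<le> j \<Longrightarrow> j \<le> p \<Longrightarrow> u i j \<otimes> d = (if j = p then \<zero> else \<beta> j \<odot> u i (Suc j))"
proof -
  assume j: "1 \<le> j" "j \<le> p"
  have "g j \<otimes> d = inverse (cc j) \<odot> (e \<otimes> d [^] Suc (j - 1))"
    by (simp add: g_def B.calg_assoc)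
  also have "\<dots> = (if j = p then \<zero> else \<beta> j \<odot> g (Suc j))"
    using j \<beta>_nz[of j] by (auto simp: d_nil g_def cc_Suc mult.left_commute[of "\<beta> j"] simp del: B.nat_pow_Suc)
  finally show ?thesis by (auto simp: u_def B.calg_assoc)
qed

end

lemma lin_maps_finsum:
  assumes V: "cvec V" and W: "cvec W" and F: "F \<in> lin_maps V W"
    and I: "finite I" and h: "\<And>i. i \<in> I \<Longrightarrow> h i \<in> carrier V"
  shows "F (\<Oplus>\<^bsub>V\<^esub>i\<in>I. h i) = (\<Oplus>\<^bsub>W\<^esub>i\<in>I. F (h i))"
proof -
  interpret V: module complex_alg V by (rule V)
  interpret W: module complex_alg W by (rule W)
  show ?thesis
    using I h
  proof (induction I)
    case empty
    then show ?case using lin_maps_zero[OF F V W] by simp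
  next
    case (insert i I)
    have c: "h i \<in> carrier V" "h \<in> I \<rightarrow> carrier V" "F (h i) \<in> carrier W" "(\<lambda>i. F (h i)) \<in> I \<rightarrow> carrier W"
      using insert.prems lin_mapsD(1)[OF F] by auto
    then show ?case
      using insert lin_mapsD(2)[OF F, of "h i" "\<Oplus>\<^bsub>V\<^esub>i\<in>I. h i"]
      by (simp add: V.finsum_insert W.finsum_insert)
  qed
qed

context matrix_hom
begin

lemma sum_mult:
  assumes "y \<in> carrier B" "\<And>i j. i \<in> {1..p} \<Longrightarrow> j \<in> {1..p} \<Longrightarrow> h i j \<in> carrier B"
  shows "y \<otimes> (\<Oplus>j\<in>{1..p}. \<Oplus>i\<in>{1..p}. h i j) = (\<Oplus>j\<in>{1..p}. \<Oplus>i\<in>{1..p}. y \<otimes> h i j)"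
proof -
  note l = lin_maps_finsum[OF B_vec B_vec lin_maps_mult_left[OF B_alg assms(1)]]
  have c: "(\<Oplus>i\<in>{1..p}. h i j) \<in> carrier B" if "j \<in> {1..p}" for j
    by (rule B.finsum_closed) (use assms that in auto)
  show ?thesis
    by (subst l, simp, erule c, rule B.finsum_cong', simp, use assms in \<open>auto intro!: B.finsum_closed\<close>, rule l, auto)
qed

lemma shift:
  assumes v: "\<And>i. 1 \<le> i \<Longrightarrow> i < p \<Longrightarrow> v i \<in> carrier B"
    and x: "\<And>i. 1 \<le> i \<Longrightarrow> i \<le> p \<Longrightarrow> x i = (if i = 1 then \<zero> else v (i - 1))"
    and y: "\<And>i. 1 \<le> i \<Longrightarrow> i \<le> p \<Longrightarrow> y i = (if i = p then \<zero> else v i)"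
  shows "(\<Oplus>i\<in>{1..p}. x i) = (\<Oplus>i\<in>{1..p}. y i)"
proof -
  \<comment> \<open>\<open>finsum_shift\<close> needs values in the carrier at all indices, so
    \<open>v\<close> is extended by zero.\<close>
  define h where "h i = (if 1 \<le> i \<and> i < p then v i else \<zero>)" for i
  have h: "h i \<in> carrier B" for i using v by (simp add: h_def)
  have "(\<Oplus>i\<in>{1..p}. x i) = (\<Oplus>i\<in>{1..p}. if i = 1 then \<zero> else h (i - 1))"
    by (rule B.finsum_cong') (use v x in \<open>auto simp: h_def\<close>)
  also have "\<dots> = (\<Oplus>i\<in>{1..p}. if i = p then \<zero> else h i)"
    by (rule B.finsum_shift[OF h])
  also have "\<dots> = (\<Oplus>i\<in>{1..p}. y i)"
    by (rule B.finsum_cong') (use v y in \<open>auto simp: h_def\<close>)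
  finally show ?thesis .
qed

text \<open>The column index is summed outside: multiplication from the left shifts rows only, so
  the sums over \<open>i\<close> can be compared for fixed \<open>j\<close>.\<close>

definition "\<phi> X = (\<Oplus>j\<in>{1..p}. \<Oplus>i\<in>{1..p}. f (X (i, j)) \<otimes> u i j)"

lemma \<phi>_cong:
  assumes "\<And>j. 1 \<le> j \<Longrightarrow> j \<le> p \<Longrightarrow> (\<Oplus>i\<in>{1..p}. x i j) = (\<Oplus>i\<in>{1..p}. y i j)"
    "\<And>i j. 1 \<le> i \<Longrightarrow> i \<le> p \<Longrightarrow> 1 \<le> j \<Longrightarrow> j \<le> p \<Longrightarrow> y i j \<in> carrier B"
  shows "(\<Oplus>j\<in>{1..p}. \<Oplus>i\<in>{1..p}. x i j) = (\<Oplus>j\<in>{1..p}. \<Oplus>i\<in>{1..p}. y i j)"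
  by (rule B.finsum_cong') (use assms in \<open>auto intro!: B.finsum_closed\<close>)

lemma \<phi>_lin: "\<phi> \<in> lin_maps A B"
proof (rule lin_mapsI)
  note fD = alg_homD[OF f]
  fix X assume X: "X \<in> carrier A"
  show "\<phi> X \<in> carrier B" unfolding \<phi>_def using X by (auto intro!: B.finsum_closed)
  show "\<phi> (c \<odot>\<^bsub>A\<^esub> X) = c \<odot> \<phi> X" for c
  proof -
    have "\<phi> (c \<odot>\<^bsub>A\<^esub> X) = (\<Oplus>j\<in>{1..p}. \<Oplus>i\<in>{1..p}. (c \<odot> \<one>) \<otimes> (f (X (i, j)) \<otimes> u i j))"
      unfolding \<phi>_def by (rule \<phi>_cong, rule B.finsum_cong') (use X in \<open>auto simp: fD\<close>)
    also have "\<dots> = (c \<odot> \<one>) \<otimes> \<phi> X"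
      unfolding \<phi>_def by (rule sum_mult[symmetric]) (use X in auto)
    finally show ?thesis using \<open>\<phi> X \<in> carrier B\<close> by simp
  qed
  fix Y assume Y: "Y \<in> carrier A"
  have "\<phi> (X \<oplus>\<^bsub>A\<^esub> Y) = (\<Oplus>j\<in>{1..p}. (\<Oplus>i\<in>{1..p}. f (X (i, j)) \<otimes> u i j) \<oplus> (\<Oplus>i\<in>{1..p}. f (Y (i, j)) \<otimes> u i j))"
    unfolding \<phi>_def
  proof (rule B.finsum_cong', simp)
    fix j assume j: "j \<in> {1..p}"
    have "(\<Oplus>i\<in>{1..p}. f ((X \<oplus>\<^bsub>A\<^esub> Y) (i, j)) \<otimes> u i j) = (\<Oplus>i\<in>{1..p}. f (X (i, j)) \<otimes> u i j \<oplus> f (Y (i, j)) \<otimes> u i j)"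
      by (rule B.finsum_cong') (use X Y j in \<open>auto simp: fD\<close>)
    also have "\<dots> = (\<Oplus>i\<in>{1..p}. f (X (i, j)) \<otimes> u i j) \<oplus> (\<Oplus>i\<in>{1..p}. f (Y (i, j)) \<otimes> u i j)"
      by (rule B.finsum_addf) (use X Y j in auto)
    finally show "(\<Oplus>i\<in>{1..p}. f ((X \<oplus>\<^bsub>A\<^esub> Y) (i, j)) \<otimes> u i j) =
      (\<Oplus>i\<in>{1..p}. f (X (i, j)) \<otimes> u i j) \<oplus> (\<Oplus>i\<in>{1..p}. f (Y (i, j)) \<otimes> u i j)" .
  qed (use X Y in \<open>auto intro!: B.finsum_closed B.a_closed\<close>)
  also have "\<dots> = \<phi> X \<oplus> \<phi> Y"
    unfolding \<phi>_def by (rule B.finsum_addf) (use X Y in \<open>auto intro!: B.finsum_closed\<close>)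
  finally show "\<phi> (X \<oplus>\<^bsub>A\<^esub> Y) = \<phi> X \<oplus> \<phi> Y" .
qed

text \<open>The images of the matrix units multiply correctly with \<open>z\<close> and
  \<open>d\<close>, and a row shift of \<open>X\<close> becomes an index shift of the sum. Left
  multiplication by generators suffices, as \<open>\<phi>_hom\<close> proceeds by induction on the
  left factor.\<close>

lemma \<phi>_left:
  assumes X: "X \<in> carrier A"
  shows "\<phi> (Z \<star> X) = z \<otimes> \<phi> X" "\<phi> (D \<star> X) = d \<otimes> \<phi> X"
    "r \<in> carrier R \<Longrightarrow> \<phi> (\<rho> r \<star> X) = f r \<otimes> \<phi> X"
proof -
  note fD = alg_homD[OF f]
  have za: "z \<otimes> (f r \<otimes> x) = f r \<otimes> (z \<otimes> x)" "d \<otimes> (f r \<otimes> x) = f r \<otimes> (d \<otimes> x)"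
    if "r \<in> carrier R" "x \<in> carrier B" for r x
    using that by (simp_all add: B.calg_assoc[symmetric] f_z f_d)
  have "z \<otimes> \<phi> X = (\<Oplus>j\<in>{1..p}. \<Oplus>i\<in>{1..p}. z \<otimes> (f (X (i, j)) \<otimes> u i j))"
    unfolding \<phi>_def by (rule sum_mult) (use X in auto)
  also have "\<dots> = \<phi> (Z \<star> X)"
    unfolding \<phi>_def
  proof (rule \<phi>_cong)
    fix j assume j: "1 \<le> j" "j \<le> p"
    show "(\<Oplus>i\<in>{1..p}. z \<otimes> (f (X (i, j)) \<otimes> u i j)) = (\<Oplus>i\<in>{1..p}. f ((Z \<star> X) (i, j)) \<otimes> u i j)"
      by (rule shift[symmetric, where v = "\<lambda>i. f (X (i, j)) \<otimes> u (Suc i) j"])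
        (use X j in \<open>simp_all add: shift_entries za z_u del: mat_entries(1)\<close>)
  qed (use X in \<open>simp_all add: mat_closed del: mat_entries(1)\<close>)
  finally show "\<phi> (Z \<star> X) = z \<otimes> \<phi> X" ..
  have "d \<otimes> \<phi> X = (\<Oplus>j\<in>{1..p}. \<Oplus>i\<in>{1..p}. d \<otimes> (f (X (i, j)) \<otimes> u i j))"
    unfolding \<phi>_def by (rule sum_mult) (use X in auto)
  also have "\<dots> = \<phi> (D \<star> X)"
    unfolding \<phi>_def
  proof (rule \<phi>_cong)
    fix j assume j: "1 \<le> j" "j \<le> p"
    show "(\<Oplus>i\<in>{1..p}. d \<otimes> (f (X (i, j)) \<otimes> u i j)) = (\<Oplus>i\<in>{1..p}. f ((D \<star> X) (i, j)) \<otimes> u i j)"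
      by (rule shift[where v = "\<lambda>i. \<beta> i \<odot> (f (X (Suc i, j)) \<otimes> u i j)"])
        (use X j in \<open>simp_all add: shift_entries za d_u fD(4) del: mat_entries(1)\<close>)
  qed (use X in \<open>simp_all add: mat_closed del: mat_entries(1)\<close>)
  finally show "\<phi> (D \<star> X) = d \<otimes> \<phi> X" ..
  show "\<phi> (\<rho> r \<star> X) = f r \<otimes> \<phi> X" if r: "r \<in> carrier R"
  proof -
    have "f r \<otimes> \<phi> X = (\<Oplus>j\<in>{1..p}. \<Oplus>i\<in>{1..p}. f r \<otimes> (f (X (i, j)) \<otimes> u i j))"
      unfolding \<phi>_def by (rule sum_mult) (use X r in auto)
    also have "\<dots> = \<phi> (\<rho> r \<star> X)"
      unfolding \<phi>_def
      by (rule \<phi>_cong, rule B.finsum_cong')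
        (use X r in \<open>auto simp: shift_entries(5) fD(5) B.calg_assoc mat_closed simp del: mat_entries(1)\<close>)
    finally show ?thesis ..
  qed
qed

lemma \<phi>_one_sum: "\<phi> \<one>\<^bsub>A\<^esub> = (\<Oplus>j\<in>{1..p}. u j j)"
  unfolding \<phi>_def
proof (rule B.finsum_cong')
  fix j assume j: "j \<in> {1..p}"
  have "(\<Oplus>i\<in>{1..p}. f (\<one>\<^bsub>A\<^esub> (i, j)) \<otimes> u i j) = (if j \<in> {1..p} then f (\<one>\<^bsub>A\<^esub> (j, j)) \<otimes> u j j else \<zero>)"
    by (rule B.finsum_only) (use j in auto)
  then show "(\<Oplus>i\<in>{1..p}. f (\<one>\<^bsub>A\<^esub> (i, j)) \<otimes> u i j) = u j j" using j by (simp add: alg_homD(6)[OF f])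
qed simp_all

text \<open>The complement \<open>y = 1 - \<phi> 1\<close> commutes with \<open>z\<close> and \<open>d\<close> and is annihilated by \<open>d\<^bsup>p-1\<^esup> z\<^bsup>p-1\<^esup>\<close>;
  commuting further powers of \<open>z\<close> and \<open>d\<close> past each other lowers both exponents to zero.\<close>

lemma \<phi>_one: "\<phi> \<one>\<^bsub>A\<^esub> = \<one>"
proof -
  define Q where "Q = (\<Oplus>j\<in>{1..p}. u j j)"
  have Qc [simp]: "Q \<in> carrier B" unfolding Q_def by (rule B.finsum_closed) simp
  note ll = lin_maps_finsum[OF B_vec B_vec lin_maps_mult_left[OF B_alg], of _ "{1..p}"]
  note lr = lin_maps_finsum[OF B_vec B_vec lin_maps_mult_right[OF B_alg], of _ "{1..p}"]
  have zQ: "z \<otimes> Q = Q \<otimes> z"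
    unfolding Q_def by (subst ll, simp, simp, simp, subst lr, simp, simp, simp,
        rule shift[symmetric, where v = "\<lambda>i. u (Suc i) i"]) (simp_all add: z_u u_z)
  have dQ: "d \<otimes> Q = Q \<otimes> d"
    unfolding Q_def by (subst ll, simp, simp, simp, subst lr, simp, simp, simp,
        rule shift[where v = "\<lambda>i. \<beta> i \<odot> u i (Suc i)"]) (simp_all add: d_u u_d)
  \<comment> \<open>\<open>u j j\<close> ends in \<open>e\<close> followed by the power
    \<open>j - 1\<close> of \<open>d\<close>, which kills \<open>e\<close> unless
    \<open>j = 1\<close>. Hence \<open>Q\<close> fixes \<open>e\<close> from the left and
    \<open>y\<close> kills it.\<close>
  have u_e: "u j j \<otimes> e = (if j = 1 then e else \<zero>)" if "1 \<le> j" for j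
  proof (cases "j = 1")
    case True
    then show ?thesis by (simp add: u_def g_def cc_def e_idem)
  next
    case False
    then have "\<exists>k. j = Suc (Suc k)" using that by presburger
    then obtain k where k: "j = Suc (Suc k)" by blast
    have "d [^] Suc k \<otimes> e = \<zero>" by (simp add: B.calg_assoc d_e)
    then show ?thesis unfolding k by (simp add: u_def g_def B.calg_assoc del: B.nat_pow_Suc)
  qed
  have Qe: "Q \<otimes> e = e"
  proof -
    have "Q \<otimes> e = (\<Oplus>j\<in>{1..p}. u j j \<otimes> e)" unfolding Q_def by (rule lr) simp_all
    also have "\<dots> = (\<Oplus>j\<in>{1..p}. if j = 1 then e else \<zero>)" by (rule B.finsum_cong') (simp_all add: u_e)
    also have "\<dots> = e" by (rule B.finsum_single) (use p2 in auto)
    finally show ?thesis .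
  qed
  define y where "y = \<one> \<oplus> (- 1) \<odot> Q"
  have y [simp]: "y \<in> carrier B" by (simp add: y_def)
  have zy: "y \<otimes> z = z \<otimes> y" and dy: "y \<otimes> d = d \<otimes> y" by (simp_all add: y_def zQ dQ)
  have ye: "y \<otimes> e = \<zero>" by (simp add: y_def Qe B_lin)
  have zpy: "y \<otimes> z [^] k = z [^] k \<otimes> y" for k :: nat
    using B.qpower_comm[OF z y, of 1 k] zy by simp
  have dpy: "y \<otimes> d [^] k = d [^] k \<otimes> y" for k :: nat
    using B.qpower_comm[OF d y, of 1 k] dy by simp
  let ?z = "z [^] (p - 1)"
  have "e \<otimes> y = y \<otimes> e"
  proof -
    have "e \<otimes> y = inverse (cc p) \<odot> (d [^] (p - 1) \<otimes> (y \<otimes> ?z))"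
      unfolding zpy by (simp add: e_def B.calg_assoc del: One_nat_def)
    also have "\<dots> = inverse (cc p) \<odot> ((y \<otimes> d [^] (p - 1)) \<otimes> ?z)"
      unfolding dpy by (simp add: B.calg_assoc del: One_nat_def)
    also have "\<dots> = y \<otimes> e"
      by (simp add: e_def B.calg_assoc del: One_nat_def)
    finally show ?thesis .
  qed
  then have "e \<otimes> y = \<zero>" using ye by simp
  then have "cc p \<odot> (e \<otimes> y) = \<zero>" by simp
  then have top: "d [^] (p - 1) \<otimes> (?z \<otimes> y) = \<zero>"
    using cc_nz[of p] by (simp add: e_def B.calg_assoc del: One_nat_def)
  have z0: "z \<otimes> ?z = \<zero>" using B.nat_pow_Suc2[OF z, of "p - 1"] z_nil p2 by simp
  have low: "d [^] k \<otimes> (?z \<otimes> y) = \<zero>" if k: "Suc k < p" "d [^] Suc k \<otimes> (?z \<otimes> y) = \<zero>" for k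
  proof -
    have zz: "z \<otimes> (?z \<otimes> y) = \<zero>" using z0 by (simp add: B.calg_assoc[symmetric] del: One_nat_def)
    have "\<zero> = d [^] Suc k \<otimes> (z \<otimes> (?z \<otimes> y))" unfolding zz by simp
    also have "\<dots> = (d [^] Suc k \<otimes> z) \<otimes> (?z \<otimes> y)" by (rule B.calg_assoc[symmetric]) simp_all
    also have "\<dots> = inverse (q\<^sup>2) ^ Suc k \<odot> (z \<otimes> (d [^] Suc k \<otimes> (?z \<otimes> y))) \<oplus> \<beta> (Suc k) \<odot> (d [^] k \<otimes> (?z \<otimes> y))"
      unfolding d_pow_z by (simp add: B.calg_assoc del: One_nat_def B.nat_pow_Suc)
    finally have "\<beta> (Suc k) \<odot> (d [^] k \<otimes> (?z \<otimes> y)) = \<zero>"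
      unfolding k(2) by simp
    then have "inverse (\<beta> (Suc k)) \<odot> (\<beta> (Suc k) \<odot> (d [^] k \<otimes> (?z \<otimes> y))) = \<zero>" by simp
    then show ?thesis using \<beta>_nz[of "Suc k"] k(1) by (simp del: One_nat_def)
  qed
  have "d [^] (p - 1 - m) \<otimes> (?z \<otimes> y) = \<zero>" if "m \<le> p - 1" for m
    using that
  proof (induction m)
    case (Suc m)
    have "Suc (p - 1 - Suc m) = p - 1 - m" using Suc.prems by simp
    then show ?case using low[of "p - 1 - Suc m"] Suc by simp
  qed (use top in simp)
  from this[of "p - 1"] have zy0: "?z \<otimes> y = \<zero>" by simp
  have low: "z [^] k \<otimes> y = \<zero>" if k: "Suc k < p" "z [^] Suc k \<otimes> y = \<zero>" for k
  proof -
    have "\<zero> = d \<otimes> (z [^] Suc k \<otimes> y)" unfolding k(2) by simp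
    also have "\<dots> = (d \<otimes> z [^] Suc k) \<otimes> y" by (rule B.calg_assoc[symmetric]) simp_all
    also have "\<dots> = inverse (q\<^sup>2) ^ Suc k \<odot> ((z [^] Suc k \<otimes> y) \<otimes> d) \<oplus> \<beta> (Suc k) \<odot> (z [^] k \<otimes> y)"
      unfolding d_z_pow by (simp add: B.calg_assoc dy del: B.nat_pow_Suc)
    finally have "\<beta> (Suc k) \<odot> (z [^] k \<otimes> y) = \<zero>"
      unfolding k(2) by simp
    then have "inverse (\<beta> (Suc k)) \<odot> (\<beta> (Suc k) \<odot> (z [^] k \<otimes> y)) = \<zero>" by simp
    then show ?thesis using \<beta>_nz[of "Suc k"] k(1) by simp
  qed
  have "z [^] (p - 1 - m) \<otimes> y = \<zero>" if "m \<le> p - 1" for m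
    using that
  proof (induction m)
    case (Suc m)
    have "Suc (p - 1 - Suc m) = p - 1 - m" using Suc.prems by simp
    then show ?case using low[of "p - 1 - Suc m"] Suc by simp
  qed (use zy0 in simp)
  from this[of "p - 1"] have "y = \<zero>" by simp
  then have "Q \<oplus> y = Q" by simp
  then have "\<one> = Q" by (simp add: y_def B_lin)
  then show ?thesis unfolding \<phi>_one_sum Q_def[symmetric] by simp
qed

lemma \<phi>_gens: "\<phi> Z = z" "\<phi> D = d" "r \<in> carrier R \<Longrightarrow> \<phi> (\<rho> r) = f r"
proof -
  interpret A: complex_algebra A by simp
  show "\<phi> Z = z" "\<phi> D = d" "r \<in> carrier R \<Longrightarrow> \<phi> (\<rho> r) = f r"
    using \<phi>_left(1,2)[of "\<one>\<^bsub>A\<^esub>"] \<phi>_left(3)[of "\<one>\<^bsub>A\<^esub>" r] by (simp_all add: \<phi>_one)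
qed

lemma \<phi>_hom: "\<phi> \<in> alg_hom A B"
proof (rule alg_homI[OF \<phi>_lin])
  interpret A: complex_algebra A by simp
  note \<phi>D = lin_mapsD[OF \<phi>_lin]
  fix X Y assume X: "X \<in> carrier A" and Y: "Y \<in> carrier A"
  have G: "r \<in> carrier R" if "r \<in> G" for r using that R_generated[unfolded alg_generated_def, THEN conjunct1] by blast
  have "\<forall>Y\<in>carrier A. \<phi> (X \<star> Y) = \<phi> X \<otimes> \<phi> Y"
    by (rule alg_generated_induct[OF mat_generated X, of "\<lambda>X. \<forall>Y\<in>carrier A. \<phi> (X \<star> Y) = \<phi> X \<otimes> \<phi> Y"])
      (use G in \<open>auto simp: \<phi>D \<phi>_one \<phi>_left \<phi>_gens A.calg_assoc B.calg_assoc\<close>)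
  then show "\<phi> (X \<star> Y) = \<phi> X \<otimes> \<phi> Y" using Y by blast
qed (rule \<phi>_one)

end

section \<open>The action\<close>

lemma end_alg_simps:
  "f \<in> carrier (end_alg V) \<longleftrightarrow> f \<in> lin_maps V V \<and> f \<in> extensional (carrier V)"
  by (simp add: end_alg_def)

lemma end_alg_apply [simp]:
  assumes "x \<in> carrier V"
  shows "(f \<otimes>\<^bsub>end_alg V\<^esub> g) x = f (g x)" "\<one>\<^bsub>end_alg V\<^esub> x = x" "\<zero>\<^bsub>end_alg V\<^esub> x = \<zero>\<^bsub>V\<^esub>"
    "(f \<oplus>\<^bsub>end_alg V\<^esub> g) x = f x \<oplus>\<^bsub>V\<^esub> g x" "(c \<odot>\<^bsub>end_alg V\<^esub> f) x = c \<odot>\<^bsub>V\<^esub> f x"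
  using assms by (simp_all add: end_alg_def compose_eq)

lemma end_alg_eqI:
  assumes "f \<in> carrier (end_alg V)" "g \<in> carrier (end_alg V)" "\<And>x. x \<in> carrier V \<Longrightarrow> f x = g x"
  shows "f = g"
  by (rule extensionalityI[of _ "carrier V"]) (use assms in \<open>auto simp: end_alg_simps\<close>)

lemma end_algI:
  assumes "cvec V" "f \<in> lin_maps V V"
  shows "(\<lambda>x\<in>carrier V. f x) \<in> carrier (end_alg V)"
  using assms by (auto simp: end_alg_simps lin_maps_def)

lemma end_algD:
  assumes "f \<in> carrier (end_alg V)"
  shows "x \<in> carrier V \<Longrightarrow> f x \<in> carrier V"
    and "x \<in> carrier V \<Longrightarrow> y \<in> carrier V \<Longrightarrow> f (x \<oplus>\<^bsub>V\<^esub> y) = f x \<oplus>\<^bsub>V\<^esub> f y"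
    and "x \<in> carrier V \<Longrightarrow> f (c \<odot>\<^bsub>V\<^esub> x) = c \<odot>\<^bsub>V\<^esub> f x"
  using assms lin_mapsD[of f V V] by (simp_all add: end_alg_simps)

lemma end_alg_algebra:
  assumes V: "cvec V"
  shows "complex_algebra (end_alg V)"
proof -
  interpret V: module complex_alg V by (rule V)
  let ?E = "end_alg V"
  note D = end_algD[of _ V]
  have ext: "f \<otimes>\<^bsub>?E\<^esub> g \<in> extensional (carrier V)" "\<one>\<^bsub>?E\<^esub> \<in> extensional (carrier V)"
    "\<zero>\<^bsub>?E\<^esub> \<in> extensional (carrier V)" "f \<oplus>\<^bsub>?E\<^esub> g \<in> extensional (carrier V)"
    "c \<odot>\<^bsub>?E\<^esub> f \<in> extensional (carrier V)" for f g c
    by (simp_all add: end_alg_def compose_def)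
  have cl: "f \<otimes>\<^bsub>?E\<^esub> g \<in> carrier ?E" if "f \<in> carrier ?E" "g \<in> carrier ?E" for f g
    unfolding end_alg_simps using D[OF that(1)] D[OF that(2)] V by (auto intro!: lin_mapsI simp: ext)
  have one: "\<one>\<^bsub>?E\<^esub> \<in> carrier ?E"
    unfolding end_alg_simps using V by (auto intro!: lin_mapsI simp: ext)
  have zero: "\<zero>\<^bsub>?E\<^esub> \<in> carrier ?E"
    unfolding end_alg_simps using V by (auto intro!: lin_mapsI simp: ext)
  have add: "f \<oplus>\<^bsub>?E\<^esub> g \<in> carrier ?E" if "f \<in> carrier ?E" "g \<in> carrier ?E" for f g
    unfolding end_alg_simps using D[OF that(1)] D[OF that(2)] V by (auto intro!: lin_mapsI simp: ext cvec_ac[OF V])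
  have sm: "c \<odot>\<^bsub>?E\<^esub> f \<in> carrier ?E" if "f \<in> carrier ?E" for f c
    unfolding end_alg_simps using D[OF that] V by (auto intro!: lin_mapsI simp: ext mult.commute)
  note cl = cl one zero add sm
  have cv: "cvec ?E"
  proof (rule cvecI)
    show "abelian_group ?E"
    proof (rule abelian_groupI)
      fix f assume f: "f \<in> carrier ?E"
      then show "\<exists>g\<in>carrier ?E. g \<oplus>\<^bsub>?E\<^esub> f = \<zero>\<^bsub>?E\<^esub>"
        by (intro bexI[of _ "(- 1) \<odot>\<^bsub>?E\<^esub> f"] end_alg_eqI[of _ V])
          (simp_all add: cl D cvec_collect[OF V] V)
    qed (auto intro!: end_alg_eqI[of _ V] simp: cl D cvec_ac[OF V] V)
  qed (auto intro!: end_alg_eqI[of _ V] simp: cl D cvec_add_smult[OF V] V)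
  show ?thesis
    by (rule complex_algebraI[OF cv]) (auto intro!: end_alg_eqI[of _ V] simp: cl D V)
qed

context restricted_quantum_group
begin

text \<open>\<open>(x, y)\<close> and \<open>(u, v)\<close> are two mutually commuting copies of the
  relation between \<open>Z\<close> and \<open>D\<close>. In the commutator of the images of
  \<open>E\<close> and \<open>F\<close> the mixed terms cancel, and the constant \<open>w\<close> of
  \<open>yx\<close> and of \<open>uv\<close> leaves the multiples of \<open>k\<close> and
  \<open>l\<close>.\<close>

lemma uq_images_split:
  fixes B :: "(complex, 'b, 'n) module_scheme" (structure)
  assumes B: "complex_algebra B"
    and cl: "x \<in> carrier B" "y \<in> carrier B" "u \<in> carrier B" "v \<in> carrier B" "k \<in> carrier B" "l \<in> carrier B"
    and kl: "k \<otimes> l = \<one>" "l \<otimes> k = \<one>" "k [^] (2 * p) = \<one>"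
    and k: "k \<otimes> x = q\<^sup>2 \<odot> (x \<otimes> k)" "k \<otimes> u = q\<^sup>2 \<odot> (u \<otimes> k)"
      "k \<otimes> y = inverse (q\<^sup>2) \<odot> (y \<otimes> k)" "k \<otimes> v = inverse (q\<^sup>2) \<odot> (v \<otimes> k)"
    and lr: "u \<otimes> x = x \<otimes> u" "v \<otimes> x = x \<otimes> v" "u \<otimes> y = y \<otimes> u" "v \<otimes> y = y \<otimes> v"
    and yx: "y \<otimes> x = inverse (q\<^sup>2) \<odot> (x \<otimes> y) \<oplus> w \<odot> \<one>"
    and uv: "u \<otimes> v = inverse (q\<^sup>2) \<odot> (v \<otimes> u) \<oplus> w \<odot> \<one>"
    and nil: "x [^] p = \<zero>" "y [^] p = \<zero>" "u [^] p = \<zero>" "v [^] p = \<zero>"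
  shows "uq_images B ((1 / w) \<odot> (u \<oplus> (- 1) \<odot> (x \<otimes> k))) k l
    ((1 / w) \<odot> (y \<oplus> (- 1) \<odot> (v \<otimes> l)))"
proof -
  interpret complex_algebra B by (rule B)
  have BV [simp]: "cvec B" using B by simp
  note [simp] = cl
  have lk: "l \<otimes> a = inverse c \<odot> (a \<otimes> l)"
    if "a \<in> carrier B" "k \<otimes> a = c \<odot> (a \<otimes> k)" "c \<noteq> 0" for a c
  proof -
    have "a \<otimes> l = (l \<otimes> k) \<otimes> (a \<otimes> l)" using that(1) by (simp add: kl)
    also have "\<dots> = l \<otimes> ((k \<otimes> a) \<otimes> l)" using that(1) by (simp add: calg_assoc)
    also have "\<dots> = c \<odot> (l \<otimes> a)" unfolding that(2) using that(1) by (simp add: calg_assoc kl)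
    finally show ?thesis using that by simp
  qed
  note l = lk[OF _ k(1)] lk[OF _ k(2)] lk[OF _ k(3)] lk[OF _ k(4)]
  \<comment> \<open>The facts \<open>ass\<close> to \<open>ass3\<close> carry the relations into
    right-nested products, so that rewriting reaches an ordered normal form.\<close>
  have ass: "a \<otimes> (b \<otimes> z) = c \<odot> (b \<otimes> (a \<otimes> z)) \<oplus> d \<odot> z"
    if "a \<otimes> b = c \<odot> (b \<otimes> a) \<oplus> d \<odot> \<one>" "a \<in> carrier B" "b \<in> carrier B" "z \<in> carrier B" for a b c d z
    using that by (simp add: calg_assoc[symmetric])
  have ass1: "a \<otimes> (b \<otimes> z) = c \<odot> (b \<otimes> (a \<otimes> z))"
    if "a \<otimes> b = c \<odot> (b \<otimes> a)" "a \<in> carrier B" "b \<in> carrier B" "z \<in> carrier B" for a b c z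
    using that by (simp add: calg_assoc[symmetric])
  have ass2: "a \<otimes> (b \<otimes> z) = b \<otimes> (a \<otimes> z)"
    if "a \<otimes> b = b \<otimes> a" "a \<in> carrier B" "b \<in> carrier B" "z \<in> carrier B" for a b z
    using that by (simp add: calg_assoc[symmetric])
  have ass3: "a \<otimes> (b \<otimes> z) = z"
    if "a \<otimes> b = \<one>" "a \<in> carrier B" "b \<in> carrier B" "z \<in> carrier B" for a b z
    using that by (simp add: calg_assoc[symmetric])
  note rules = calg_assoc k l lr yx uv kl(1,2) ass[OF yx] ass[OF uv] ass3[OF kl(1)] ass3[OF kl(2)]
    ass1[OF k(1)] ass1[OF k(2)] ass1[OF k(3)] ass1[OF k(4)] ass1[OF l(1)] ass1[OF l(2)] ass1[OF l(3)] ass1[OF l(4)]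
    ass2[OF lr(1)] ass2[OF lr(2)] ass2[OF lr(3)] ass2[OF lr(4)]
  note lin = cvec_ac[OF BV] cvec_collect[OF BV] cvec_collect_far[OF BV]
  \<comment> \<open>The summands commute up to \<open>q\<^sup>2\<close>, so the q-binomial theorem
    applies; the second is nilpotent because its factors commute up to a scalar and one of them is
    nilpotent.\<close>
  have pw: "(a \<oplus> (- 1) \<odot> (b \<otimes> c)) [^] p = \<zero>"
    if abc: "a \<in> carrier B" "b \<in> carrier B" "c \<in> carrier B" and cb: "c \<otimes> b = q\<^sup>2 \<odot> (b \<otimes> c)"
      and ba: "(b \<otimes> c) \<otimes> a = q\<^sup>2 \<odot> (a \<otimes> (b \<otimes> c))" and 0: "a [^] p = \<zero>" "b [^] p = \<zero>" for a b c
  proof (rule qbinomial_nilpotent[where z = "q\<^sup>2"])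
    obtain s where "(b \<otimes> c) [^] p = s \<odot> (b [^] p \<otimes> c [^] p)"
      using qcomm_pow[OF B abc(2,3) cb] by blast
    then have "(b \<otimes> c) [^] p = \<zero>" using abc 0 by simp
    then show "((- 1) \<odot> (b \<otimes> c)) [^] p = \<zero>" using abc by (simp add: smult_pow)
  qed (use abc 0 ba q_sq_p q_pow_ne_1 in simp_all)
  have "((1 / w) \<odot> (u \<oplus> (- 1) \<odot> (x \<otimes> k))) [^] p = \<zero>"
    by (subst smult_pow, simp, subst pw) (simp_all add: rules nil)
  moreover have "((1 / w) \<odot> (y \<oplus> (- 1) \<odot> (v \<otimes> l))) [^] p = \<zero>"
    by (subst smult_pow, simp, subst pw) (simp_all add: rules nil)
  ultimately show ?thesis
    unfolding uq_images_def by (intro conjI B kl cl; (assumption | simp add: rules lin))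
qed

end

locale matrix_action = matrix_algebra p R G
  for p :: nat and R :: "(complex, 'r, 'm) module_scheme" and G :: "'r set" +
  fixes \<sigma> :: "'r \<Rightarrow> 'r"
  assumes \<sigma>: "\<sigma> \<in> alg_hom R R" and \<sigma>_order: "r \<in> carrier R \<Longrightarrow> (\<sigma> ^^ (2 * p)) r = r"
begin

abbreviation "\<E> \<equiv> end_alg A"
abbreviation "\<kappa> \<equiv> act_K p R \<sigma>"

lemma \<E>_alg [simp]: "complex_algebra \<E>"
  by (rule end_alg_algebra) simp

lemma \<E>_vec [simp]: "cvec \<E>" by simp

lemmas \<sigma>D = alg_homD[OF \<sigma>]

lemma \<sigma>_zero [simp]: "\<sigma> \<zero>\<^bsub>R\<^esub> = \<zero>\<^bsub>R\<^esub>"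
  by (rule lin_maps_zero[OF \<sigma>D(1)]) simp_all

lemma \<kappa>_entry:
  assumes "X \<in> carrier A" "1 \<le> i" "i \<le> p" "1 \<le> j" "j \<le> p"
  shows "\<kappa> X (i, j) = (q powi (2 * (int i - int j))) \<odot>\<^bsub>R\<^esub> \<sigma> (X (i, j))"
  using assms by (simp add: act_K_def q_def)

lemma \<kappa>_closed: "X \<in> carrier A \<Longrightarrow> \<kappa> X \<in> carrier A"
  using \<sigma>D(2) by (auto simp: act_K_def mat_carrier PiE_iff)

text \<open>Apart from \<open>\<sigma>\<close> on the entries, \<open>\<kappa>\<close> is
  conjugation by the diagonal matrix with entries \<open>q powi (2 * i)\<close>; this is the cocycle
  identity for the weights in the proof.\<close>

lemma \<kappa>_hom: "\<kappa> \<in> alg_hom A A"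
proof (intro alg_homI lin_mapsI)
  fix X Y assume X: "X \<in> carrier A" and Y: "Y \<in> carrier A"
  show "\<kappa> (X \<star> Y) = \<kappa> X \<star> \<kappa> Y"
  proof (rule mat_eqI)
    fix i j assume ij: "1 \<le> i" "i \<le> p" "1 \<le> j" "j \<le> p"
    define c where "c i j = q powi (2 * (int i - int j))" for i j :: nat
    have c: "c k j * c i k = c i j" for k
      by (simp add: c_def power_int_add[symmetric] algebra_simps)
    have \<kappa>c: "\<kappa> W (i, j) = c i j \<odot>\<^bsub>R\<^esub> \<sigma> (W (i, j))"
      if "W \<in> carrier A" "1 \<le> i" "i \<le> p" "1 \<le> j" "j \<le> p" for W i j
      using that by (simp add: \<kappa>_entry c_def)
    have "\<kappa> (X \<star> Y) (i, j) = c i j \<odot>\<^bsub>R\<^esub> (\<Oplus>\<^bsub>R\<^esub>k\<in>{1..p}. \<sigma> (X (i, k) \<otimes>\<^bsub>R\<^esub> Y (k, j)))"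
      using lin_maps_finsum[OF R_vec R_vec \<sigma>D(1), of "{1..p}" "\<lambda>k. X (i, k) \<otimes>\<^bsub>R\<^esub> Y (k, j)"] X Y ij
      by (simp add: \<kappa>c mat_closed)
    also have "\<dots> = (\<Oplus>\<^bsub>R\<^esub>k\<in>{1..p}. c i j \<odot>\<^bsub>R\<^esub> \<sigma> (X (i, k) \<otimes>\<^bsub>R\<^esub> Y (k, j)))"
      by (rule R.finsum_smult_ldistr) (use X Y ij \<sigma>D(2) in auto)
    also have "\<dots> = (\<Oplus>\<^bsub>R\<^esub>k\<in>{1..p}. \<kappa> X (i, k) \<otimes>\<^bsub>R\<^esub> \<kappa> Y (k, j))"
      by (rule R.finsum_cong') (use X Y ij in \<open>auto simp: \<sigma>D(2,5) \<kappa>c c\<close>)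
    finally show "\<kappa> (X \<star> Y) (i, j) = (\<kappa> X \<star> \<kappa> Y) (i, j)" using ij by simp
  qed (use X Y in \<open>simp_all add: mat_closed \<kappa>_closed\<close>)
  show "\<kappa> (X \<oplus>\<^bsub>A\<^esub> Y) = \<kappa> X \<oplus>\<^bsub>A\<^esub> \<kappa> Y"
    by (rule mat_eqI) (use X Y in \<open>simp_all add: \<kappa>_closed mat_closed \<kappa>_entry \<sigma>D\<close>)
  show "\<kappa> (c \<odot>\<^bsub>A\<^esub> X) = c \<odot>\<^bsub>A\<^esub> \<kappa> X" for c
    by (rule mat_eqI) (use X in \<open>simp_all add: \<kappa>_closed mat_closed \<kappa>_entry \<sigma>D mult.commute\<close>)
  show "\<kappa> X \<in> carrier A" by (rule \<kappa>_closed[OF X])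
next
  show "\<kappa> \<one>\<^bsub>A\<^esub> = \<one>\<^bsub>A\<^esub>"
    by (rule mat_eqI) (simp_all add: \<kappa>_closed mat_closed \<kappa>_entry \<sigma>D)
qed

lemmas \<kappa>D = alg_homD[OF \<kappa>_hom]

lemma \<kappa>_gens: "\<kappa> Z = q\<^sup>2 \<odot>\<^bsub>A\<^esub> Z" "\<kappa> D = inverse (q\<^sup>2) \<odot>\<^bsub>A\<^esub> D" "r \<in> carrier R \<Longrightarrow> \<kappa> (\<rho> r) = \<rho> (\<sigma> r)"
proof -
  have 1: "2 * int (Suc j) - 2 * int j = 2" "2 * int j - 2 * int (Suc j) = - 2" "int j * 2 - int (Suc j) * 2 = - 2" for j by auto
  have 2: "q powi 2 = q\<^sup>2" "q powi - 2 = inverse (q\<^sup>2)"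
    using power_int_of_nat[of q 2] by (simp_all add: power_int_minus)
  show "\<kappa> Z = q\<^sup>2 \<odot>\<^bsub>A\<^esub> Z"
    by (rule mat_eqI) (auto simp: \<kappa>_closed mat_closed \<kappa>_entry \<sigma>D 1 2 simp del: of_nat_Suc)
  show "\<kappa> D = inverse (q\<^sup>2) \<odot>\<^bsub>A\<^esub> D"
    by (rule mat_eqI) (auto simp: \<kappa>_closed mat_closed \<kappa>_entry \<sigma>D 1 2 mult.commute simp del: of_nat_Suc)
  show "\<kappa> (\<rho> r) = \<rho> (\<sigma> r)" if "r \<in> carrier R"
    by (rule mat_eqI) (use that in \<open>auto simp: \<kappa>_closed mat_closed \<kappa>_entry \<sigma>D\<close>)
qed

lemma \<kappa>_\<E>: "\<kappa> \<in> carrier \<E>"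
  using \<kappa>D(1) by (simp add: end_alg_simps act_K_def)

text \<open>Each entry acquires the \<open>2 * p\<close>-th power of a power of \<open>q\<close>,
  which is 1, and \<open>2 * p\<close> applications of \<open>\<sigma>\<close>, which restore
  it.\<close>

lemma \<kappa>_pow: "\<kappa> [^]\<^bsub>\<E>\<^esub> (2 * p) = \<one>\<^bsub>\<E>\<^esub>"
proof (rule end_alg_eqI)
  interpret E: complex_algebra \<E> by simp
  note k [simp] = \<kappa>_\<E>
  show "\<kappa> [^]\<^bsub>\<E>\<^esub> (2 * p) \<in> carrier \<E>" "\<one>\<^bsub>\<E>\<^esub> \<in> carrier \<E>" by simp_all
  fix X assume X: "X \<in> carrier A"
  have \<sigma>n: "(\<sigma> ^^ n) r \<in> carrier R" if "r \<in> carrier R" for n r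
    using that by (induction n) (simp_all add: \<sigma>D)
  have *: "(\<kappa> [^]\<^bsub>\<E>\<^esub> n) X \<in> carrier A \<and> (\<kappa> [^]\<^bsub>\<E>\<^esub> n) X (i, j) = (q powi (2 * (int i - int j))) ^ n \<odot>\<^bsub>R\<^esub> (\<sigma> ^^ n) (X (i, j))"
    if "1 \<le> i" "i \<le> p" "1 \<le> j" "j \<le> p" for i j n
  proof (induction n)
    case (Suc n)
    have "(\<kappa> [^]\<^bsub>\<E>\<^esub> Suc n) X = \<kappa> ((\<kappa> [^]\<^bsub>\<E>\<^esub> n) X)"
      unfolding E.nat_pow_Suc2[OF k] using X by simp
    then show ?case using Suc X that by (simp add: \<kappa>_entry \<kappa>_closed \<sigma>D \<sigma>n mult.commute)
  qed (use X that in simp)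
  have "(q powi m) ^ (2 * p) = 1" for m
  proof -
    have "(q powi m) ^ (2 * p) = (q ^ (2 * p)) powi m"
      by (simp add: power_int_power power_int_power' mult.commute)
    then show ?thesis unfolding q_2p by simp
  qed
  then show "(\<kappa> [^]\<^bsub>\<E>\<^esub> (2 * p)) X = \<one>\<^bsub>\<E>\<^esub> X"
    using *[of _ _ "2 * p"] *[of 1 1 "2 * p"] X p2 \<sigma>_order by (subst end_alg_apply(2)[OF X], intro mat_eqI) auto
qed

definition "lm a = (\<lambda>X\<in>carrier A. a \<star> X)"
definition "rm a = (\<lambda>X\<in>carrier A. X \<star> a)"
definition "\<iota> = \<kappa> [^]\<^bsub>\<E>\<^esub> (2 * p - 1)"

lemma mults_closed [simp]: "a \<in> carrier A \<Longrightarrow> lm a \<in> carrier \<E>" "a \<in> carrier A \<Longrightarrow> rm a \<in> carrier \<E>"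
  unfolding lm_def rm_def by (rule end_algI; simp add: lin_maps_mult_left lin_maps_mult_right)+

lemma mults_apply [simp]: "X \<in> carrier A \<Longrightarrow> lm a X = a \<star> X" "X \<in> carrier A \<Longrightarrow> rm a X = X \<star> a"
  by (simp_all add: lm_def rm_def)

lemma \<iota>: "\<iota> \<in> carrier \<E>" "\<kappa> \<otimes>\<^bsub>\<E>\<^esub> \<iota> = \<one>\<^bsub>\<E>\<^esub>" "\<iota> \<otimes>\<^bsub>\<E>\<^esub> \<kappa> = \<one>\<^bsub>\<E>\<^esub>"
proof -
  interpret E: complex_algebra \<E> by simp
  note k [simp] = \<kappa>_\<E>
  have s: "Suc (2 * p - 1) = 2 * p" using p2 by simp
  show "\<iota> \<in> carrier \<E>" by (simp add: \<iota>_def)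
  show "\<iota> \<otimes>\<^bsub>\<E>\<^esub> \<kappa> = \<one>\<^bsub>\<E>\<^esub>" "\<kappa> \<otimes>\<^bsub>\<E>\<^esub> \<iota> = \<one>\<^bsub>\<E>\<^esub>"
    unfolding \<iota>_def using E.nat_pow_Suc[of \<kappa> "2 * p - 1"] E.nat_pow_Suc2[OF k, of "2 * p - 1"]
    unfolding s \<kappa>_pow by simp_all
qed

lemma \<kappa>_\<iota>: "X \<in> carrier A \<Longrightarrow> \<iota> X \<in> carrier A" "X \<in> carrier A \<Longrightarrow> \<kappa> (\<iota> X) = X" "X \<in> carrier A \<Longrightarrow> \<iota> (\<kappa> X) = X"
  using end_algD(1)[OF \<iota>(1)] end_alg_apply(1,2)[of X A] \<iota>(2,3) by metis+

lemma pow_mults: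
  assumes "a \<in> carrier A"
  shows "lm a [^]\<^bsub>\<E>\<^esub> (n::nat) = lm (a [^]\<^bsub>A\<^esub> n)" "rm a [^]\<^bsub>\<E>\<^esub> (n::nat) = rm (a [^]\<^bsub>A\<^esub> n)"
proof -
  interpret E: complex_algebra \<E> by simp
  interpret A: complex_algebra A by simp
  have "(lm a [^]\<^bsub>\<E>\<^esub> n) X = a [^]\<^bsub>A\<^esub> n \<star> X \<and> (rm a [^]\<^bsub>\<E>\<^esub> n) X = X \<star> a [^]\<^bsub>A\<^esub> n" if "X \<in> carrier A" for X
    using that
  proof (induction n arbitrary: X)
    case (Suc n)
    have "X \<star> a [^]\<^bsub>A\<^esub> Suc n = (X \<star> a) \<star> a [^]\<^bsub>A\<^esub> n"
      unfolding A.nat_pow_Suc2[OF assms] using Suc.prems assms by (simp add: A.calg_assoc)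
    then show ?case using Suc assms by (simp add: A.calg_assoc)
  qed simp
  then show "lm a [^]\<^bsub>\<E>\<^esub> n = lm (a [^]\<^bsub>A\<^esub> n)" "rm a [^]\<^bsub>\<E>\<^esub> n = rm (a [^]\<^bsub>A\<^esub> n)"
    using assms by (auto intro!: end_alg_eqI[of _ A])
qed

text \<open>This is the shape of \<open>uq_images_split\<close> with \<open>x\<close>,
  \<open>y\<close> the left and \<open>u\<close>, \<open>v\<close> the right multiplications by
  \<open>Z\<close> and \<open>D\<close>.\<close>

lemma act_ops:
  "act_E p R \<sigma> = (1 / w) \<odot>\<^bsub>\<E>\<^esub> (rm Z \<oplus>\<^bsub>\<E>\<^esub> (- 1) \<odot>\<^bsub>\<E>\<^esub> (lm Z \<otimes>\<^bsub>\<E>\<^esub> \<kappa>))" (is "?e = ?e'")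
  "act_F p R \<sigma> = (1 / w) \<odot>\<^bsub>\<E>\<^esub> (lm D \<oplus>\<^bsub>\<E>\<^esub> (- 1) \<odot>\<^bsub>\<E>\<^esub> (rm D \<otimes>\<^bsub>\<E>\<^esub> \<iota>))" (is "?f = ?f'")
proof -
  interpret E: complex_algebra \<E> by simp
  interpret A: complex_algebra A by simp
  note [simp] = \<kappa>_\<E> \<iota>(1) \<kappa>_closed \<kappa>_\<iota>
  have inv: "inv_into (carrier A) \<kappa> X = \<iota> X" if "X \<in> carrier A" for X
    by (rule inv_into_f_eq[of \<kappa> "carrier A" "\<iota> X" X]) (use that inj_on_inverseI[of "carrier A" \<iota> \<kappa>] in simp_all)
  have "?e' \<in> carrier \<E>" "?f' \<in> carrier \<E>" by simp_all
  then have x: "?e' \<in> extensional (carrier A)" "?f' \<in> extensional (carrier A)" by (simp_all only: end_alg_simps)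
  show "?e = ?e'" "?f = ?f'"
    by (rule extensionalityI[OF _ x(1)] extensionalityI[OF _ x(2)];
        simp add: act_E_def act_F_def Let_def q_def[symmetric] w_def[symmetric] cvec_minus[OF mat_vec] inv)+
qed

lemma uq_images_act: "uq_images \<E> (act_E p R \<sigma>) \<kappa> \<iota> (act_F p R \<sigma>)"
  unfolding act_ops
proof (rule uq_images_split)
  interpret E: complex_algebra \<E> by simp
  interpret A: complex_algebra A by simp
  note [simp] = \<kappa>_\<E> \<iota>(1) \<kappa>_closed \<kappa>_\<iota>
  show "\<kappa> \<otimes>\<^bsub>\<E>\<^esub> lm Z = q\<^sup>2 \<odot>\<^bsub>\<E>\<^esub> (lm Z \<otimes>\<^bsub>\<E>\<^esub> \<kappa>)" "\<kappa> \<otimes>\<^bsub>\<E>\<^esub> rm Z = q\<^sup>2 \<odot>\<^bsub>\<E>\<^esub> (rm Z \<otimes>\<^bsub>\<E>\<^esub> \<kappa>)"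
    "\<kappa> \<otimes>\<^bsub>\<E>\<^esub> lm D = inverse (q\<^sup>2) \<odot>\<^bsub>\<E>\<^esub> (lm D \<otimes>\<^bsub>\<E>\<^esub> \<kappa>)" "\<kappa> \<otimes>\<^bsub>\<E>\<^esub> rm D = inverse (q\<^sup>2) \<odot>\<^bsub>\<E>\<^esub> (rm D \<otimes>\<^bsub>\<E>\<^esub> \<kappa>)"
    by (rule end_alg_eqI[of _ A]; simp add: \<kappa>D(5) \<kappa>_gens)+
  show "rm Z \<otimes>\<^bsub>\<E>\<^esub> lm Z = lm Z \<otimes>\<^bsub>\<E>\<^esub> rm Z" "rm D \<otimes>\<^bsub>\<E>\<^esub> lm Z = lm Z \<otimes>\<^bsub>\<E>\<^esub> rm D"
    "rm Z \<otimes>\<^bsub>\<E>\<^esub> lm D = lm D \<otimes>\<^bsub>\<E>\<^esub> rm Z" "rm D \<otimes>\<^bsub>\<E>\<^esub> lm D = lm D \<otimes>\<^bsub>\<E>\<^esub> rm D"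
    by (rule end_alg_eqI[of _ A]; simp add: A.calg_assoc)+
  show "lm D \<otimes>\<^bsub>\<E>\<^esub> lm Z = inverse (q\<^sup>2) \<odot>\<^bsub>\<E>\<^esub> (lm Z \<otimes>\<^bsub>\<E>\<^esub> lm D) \<oplus>\<^bsub>\<E>\<^esub> w \<odot>\<^bsub>\<E>\<^esub> \<one>\<^bsub>\<E>\<^esub>"
    by (rule end_alg_eqI[of _ A]) (simp_all add: A.calg_assoc[symmetric] D_Z)
  \<comment> \<open>Right multiplications compose in reverse order, so this is again the relation
    for \<open>D \<star> Z\<close>.\<close>
  show "rm Z \<otimes>\<^bsub>\<E>\<^esub> rm D = inverse (q\<^sup>2) \<odot>\<^bsub>\<E>\<^esub> (rm D \<otimes>\<^bsub>\<E>\<^esub> rm Z) \<oplus>\<^bsub>\<E>\<^esub> w \<odot>\<^bsub>\<E>\<^esub> \<one>\<^bsub>\<E>\<^esub>"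
    by (rule end_alg_eqI[of _ A]) (simp_all add: A.calg_assoc D_Z)
  show "lm Z [^]\<^bsub>\<E>\<^esub> p = \<zero>\<^bsub>\<E>\<^esub>" "lm D [^]\<^bsub>\<E>\<^esub> p = \<zero>\<^bsub>\<E>\<^esub>" "rm Z [^]\<^bsub>\<E>\<^esub> p = \<zero>\<^bsub>\<E>\<^esub>" "rm D [^]\<^bsub>\<E>\<^esub> p = \<zero>\<^bsub>\<E>\<^esub>"
    unfolding pow_mults[OF ZD_closed(1)] pow_mults[OF ZD_closed(2)] Z_nil D_nil
    by (rule end_alg_eqI[of _ A]; simp)+
qed (simp_all add: \<kappa>_\<E> \<iota> \<kappa>_pow)

abbreviation "\<alpha> \<equiv> uq_act p R \<sigma>"

lemma act_hom: "\<alpha> \<in> alg_hom H \<E>"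
  and act_gens: "\<alpha> E = act_E p R \<sigma>" "\<alpha> K = \<kappa>" "\<alpha> F = act_F p R \<sigma>" "\<alpha> L = \<iota>"
proof -
  interpret E: complex_algebra \<E> by simp
  have e: "\<alpha> = the_alg_hom U \<E> {(E, act_E p R \<sigma>), (K, \<kappa>), (F, act_F p R \<sigma>)}"
    by (simp add: uq_act_def the_alg_hom_def alg_hom_H H_simps)
  show h: "\<alpha> \<in> alg_hom H \<E>" and "\<alpha> E = act_E p R \<sigma>" and k: "\<alpha> K = \<kappa>" and "\<alpha> F = act_F p R \<sigma>"
    unfolding e by (rule uq_the_hom[OF uq_images_act])+
  have "\<alpha> L = \<alpha> L \<otimes>\<^bsub>\<E>\<^esub> (\<kappa> \<otimes>\<^bsub>\<E>\<^esub> \<iota>)" using alg_homD(2)[OF h] by (simp add: \<iota>)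
  also have "\<dots> = \<alpha> (L \<cdot> K) \<otimes>\<^bsub>\<E>\<^esub> \<iota>"
    unfolding alg_homD(5)[OF h L_closed EKF(2)] k by (rule E.calg_assoc[symmetric]) (simp_all add: alg_homD(2)[OF h] \<iota> \<kappa>_\<E>)
  also have "\<dots> = \<iota>" using alg_homD(6)[OF h] by (simp add: \<iota>)
  finally show "\<alpha> L = \<iota>" .
qed

lemma act_simps [simp]:
  assumes "X \<in> carrier A"
  shows "h \<in> carrier H \<Longrightarrow> \<alpha> h X \<in> carrier A"
    "h \<in> carrier H \<Longrightarrow> Y \<in> carrier A \<Longrightarrow> \<alpha> h (X \<oplus>\<^bsub>A\<^esub> Y) = \<alpha> h X \<oplus>\<^bsub>A\<^esub> \<alpha> h Y"
    "h \<in> carrier H \<Longrightarrow> \<alpha> h (c \<odot>\<^bsub>A\<^esub> X) = c \<odot>\<^bsub>A\<^esub> \<alpha> h X"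
    "h \<in> carrier H \<Longrightarrow> g \<in> carrier H \<Longrightarrow> \<alpha> (h \<oplus>\<^bsub>H\<^esub> g) X = \<alpha> h X \<oplus>\<^bsub>A\<^esub> \<alpha> g X"
    "h \<in> carrier H \<Longrightarrow> \<alpha> (c \<odot>\<^bsub>H\<^esub> h) X = c \<odot>\<^bsub>A\<^esub> \<alpha> h X"
    "h \<in> carrier H \<Longrightarrow> g \<in> carrier H \<Longrightarrow> \<alpha> (h \<cdot> g) X = \<alpha> h (\<alpha> g X)"
    "\<alpha> \<one>\<^bsub>H\<^esub> X = X"
    "\<alpha> E X = (1 / w) \<odot>\<^bsub>A\<^esub> (X \<star> Z \<oplus>\<^bsub>A\<^esub> (- 1) \<odot>\<^bsub>A\<^esub> (Z \<star> \<kappa> X))" "\<alpha> K X = \<kappa> X"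
    "\<alpha> F X = (1 / w) \<odot>\<^bsub>A\<^esub> (D \<star> X \<oplus>\<^bsub>A\<^esub> (- 1) \<odot>\<^bsub>A\<^esub> (\<iota> X \<star> D))" "\<alpha> L X = \<iota> X"
    "\<kappa> X \<in> carrier A" "\<iota> X \<in> carrier A" "\<kappa> (\<iota> X) = X" "\<iota> (\<kappa> X) = X"
  using assms end_algD[of "\<alpha> h" A] alg_homD[OF act_hom]
  by (simp_all add: act_gens act_ops \<kappa>_closed \<kappa>_\<iota>)

lemma \<kappa>_simps [simp]:
  assumes "X \<in> carrier A" "Y \<in> carrier A"
  shows "\<kappa> (X \<oplus>\<^bsub>A\<^esub> Y) = \<kappa> X \<oplus>\<^bsub>A\<^esub> \<kappa> Y" "\<iota> (X \<oplus>\<^bsub>A\<^esub> Y) = \<iota> X \<oplus>\<^bsub>A\<^esub> \<iota> Y"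
    "\<kappa> (c \<odot>\<^bsub>A\<^esub> X) = c \<odot>\<^bsub>A\<^esub> \<kappa> X" "\<iota> (c \<odot>\<^bsub>A\<^esub> X) = c \<odot>\<^bsub>A\<^esub> \<iota> X"
    "\<kappa> (X \<star> Y) = \<kappa> X \<star> \<kappa> Y" "\<iota> (X \<star> Y) = \<iota> X \<star> \<iota> Y"
proof -
  note l = end_algD[OF \<iota>(1)]
  show "\<kappa> (X \<oplus>\<^bsub>A\<^esub> Y) = \<kappa> X \<oplus>\<^bsub>A\<^esub> \<kappa> Y" "\<iota> (X \<oplus>\<^bsub>A\<^esub> Y) = \<iota> X \<oplus>\<^bsub>A\<^esub> \<iota> Y"
    "\<kappa> (c \<odot>\<^bsub>A\<^esub> X) = c \<odot>\<^bsub>A\<^esub> \<kappa> X" "\<iota> (c \<odot>\<^bsub>A\<^esub> X) = c \<odot>\<^bsub>A\<^esub> \<iota> X" "\<kappa> (X \<star> Y) = \<kappa> X \<star> \<kappa> Y"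
    using assms by (simp_all add: \<kappa>D(3-6) l(2,3))
  have "\<iota> (\<kappa> (\<iota> X) \<star> \<kappa> (\<iota> Y)) = \<iota> X \<star> \<iota> Y"
    unfolding \<kappa>D(5)[OF \<kappa>_\<iota>(1)[OF assms(1)] \<kappa>_\<iota>(1)[OF assms(2)], symmetric] using assms by (intro \<kappa>_\<iota>(3)) simp
  then show "\<iota> (X \<star> Y) = \<iota> X \<star> \<iota> Y" using assms by simp
qed

lemma \<kappa>_one [simp]: "\<kappa> \<one>\<^bsub>A\<^esub> = \<one>\<^bsub>A\<^esub>" "\<iota> \<one>\<^bsub>A\<^esub> = \<one>\<^bsub>A\<^esub>"
proof -
  show "\<kappa> \<one>\<^bsub>A\<^esub> = \<one>\<^bsub>A\<^esub>" by (rule \<kappa>D(6))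
  have "\<iota> (\<kappa> \<one>\<^bsub>A\<^esub>) = \<one>\<^bsub>A\<^esub>" by (rule \<kappa>_\<iota>(3)) simp
  then show "\<iota> \<one>\<^bsub>A\<^esub> = \<one>\<^bsub>A\<^esub>" by (simp only: \<kappa>D(6))
qed

lemmas A_assoc = alg_assoc[OF mat_alg]
lemmas A_lin = cvec_ac[OF mat_vec] cvec_collect[OF mat_vec]

lemma act_bilin: "bilin H A A \<alpha>"
  by (simp add: bilin_def)

lemma act_unit: "h \<in> carrier H \<Longrightarrow> \<alpha> h \<one>\<^bsub>A\<^esub> = counit H h \<odot>\<^bsub>A\<^esub> \<one>\<^bsub>A\<^esub>"
proof (induction h rule: H_induct)
  case (add x y)
  then show ?case by (simp add: cvec_add_smult[OF mat_vec])
qed (simp_all add: A_lin mult.commute)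

text \<open>For products of elements of \<open>H\<close> the two Sweedler sums are exchanged. On
  generators \<open>\<kappa>\<close> is an algebra map, while \<open>E\<close> and \<open>F\<close>
  are commutators twisted by \<open>\<kappa>\<close> or \<open>\<iota>\<close> and hence twisted
  derivations.\<close>

lemma act_alg:
  assumes "h \<in> carrier H" "X \<in> carrier A" "Y \<in> carrier A"
  shows "\<alpha> h (X \<star> Y) = TL H H A (\<lambda>x y. \<alpha> x X \<star> \<alpha> y Y) (comult H h)"
  using assms
proof (induction h arbitrary: X Y rule: H_induct)
  case (mult h g)
  have "\<alpha> (h \<cdot> g) (X \<star> Y) = \<alpha> h (TL H H A (\<lambda>x y. \<alpha> x X \<star> \<alpha> y Y) (comult H g))"
    using mult by simp
  also have "\<dots> = TL H H A (\<lambda>x y. \<alpha> h (\<alpha> x X \<star> \<alpha> y Y)) (comult H g)"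
    by (rule TL_lin[OF mat_vec mat_vec]) (use mult in \<open>auto intro!: lin_mapsI\<close>)
  also have "\<dots> = TL H H A (\<lambda>x y. TL H H A (\<lambda>u v. \<alpha> u (\<alpha> x X) \<star> \<alpha> v (\<alpha> y Y)) (comult H h)) (comult H g)"
    by (rule TL_cong) (use mult in simp_all)
  also have "\<dots> = TL H H A (\<lambda>u v. TL H H A (\<lambda>x y. \<alpha> u (\<alpha> x X) \<star> \<alpha> v (\<alpha> y Y)) (comult H g)) (comult H h)"
    by (rule TL_swap) (use mult in simp_all)
  also have "\<dots> = TL H H A (\<lambda>x y. \<alpha> x X \<star> \<alpha> y Y) (comult H (h \<cdot> g))"
    using mult by (simp add: bilin_def)
  finally show ?case .
qed (simp_all add: tensor_one bilin_def A_assoc A_lin)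


section \<open>The coaction\<close>

abbreviation "T \<equiv> tensor H A"
abbreviation pure_T (infixl "\<boxdot>" 75) where "x \<boxdot> Y \<equiv> x \<boxtimes>\<^bsub>T\<^esub> Y"
abbreviation "\<zeta> \<equiv> (L \<boxdot> Z) \<oplus>\<^bsub>T\<^esub> (- w) \<odot>\<^bsub>T\<^esub> ((E \<cdot> L) \<boxdot> \<one>\<^bsub>A\<^esub>)"
abbreviation "\<xi> \<equiv> (L \<boxdot> D) \<oplus>\<^bsub>T\<^esub> w \<odot>\<^bsub>T\<^esub> (F \<boxdot> \<one>\<^bsub>A\<^esub>)"

lemma T_vec: "cvec T" by simp

lemmas T_lin = cvec_ac[OF T_vec] cvec_collect[OF T_vec] cvec_collect_far[OF T_vec]

text \<open>In the relation for \<open>\<xi>\<close> and \<open>\<zeta>\<close> the term of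
  \<open>D \<star> Z\<close> contributes \<open>w\<close> times the square of \<open>L\<close>, and
  the commutator of \<open>E\<close> and \<open>F\<close> contributes \<open>w\<close> times one
  minus that square; the sum is the required constant.\<close>

lemma coact_matrix_hom: "matrix_hom p R G T (\<lambda>r. \<one>\<^bsub>H\<^esub> \<boxdot> \<rho> r) \<zeta> \<xi>"
proof (intro matrix_hom.intro matrix_hom_axioms.intro)
  interpret T: complex_algebra T by simp
  interpret H: complex_algebra H by simp
  note \<rho>D = alg_homD[OF \<rho>_hom]
  show "matrix_algebra p R G" by unfold_locales
  show "complex_algebra T" by simp
  show "(\<lambda>r. \<one>\<^bsub>H\<^esub> \<boxdot> \<rho> r) \<in> alg_hom R T"
    by (intro alg_homI lin_mapsI) (simp_all add: \<rho>D tensor_one)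
  show "\<zeta> \<otimes>\<^bsub>T\<^esub> (\<one>\<^bsub>H\<^esub> \<boxdot> \<rho> r) = (\<one>\<^bsub>H\<^esub> \<boxdot> \<rho> r) \<otimes>\<^bsub>T\<^esub> \<zeta>"
    "\<xi> \<otimes>\<^bsub>T\<^esub> (\<one>\<^bsub>H\<^esub> \<boxdot> \<rho> r) = (\<one>\<^bsub>H\<^esub> \<boxdot> \<rho> r) \<otimes>\<^bsub>T\<^esub> \<xi>" if "r \<in> carrier R" for r
    using that by (simp_all add: \<rho>_comm)
  have EF: "E \<cdot> (F \<cdot> L) = F \<cdot> (E \<cdot> L) \<oplus>\<^bsub>H\<^esub> ((1 / w) \<odot>\<^bsub>H\<^esub> \<one>\<^bsub>H\<^esub> \<oplus>\<^bsub>H\<^esub> (- (1 / w)) \<odot>\<^bsub>H\<^esub> (L \<cdot> L))"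
  proof -
    have "E \<cdot> (F \<cdot> L) = (E \<cdot> F) \<cdot> L" by (simp add: H_assoc)
    then show ?thesis unfolding rels(5) by (simp add: H_assoc)
  qed
  have qq: "inverse (q\<^sup>2) * (w * q\<^sup>2) = w" "inverse (q\<^sup>2) * (w * (w * q\<^sup>2)) = w * w"
    "inverse (q\<^sup>2) * w = w * inverse (q\<^sup>2)" "q\<^sup>2 * (w * inverse (q\<^sup>2)) = w"
    by simp_all
  show "\<xi> \<otimes>\<^bsub>T\<^esub> \<zeta> = inverse (q\<^sup>2) \<odot>\<^bsub>T\<^esub> (\<zeta> \<otimes>\<^bsub>T\<^esub> \<xi>) \<oplus>\<^bsub>T\<^esub> w \<odot>\<^bsub>T\<^esub> \<one>\<^bsub>T\<^esub>"
    by (simp add: H_assoc rels rels_assoc EF D_Z tensor_one T_lin qq)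
  have z: "(a \<boxdot> b) [^]\<^bsub>T\<^esub> p = \<zero>\<^bsub>T\<^esub>" if "a \<in> carrier H" "b \<in> carrier A"
    "a [^]\<^bsub>H\<^esub> p = \<zero>\<^bsub>H\<^esub> \<or> b [^]\<^bsub>A\<^esub> p = \<zero>\<^bsub>A\<^esub>" for a b
  proof -
    interpret A: complex_algebra A by simp
    have "(0 \<odot>\<^bsub>H\<^esub> \<one>\<^bsub>H\<^esub>) \<boxdot> (b [^]\<^bsub>A\<^esub> p) = \<zero>\<^bsub>T\<^esub>" "(a [^]\<^bsub>H\<^esub> p) \<boxdot> (0 \<odot>\<^bsub>A\<^esub> \<one>\<^bsub>A\<^esub>) = \<zero>\<^bsub>T\<^esub>"
      using that(1,2) by (subst tensor_pure; simp)+
    then show ?thesis using that by (auto simp: pure_pow)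
  qed
  have EL: "(E \<cdot> L) [^]\<^bsub>H\<^esub> p = \<zero>\<^bsub>H\<^esub>"
    using qcomm_pow[OF H_alg EKF(1) L_closed rels(2), of p] by (auto simp: pow_rels)
  show "\<zeta> [^]\<^bsub>T\<^esub> p = \<zero>\<^bsub>T\<^esub>"
  proof (rule T.qbinomial_nilpotent[where z = "q\<^sup>2"])
    show "((- w) \<odot>\<^bsub>T\<^esub> ((E \<cdot> L) \<boxdot> \<one>\<^bsub>A\<^esub>)) [^]\<^bsub>T\<^esub> p = \<zero>\<^bsub>T\<^esub>" "(L \<boxdot> Z) [^]\<^bsub>T\<^esub> p = \<zero>\<^bsub>T\<^esub>"
      by (simp_all add: T.smult_pow z EL Z_nil)
  qed (use q_sq_p q_pow_ne_1 in \<open>simp_all add: H_assoc rels rels_assoc qq\<close>)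
  \<comment> \<open>The summands of \<open>\<xi>\<close> are exchanged so that the factor of their
    q-commutation is \<open>q\<^sup>2\<close>, not its inverse.\<close>
  have "(w \<odot>\<^bsub>T\<^esub> (F \<boxdot> \<one>\<^bsub>A\<^esub>) \<oplus>\<^bsub>T\<^esub> (L \<boxdot> D)) [^]\<^bsub>T\<^esub> p = \<zero>\<^bsub>T\<^esub>"
  proof (rule T.qbinomial_nilpotent[where z = "q\<^sup>2"])
    show "(w \<odot>\<^bsub>T\<^esub> (F \<boxdot> \<one>\<^bsub>A\<^esub>)) [^]\<^bsub>T\<^esub> p = \<zero>\<^bsub>T\<^esub>" "(L \<boxdot> D) [^]\<^bsub>T\<^esub> p = \<zero>\<^bsub>T\<^esub>"
      by (simp_all add: T.smult_pow z pow_rels D_nil)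
  qed (use q_sq_p q_pow_ne_1 in \<open>simp_all add: H_assoc rels rels_assoc mult.commute\<close>)
  then show "\<xi> [^]\<^bsub>T\<^esub> p = \<zero>\<^bsub>T\<^esub>" by (simp add: T.a_comm)
qed simp_all

abbreviation "\<delta> \<equiv> uq_coact p R G"

lemma coact_hom: "\<delta> \<in> alg_hom A T"
  and coact_gens [simp]: "\<delta> Z = \<zeta>" "\<delta> D = \<xi>" "r \<in> carrier R \<Longrightarrow> \<delta> (\<rho> r) = \<one>\<^bsub>H\<^esub> \<boxdot> \<rho> r"
proof -
  interpret M: matrix_hom p R G T "\<lambda>r. \<one>\<^bsub>H\<^esub> \<boxdot> \<rho> r" \<zeta> \<xi> by (rule coact_matrix_hom)
  have G: "r \<in> carrier R" if "r \<in> G" for r using that R_generated[unfolded alg_generated_def, THEN conjunct1] by blast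
  define vals where "vals = (\<lambda>r. (\<rho> r, \<one>\<^bsub>H\<^esub> \<boxdot> \<rho> r)) ` G \<union> {(Z, \<zeta>), (D, \<xi>)}"
  have "inverse q - q = - w" by (simp add: w_def)
  then have e: "\<delta> = the_alg_hom A T vals"
    by (simp add: vals_def uq_coact_def Let_def q_def[symmetric] w_def[symmetric] L_def[symmetric] cvec_minus[OF T_vec])
  have "fst ` vals = \<rho> ` G \<union> {Z, D}" by (auto simp: vals_def image_Un image_image)
  then have "alg_generated A (fst ` vals)" using mat_generated by simp
  note t = the_alg_hom[OF mat_alg this M.\<phi>_hom, folded e]
  have v: "M.\<phi> x = y" if "(x, y) \<in> vals" for x y using that G by (auto simp: vals_def M.\<phi>_gens)
  show h: "\<delta> \<in> alg_hom A T" by (rule t(1)) (rule v)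
  show Z: "\<delta> Z = \<zeta>" and D: "\<delta> D = \<xi>" by (rule t(2), erule v, simp add: vals_def)+
  have "\<delta> (\<rho> r) = \<one>\<^bsub>H\<^esub> \<boxdot> \<rho> r" if "r \<in> G" for r
    by (rule t(2), erule v) (use that in \<open>simp add: vals_def\<close>)
  \<comment> \<open>The description of \<open>\<delta>\<close> fixes scalar matrices only for
    generators in \<open>G\<close>; agreement with \<open>M.\<phi>\<close> gives the value at every
    scalar matrix.\<close>
  then have "\<delta> X = M.\<phi> X" if "X \<in> carrier A" for X
    by (intro alg_hom_eqI[OF mat_generated h M.\<phi>_hom _ that]) (use G Z D in \<open>auto simp: M.\<phi>_gens\<close>)
  then show "r \<in> carrier R \<Longrightarrow> \<delta> (\<rho> r) = \<one>\<^bsub>H\<^esub> \<boxdot> \<rho> r" by (simp add: M.\<phi>_gens)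
qed

lemmas coact_simps [simp] = alg_homD(2-6)[OF coact_hom]

lemma mat_induct [consumes 1, case_names one scalar Z D add mult smult]:
  assumes "X \<in> carrier A" "Q \<one>\<^bsub>A\<^esub>" "\<And>r. r \<in> carrier R \<Longrightarrow> Q (\<rho> r)" "Q Z" "Q D"
    "\<And>x y. x \<in> carrier A \<Longrightarrow> y \<in> carrier A \<Longrightarrow> Q x \<Longrightarrow> Q y \<Longrightarrow> Q (x \<oplus>\<^bsub>A\<^esub> y)"
    "\<And>x y. x \<in> carrier A \<Longrightarrow> y \<in> carrier A \<Longrightarrow> Q x \<Longrightarrow> Q y \<Longrightarrow> Q (x \<star> y)"
    "\<And>c x. x \<in> carrier A \<Longrightarrow> Q x \<Longrightarrow> Q (c \<odot>\<^bsub>A\<^esub> x)"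
  shows "Q X"
proof -
  have "r \<in> carrier R" if "r \<in> G" for r using that R_generated[unfolded alg_generated_def, THEN conjunct1] by blast
  then show ?thesis
    by (intro alg_generated_induct[OF mat_generated assms(1), of Q]) (use assms in auto)
qed

text \<open>As for the coproduct, both iterated maps are linear and multiplicative, so generators
  suffice.\<close>

lemma coact_coassoc:
  assumes "X \<in> carrier A"
  shows "TL H A (tensor H T) (\<lambda>x Y. TL H H (tensor H T)
        (\<lambda>u v. u \<boxtimes>\<^bsub>tensor H T\<^esub> (v \<boxdot> Y)) (comult H x)) (\<delta> X) =
      TL H A (tensor H T) (\<lambda>x Y. TL H A (tensor H T)
        (\<lambda>u W. x \<boxtimes>\<^bsub>tensor H T\<^esub> (u \<boxdot> W)) (\<delta> Y)) (\<delta> X)"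
    (is "?A X = ?B X")
proof -
  let ?T = "tensor H T"
  have lin: "?A \<in> lin_maps A ?T" "?B \<in> lin_maps A ?T"
    by (rule lin_mapsI; simp add: bilin_def)+
  note linD = lin_mapsD[OF lin(1)] lin_mapsD[OF lin(2)]
  have A: "?A (h \<star> k) = ?A h \<otimes>\<^bsub>?T\<^esub> ?A k" if "h \<in> carrier A" "k \<in> carrier A" for h k
  proof -
    have "?A (h \<star> k) = TL H A ?T (\<lambda>x y. TL H A ?T (\<lambda>x' y'. TL H H ?T (\<lambda>u v. TL H H ?T (\<lambda>u' v'.
        (u \<boxtimes>\<^bsub>?T\<^esub> (v \<boxdot> y)) \<otimes>\<^bsub>?T\<^esub> (u' \<boxtimes>\<^bsub>?T\<^esub> (v' \<boxdot> y')))
        (comult H x')) (comult H x)) (\<delta> k)) (\<delta> h)"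
      using that by (simp add: bilin_def)
    also have "\<dots> = TL H A ?T (\<lambda>x y. TL H A ?T (\<lambda>x' y'.
        TL H H ?T (\<lambda>u v. u \<boxtimes>\<^bsub>?T\<^esub> (v \<boxdot> y)) (comult H x) \<otimes>\<^bsub>?T\<^esub>
        TL H H ?T (\<lambda>u' v'. u' \<boxtimes>\<^bsub>?T\<^esub> (v' \<boxdot> y')) (comult H x')) (\<delta> k)) (\<delta> h)"
      by (intro TL_cong refl, subst TL_prod) simp_all
    also have "\<dots> = ?A h \<otimes>\<^bsub>?T\<^esub> ?A k"
      by (subst TL_prod) simp_all
    finally show ?thesis .
  qed
  have B: "?B (h \<star> k) = ?B h \<otimes>\<^bsub>?T\<^esub> ?B k" if "h \<in> carrier A" "k \<in> carrier A" for h k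
  proof -
    have "?B (h \<star> k) = TL H A ?T (\<lambda>x y. TL H A ?T (\<lambda>x' y'. TL H A ?T (\<lambda>u v. TL H A ?T (\<lambda>u' v'.
        (x \<boxtimes>\<^bsub>?T\<^esub> (u \<boxdot> v)) \<otimes>\<^bsub>?T\<^esub> (x' \<boxtimes>\<^bsub>?T\<^esub> (u' \<boxdot> v')))
        (\<delta> y')) (\<delta> y)) (\<delta> k)) (\<delta> h)"
      using that by (simp add: bilin_def)
    also have "\<dots> = TL H A ?T (\<lambda>x y. TL H A ?T (\<lambda>x' y'.
        TL H A ?T (\<lambda>u v. x \<boxtimes>\<^bsub>?T\<^esub> (u \<boxdot> v)) (\<delta> y) \<otimes>\<^bsub>?T\<^esub>
        TL H A ?T (\<lambda>u' v'. x' \<boxtimes>\<^bsub>?T\<^esub> (u' \<boxdot> v')) (\<delta> y')) (\<delta> k)) (\<delta> h)"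
      by (intro TL_cong refl, subst TL_prod) simp_all
    also have "\<dots> = ?B h \<otimes>\<^bsub>?T\<^esub> ?B k"
      by (subst TL_prod) simp_all
    finally show ?thesis .
  qed
  show ?thesis using assms
  proof (induction X rule: mat_induct)
    case (add x y)
    then show ?case by (simp only: linD)
  next
    case (mult x y)
    then show ?case by (simp only: A B)
  next
    case (smult c x)
    then show ?case by (simp only: linD)
  qed (simp_all add: tensor_one bilin_def cvec_ac[where V = "tensor H T"])
qed

lemma coact_counit:
  assumes "X \<in> carrier A"
  shows "TL H A A (\<lambda>x Y. counit H x \<odot>\<^bsub>A\<^esub> Y) (\<delta> X) = X" (is "?A X = X")
proof -
  have b: "bilin H A A (\<lambda>x Y. counit H x \<odot>\<^bsub>A\<^esub> Y)"
    by (simp_all add: bilin_def cvec_add_smult[OF mat_vec] mult.commute)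
  have A: "?A (h \<star> k) = ?A h \<star> ?A k" if "h \<in> carrier A" "k \<in> carrier A" for h k
    using that b by (simp add: TL_prod[OF mat_alg] mult.commute)
  show ?thesis using assms
    by (induction X rule: mat_induct) (simp_all only: A, simp_all add: b tensor_one)
qed

text \<open>For \<open>Z\<close> and \<open>D\<close> this is the definition of the action of
  \<open>E\<close> and \<open>F\<close>, solved for \<open>Z \<star> Y\<close> and
  \<open>D \<star> Y\<close>. It passes to products since the coaction is multiplicative and the
  action of a product is the composition of the actions.\<close>

lemma braided_comm:
  assumes "X \<in> carrier A" "Y \<in> carrier A"
  shows "X \<star> Y = TL H A A (\<lambda>x W. \<alpha> x Y \<star> W) (\<delta> X)"
  using assms
proof (induction X arbitrary: Y rule: mat_induct)
  case (mult X X')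
  have b: "bilin H A A (\<lambda>x W. \<alpha> x Y \<star> W)" using mult by (simp add: bilin_def)
  have "TL H A A (\<lambda>x W. \<alpha> x Y \<star> W) (\<delta> (X \<star> X')) =
      TL H A A (\<lambda>x W. TL H A A (\<lambda>x' W'. \<alpha> x (\<alpha> x' Y) \<star> W \<star> W') (\<delta> X')) (\<delta> X)"
    using mult(1,2,5) b by (simp add: A_assoc)
  also have "\<dots> = TL H A A (\<lambda>x' W'. TL H A A (\<lambda>x W. \<alpha> x (\<alpha> x' Y) \<star> W \<star> W') (\<delta> X)) (\<delta> X')"
    by (rule TL_swap) (use mult(1,2,5) in simp_all)
  also have "\<dots> = TL H A A (\<lambda>x' W'. (X \<star> \<alpha> x' Y) \<star> W') (\<delta> X')"
    by (rule TL_cong) (use mult(1,2,5) in \<open>simp_all add: mult(3) TL_mult_right[OF mat_alg]\<close>)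
  also have "\<dots> = TL H A A (\<lambda>x' W'. X \<star> (\<alpha> x' Y \<star> W')) (\<delta> X')"
    by (rule TL_cong) (use mult(1,2,5) in \<open>simp_all add: A_assoc\<close>)
  also have "\<dots> = X \<star> (X' \<star> Y)"
    unfolding mult(4)[OF mult(5)] using mult(1,2,5) by (simp add: TL_mult_left[OF mat_alg])
  finally show ?case using mult(1,2,5) by (simp add: A_assoc)
qed (simp_all add: bilin_def tensor_one A_assoc A_lin \<rho>_comm)

section \<open>The Yetter-Drinfeld condition\<close>

text \<open>Writing \<open>u \<otimes> v\<close> for the coproduct of \<open>h\<close>, the Yetter--Drinfeld condition says that the
  action \<open>h.(x \<otimes> Y) = u x \<otimes> v.Y\<close> of \<open>H\<close> on \<open>H \<otimes> A\<close> satisfies \<open>h.\<delta>(X) = \<delta>(u.X) (v \<otimes> 1)\<close>.\<close>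

definition "lft h S = TL H H T (\<lambda>u v. TL H A T (\<lambda>x Y. (u \<cdot> x) \<boxdot> \<alpha> v Y) S) (comult H h)"
definition "rgt h X = TL H H T (\<lambda>u v. \<delta> (\<alpha> u X) \<otimes>\<^bsub>T\<^esub> (v \<boxdot> \<one>\<^bsub>A\<^esub>)) (comult H h)"

lemma lft_simps [simp]:
  assumes "h \<in> carrier H"
  shows "S \<in> carrier T \<Longrightarrow> lft h S \<in> carrier T"
    "S \<in> carrier T \<Longrightarrow> S' \<in> carrier T \<Longrightarrow> lft h (S \<oplus>\<^bsub>T\<^esub> S') = lft h S \<oplus>\<^bsub>T\<^esub> lft h S'"
    "S \<in> carrier T \<Longrightarrow> lft h (c \<odot>\<^bsub>T\<^esub> S) = c \<odot>\<^bsub>T\<^esub> lft h S"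
    "x \<in> carrier H \<Longrightarrow> Y \<in> carrier A \<Longrightarrow>
      lft h (x \<boxdot> Y) = TL H H T (\<lambda>u v. (u \<cdot> x) \<boxdot> \<alpha> v Y) (comult H h)"
  using assms by (simp_all add: lft_def bilin_def)

lemma lft_lin: "h \<in> carrier H \<Longrightarrow> lft h \<in> lin_maps T T"
  by (rule lin_mapsI) simp_all

lemma T_eqI:
  assumes "f \<in> lin_maps T T" "g \<in> lin_maps T T" "S \<in> carrier T"
    "\<And>x Y. x \<in> carrier H \<Longrightarrow> Y \<in> carrier A \<Longrightarrow> f (x \<boxdot> Y) = g (x \<boxdot> Y)"
  shows "f S = g S"
  by (rule tensor_lin_eqI[OF H_vec mat_vec T_vec assms])

lemma lft_mult:
  assumes "h \<in> carrier H" "g \<in> carrier H" "S \<in> carrier T"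
  shows "lft (h \<cdot> g) S = lft h (lft g S)"
proof (rule T_eqI[OF lft_lin _ assms(3)])
  show "h \<cdot> g \<in> carrier H" using assms by simp
  show "(\<lambda>S. lft h (lft g S)) \<in> lin_maps T T" by (rule lin_mapsI) (use assms in simp_all)
  fix x Y assume xY: "x \<in> carrier H" "Y \<in> carrier A"
  have "lft h (lft g (x \<boxdot> Y)) = TL H H T (\<lambda>u v. lft h ((u \<cdot> x) \<boxdot> \<alpha> v Y)) (comult H g)"
    unfolding lft_simps(4)[OF assms(2) xY] by (rule TL_lin[OF T_vec T_vec lft_lin]) (use assms xY in simp_all)
  also have "\<dots> = TL H H T (\<lambda>u v. TL H H T (\<lambda>u' v'. (u' \<cdot> (u \<cdot> x)) \<boxdot> \<alpha> v' (\<alpha> v Y)) (comult H h)) (comult H g)"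
    by (rule TL_cong) (use assms xY in simp_all)
  also have "\<dots> = TL H H T (\<lambda>u' v'. TL H H T (\<lambda>u v. (u' \<cdot> (u \<cdot> x)) \<boxdot> \<alpha> v' (\<alpha> v Y)) (comult H g)) (comult H h)"
    by (rule TL_swap) (use assms xY in simp_all)
  also have "\<dots> = lft (h \<cdot> g) (x \<boxdot> Y)"
    using assms xY by (simp add: H_assoc bilin_def)
  finally show "lft (h \<cdot> g) (x \<boxdot> Y) = lft h (lft g (x \<boxdot> Y))" ..
qed

lemma lft_right:
  assumes "h \<in> carrier H" "g \<in> carrier H" "S \<in> carrier T"
  shows "lft h (S \<otimes>\<^bsub>T\<^esub> (g \<boxdot> \<one>\<^bsub>A\<^esub>)) = lft h S \<otimes>\<^bsub>T\<^esub> (g \<boxdot> \<one>\<^bsub>A\<^esub>)"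
proof (rule T_eqI[OF _ _ assms(3)])
  interpret T: complex_algebra T by simp
  interpret A: complex_algebra A by simp
  show "(\<lambda>S. lft h (S \<otimes>\<^bsub>T\<^esub> (g \<boxdot> \<one>\<^bsub>A\<^esub>))) \<in> lin_maps T T"
    "(\<lambda>S. lft h S \<otimes>\<^bsub>T\<^esub> (g \<boxdot> \<one>\<^bsub>A\<^esub>)) \<in> lin_maps T T"
    by (rule lin_mapsI; use assms in simp)+
  fix x Y assume xY: "x \<in> carrier H" "Y \<in> carrier A"
  show "lft h ((x \<boxdot> Y) \<otimes>\<^bsub>T\<^esub> (g \<boxdot> \<one>\<^bsub>A\<^esub>)) = lft h (x \<boxdot> Y) \<otimes>\<^bsub>T\<^esub> (g \<boxdot> \<one>\<^bsub>A\<^esub>)"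
    using assms xY by (simp add: TL_mult_right[OF T.is_calg] H_assoc)
qed

lemma yd_mult:
  assumes "h \<in> carrier H" "g \<in> carrier H" "X \<in> carrier A"
    and h: "\<And>X. X \<in> carrier A \<Longrightarrow> lft h (\<delta> X) = rgt h X"
    and g: "\<And>X. X \<in> carrier A \<Longrightarrow> lft g (\<delta> X) = rgt g X"
  shows "lft (h \<cdot> g) (\<delta> X) = rgt (h \<cdot> g) X"
proof -
  interpret T: complex_algebra T by simp
  interpret A: complex_algebra A by simp
  have "lft (h \<cdot> g) (\<delta> X) = lft h (TL H H T (\<lambda>u v. \<delta> (\<alpha> u X) \<otimes>\<^bsub>T\<^esub> (v \<boxdot> \<one>\<^bsub>A\<^esub>)) (comult H g))"
    using assms(1-3) by (simp only: lft_mult coact_simps(1) g rgt_def)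
  also have "\<dots> = TL H H T (\<lambda>u v. lft h (\<delta> (\<alpha> u X) \<otimes>\<^bsub>T\<^esub> (v \<boxdot> \<one>\<^bsub>A\<^esub>))) (comult H g)"
    by (rule TL_lin[OF T_vec T_vec lft_lin]) (use assms(1-3) in simp_all)
  also have "\<dots> = TL H H T (\<lambda>u v. rgt h (\<alpha> u X) \<otimes>\<^bsub>T\<^esub> (v \<boxdot> \<one>\<^bsub>A\<^esub>)) (comult H g)"
    by (rule TL_cong) (use assms(1-3) in \<open>simp_all add: lft_right h\<close>)
  also have "\<dots> = TL H H T (\<lambda>u v. TL H H T (\<lambda>u' v'. \<delta> (\<alpha> u' (\<alpha> u X)) \<otimes>\<^bsub>T\<^esub> ((v' \<cdot> v) \<boxdot> \<one>\<^bsub>A\<^esub>)) (comult H h)) (comult H g)"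
    by (rule TL_cong) (use assms(1-3) in \<open>simp_all add: rgt_def TL_mult_right[OF T.is_calg] T.calg_assoc\<close>)
  also have "\<dots> = TL H H T (\<lambda>u' v'. TL H H T (\<lambda>u v. \<delta> (\<alpha> u' (\<alpha> u X)) \<otimes>\<^bsub>T\<^esub> ((v' \<cdot> v) \<boxdot> \<one>\<^bsub>A\<^esub>)) (comult H g)) (comult H h)"
    by (rule TL_swap) (use assms(1-3) in simp_all)
  also have "\<dots> = rgt (h \<cdot> g) X"
    using assms(1-3) by (simp add: rgt_def bilin_def)
  finally show ?thesis .
qed

text \<open>Conjugation by \<open>K\<close> on the first leg together with \<open>\<kappa>\<close>
  on the second is multiplicative, so the formula is checked on generators. The one for
  \<open>\<iota>\<close> follows by inverting this map.\<close>

lemma coact_\<kappa>: "X \<in> carrier A \<Longrightarrow> \<delta> (\<kappa> X) = TL H A T (\<lambda>x Y. (K \<cdot> (x \<cdot> L)) \<boxdot> \<kappa> Y) (\<delta> X)"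
  and coact_\<iota>: "X \<in> carrier A \<Longrightarrow> \<delta> (\<iota> X) = TL H A T (\<lambda>x Y. (L \<cdot> (x \<cdot> K)) \<boxdot> \<iota> Y) (\<delta> X)"
proof -
  interpret T: complex_algebra T by simp
  let ?N = "TL H A T (\<lambda>x Y. (K \<cdot> (x \<cdot> L)) \<boxdot> \<kappa> Y)"
  let ?M = "TL H A T (\<lambda>x Y. (L \<cdot> (x \<cdot> K)) \<boxdot> \<iota> Y)"
  have b: "bilin H A T (\<lambda>x Y. (K \<cdot> (x \<cdot> L)) \<boxdot> \<kappa> Y)" "bilin H A T (\<lambda>x Y. (L \<cdot> (x \<cdot> K)) \<boxdot> \<iota> Y)"
    by (simp_all add: bilin_def)
  have N: "?N (S \<otimes>\<^bsub>T\<^esub> S') = ?N S \<otimes>\<^bsub>T\<^esub> ?N S'" if "S \<in> carrier T" "S' \<in> carrier T" for S S'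
    using that b by (simp add: TL_prod[OF T.is_calg] H_assoc rels_assoc(1,2))
  show *: "\<delta> (\<kappa> X) = ?N (\<delta> X)" if "X \<in> carrier A" for X
    using that
  proof (induction X rule: mat_induct)
    case (mult x y)
    then show ?case by (simp add: N)
  qed (simp_all add: b \<kappa>_gens \<sigma>D tensor_one H_assoc rels rels_assoc T_lin mult.commute)
  have "?M (?N S) = S" if "S \<in> carrier T" for S
    by (rule T_eqI[OF _ _ that]) (use b in \<open>auto intro!: lin_mapsI simp: H_assoc rels_assoc\<close>)
  then show "\<delta> (\<iota> X) = ?M (\<delta> X)" if "X \<in> carrier A" using *[of "\<iota> X"] that by simp
qed

text \<open>\<open>lft E\<close> and \<open>lft F\<close> have the same form as the action on
  matrices, with \<open>\<zeta>\<close>, \<open>\<xi>\<close> in place of \<open>Z\<close>,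
  \<open>D\<close> and with \<open>?N\<close>, \<open>?M\<close> in place of
  \<open>\<kappa>\<close>, \<open>\<iota>\<close>. As \<open>\<delta>\<close> is a homomorphism that
  respects these replacements, it carries one form to the other.\<close>

lemma yd_gens:
  assumes X: "X \<in> carrier A"
  shows "lft K (\<delta> X) = rgt K X" "lft E (\<delta> X) = rgt E X" "lft F (\<delta> X) = rgt F X"
proof -
  interpret T: complex_algebra T by simp
  interpret A: complex_algebra A by simp
  let ?N = "TL H A T (\<lambda>x Y. (K \<cdot> (x \<cdot> L)) \<boxdot> \<kappa> Y)"
  let ?M = "TL H A T (\<lambda>x Y. (L \<cdot> (x \<cdot> K)) \<boxdot> \<iota> Y)"
  have b [simp]: "bilin H A T (\<lambda>x Y. (K \<cdot> (x \<cdot> L)) \<boxdot> \<kappa> Y)" "bilin H A T (\<lambda>x Y. (L \<cdot> (x \<cdot> K)) \<boxdot> \<iota> Y)"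
    by (simp_all add: bilin_def)
  have "lft K S = ?N S \<otimes>\<^bsub>T\<^esub> (K \<boxdot> \<one>\<^bsub>A\<^esub>)" if "S \<in> carrier T" for S
    by (rule T_eqI[OF lft_lin _ that])
      (auto intro!: lin_mapsI simp: bilin_def H_assoc rels_assoc)
  then show "lft K (\<delta> X) = rgt K X"
    using X by (simp add: rgt_def bilin_def coact_\<kappa>)
  \<comment> \<open>For \<open>S = \<delta> X\<close> the bracket with its scalar is the coaction of
    \<open>\<alpha> E X\<close>; the factors with \<open>K\<close> and \<open>E\<close> match the
    two terms of the coproduct of \<open>E\<close> in \<open>rgt E X\<close>.\<close>
  have "lft E S = (1 / w) \<odot>\<^bsub>T\<^esub> (S \<otimes>\<^bsub>T\<^esub> \<zeta> \<oplus>\<^bsub>T\<^esub> (- 1) \<odot>\<^bsub>T\<^esub> (\<zeta> \<otimes>\<^bsub>T\<^esub> ?N S)) \<otimes>\<^bsub>T\<^esub> (K \<boxdot> \<one>\<^bsub>A\<^esub>) \<oplus>\<^bsub>T\<^esub> S \<otimes>\<^bsub>T\<^esub> (E \<boxdot> \<one>\<^bsub>A\<^esub>)"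
    if "S \<in> carrier T" for S
  proof (rule T_eqI[OF lft_lin _ that])
    fix x Y assume xY [simp]: "x \<in> carrier H" "Y \<in> carrier A"
    have e: "lft E (x \<boxdot> Y) = ((E \<cdot> x) \<boxdot> \<kappa> Y) \<oplus>\<^bsub>T\<^esub> (x \<boxdot> \<alpha> E Y)"
      by (simp add: bilin_def del: act_simps(8))
    show "lft E (x \<boxdot> Y) = (1 / w) \<odot>\<^bsub>T\<^esub> ((x \<boxdot> Y) \<otimes>\<^bsub>T\<^esub> \<zeta> \<oplus>\<^bsub>T\<^esub> (- 1) \<odot>\<^bsub>T\<^esub> (\<zeta> \<otimes>\<^bsub>T\<^esub> ?N (x \<boxdot> Y))) \<otimes>\<^bsub>T\<^esub> (K \<boxdot> \<one>\<^bsub>A\<^esub>)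
      \<oplus>\<^bsub>T\<^esub> (x \<boxdot> Y) \<otimes>\<^bsub>T\<^esub> (E \<boxdot> \<one>\<^bsub>A\<^esub>)"
      unfolding e by (simp add: H_assoc rels_assoc(1,2) T_lin)
  next
    show "(\<lambda>S. (1 / w) \<odot>\<^bsub>T\<^esub> (S \<otimes>\<^bsub>T\<^esub> \<zeta> \<oplus>\<^bsub>T\<^esub> (- 1) \<odot>\<^bsub>T\<^esub> (\<zeta> \<otimes>\<^bsub>T\<^esub> ?N S)) \<otimes>\<^bsub>T\<^esub> (K \<boxdot> \<one>\<^bsub>A\<^esub>) \<oplus>\<^bsub>T\<^esub> S \<otimes>\<^bsub>T\<^esub> (E \<boxdot> \<one>\<^bsub>A\<^esub>)) \<in> lin_maps T T"
      by (intro lin_mapsI) (simp_all add: T_lin)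
  qed simp
  then show "lft E (\<delta> X) = rgt E X"
    using X by (simp add: rgt_def bilin_def coact_\<kappa> del: coact_gens) simp
  \<comment> \<open>Here the bracket with its scalar becomes the coaction of
    \<open>\<alpha> F X\<close>, and the last summand belongs to the term with \<open>L\<close> in
    the coproduct of \<open>F\<close>.\<close>
  have "lft F S = (1 / w) \<odot>\<^bsub>T\<^esub> (\<xi> \<otimes>\<^bsub>T\<^esub> S \<oplus>\<^bsub>T\<^esub> (- 1) \<odot>\<^bsub>T\<^esub> (?M S \<otimes>\<^bsub>T\<^esub> \<xi>)) \<oplus>\<^bsub>T\<^esub> ?M S \<otimes>\<^bsub>T\<^esub> (F \<boxdot> \<one>\<^bsub>A\<^esub>)"
    if "S \<in> carrier T" for S
  proof (rule T_eqI[OF lft_lin _ that])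
    fix x Y assume xY [simp]: "x \<in> carrier H" "Y \<in> carrier A"
    have e: "lft F (x \<boxdot> Y) = ((F \<cdot> x) \<boxdot> Y) \<oplus>\<^bsub>T\<^esub> ((L \<cdot> x) \<boxdot> \<alpha> F Y)"
      by (simp add: bilin_def del: act_simps(10))
    show "lft F (x \<boxdot> Y) = (1 / w) \<odot>\<^bsub>T\<^esub> (\<xi> \<otimes>\<^bsub>T\<^esub> (x \<boxdot> Y) \<oplus>\<^bsub>T\<^esub> (- 1) \<odot>\<^bsub>T\<^esub> (?M (x \<boxdot> Y) \<otimes>\<^bsub>T\<^esub> \<xi>)) \<oplus>\<^bsub>T\<^esub> ?M (x \<boxdot> Y) \<otimes>\<^bsub>T\<^esub> (F \<boxdot> \<one>\<^bsub>A\<^esub>)"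
      unfolding e by (simp add: H_assoc rels_assoc(1,2) T_lin)
  next
    show "(\<lambda>S. (1 / w) \<odot>\<^bsub>T\<^esub> (\<xi> \<otimes>\<^bsub>T\<^esub> S \<oplus>\<^bsub>T\<^esub> (- 1) \<odot>\<^bsub>T\<^esub> (?M S \<otimes>\<^bsub>T\<^esub> \<xi>)) \<oplus>\<^bsub>T\<^esub> ?M S \<otimes>\<^bsub>T\<^esub> (F \<boxdot> \<one>\<^bsub>A\<^esub>)) \<in> lin_maps T T"
      by (intro lin_mapsI) (simp_all add: T_lin)
  qed simp
  then show "lft F (\<delta> X) = rgt F X"
    using X by (simp add: rgt_def bilin_def coact_\<iota> tensor_one[symmetric] del: coact_gens) simp
qed

lemma yd:
  assumes "h \<in> carrier H" "X \<in> carrier A"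
  shows "lft h (\<delta> X) = rgt h X"
proof -
  have b: "bilin H H T (\<lambda>u v. TL H A T (\<lambda>x Y. (u \<cdot> x) \<boxdot> \<alpha> v Y) (\<delta> X))"
    "bilin H H T (\<lambda>u v. \<delta> (\<alpha> u X) \<otimes>\<^bsub>T\<^esub> (v \<boxdot> \<one>\<^bsub>A\<^esub>))" if "X \<in> carrier A" for X
    using that by (simp_all add: bilin_def)
  have lin: "(\<lambda>h. lft h (\<delta> X)) \<in> lin_maps H T" "(\<lambda>h. rgt h X) \<in> lin_maps H T" if "X \<in> carrier A" for X
    unfolding lft_def rgt_def using b[OF that] that by (auto intro!: lin_mapsI)
  show ?thesis using assms
  proof (induction h arbitrary: X rule: H_induct)
    case (mult h g)
    then show ?case using yd_mult[of h g X] by blast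
  next
    case (add h g)
    then show ?case using lin_mapsD(2)[OF lin(1), of X h g] lin_mapsD(2)[OF lin(2), of X h g] by simp
  next
    case (smult c h)
    then show ?case using lin_mapsD(3)[OF lin(1), of X h c] lin_mapsD(3)[OF lin(2), of X h c] by simp
  next
    case one
    interpret T: complex_algebra T by simp
    show ?case
      unfolding lft_def rgt_def using one b[of X] by (simp add: tensor_one tensor_TL_expand[of H A, simplified]) (simp add: tensor_one[symmetric])
  qed (simp_all only: yd_gens)
qed

lemma yd_algebra_uq: "yd_algebra H A \<alpha> \<delta>"
proof (intro yd_algebra.intro yd_algebra_axioms.intro)
  interpret T: complex_algebra T by simp
  interpret A: complex_algebra A by simp
  fix h X assume hX: "h \<in> carrier H" "X \<in> carrier A"
  have "TL H A T (\<lambda>x Y. (x \<cdot> v) \<boxdot> Y) S = S \<otimes>\<^bsub>T\<^esub> (v \<boxdot> \<one>\<^bsub>A\<^esub>)" if "v \<in> carrier H" "S \<in> carrier T" for v S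
    by (rule T_eqI[OF _ _ that(2)]) (use that(1) in \<open>auto intro!: lin_mapsI simp: bilin_def\<close>)
  then have "TL H H T (\<lambda>u v. TL H A T (\<lambda>x Y. (x \<cdot> v) \<boxdot> Y) (\<delta> (\<alpha> u X))) (comult H h) = rgt h X"
    using hX by (simp add: rgt_def)
  then show "TL H H T (\<lambda>u v. TL H A T (\<lambda>x Y. (u \<cdot> x) \<boxdot> \<alpha> v Y) (\<delta> X)) (comult H h) =
      TL H H T (\<lambda>u v. TL H A T (\<lambda>x Y. (x \<cdot> v) \<boxdot> Y) (\<delta> (\<alpha> u X))) (comult H h)"
    using yd[OF hX] by (simp add: lft_def)
qed ((rule uq_hopf_algebra mat_alg act_bilin act_unit act_alg coact_hom coact_coassoc coact_counit braided_comm; assumption) | simp)+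

end

section \<open>The two coefficient algebras\<close>

context restricted_quantum_group
begin

text \<open>The constants are generated by the unit alone, hence the empty set of
  generators.\<close>

lemma matrix_action_complex: "matrix_action p complex_alg {} (\<lambda>x. x)"
proof (intro matrix_action.intro matrix_algebra.intro matrix_space.intro restricted_quantum_group_axioms
    matrix_algebra_axioms.intro matrix_action_axioms.intro)
  show "alg_generated complex_alg {}"
    unfolding alg_generated_def
  proof (intro conjI allI impI ballI)
    fix Q x
    assume Q: "Q \<one>\<^bsub>complex_alg\<^esub>" "\<forall>c. \<forall>x\<in>carrier complex_alg. Q x \<longrightarrow> Q (c \<odot>\<^bsub>complex_alg\<^esub> x)"
    show "Q x" using Q(2)[rule_format, of "\<one>\<^bsub>complex_alg\<^esub>" x] Q(1) by simp
  qed simp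
  show "(\<lambda>x. x) \<in> alg_hom complex_alg complex_alg" by (auto intro!: alg_homI lin_mapsI)
  show "((\<lambda>x. x) ^^ (2 * p)) r = r" for r :: complex by (simp add: id_def[symmetric])
qed (simp_all add: mult.commute)

definition "m = (monom 1 (2 * p) - 1 :: complex poly)"
abbreviation "I \<equiv> cyc_ideal p"
abbreviation "pr f \<equiv> I +>\<^bsub>poly_alg\<^esub> f"
abbreviation "R \<equiv> cyc_alg p"

lemma poly_alg_algebra [simp]: "complex_algebra poly_alg"
  unfolding poly_alg_def
  by (rule complex_algebra_type_alg) (unfold_locales, simp_all add: smult_add_left smult_add_right)

lemma poly_simps [simp]:
  "carrier poly_alg = UNIV" "x \<otimes>\<^bsub>poly_alg\<^esub> y = x * y" "\<one>\<^bsub>poly_alg\<^esub> = 1"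
  "\<zero>\<^bsub>poly_alg\<^esub> = 0" "x \<oplus>\<^bsub>poly_alg\<^esub> y = x + y" "c \<odot>\<^bsub>poly_alg\<^esub> x = Polynomial.smult c x"
  by (simp_all add: poly_alg_def)

lemma cyc_ideal: "ideal I poly_alg" and cyc_ideal_iff: "f \<in> I \<longleftrightarrow> m dvd f"
proof -
  interpret P: complex_algebra poly_alg by simp
  show I: "ideal I poly_alg" unfolding cyc_ideal_def by (rule P.genideal_ideal) simp
  then interpret I: ideal I poly_alg .
  have m: "m \<in> I" using P.genideal_self[of "{m}"] by (simp add: cyc_ideal_def m_def)
  have neg: "\<ominus>\<^bsub>poly_alg\<^esub> x = - x" for x by (rule P.minus_equality) simp_all
  have "ideal {f. m dvd f} poly_alg"
    by (intro idealI P.ring_axioms P.add.subgroupI) (auto simp: neg)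
  then have "I \<subseteq> {f. m dvd f}"
    unfolding cyc_ideal_def by (rule P.genideal_minimal) (simp add: m_def)
  moreover have "m * h \<in> I" for h using I.I_r_closed[OF m, of h] by simp
  ultimately show "f \<in> I \<longleftrightarrow> m dvd f" by (auto elim: dvdE)
qed

lemmas cyc_pi = quot_alg_pi[OF poly_alg_algebra cyc_ideal, folded cyc_alg_def, simplified]

lemma cyc_carrier: "carrier R = range pr"
  using quot_alg_fields(1)[OF poly_alg_algebra cyc_ideal] by (simp add: cyc_alg_def)

lemma cyc_algebra: "complex_algebra R"
  unfolding cyc_alg_def by (rule quot_alg_algebra[OF poly_alg_algebra cyc_ideal])

lemma poly_generated: "alg_generated poly_alg {[:0, 1:]}"
  unfolding alg_generated_def
proof (intro conjI allI impI ballI)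
  fix Q and f :: "complex poly"
  assume Q: "Q \<one>\<^bsub>poly_alg\<^esub>" "\<forall>g\<in>{[:0, 1:]}. Q g"
    "\<forall>x\<in>carrier poly_alg. \<forall>y\<in>carrier poly_alg. Q x \<longrightarrow> Q y \<longrightarrow> Q (x \<oplus>\<^bsub>poly_alg\<^esub> y) \<and> Q (x \<otimes>\<^bsub>poly_alg\<^esub> y)"
    "\<forall>c. \<forall>x\<in>carrier poly_alg. Q x \<longrightarrow> Q (c \<odot>\<^bsub>poly_alg\<^esub> x)"
  show "Q f"
  proof (induction f)
    case 0
    show ?case using Q(4)[rule_format, of 1 0] Q(1) by simp
  next
    case (pCons a f)
    have "Q (Polynomial.smult a 1)" using Q(4)[rule_format, of 1 a] Q(1) by simp
    moreover have "Q ([:0, 1:] * f)" using Q(3)[rule_format, of "[:0, 1:]" f] Q(2) pCons by simp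
    ultimately have "Q (Polynomial.smult a 1 + [:0, 1:] * f)"
      using Q(3)[rule_format, of "Polynomial.smult a 1" "[:0, 1:] * f"] by simp
    then show ?case by simp
  qed
qed simp

abbreviation sb :: "complex \<Rightarrow> complex poly \<Rightarrow> complex poly" where "sb c f \<equiv> pcompose f [:0, c:]"

lemma sb_sb: "sb c (sb d f) = sb (d * c) f"
  by (rule poly_eq_poly_eq_iff[THEN iffD1], rule ext) (simp add: poly_pcompose mult_ac)

text \<open>Scaling the variable by a \<open>2 p\<close>-th root of unity preserves its
  \<open>2 p\<close>-th power, so the substitution preserves the ideal and descends to the
  quotient.\<close>

lemma sb_m: "c ^ (2 * p) = 1 \<Longrightarrow> sb c m = m"
  by (rule poly_eq_poly_eq_iff[THEN iffD1], rule ext) (simp add: poly_pcompose m_def poly_monom power_mult_distrib)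

lemma inv_q_2p: "inverse q ^ (2 * p) = 1"
  by (simp only: power_inverse q_2p inverse_1)

lemma sb_I: "c ^ (2 * p) = 1 \<Longrightarrow> f \<in> I \<Longrightarrow> sb c f \<in> I"
  unfolding cyc_ideal_iff using sb_m[of c] by (auto simp: pcompose_mult elim!: dvdE)

text \<open>\<open>cyc_subst\<close> is the image of a whole coset. This is again a whole coset
  because the substitution maps the ideal onto itself, scaling by \<open>q\<close> being inverse to
  scaling by \<open>inverse q\<close>.\<close>

lemma cyc_subst_pi: "cyc_subst p (pr f) = pr (sb (inverse q) f)"
proof -
  have "sb (inverse q) ` I = I"
  proof (intro equalityI subsetI)
    fix g assume "g \<in> I"
    then have "sb q g \<in> I" by (rule sb_I[OF q_2p])
    moreover have "g = sb (inverse q) (sb q g)" by (simp add: sb_sb)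
    ultimately show "g \<in> sb (inverse q) ` I" by blast
  qed (use sb_I[OF inv_q_2p] in blast)
  moreover have coset: "pr f = (\<lambda>i. i + f) ` I" for f by (auto simp: a_r_coset_def')
  moreover have "cyc_subst p (pr f) = (\<lambda>i. i + sb (inverse q) f) ` (sb (inverse q) ` I)"
    unfolding cyc_subst_def coset image_image q_def[symmetric] by (simp only: pcompose_add)
  ultimately show ?thesis by simp
qed

lemma matrix_action_cyc: "matrix_action p R {cyc_gen p} (cyc_subst p)"
proof -
  interpret R: complex_algebra R by (rule cyc_algebra)
  show ?thesis
  proof (intro matrix_action.intro matrix_algebra.intro matrix_space.intro restricted_quantum_group_axioms
      matrix_algebra_axioms.intro matrix_action_axioms.intro cyc_algebra)
    show "x \<otimes>\<^bsub>R\<^esub> y = y \<otimes>\<^bsub>R\<^esub> x" if "x \<in> carrier R" "y \<in> carrier R" for x y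
      using that by (auto simp: cyc_carrier cyc_pi mult.commute)
    show "alg_generated R {cyc_gen p}"
      using quot_alg_generated[OF poly_alg_algebra cyc_ideal poly_generated] by (simp add: cyc_alg_def cyc_gen_def)
    show "cyc_subst p \<in> alg_hom R R"
      by (intro alg_homI lin_mapsI)
        (auto simp: cyc_carrier cyc_pi cyc_subst_pi pcompose_add pcompose_smult pcompose_mult
          quot_alg_fields(5)[OF poly_alg_algebra cyc_ideal, folded cyc_alg_def] pcompose_1)
    have "(cyc_subst p ^^ n) (pr f) = pr (sb (inverse q ^ n) f)" for n f
      by (induction n) (simp_all add: cyc_subst_pi sb_sb mult.commute)
    then show "(cyc_subst p ^^ (2 * p)) r = r" if "r \<in> carrier R" for r
      using that unfolding cyc_carrier by (auto simp: inv_q_2p)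
  qed
qed

end

section \<open>Matrices over the quantum group\<close>

lemma lin_maps_sum:
  assumes V: "cvec V" and W: "cvec W" and I: "finite I" and f: "\<And>i. i \<in> I \<Longrightarrow> f i \<in> lin_maps V W"
  shows "(\<lambda>x. \<Oplus>\<^bsub>W\<^esub>i\<in>I. f i x) \<in> lin_maps V W"
proof (rule lin_mapsI)
  interpret W: module complex_alg W by (rule W)
  fix x assume x: "x \<in> carrier V"
  show "(\<Oplus>\<^bsub>W\<^esub>i\<in>I. f i x) \<in> carrier W" using x lin_mapsD(1)[OF f] by (auto intro!: W.finsum_closed)
  show "(\<Oplus>\<^bsub>W\<^esub>i\<in>I. f i (c \<odot>\<^bsub>V\<^esub> x)) = c \<odot>\<^bsub>W\<^esub> (\<Oplus>\<^bsub>W\<^esub>i\<in>I. f i x)" for c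
  proof -
    have "(\<Oplus>\<^bsub>W\<^esub>i\<in>I. f i (c \<odot>\<^bsub>V\<^esub> x)) = (\<Oplus>\<^bsub>W\<^esub>i\<in>I. c \<odot>\<^bsub>W\<^esub> f i x)"
      by (rule W.finsum_cong') (use x W lin_mapsD[OF f] in auto)
    also have "\<dots> = c \<odot>\<^bsub>W\<^esub> (\<Oplus>\<^bsub>W\<^esub>i\<in>I. f i x)"
      by (rule W.finsum_smult_ldistr[symmetric]) (use x I lin_mapsD(1)[OF f] in auto)
    finally show ?thesis .
  qed
  fix y assume y: "y \<in> carrier V"
  have "(\<Oplus>\<^bsub>W\<^esub>i\<in>I. f i (x \<oplus>\<^bsub>V\<^esub> y)) = (\<Oplus>\<^bsub>W\<^esub>i\<in>I. f i x \<oplus>\<^bsub>W\<^esub> f i y)"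
    by (rule W.finsum_cong') (use x y W lin_mapsD[OF f] in auto)
  also have "\<dots> = (\<Oplus>\<^bsub>W\<^esub>i\<in>I. f i x) \<oplus>\<^bsub>W\<^esub> (\<Oplus>\<^bsub>W\<^esub>i\<in>I. f i y)"
    by (rule W.finsum_addf) (use x y lin_mapsD(1)[OF f] in auto)
  finally show "(\<Oplus>\<^bsub>W\<^esub>i\<in>I. f i (x \<oplus>\<^bsub>V\<^esub> y)) = (\<Oplus>\<^bsub>W\<^esub>i\<in>I. f i x) \<oplus>\<^bsub>W\<^esub> (\<Oplus>\<^bsub>W\<^esub>i\<in>I. f i y)" .
qed

context restricted_quantum_group
begin

lemma mat_iso:
  defines "A \<equiv> mat_alg p complex_alg" and "V \<equiv> mat_alg p H"
  shows "mat_iso p \<in> lin_maps (tensor A H) V" (is ?lin)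
    and "bij_betw (mat_iso p) (carrier (tensor A H)) (carrier V)" (is ?bij)
proof -
  let ?P = "{1..p} \<times> {1..p}"
  interpret A: matrix_space p complex_alg by (rule matrix_space.intro[OF restricted_quantum_group_axioms]) simp
  interpret V: matrix_space p H by (rule matrix_space.intro[OF restricted_quantum_group_axioms]) simp
  have A [simp]: "cvec A" and V [simp]: "cvec V" by (simp_all add: A_def V_def)
  define T where "T = tensor A H"
  have T [simp]: "cvec T" by (simp add: T_def)
  interpret T: module complex_alg T using T .
  define g where "g X h = (\<lambda>ij\<in>?P. X ij \<odot>\<^bsub>H\<^esub> h)" for X :: "nat \<times> nat \<Rightarrow> complex" and h
  have gc: "g X h \<in> carrier V" if "h \<in> carrier H" for X h
    using that by (auto simp: g_def V_def V.mat_carrier)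
  have g_entry: "g X h (i, j) = X (i, j) \<odot>\<^bsub>H\<^esub> h" if "1 \<le> i" "i \<le> p" "1 \<le> j" "j \<le> p" for X h i j
    using that by (simp add: g_def)
  have b: "bilin A H V g"
    unfolding bilin_def A_def V_def
    by (auto intro!: V.mat_eqI V.mat_closed gc[unfolded V_def] simp: g_entry cvec_add_smult[OF H_vec] mult.commute)
  note l = tensor_TL_lin_maps[OF A H_vec V b, folded T_def]
  have iso: "mat_iso p S = TL A H V g S" if "S \<in> carrier T" for S
    using tensor_lift_TL[OF A H_vec V b] that by (simp add: mat_iso_def T_def V_def[symmetric] g_def)
  show lin: ?lin
    unfolding T_def[symmetric] by (rule lin_mapsI) (use lin_mapsD[OF l] iso T.a_closed T.smult_closed in simp_all)
  define u where "u k = (\<lambda>ij\<in>?P. if ij = k then 1 else 0 :: complex)" for k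
  have u: "u k \<in> carrier A" for k by (auto simp: u_def A_def A.mat_carrier)
  \<comment> \<open>The candidate inverse: each entry is tensored with the matrix unit of its
    position.\<close>
  define \<Psi> where "\<Psi> M = (\<Oplus>\<^bsub>T\<^esub>k\<in>?P. u k \<boxtimes>\<^bsub>T\<^esub> M k)" for M
  have "(\<lambda>M. u k \<boxtimes>\<^bsub>T\<^esub> M k) \<in> lin_maps V T" if "k \<in> ?P" for k
    using that u H_vec by (auto intro!: lin_mapsI simp: V_def T_def)
  then have \<Psi>_lin: "\<Psi> \<in> lin_maps V T"
    unfolding \<Psi>_def by (intro lin_maps_sum[OF V T]) auto
  have ent: "(\<lambda>X. X (i, j)) \<in> lin_maps V H" if "1 \<le> i" "i \<le> p" "1 \<le> j" "j \<le> p" for i j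
    by (rule lin_mapsI) (use that in \<open>simp_all add: V_def\<close>)
  have entA: "(\<lambda>X. X (i, j)) \<in> lin_maps A complex_alg" if "1 \<le> i" "i \<le> p" "1 \<le> j" "j \<le> p" for i j
    by (rule lin_mapsI) (use that in \<open>simp_all add: A_def\<close>)
  interpret V': module complex_alg V using V .
  have \<Phi>\<Psi>: "TL A H V g (\<Psi> M) = M" if M: "M \<in> carrier V" for M
  proof -
    have Mk: "M k \<in> carrier H" if "k \<in> ?P" for k using M that by (auto simp: V_def)
    have "TL A H V g (\<Psi> M) = (\<Oplus>\<^bsub>V\<^esub>k\<in>?P. TL A H V g (u k \<boxtimes>\<^bsub>T\<^esub> M k))"
      unfolding \<Psi>_def by (rule lin_maps_finsum[OF T V l]) (use u Mk in \<open>auto simp: T_def\<close>)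
    also have "\<dots> = (\<Oplus>\<^bsub>V\<^esub>k\<in>?P. g (u k) (M k))"
      by (rule V'.finsum_cong')
         (use u Mk b gc V in \<open>auto simp: T_def\<close>)
    also have "\<dots> = M"
      unfolding V_def
    proof (rule V.mat_eqI)
      show "(\<Oplus>\<^bsub>mat_alg p H\<^esub>k\<in>?P. g (u k) (M k)) \<in> carrier (mat_alg p H)"
        unfolding V_def[symmetric] using gc Mk by (intro V'.finsum_closed) auto
      fix i j assume ij: "1 \<le> i" "i \<le> p" "1 \<le> j" "j \<le> p"
      have "(\<Oplus>\<^bsub>V\<^esub>k\<in>?P. g (u k) (M k)) (i, j) = (\<Oplus>\<^bsub>H\<^esub>k\<in>?P. g (u k) (M k) (i, j))"
        by (rule lin_maps_finsum[OF V H_vec ent[OF ij]]) (use gc Mk in auto)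
      also have "\<dots> = (\<Oplus>\<^bsub>H\<^esub>k\<in>?P. if k = (i, j) then M k else \<zero>\<^bsub>H\<^esub>)"
        by (rule V.R.finsum_cong') (use ij Mk in \<open>auto simp: g_entry u_def\<close>)
      also have "\<dots> = M (i, j)" by (rule V.R.finsum_single) (use ij Mk in auto)
      finally show "(\<Oplus>\<^bsub>mat_alg p H\<^esub>k\<in>?P. g (u k) (M k)) (i, j) = M (i, j)" unfolding V_def .
    qed (use M in \<open>simp add: V_def\<close>)
    finally show ?thesis .
  qed
  have \<Psi>\<Phi>: "\<Psi> (TL A H V g S) = S" if S: "S \<in> carrier T" for S
  proof (rule tensor_lin_eqI[OF A H_vec T _ _ S[unfolded T_def], folded T_def])
    show "(\<lambda>S. \<Psi> (TL A H V g S)) \<in> lin_maps T T" by (rule lin_maps_comp[OF l \<Psi>_lin])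
    show "(\<lambda>S. S) \<in> lin_maps T T" by (rule lin_mapsI) simp_all
    fix X h assume X: "X \<in> carrier A" and h: "h \<in> carrier H"
    have "\<Psi> (g X h) = (\<Oplus>\<^bsub>T\<^esub>k\<in>?P. (X k \<odot>\<^bsub>A\<^esub> u k) \<boxtimes>\<^bsub>T\<^esub> h)"
      unfolding \<Psi>_def by (rule T.finsum_cong') (use X h u in \<open>auto simp: g_def T_def\<close>)
    also have "\<dots> = (\<Oplus>\<^bsub>A\<^esub>k\<in>?P. X k \<odot>\<^bsub>A\<^esub> u k) \<boxtimes>\<^bsub>T\<^esub> h"
      by (rule lin_maps_finsum[OF A T, of "\<lambda>X. X \<boxtimes>\<^bsub>T\<^esub> h", symmetric]) (use X h u in \<open>auto intro!: lin_mapsI simp: T_def\<close>)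
    also have "(\<Oplus>\<^bsub>A\<^esub>k\<in>?P. X k \<odot>\<^bsub>A\<^esub> u k) = X"
      unfolding A_def
    proof (rule A.mat_eqI)
      interpret A': module complex_alg A using A .
      show "(\<Oplus>\<^bsub>mat_alg p complex_alg\<^esub>k\<in>?P. X k \<odot>\<^bsub>mat_alg p complex_alg\<^esub> u k) \<in> carrier (mat_alg p complex_alg)"
        unfolding A_def[symmetric] using u by (intro A'.finsum_closed) auto
      fix i j assume ij: "1 \<le> i" "i \<le> p" "1 \<le> j" "j \<le> p"
      have "(\<Oplus>\<^bsub>A\<^esub>k\<in>?P. X k \<odot>\<^bsub>A\<^esub> u k) (i, j) = (\<Oplus>\<^bsub>complex_alg\<^esub>k\<in>?P. (X k \<odot>\<^bsub>A\<^esub> u k) (i, j))"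
        by (rule lin_maps_finsum[OF A _ entA[OF ij]]) (use u in auto)
      also have "\<dots> = (\<Oplus>\<^bsub>complex_alg\<^esub>k\<in>?P. if k = (i, j) then X k else \<zero>\<^bsub>complex_alg\<^esub>)"
        by (rule A.R.finsum_cong') (use ij in \<open>auto simp: A_def u_def\<close>)
      also have "\<dots> = X (i, j)" by (rule A.R.finsum_single) (use ij in auto)
      finally show "(\<Oplus>\<^bsub>mat_alg p complex_alg\<^esub>k\<in>?P. X k \<odot>\<^bsub>mat_alg p complex_alg\<^esub> u k) (i, j) = X (i, j)" unfolding A_def .
    qed (use X in \<open>simp add: A_def\<close>)
    finally show "\<Psi> (TL A H V g (X \<boxtimes>\<^bsub>T\<^esub> h)) = X \<boxtimes>\<^bsub>T\<^esub> h" using X h b by (simp add: T_def)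
  qed
  show ?bij
    unfolding T_def[symmetric]
    by (rule bij_betw_byWitness[of _ \<Psi>]) (use iso \<Phi>\<Psi> \<Psi>\<Phi> lin_mapsD(1)[OF l] lin_mapsD(1)[OF \<Psi>_lin] in auto)
qed

end

theorem mainTheorem5:
  fixes p :: nat
  assumes "p \<ge> 2"
  shows
    "(let H = uq p;
         R = cyc_alg p;
         A = mat_alg p R;
         act = uq_act p R (cyc_subst p);
         \<delta> = uq_coact p R {cyc_gen p}
     in hopf_algebroid A (smash H A act) (smash_source H A) (smash_target H A \<delta>)
          (smash_counit H A) (smash_comult H A act \<delta>) (smash_antipode H A act \<delta>)) \<and>
     (let H = uq p;
         A = mat_alg p complex_alg;
         act = uq_act p complex_alg (\<lambda>x. x);
         \<delta> = uq_coact p complex_alg {}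
     in hopf_algebroid A (smash H A act) (smash_source H A) (smash_target H A \<delta>)
          (smash_counit H A) (smash_comult H A act \<delta>) (smash_antipode H A act \<delta>)) \<and>
     (let H = uq p;
         A = mat_alg p complex_alg;
         act = uq_act p complex_alg (\<lambda>x. x);
         \<delta> = uq_coact p complex_alg {};
         X = smash H A act;
         \<Phi> = mat_iso p;
         \<Psi> = inv_into (carrier X) \<Phi>;
         M = transport_alg \<Phi> X (mat_alg p H);
         s = \<Phi> \<circ> smash_source H A;
         t = \<Phi> \<circ> smash_target H A \<delta>
     in \<Phi> \<in> lin_maps X (mat_alg p H) \<and> bij_betw \<Phi> (carrier X) (carrier (mat_alg p H)) \<and>
        hopf_algebroid A M s t (smash_counit H A \<circ> \<Psi>)
          (transport_comult \<Phi> X (tensor2 A M s t) (smash_comult H A act \<delta>))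
          (\<Phi> \<circ> smash_antipode H A act \<delta> \<circ> \<Psi>))"
proof -
  interpret restricted_quantum_group p by unfold_locales (rule assms)
  interpret R: matrix_action p "cyc_alg p" "{cyc_gen p}" "cyc_subst p" by (rule matrix_action_cyc)
  interpret C: matrix_action p complex_alg "{}" "\<lambda>x. x" by (rule matrix_action_complex)
  interpret C: yd_algebra H C.A C.\<alpha> C.\<delta> by (rule C.yd_algebra_uq)
  interpret V: matrix_space p H by (rule matrix_space.intro[OF restricted_quantum_group_axioms]) simp
  \<comment> \<open>The smash product has the carrier and the linear operations of the tensor
    product, so \<open>mat_iso\<close> applies to it unchanged.\<close>
  have iso: "mat_iso p \<in> lin_maps (smash H C.A C.\<alpha>) (mat_alg p H)"
    "bij_betw (mat_iso p) (carrier (smash H C.A C.\<alpha>)) (carrier (mat_alg p H))"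
    using mat_iso by simp_all
  show ?thesis
    unfolding Let_def
    by (intro conjI yd_algebra.hopf_algebroid_smash[OF R.yd_algebra_uq] C.hopf_algebroid_smash iso
        C.hopf_algebroid_transport[OF V.mat_vec iso])
qed

end
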